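(* Let $n\geq 4$ and let $f$ be an irreducible $n$-quasigroup on a nonempty set $\Sigma$. Then $f$ has an irreducible $(n-1)$-ary retract or an irreducible $(n-2)$-ary retract. Moreover, if the order $|\Sigma|$ is finite and prime, then $f$ has an irreducible $(n-1)$-ary retract.
   Context: An $n$-quasigroup (of order $|\Sigma|$) is an operation $f:\Sigma^n\to\Sigma$ on a nonempty set $\Sigma$ such that in the equality $x_0=f(x_1,\ldots,x_n)$ knowledge of any $n$ of $x_0,\ldots,x_n$ uniquely specifies the remaining one. Its predicate form is $f\langle x_0,x_1,\ldots,x_n\rangle \Leftrightarrow x_0=f(x_1,\ldots,x_n)$. Retract: if fixed values are assigned to $l\in\{1,\ldots,n\}$ of the variables $x_0,\ldots,x_n$ in the predicate $f\langle x_0,\ldots,x_n\rangle$, the resulting $(n-l+1)$-ary predicate corresponds to an $(n-l)$-quasigroup (taking, e.g., the remaining variable of smallest index as the dependent one), called an $(n-l)$-ary retract, or $(n-l)$-retract, of $f$. The variable $x_0$ may be among the fixed ones. An $n$-quasigroup $f$ is reducible if there exist $m\in\{2,\ldots,n-1\}$, an $(n-m+1)$-quasigroup $h$, an $m$-quasigroup $g$ (both on $\Sigma$) and a permutation $\sigma$ of $\{1,\ldots,n\}$ such that $f(x_1,\ldots,x_n)= h(g(x_{\sigma(1)},\ldots,x_{\sigma(m)}),x_{\sigma(m+1)},\ldots,x_{\sigma(n)})$ for all $x_1,\ldots,x_n\in\Sigma$. Otherwise it is irreducible; in particular, all $n$-quasigroups with $n\le 2$ are irreducible. *)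

theory Defs
  imports "HOL-Combinatorics.Permutations" "HOL-Computational_Algebra.Primes"
begin

text \<open>
  Tuples are lists. An operation of arity \<open>n\<close> on \<open>S\<close> is a function on lists of which only the
  values on \<open>tuples S n\<close> matter. Positions are counted from 0: the arguments
  \<open>x\<^sub>1, \<dots>, x\<^sub>n\<close> form a list of length \<open>n\<close>, while in the predicate form the list
  \<open>[x\<^sub>0, x\<^sub>1, \<dots>, x\<^sub>n]\<close> has length \<open>n + 1\<close>, with \<open>x\<^sub>i\<close> at position \<open>i\<close>.
\<close>

definition tuples :: "'a set \<Rightarrow> nat \<Rightarrow> 'a list set" where
  "tuples S n = {xs. length xs = n \<and> set xs \<subseteq> S}"

definition predicate_form :: "('a list \<Rightarrow> 'a) \<Rightarrow> 'a list \<Rightarrow> bool" where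
  "predicate_form f xs \<longleftrightarrow> hd xs = f (tl xs)"

definition quasigroup :: "'a set \<Rightarrow> nat \<Rightarrow> ('a list \<Rightarrow> 'a) \<Rightarrow> bool" where
  "quasigroup S n f \<longleftrightarrow>
     f \<in> tuples S n \<rightarrow> S \<and>
     (\<forall>xs \<in> tuples S (n + 1). \<forall>i \<le> n. \<exists>!y. y \<in> S \<and> predicate_form f (xs[i := y]))"

text \<open>
  \<open>I\<close> is the set of fixed positions in \<open>0, \<dots>, n\<close> and \<open>a\<close> gives their values. The list
  \<open>nths xs (- I)\<close> consists of the remaining variables in increasing order of index, so the
  one of smallest index is the dependent variable of \<open>g\<close>.
\<close>

definition retract :: "'a set \<Rightarrow> nat \<Rightarrow> ('a list \<Rightarrow> 'a) \<Rightarrow> nat \<Rightarrow> ('a list \<Rightarrow> 'a) \<Rightarrow> bool" where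
  "retract S n f k g \<longleftrightarrow>
     k < n \<and> quasigroup S k g \<and>
     (\<exists>I a. I \<subseteq> {0..n} \<and> card I = n - k \<and> a \<in> I \<rightarrow> S \<and>
        (\<forall>xs \<in> tuples S (n + 1). (\<forall>i \<in> I. xs ! i = a i) \<longrightarrow>
           (predicate_form g (nths xs (- I)) \<longleftrightarrow> predicate_form f xs)))"

definition reducible_quasigroup :: "'a set \<Rightarrow> nat \<Rightarrow> ('a list \<Rightarrow> 'a) \<Rightarrow> bool" where
  "reducible_quasigroup S n f \<longleftrightarrow>
     quasigroup S n f \<and>
     (\<exists>m \<in> {2..n - 1}. \<exists>h g \<sigma>.
        quasigroup S (n - m + 1) h \<and> quasigroup S m g \<and> \<sigma> permutes {..<n} \<and>
        (\<forall>xs \<in> tuples S n.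
           f xs = h (g (take m (permute_list \<sigma> xs)) # drop m (permute_list \<sigma> xs))))"

definition irreducible_quasigroup :: "'a set \<Rightarrow> nat \<Rightarrow> ('a list \<Rightarrow> 'a) \<Rightarrow> bool" where
  "irreducible_quasigroup S n f \<longleftrightarrow> quasigroup S n f \<and> \<not> reducible_quasigroup S n f"

end

theory Submission
  imports Defs "HOL-Number_Theory.Cong"
begin

text \<open>
  The dependent variable \<open>x\<^sub>0\<close> is treated like the others: an \<open>n\<close>-quasigroup is a predicate \<open>F\<close> on the
  functions from \<open>V = {0..n}\<close> to \<open>S\<close> in which any \<open>n\<close> coordinates determine the last one. It is reducible
  iff some \<open>A \<subseteq> V\<close> with at least two elements inside and outside \<open>splits\<close> it: whenever \<open>x\<close>, \<open>y\<close> and the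
  point that agrees with \<open>x\<close> on \<open>A\<close> and with \<open>y\<close> elsewhere satisfy \<open>F\<close>, so does the opposite mixture. Whether
  \<open>A\<close> splits can be tested on retracts in four coordinates, two in \<open>A\<close> and two outside.

  Suppose that the retracts with \<open>card V - 1\<close> or \<open>card V - 2\<close> coordinates are all reducible. If \<open>X\<close> is a maximal
  coordinate set of an irreducible proper retract, then each other coordinate \<open>i\<close> has a unique twin
  \<open>x \<in> X\<close> such that \<open>{i, x}\<close> splits \<open>X \<union> {i}\<close>, the twin does not depend on the values of the remaining
  coordinates, and some \<open>x\<close> together with all its twins splits \<open>V\<close>. If no proper retract in four or more coordinates
  is irreducible, then \<open>V\<close> is split by the same combinatorics by which the quartets determine a tree.

  Now let \<open>card S\<close> be prime, all retracts with \<open>card V - 1\<close> coordinates reducible, and the one on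
  \<open>X = V - {i, j}\<close> irreducible. The twin of \<open>i\<close> may depend on the value of \<open>j\<close> and vice versa; passing from one value to
  another permutes \<open>S\<close> at the twin. Such permutations yield autotopies of the retracts on \<open>X\<close> that move just two
  coordinates, and a nontrivial group of these is transitive since \<open>card S\<close> is prime, so that the two coordinates
  split \<open>X\<close>. For \<open>card X > 3\<close> this forces constant twins and then a split of \<open>V\<close>. For \<open>card X = 3\<close> either no such
  autotopy exists, which gives the same conclusion, or all retracts on three coordinates are isotopic to the
  cyclic group of order \<open>card S\<close>, and a split of \<open>V\<close> is found by comparing the translation groups that they
  induce on a common coordinate.
\<close>

section \<open>Splits\<close>

text \<open>Four coordinates may be split by more than one pairing, as for an iterated group
  operation, and this is the obstacle to reading a tree off the quartets: such a pairing need not, a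
  priori, persist when the other coordinates change their values. A quartet with a single pairing
  does persist, which makes it possible to locate an edge of the tree that is visible for all values
  at once. If there are no such quartets, each coordinate has a twin among any four others, and the
  pairings are constant for that reason instead.

  In the prime case the obstacle is a set \<open>X\<close> of three coordinates. It is never split,
  so its irreducibility carries no information, and its twins need not be unique. The absence of
  autotopies moving two coordinates takes the place of irreducibility there: it turns every identity
  between two products of coordinate permutations into equalities of the factors.\<close>

definition mix :: "'i set \<Rightarrow> ('i \<Rightarrow> 'a) \<Rightarrow> ('i \<Rightarrow> 'a) \<Rightarrow> 'i \<Rightarrow> 'a" where
  "mix A x y = (\<lambda>k. if k \<in> A then x k else y k)"

lemma mix_apply: "mix A x y k = (if k \<in> A then x k else y k)"
  by (simp add: mix_def)

locale latin =
  fixes S :: "'a set" and V :: "'i set" and F :: "('i \<Rightarrow> 'a) \<Rightarrow> bool"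
  assumes finite_V: "finite V"
    and unique_value: "\<And>x i. (\<forall>k. x k \<in> S) \<Longrightarrow> i \<in> V \<Longrightarrow> \<exists>!a. a \<in> S \<and> F (x(i := a))"
begin

text \<open>A retract is encoded as a set \<open>Y\<close> of free coordinates together with a base
  point that supplies the fixed values. No predicate of smaller arity is formed, so all retracts
  live on the same type and can be compared directly.\<close>

definition pts :: "'i set \<Rightarrow> ('i \<Rightarrow> 'a) \<Rightarrow> ('i \<Rightarrow> 'a) set" where
  "pts Y e = {x. (\<forall>k. x k \<in> S) \<and> (\<forall>k. k \<notin> Y \<longrightarrow> x k = e k)}"

text \<open>The condition makes the relation between the part of a point in \<open>A\<close> and the
  part outside a union of disjoint rectangles. This is the shape of an equation
  \<open>g (x_A) = h (x_B)\<close> in which no variable is singled out. Only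
  \<open>A \<inter> Y\<close> matters.\<close>

definition splits :: "'i set \<Rightarrow> ('i \<Rightarrow> 'a) \<Rightarrow> 'i set \<Rightarrow> bool" where
  "splits Y e A \<longleftrightarrow>
     (\<forall>x \<in> pts Y e. \<forall>y \<in> pts Y e. F x \<longrightarrow> F y \<longrightarrow> F (mix A x y) \<longrightarrow> F (mix A y x))"

definition red :: "'i set \<Rightarrow> ('i \<Rightarrow> 'a) \<Rightarrow> bool" where
  "red Y e \<longleftrightarrow> (\<exists>A \<subseteq> Y. 2 \<le> card A \<and> 2 \<le> card (Y - A) \<and> splits Y e A)"

lemma pts_in: "x \<in> pts Y e \<Longrightarrow> x k \<in> S"
  by (simp add: pts_def)

lemma pts_off: "x \<in> pts Y e \<Longrightarrow> k \<notin> Y \<Longrightarrow> x k = e k"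
  by (simp add: pts_def)

lemma pts_trans: "x \<in> pts Y' e' \<Longrightarrow> e' \<in> pts Y e \<Longrightarrow> Y' \<subseteq> Y \<Longrightarrow> x \<in> pts Y e"
  by (auto simp: pts_def)

lemma pts_base: "e' \<in> pts Y e \<Longrightarrow> pts Y e' = pts Y e"
  by (auto simp: pts_def)

lemma pts_refl: "(\<forall>k. e k \<in> S) \<Longrightarrow> e \<in> pts Y e"
  by (auto simp: pts_def)

lemma pts_mix: "x \<in> pts Y e \<Longrightarrow> y \<in> pts Y e \<Longrightarrow> mix A x y \<in> pts Y e"
  by (auto simp: pts_def mix_def)

lemma pts_upd: "x \<in> pts Y e \<Longrightarrow> k \<in> Y \<Longrightarrow> a \<in> S \<Longrightarrow> x(k := a) \<in> pts Y e"
  by (auto simp: pts_def)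

lemma splitsD:
  "splits Y e A \<Longrightarrow> x \<in> pts Y e \<Longrightarrow> y \<in> pts Y e \<Longrightarrow> F x \<Longrightarrow> F y \<Longrightarrow> F (mix A x y) \<Longrightarrow> F (mix A y x)"
  by (auto simp: splits_def)

lemma splits_base: "e' \<in> pts Y e \<Longrightarrow> splits Y e' A = splits Y e A"
  by (simp add: splits_def pts_base)

lemma red_base: "e' \<in> pts Y e \<Longrightarrow> red Y e' = red Y e"
  by (simp add: red_def splits_base)

lemma splits_Int_eq:
  assumes "A \<inter> Y = B \<inter> Y"
  shows "splits Y e A = splits Y e B"
proof -
  have "mix A x y = mix B x y" if "x \<in> pts Y e" "y \<in> pts Y e" for x y
  proof
    fix k show "mix A x y k = mix B x y k"
      using that assms by (cases "k \<in> Y") (auto simp: mix_def pts_def)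
  qed
  then show ?thesis by (simp add: splits_def cong: ball_cong)
qed

lemma splits_compl:
  assumes "\<And>k. k \<in> Y \<Longrightarrow> k \<in> A \<longleftrightarrow> k \<notin> B"
  shows "splits Y e A = splits Y e B"
proof -
  have *: "mix A x y = mix B y x" if "x \<in> pts Y e" "y \<in> pts Y e" for x y
  proof
    fix k show "mix A x y k = mix B y x k"
      using that assms by (cases "k \<in> Y") (auto simp: mix_def pts_def)
  qed
  show ?thesis by (auto simp add: splits_def *)
qed

lemma splits_mono:
  assumes "splits Y e A" "e' \<in> pts Y e" "Y' \<subseteq> Y"
  shows "splits Y' e' A"
  using assms unfolding splits_def by (meson pts_trans)

lemma splits_restrict:
  assumes "splits Y e A" "e' \<in> pts Y e" "Y' \<subseteq> Y" "A \<inter> Y' = B \<inter> Y'"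
  shows "splits Y' e' B"
  using splits_mono[OF assms(1-3)] splits_Int_eq[OF assms(4)] by blast

lemma splits_restrict_compl:
  assumes "splits Y e A" "e' \<in> pts Y e" "Y' \<subseteq> Y" "\<And>k. k \<in> Y' \<Longrightarrow> k \<in> A \<longleftrightarrow> k \<notin> B"
  shows "splits Y' e' B"
  using splits_mono[OF assms(1-3)] splits_compl[OF assms(4)] by blast

section \<open>Local tests for splits and their transfer between retracts\<close>

lemma solve:
  assumes "\<forall>k. x k \<in> S" "i \<in> V" obtains a where "a \<in> S" "F (x(i := a))"
  using unique_value[OF assms] by blast

lemma same_value:
  assumes "\<forall>k. x k \<in> S" "\<forall>k. y k \<in> S" "i \<in> V" "F x" "F y" "\<And>k. k \<noteq> i \<Longrightarrow> x k = y k"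
  shows "x = y"
proof -
  have "y = x(i := y i)" using assms(6) by (metis fun_upd_apply ext)
  moreover have "x = x(i := x i)" by simp
  ultimately have "x i = y i"
    using unique_value[OF assms(1,3)] assms by (metis (no_types, lifting))
  then show ?thesis using assms(6) by (metis ext)
qed

text \<open>Induction on \<open>D\<close>, with \<open>d0\<close> as the spare variable that is
  solved for. One coordinate \<open>d\<close> is changed first, which only involves the given split
  of \<open>A \<union> {d, d0}\<close>; the others follow with \<open>d\<close> frozen.\<close>

lemma splits_local1:
  assumes "finite D" "d0 \<in> D" "A \<inter> D = {}" "D \<subseteq> V"
    and "\<And>d e'. d \<in> D - {d0} \<Longrightarrow> e' \<in> pts (A \<union> D) e \<Longrightarrow> splits (A \<union> {d, d0}) e' A"
  shows "splits (A \<union> D) e A"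
proof -
  have "finite (D - {d0})" using assms(1) by blast
  from this assms(2-5) show ?thesis
  proof (induction "D - {d0}" arbitrary: D e rule: finite_induct)
    case empty
    then have D: "D = {d0}" by blast
    show ?case unfolding splits_def
    proof (intro ballI impI)
      fix x y assume a: "x \<in> pts (A \<union> D) e" "y \<in> pts (A \<union> D) e" "F x" "F y" "F (mix A x y)"
      have m: "mix A x y \<in> pts (A \<union> D) e" using a(1,2) by (rule pts_mix)
      have "x = mix A x y"
      proof (rule same_value[of x _ d0])
        fix k assume "k \<noteq> d0" then show "x k = mix A x y k"
          using a(1,2) D unfolding mix_apply by (auto simp: pts_def)
      qed (use a m pts_in empty.prems(1-3) in auto)
      then have "mix A y x = y"
        using a D empty.prems(2)
        by (intro ext) (smt (verit) Un_iff empty_iff insert_iff mix_apply pts_off)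
      then show "F (mix A y x)" using a by simp
    qed
  next
    case (insert d D')
    have dD: "d \<in> D" "d \<noteq> d0" using insert.hyps by auto
    define D1 where "D1 = D - {d}"
    have IH: "splits (A \<union> D1) e' A" if e': "e' \<in> pts (A \<union> D) e" for e'
    proof (rule insert.hyps(3))
      show "D' = D1 - {d0}" using insert(2,4) by (auto simp: D1_def)
      show "d0 \<in> D1" "A \<inter> D1 = {}" "D1 \<subseteq> V"
        using insert.prems(1-3) dD by (auto simp: D1_def)
      fix c e'' assume c: "c \<in> D1 - {d0}" "e'' \<in> pts (A \<union> D1) e'"
      then have "e'' \<in> pts (A \<union> D) e" using e' pts_trans[of e'' "A \<union> D1" e' "A \<union> D" e]
        by (auto simp: D1_def)
      then show "splits (A \<union> {c, d0}) e'' A" using insert.prems(4)[of c e''] c by (auto simp: D1_def)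
    qed
    show ?case unfolding splits_def
    proof (intro ballI impI)
      fix x y assume a: "x \<in> pts (A \<union> D) e" "y \<in> pts (A \<union> D) e" "F x" "F y" "F (mix A x y)"
      \<comment> \<open>The intermediate point \<open>x2\<close> has the values of \<open>x\<close>
        on \<open>A\<close> and at \<open>d\<close>, those of \<open>y\<close> elsewhere, and
        \<open>d0\<close> solved for.\<close>
      let ?m = "(mix A x y)(d := x d)"
      have m1: "mix A x y \<in> pts (A \<union> D) e" using a(1,2) by (rule pts_mix)
      have m: "?m \<in> pts (A \<union> D) e" by (rule pts_upd[OF m1]) (use dD pts_in[OF a(1)] in auto)
      have "\<forall>k. ?m k \<in> S" using pts_in[OF m] by blast
      then obtain t where t: "t \<in> S" "F (?m(d0 := t))"
        using insert.prems(1,3) solve[of ?m d0] by blast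
      define x2 where "x2 = ?m(d0 := t)"
      have x2: "x2 \<in> pts (A \<union> D) e" "F x2"
        unfolding x2_def using t insert.prems(1) by (auto intro: pts_upd[OF m])
      have x2y: "x2 \<in> pts (A \<union> {d, d0}) y"
        using x2 a by (auto simp: pts_def x2_def mix_def)
      have mx2: "mix A x2 y = mix A x y"
        using insert.prems(1-3) dD by (auto simp: x2_def mix_def fun_eq_iff)
      have s1: "splits (A \<union> {d, d0}) y A" using insert.prems(4)[of d y] a dD by auto
      have y2: "F (mix A y x2)"
        using splitsD[OF s1 x2y pts_refl] x2 a mx2 pts_in by metis
      have y2p: "mix A y x2 \<in> pts (A \<union> D1) x"
        using x2 a insert.prems(1-3) dD by (auto simp: pts_def x2_def mix_def D1_def)
      have xx: "x \<in> pts (A \<union> D1) x" using a pts_in by (auto intro: pts_refl)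
      have mm: "mix A x (mix A y x2) = x2"
        using insert.prems(1-3) dD by (auto simp: x2_def mix_def fun_eq_iff)
      have "F (mix A (mix A y x2) x)"
        using splitsD[OF IH[OF a(1)] xx y2p a(3) y2] mm x2 by simp
      moreover have "mix A (mix A y x2) x = mix A y x" by (auto simp: mix_def)
      ultimately show "F (mix A y x)" by simp
    qed
  qed
qed

text \<open>One fixed coordinate on each side suffices for the tests: \<open>splits_local1\<close>
  is applied once to each of the two complementary sets.\<close>

lemma splits_local:
  assumes "A \<subseteq> Y" "Y \<subseteq> V" "c0 \<in> A" "d0 \<in> Y - A"
    and q: "\<And>c d e'. c \<in> A - {c0} \<Longrightarrow> d \<in> Y - A - {d0} \<Longrightarrow> e' \<in> pts Y e \<Longrightarrow> splits {c, c0, d, d0} e' {c, c0}"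
  shows "splits Y e A"
proof -
  have fY: "finite Y" using assms finite_V finite_subset by blast
  let ?D = "Y - A"
  have 1: "splits (A \<union> {d, d0}) e' A" if d: "d \<in> ?D - {d0}" and e': "e' \<in> pts Y e" for d e'
  proof -
    have AV: "A \<subseteq> V" and "finite A" using assms(1,2) fY finite_subset by auto
    have "splits ({d, d0} \<union> A) e' {d, d0}"
    proof (rule splits_local1[of A c0])
      fix c e'' assume c: "c \<in> A - {c0}" "e'' \<in> pts ({d, d0} \<union> A) e'"
      have "e'' \<in> pts Y e" by (rule pts_trans[OF c(2) e']) (use assms(1-4) d in auto)
      then have s: "splits {c, c0, d, d0} e'' {c, c0}" using q[OF c(1) d] by simp
      have "{c, c0, d, d0} = {d, d0} \<union> {c, c0}" by blast
      moreover have "splits {c, c0, d, d0} e'' {d, d0}"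
        by (rule splits_compl[THEN iffD1, OF _ s]) (use c d assms(1-4) in auto)
      ultimately show "splits ({d, d0} \<union> {c, c0}) e'' {d, d0}" by simp
    qed (use assms(3,4) AV \<open>finite A\<close> d in auto)
    then have s: "splits (A \<union> {d, d0}) e' {d, d0}" by (simp add: Un_commute)
    show ?thesis by (rule splits_compl[THEN iffD1, OF _ s]) (use d assms(1-4) in auto)
  qed
  have "A \<union> ?D = Y" using assms(1) by blast
  moreover have "splits (A \<union> ?D) e A"
    by (rule splits_local1[of ?D d0]) (use 1 fY assms(1-4) calculation in auto)
  ultimately show ?thesis by simp
qed

text \<open>If \<open>D\<close> splits \<open>Y\<close>, then \<open>D\<close> acts on the rest
  through a single value, and \<open>d\<close> alone reaches every such value. So \<open>d\<close>
  can represent \<open>D\<close> while its other elements are frozen, and a split away from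
  \<open>D\<close> seen in this smaller retract is one of \<open>Y\<close>.\<close>

lemma splits_transfer:
  assumes D: "splits Y e D" and dD: "d \<in> D" "D \<subseteq> Y" "Y \<subseteq> V" and B: "B \<inter> D = {}" "B \<subseteq> Y"
    and e': "e' \<in> pts Y e" and s: "splits (insert d (Y - D)) e' B"
  shows "splits Y e B"
  unfolding splits_def
proof (intro ballI impI)
  fix x y assume a: "x \<in> pts Y e" "y \<in> pts Y e" "F x" "F y" "F (mix B x y)"
  \<comment> \<open>Every context \<open>w\<close> outside \<open>D\<close> has a matching part in
    \<open>D\<close> that differs from \<open>e'\<close> at most at \<open>d\<close>.\<close>
  have ex: "\<exists>z \<in> pts Y e. F (mix D z w) \<and> (\<forall>k \<in> D - {d}. z k = e' k)" if w: "w \<in> pts Y e" for w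
  proof -
    have m: "mix D e' w \<in> pts Y e" using e' w by (rule pts_mix)
    obtain t where t: "t \<in> S" "F ((mix D e' w)(d := t))"
      using solve[of "mix D e' w" d] pts_in[OF m] dD by blast
    have "(mix D e' w)(d := t) = mix D (e'(d := t)) w" using dD by (auto simp: mix_def)
    moreover have "e'(d := t) \<in> pts Y e" using e' t dD by (intro pts_upd) auto
    ultimately show ?thesis using t by (intro bexI[of _ "e'(d := t)"]) auto
  qed
  obtain u where u: "u \<in> pts Y e" "F (mix D u x)" "\<forall>k \<in> D - {d}. u k = e' k" using ex[OF a(1)] by blast
  obtain v where v: "v \<in> pts Y e" "F (mix D v y)" "\<forall>k \<in> D - {d}. v k = e' k" using ex[OF a(2)] by blast
  let ?x = "mix D u x" and ?y = "mix D v y"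
  have p: "?x \<in> pts Y e" "?y \<in> pts Y e" "mix B x y \<in> pts Y e" using a u v pts_mix by auto
  have xy: "F (mix B ?x ?y)"
  proof -
    have 1: "mix D (mix B x y) ?y = y" using B by (auto simp: mix_def fun_eq_iff)
    have 2: "mix D ?y (mix B x y) = mix B ?x ?y" using B by (auto simp: mix_def fun_eq_iff)
    show ?thesis using splitsD[OF D p(3) p(2) a(5) v(2)] 1 2 a by simp
  qed
  have q: "?x \<in> pts (insert d (Y - D)) e'" "?y \<in> pts (insert d (Y - D)) e'"
    using u v a e' by (auto simp: pts_def mix_def)
  have yx: "F (mix B ?y ?x)" using splitsD[OF s q u(2) v(2) xy] .
  have 1: "mix D x (mix B ?y ?x) = mix B y x" using B by (auto simp: mix_def fun_eq_iff)
  have 2: "mix D (mix B ?y ?x) x = ?x" using B by (auto simp: mix_def fun_eq_iff)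
  show "F (mix B y x)"
    using splitsD[OF D pts_mix[OF p(2,1)] a(1) yx a(3)] 1 2 u by simp
qed

text \<open>Take the fixed test coordinates in \<open>A \<inter> B\<close> and outside
  \<open>A \<union> B\<close>. Any other coordinate outside the intersection lies outside
  \<open>A\<close> or outside \<open>B\<close>, and that set settles the test.\<close>

lemma splits_Int:
  assumes "splits Y e A" "splits Y e B" "A \<subseteq> Y" "B \<subseteq> Y" "Y \<subseteq> V" "A \<inter> B \<noteq> {}" "A \<union> B \<noteq> Y"
  shows "splits Y e (A \<inter> B)"
proof -
  obtain c0 d0 where c: "c0 \<in> A \<inter> B" "d0 \<in> Y - (A \<union> B)" using assms by blast
  show ?thesis
  proof (rule splits_local[of _ _ c0 d0])
    fix c d e' assume h: "c \<in> A \<inter> B - {c0}" "d \<in> Y - A \<inter> B - {d0}" "e' \<in> pts Y e"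
    then consider "d \<notin> A" | "d \<notin> B" by blast
    then show "splits {c, c0, d, d0} e' {c, c0}"
    proof cases
      case 1 show ?thesis by (rule splits_restrict[OF assms(1) h(3)]) (use 1 h c assms in auto)
    next
      case 2 show ?thesis by (rule splits_restrict[OF assms(2) h(3)]) (use 2 h c assms in auto)
    qed
  qed (use c assms in auto)
qed

lemma splits_Un:
  assumes "splits Y e A" "splits Y e B" "A \<subseteq> Y" "B \<subseteq> Y" "Y \<subseteq> V" "A \<inter> B \<noteq> {}" "A \<union> B \<noteq> Y"
  shows "splits Y e (A \<union> B)"
proof -
  have c: "splits Y e (Y - C) = splits Y e C" for C by (rule splits_compl) auto
  have "splits Y e ((Y - A) \<inter> (Y - B))"
    by (rule splits_Int) (use assms c in auto)
  moreover have "(Y - A) \<inter> (Y - B) = Y - (A \<union> B)" by blast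
  ultimately show ?thesis using c by metis
qed

lemma splits_Compl: "splits Y e (Y - A) = splits Y e A"
  by (rule splits_compl) auto

lemma splits_singleton:
  assumes "c \<in> V" "Y \<subseteq> V" "c \<in> Y" shows "splits Y e {c}"
proof (cases "Y = {c}")
  case True
  have "splits Y e {}" by (simp add: splits_def mix_def)
  then show ?thesis by (rule splits_compl[THEN iffD1, rotated]) (use True in auto)
next
  case False
  then obtain d0 where d0: "d0 \<in> Y - {c}" using assms by blast
  show ?thesis by (rule splits_local[of "{c}" Y c d0]) (use assms d0 in auto)
qed

end

section \<open>Twins of coordinates outside an irreducible set\<close>

lemma card_le1_cases: "finite B \<Longrightarrow> card B \<le> 1 \<Longrightarrow> B = {} \<or> (\<exists>x. B = {x})"
  by (metis card_1_singletonE card_eq_0_iff le_neq_implies_less less_one)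

context latin
begin

lemma redI: "A \<subseteq> Y \<Longrightarrow> 2 \<le> card A \<Longrightarrow> 2 \<le> card (Y - A) \<Longrightarrow> splits Y e A \<Longrightarrow> red Y e"
  unfolding red_def by blast

lemma irr_trace:
  assumes "\<not> red X e" "finite X" "X \<subseteq> Y" "splits Y e' B" "e \<in> pts Y e'"
  shows "card (X \<inter> B) \<le> 1 \<or> card (X - B) \<le> 1"
proof (rule ccontr)
  assume h: "\<not> ?thesis"
  have "splits X e (X \<inter> B)" by (rule splits_restrict[OF assms(4,5,3)]) auto
  moreover have "X - (X \<inter> B) = X - B" by blast
  ultimately have "red X e" using h by (intro redI[of "X \<inter> B"]) auto
  then show False using assms(1) by blast
qed

lemma irr_split:
  assumes "\<not> red X e" "X \<subseteq> Y" "Y \<subseteq> V" "red Y e'" "e \<in> pts Y e'"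
  obtains B where "B \<subseteq> Y" "2 \<le> card B" "2 \<le> card (Y - B)" "splits Y e' B" "card (X \<inter> B) \<le> 1"
proof -
  obtain B where B: "B \<subseteq> Y" "2 \<le> card B" "2 \<le> card (Y - B)" "splits Y e' B"
    using assms(4) unfolding red_def by blast
  have fX: "finite X" using assms(2,3) finite_V finite_subset by (metis subset_trans)
  show thesis
  proof (cases "card (X \<inter> B) \<le> 1")
    case True then show ?thesis using that B by blast
  next
    case False
    then have "card (X - B) \<le> 1" using irr_trace[OF assms(1) fX assms(2) B(4) assms(5)] by blast
    moreover have "X \<inter> (Y - B) = X - B" "Y - (Y - B) = B" using assms(2) B(1) by auto
    ultimately show ?thesis using that[of "Y - B"] B splits_Compl by auto
  qed
qed

text \<open>A split of \<open>insert i X\<close> induces no proper split of \<open>X\<close>, so one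
  of its sides has at most one element in \<open>X\<close>. That side has two elements, hence it is
  \<open>i\<close> with a partner.\<close>

lemma attach:
  assumes "\<not> red X e" "X \<subseteq> V" "i \<in> V - X" "red (insert i X) e'" "e \<in> pts (insert i X) e'"
  obtains x where "x \<in> X" "splits (insert i X) e' {i, x}"
proof -
  have fX: "finite X" using assms(2) finite_V finite_subset by blast
  obtain B where B: "B \<subseteq> insert i X" "2 \<le> card B" "splits (insert i X) e' B" "card (X \<inter> B) \<le> 1"
    using irr_split[OF assms(1) subset_insertI _ assms(4,5)] assms(2,3)
    by (metis DiffD1 insert_subset)
  have Bs: "B \<subseteq> insert i (X \<inter> B)" using B(1) by blast
  from card_le1_cases[OF _ B(4)] fX consider "X \<inter> B = {}" | x where "X \<inter> B = {x}" by auto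
  then show thesis
  proof cases
    case 1
    then have "card B \<le> card {i}" using Bs by (intro card_mono) auto
    then show ?thesis using B(2) by simp
  next
    case 2
    have "i \<in> B"
    proof (rule ccontr)
      assume "i \<notin> B" then have "card B \<le> card {x}" using Bs 2 by (intro card_mono) auto
      then show False using B(2) by simp
    qed
    then have "B = {i, x}" using 2 Bs by blast
    then show ?thesis using that B(3) 2 by blast
  qed
qed

text \<open>Two partners give the split \<open>{i, x, y}\<close> by union, hence the split
  \<open>{x, y}\<close> of \<open>X\<close>. This is a contradiction only if two elements of
  \<open>X\<close> remain outside the pair, hence the bound four.\<close>

lemma attach_unique:
  assumes "\<not> red X e" "X \<subseteq> V" "4 \<le> card X" "i \<in> V - X" "e \<in> pts (insert i X) e'"
    and "splits (insert i X) e' {i, x}" "splits (insert i X) e' {i, y}" "x \<in> X" "y \<in> X"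
  shows "x = y"
proof (rule ccontr)
  assume ne: "x \<noteq> y"
  have fX: "finite X" using assms(2) finite_V finite_subset by blast
  have u: "{i, x} \<union> {i, y} \<noteq> insert i X"
  proof
    assume "{i, x} \<union> {i, y} = insert i X"
    then have "insert i X \<subseteq> {i, x, y}" by auto
    then have "X \<subseteq> {x, y}" using assms(4) by auto
    then have "card X \<le> card {x, y}" by (intro card_mono) auto
    then show False using assms(3) ne by simp
  qed
  have "splits (insert i X) e' ({i, x} \<union> {i, y})"
    by (rule splits_Un[OF assms(6,7)]) (use assms(2,4,8,9) u in auto)
  then have "splits X e {x, y}"
    by (rule splits_restrict[OF _ assms(5)]) (use assms in auto)
  moreover have "card (X - {x, y}) \<ge> 2" using assms(3,8,9) ne fX by (simp add: card_Diff_subset)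
  ultimately have "red X e" using ne assms by (intro redI[of "{x, y}"]) auto
  then show False using assms(1) by blast
qed

text \<open>The value of \<open>i\<close> can be absorbed into its twin \<open>x\<close>. A split of
  \<open>X\<close> found for one value of \<open>i\<close>, taken on the side without
  \<open>x\<close>, lifts to \<open>insert i X\<close> and restricts to every other value.\<close>

lemma irr_transfer:
  assumes "\<not> red X e" "X \<subseteq> V" "x \<in> X" "i \<in> V - X" "splits (insert i X) e' {i, x}"
    "e \<in> pts (insert i X) e'" "e2 \<in> pts (insert i X) e'"
  shows "\<not> red X e2"
proof
  assume "red X e2"
  then obtain A where A: "A \<subseteq> X" "2 \<le> card A" "2 \<le> card (X - A)" "splits X e2 A"
    unfolding red_def by blast
  obtain B where B: "B \<subseteq> X" "2 \<le> card B" "2 \<le> card (X - B)" "splits X e2 B" "x \<notin> B"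
  proof (cases "x \<in> A")
    case True
    have "X - (X - A) = A" using A by blast
    then show ?thesis using that[of "X - A"] A True splits_Compl by auto
  qed (use A that in auto)
  have eq: "insert x (insert i X - {i, x}) = X" using assms(3,4) by blast
  have "splits (insert i X) e' B"
    by (rule splits_transfer[OF assms(5), of x]) (use assms B eq in auto)
  then have "splits X e B" by (rule splits_restrict[OF _ assms(6)]) auto
  then show False using assms(1) B redI by blast
qed

lemma change_coordinates:
  assumes "finite D" "e' \<in> pts D e" "P e" "(\<forall>k. e k \<in> S)"
    and "\<And>d x b. d \<in> D \<Longrightarrow> x \<in> pts D e \<Longrightarrow> P x \<Longrightarrow> b \<in> S \<Longrightarrow> P (x(d := b))"
  shows "P e'"
  using assms(1,2) assms(5)
proof (induction D arbitrary: e' rule: finite_induct)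
  case empty
  then have "e' = e" by (auto simp: pts_def)
  then show ?case using assms(3) by simp
next
  case (insert d D)
  have p: "e'(d := e d) \<in> pts D e" using insert.prems(1) assms(4) by (auto simp: pts_def)
  have "P (e'(d := e d))"
  proof (rule insert.IH[OF p])
    fix k x b assume "k \<in> D" "x \<in> pts D e" "P x" "b \<in> S"
    moreover from this(2) have "x \<in> pts (insert d D) e" by (auto simp: pts_def)
    ultimately show "P (x(k := b))" using insert.prems(2)[of k x b] by blast
  qed
  moreover have "e'(d := e d) \<in> pts (insert d D) e" "e' d \<in> S"
    using p insert.prems(1) by (auto simp: pts_def)
  ultimately have "P ((e'(d := e d))(d := e' d))"
    using insert.prems(2)[of d "e'(d := e d)" "e' d"] by blast
  then show ?case by simp
qed

text \<open>Extensions by one or two coordinates are enough, because a test quadruple with two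
  coordinates in \<open>X\<close> has at most two others.\<close>

theorem red_if_extensions_red:
  assumes irr: "\<not> red X e" and val: "\<forall>k. e k \<in> S" and XV: "X \<subset> V" and X4: "4 \<le> card X"
    and ext1: "\<And>i e'. i \<in> V - X \<Longrightarrow> e' \<in> pts V e \<Longrightarrow> red (insert i X) e'"
    and ext2: "\<And>i j e'. i \<in> V - X \<Longrightarrow> j \<in> V - X \<Longrightarrow> i \<noteq> j \<Longrightarrow> e' \<in> pts V e \<Longrightarrow> red (insert i (insert j X)) e'"
  shows "red V e"
proof -
  have fX: "finite X" using XV finite_V finite_subset by blast
  have self: "e' \<in> pts Y e'" if "e' \<in> pts V e" for Y e' using that by (auto simp: pts_def)
  have irr_all: "\<not> red X e'" if e': "e' \<in> pts V e" for e'
  proof -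
    define e1 where "e1 = mix X e' e"
    have e1: "e1 \<in> pts X e" "e' \<in> pts (V - X) e1" "e1 \<in> pts V e"
      using e' XV val by (auto simp: pts_def e1_def mix_def)
    show ?thesis
    proof (rule change_coordinates[of "V - X" e' e1])
      show "\<not> red X e1" using irr red_base e1(1) by blast
      fix d x b assume h: "d \<in> V - X" "x \<in> pts (V - X) e1" "\<not> red X x" "b \<in> S"
      have x: "x \<in> pts V e" using h(2) e1(3) pts_trans by (meson Diff_subset)
      obtain u where u: "u \<in> X" "splits (insert d X) x {d, u}"
        using attach[OF h(3) _ h(1) ext1[OF h(1) x] self[OF x]] XV by blast
      show "\<not> red X (x(d := b))"
        by (rule irr_transfer[OF h(3) _ u(1) h(1) u(2)]) (use x XV h self in \<open>auto intro: pts_upd\<close>)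
    qed (use e1 finite_V in \<open>auto simp: pts_in\<close>)
  qed
  have att: "\<exists>x \<in> X. splits (insert i X) e' {i, x}" if "i \<in> V - X" "e' \<in> pts V e" for i e'
    using attach[OF irr_all[OF that(2)] _ that(1) ext1[OF that] self[OF that(2)]] XV by blast
  have uniq: "x = y" if "i \<in> V - X" "e' \<in> pts V e" "splits (insert i X) e' {i, x}"
      "splits (insert i X) e' {i, y}" "x \<in> X" "y \<in> X" for i e' x y
    using attach_unique[OF irr_all[OF that(2)] _ X4 that(1) self[OF that(2)] that(3-6)] XV by blast
  \<comment> \<open>Up to complements, a split of \<open>X\<close> with \<open>i\<close> and
    \<open>j\<close> is \<open>{i, j}\<close>, \<open>{i, u}\<close>, \<open>{j, u}\<close> or
    \<open>{i, j, u}\<close> for some \<open>u\<close> in \<open>X\<close>. In each case the twin of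
    \<open>i\<close> survives a change of \<open>j\<close>, and \<open>{i, x}\<close> splits the
    whole set unless \<open>j\<close> has the same twin.\<close>
  have pair: "splits (insert i X) (e'(j := b)) {i, x} \<and>
      (\<forall>y \<in> X. splits (insert j X) e' {j, y} \<longrightarrow> y \<noteq> x \<longrightarrow>
         splits (insert j X) (e'(i := c)) {j, y} \<longrightarrow> splits (insert i (insert j X)) e' {i, x})"
    if ij: "i \<in> V - X" "j \<in> V - X" "i \<noteq> j" and e': "e' \<in> pts V e" and b: "b \<in> S" and x: "x \<in> X"
      and sx: "splits (insert i X) e' {i, x}" for i j e' b x c
  proof -
    let ?Y = "insert i (insert j X)"
    have YV: "?Y \<subseteq> V" using ij XV by blast
    have red: "red ?Y e'" using ext2 ij e' by blast
    obtain B where B: "B \<subseteq> ?Y" "2 \<le> card B" "splits ?Y e' B" "card (X \<inter> B) \<le> 1"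
      using irr_split[OF irr_all[OF e'] _ YV red self[OF e']] by blast
    have eb: "e'(j := b) \<in> pts ?Y e'" "e'(j := b) \<in> pts V e" using e' b ij
      by (auto simp: pts_def)
    have down: "splits (insert i X) (e'(j := b)) C" if "splits ?Y e' C" for C
      by (rule splits_restrict[OF that eb(1)]) auto
    have down0: "splits (insert i X) e' C" if "splits ?Y e' C" for C
      by (rule splits_restrict[OF that self[OF e']]) auto
    have downj: "splits (insert j X) e' C" if "splits ?Y e' C" for C
      by (rule splits_restrict[OF that self[OF e']]) auto
    have cut: "splits (insert i X) f (insert j C) = splits (insert i X) f C" for f C
      using ij by (intro splits_Int_eq) auto
    have cutj: "splits (insert j X) f (insert i C) = splits (insert j X) f C" for f C
      using ij by (intro splits_Int_eq) auto
    have Bs: "B \<subseteq> {i, j} \<union> (X \<inter> B)" using B(1) by blast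
    from card_le1_cases[OF _ B(4)] fX consider "X \<inter> B = {}" | u where "X \<inter> B = {u}" by auto
    then show ?thesis
    proof cases
      case 1
      then have "B = {i, j}"
        using Bs B(2) ij(3) by (metis card_2_iff card_mono card_seteq finite.intros sup_bot.right_neutral card_insert_disjoint)
      then have sB: "splits ?Y e' {i, j}" using B(3) by simp
      have eqs: "insert i (?Y - {i, j}) = insert i X" using ij by blast
      have "splits (insert i X) e' (X - {x})"
        using splits_compl[of "insert i X" "{i, x}" "X - {x}" e'] sx ij(1) x by auto
      \<comment> \<open>\<open>{i, j}\<close> now acts like one coordinate. Lifting needs a set that
        avoids it, so the complement of the twin pair is lifted.\<close>
      then have s: "splits ?Y e' (X - {x})"
        by - (rule splits_transfer[OF sB, of i _ e'], use ij YV x eqs self[OF e'] in auto)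
      have "splits (insert i X) (e'(j := b)) {i, x}"
        using down[OF s] splits_compl[of "insert i X" "{i, x}" "X - {x}"] ij(1) x by auto
      moreover have "splits (insert j X) e' {j, x}"
        using downj[OF s] splits_compl[of "insert j X" "{j, x}" "X - {x}"] ij(2) x by auto
      ultimately show ?thesis using uniq[OF ij(2) e'] x by blast
    next
      case 2
      then have uX: "u \<in> X" "u \<in> B" by auto
      have "\<not> B \<subseteq> {u}" using B(2) card_mono[of "{u}" B] by auto
      then consider "B = {i, u}" | "B = {i, j, u}" | "B = {j, u}" using Bs 2 uX by blast
      then show ?thesis
      proof cases
        case 1
        then have "u = x" using uniq[OF ij(1) e' down0[of "{i, u}"] sx uX(1) x] B(3) by simp
        then show ?thesis using 1 B(3) down by blast
      next
        case 2
        then have "u = x" using uniq[OF ij(1) e' _ sx uX(1) x] down0[OF B(3)] cut[of _ "{i, u}"]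
          by (simp add: insert_commute)
        moreover have "splits (insert i X) (e'(j := b)) {i, u}"
          using down[OF B(3)] cut[of _ "{i, u}"] 2 by (simp add: insert_commute)
        moreover have "splits (insert j X) e' {j, u}" using downj[OF B(3)] cutj[of _ "{j, u}"] 2 by simp
        ultimately show ?thesis using uniq[OF ij(2) e'] x by blast
      next
        case 3
        then have sB: "splits ?Y e' {j, u}" using B(3) by simp
        have eqs: "insert u (?Y - {j, u}) = insert i X" using ij uX by blast
        have tr: "splits ?Y e' {i, v}" if "v \<in> X" "v \<noteq> u" "f \<in> pts ?Y e'" "splits (insert i X) f {i, v}" for v f
          by (rule splits_transfer[OF sB, of u]) (use that ij YV eqs uX in auto)
        show ?thesis
        proof (cases "u = x")
          case False
          then have "splits ?Y e' {i, x}" using tr[OF x _ self[OF e'] sx] by blast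
          then show ?thesis using down by blast
        next
          case True
          obtain v where v: "v \<in> X" "splits (insert i X) (e'(j := b)) {i, v}"
            using att[OF ij(1) eb(2)] by blast
          have "v = u"
          proof (rule ccontr)
            assume "v \<noteq> u"
            then have "splits ?Y e' {i, v}" using tr[OF v(1) _ eb(1) v(2)] by blast
            then show False using uniq[OF ij(1) e' down0 sx v(1) x] \<open>v \<noteq> u\<close> True by blast
          qed
          then show ?thesis using v True downj[OF sB] uniq[OF ij(2) e'] x by blast
        qed
      qed
    qed
  qed
  have const: "splits (insert i X) e' {i, x}"
    if i: "i \<in> V - X" and x: "x \<in> X" "splits (insert i X) e {i, x}" and e': "e' \<in> pts V e" for i x e'
  proof -
    define e1 where "e1 = mix (insert i X) e' e"
    have e1: "e1 \<in> pts (insert i X) e" "e' \<in> pts (V - insert i X) e1" "e1 \<in> pts V e"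
      using e' i XV val by (auto simp: pts_def e1_def mix_def)
    show ?thesis
    proof (rule change_coordinates[of "V - insert i X" e' e1])
      show "splits (insert i X) e1 {i, x}" using x splits_base e1(1) by blast
      fix d y b assume h: "d \<in> V - insert i X" "y \<in> pts (V - insert i X) e1" "splits (insert i X) y {i, x}" "b \<in> S"
      have y: "y \<in> pts V e" using h(2) e1(3) pts_trans by (meson Diff_subset)
      show "splits (insert i X) (y(d := b)) {i, x}"
        using pair[OF i _ _ y h(4) x(1) h(3)] h(1) by blast
    qed (use e1 finite_V in \<open>auto simp: pts_in\<close>)
  qed
  have eV: "e \<in> pts V e" using val by (simp add: pts_refl)
  obtain c where c: "\<And>i. i \<in> V - X \<Longrightarrow> c i \<in> X \<and> splits (insert i X) e {i, c i}"
    using att[OF _ eV] by metis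
  \<comment> \<open>Any outside coordinate will do: its twin class has two elements, and three
    elements of \<open>X\<close> stay outside the class.\<close>
  obtain i0 where i0: "i0 \<in> V - X" using XV by blast
  define x where "x = c i0"
  have x: "x \<in> X" using c i0 x_def by blast
  define C where "C = insert x {i \<in> V - X. c i = x}"
  have X3: "3 \<le> card (X - {x})" using X4 x fX by simp
  then have "X - {x} \<noteq> {}" by (metis card.empty not_numeral_le_zero)
  then obtain d0 where d0: "d0 \<in> X - {x}" by blast
  have CV: "C \<subseteq> V" using x XV by (auto simp: C_def)
  have "splits V e C"
  proof (rule splits_local[of _ _ x d0])
    fix i d e' assume h: "i \<in> C - {x}" "d \<in> V - C - {d0}" "e' \<in> pts V e"
    have i: "i \<in> V - X" "c i = x" using h by (auto simp: C_def)
    have six: "splits (insert i X) f {i, x}" if "f \<in> pts V e" for f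
      using const[OF i(1) _ _ that] c[OF i(1)] i by simp
    show "splits {i, x, d, d0} e' {i, x}"
    proof (cases "d \<in> X")
      case True
      show ?thesis by (rule splits_restrict[OF six[OF h(3)] self[OF h(3)]]) (use True d0 x h i in auto)
    next
      case False
      then have d: "d \<in> V - X" "c d \<noteq> x" using h by (auto simp: C_def)
      have "splits (insert d X) f {d, c d}" if "f \<in> pts V e" for f
        using const[OF d(1) _ _ that] c[OF d(1)] by simp
      then have "splits (insert i (insert d X)) e' {i, x}"
        using pair[OF i(1) d(1) _ h(3) _ x six[OF h(3)], of "e' d" "e' i"] i d c[OF d(1)] h(3)
          pts_in[OF h(3)] by auto
      then show ?thesis by (rule splits_restrict[OF _ self[OF h(3)]]) (use d0 x d i in auto)
    qed
  qed (use CV x d0 XV in \<open>auto simp: C_def\<close>)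
  moreover have "2 \<le> card C"
  proof -
    have "{x, i0} \<subseteq> C" using i0 by (auto simp: C_def x_def)
    then have "card {x, i0} \<le> card C" using CV finite_V finite_subset by (intro card_mono) auto
    then show ?thesis using x i0 by (auto simp: card_insert_if split: if_splits)
  qed
  moreover have "2 \<le> card (V - C)"
  proof -
    have "X - {x} \<subseteq> V - C" using XV by (auto simp: C_def)
    then have "card (X - {x}) \<le> card (V - C)" using finite_V by (intro card_mono) auto
    then show ?thesis using X3 by simp
  qed
  ultimately show ?thesis using CV redI by blast
qed

end

section \<open>Completely reducible retracts and quartets\<close>

context latin
begin

text \<open>As in \<open>irr_transfer\<close>, the value of \<open>i\<close> can be absorbed into
  \<open>x\<close>. Lifting requires a side without \<open>x\<close>, hence the passage to the
  complement in \<open>B\<close>.\<close>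

lemma twin_transfer:
  assumes "splits (insert i X) e {i, x}" "x \<in> X" "i \<in> V - X" "X \<subseteq> V"
    and "e1 \<in> pts (insert i X) e" "e2 \<in> pts (insert i X) e" "splits X e1 C"
  shows "splits X e2 C"
proof -
  define B where "B = (if x \<in> C then X - C else C \<inter> X)"
  have B: "splits X f C = splits X f B" for f
  proof (cases "x \<in> C")
    case True then show ?thesis unfolding B_def by (simp, intro splits_compl) auto
  next
    case False then show ?thesis unfolding B_def by (simp, intro splits_Int_eq) auto
  qed
  have xB: "x \<notin> B" "B \<subseteq> X" using assms(2) by (auto simp: B_def)
  have eq: "insert x (insert i X - {i, x}) = X" using assms(2,3) by blast
  have s1: "splits X e1 B" using assms(7) B by simp
  have "splits (insert i X) e B"
    by (rule splits_transfer[OF assms(1) _ _ _ _ _ assms(5), of x]) (use assms(2-4) xB s1 eq in auto)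
  then have "splits X e2 B" by (rule splits_restrict[OF _ assms(6)]) auto
  then show ?thesis using B by simp
qed

lemma constant_on_pts:
  assumes "Y \<subseteq> V" "e \<in> pts V b" "e' \<in> pts V b" "P e"
    and step: "\<And>x d c. d \<in> V - Y \<Longrightarrow> x \<in> pts V b \<Longrightarrow> P x \<Longrightarrow> c \<in> S \<Longrightarrow> P (x(d := c))"
    and irrelevant: "\<And>x y. x \<in> pts V b \<Longrightarrow> y \<in> pts Y x \<Longrightarrow> P x \<Longrightarrow> P y"
  shows "P e'"
proof -
  define e1 where "e1 = mix Y e' e"
  have e1: "e1 \<in> pts Y e" "e' \<in> pts (V - Y) e1" "e1 \<in> pts V b"
    using assms(1-3) by (auto simp: pts_def e1_def mix_def)
  show ?thesis
  proof (rule change_coordinates[of "V - Y" e' e1])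
    show "P e1" using irrelevant[OF assms(2) e1(1) assms(4)] .
    fix d y c assume h: "d \<in> V - Y" "y \<in> pts (V - Y) e1" "P y" "c \<in> S"
    have y: "y \<in> pts V b" using h(2) e1(3) pts_trans by (meson Diff_subset)
    show "P (y(d := c))" using step[OF h(1) y h(3,4)] .
  qed (use e1 finite_V in \<open>auto simp: pts_in\<close>)
qed

text \<open>\<open>crd\<close> stands for completely reducible: the decomposition can be continued
  down to binary operations, which is what makes a tree available.\<close>

definition crd :: "'i set \<Rightarrow> ('i \<Rightarrow> 'a) \<Rightarrow> bool" where
  "crd Y e \<longleftrightarrow> (\<forall>Y' \<subseteq> Y. \<forall>e' \<in> pts Y e. 4 \<le> card Y' \<longrightarrow> red Y' e')"

lemma crd_mono: "crd Y e \<Longrightarrow> Y' \<subseteq> Y \<Longrightarrow> e' \<in> pts Y e \<Longrightarrow> crd Y' e'"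
  unfolding crd_def by (meson pts_trans subset_trans)

lemma red_avoid:
  assumes "red Y e" "w \<in> Y"
  obtains B where "B \<subseteq> Y" "w \<notin> B" "2 \<le> card B" "2 \<le> card (Y - B)" "splits Y e B"
proof -
  obtain A where A: "A \<subseteq> Y" "2 \<le> card A" "2 \<le> card (Y - A)" "splits Y e A"
    using assms unfolding red_def by blast
  have "Y - (Y - A) = A" using A by blast
  moreover have "splits Y e (Y - A)" using A(4) splits_Compl by blast
  ultimately show thesis using that[of A] that[of "Y - A"] A assms(2) by (cases "w \<in> A") simp_all
qed

text \<open>A smallest split has two elements. If \<open>A\<close> had three, freeze all outside
  coordinates but one, \<open>w\<close>; the retract on \<open>insert w A\<close> is reducible, and
  its split on the side without \<open>w\<close> lifts to a smaller split of
  \<open>Y\<close>.\<close>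

lemma cherry:
  assumes "crd Y e" "Y \<subseteq> V" "4 \<le> card Y" "\<forall>k. e k \<in> S"
  obtains p q where "p \<in> Y" "q \<in> Y" "p \<noteq> q" "splits Y e {p, q}"
proof -
  have ee: "e \<in> pts X e" for X using assms(4) by (rule pts_refl)
  have fY: "finite Y" using assms(2) finite_V finite_subset by blast
  let ?P = "\<lambda>A. A \<subseteq> Y \<and> 2 \<le> card A \<and> 2 \<le> card (Y - A) \<and> splits Y e A"
  have "red Y e" using assms(1,3) ee[of Y] unfolding crd_def by blast
  then obtain A0 where "?P A0" unfolding red_def by (elim exE)
  then obtain A where A: "?P A \<and> (\<forall>B. ?P B \<longrightarrow> card A \<le> card B)"
    by (elim ex_has_least_nat[of ?P _ card, THEN exE])
  have fA: "finite A" using A(1) fY finite_subset by blast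
  have "card A = 2"
  proof (rule ccontr)
    assume "card A \<noteq> 2"
    then have c3: "3 \<le> card A" using A(1) by linarith
    have "Y - A \<noteq> {}" using A(1) by (metis card.empty not_numeral_le_zero)
    then obtain w where w: "w \<in> Y - A" by blast
    have "4 \<le> card (insert w A)" using w c3 fA by simp
    moreover have "insert w A \<subseteq> Y" using w A(1) by blast
    ultimately have "red (insert w A) e" using assms(1) ee[of Y] unfolding crd_def by blast
    then obtain B where B: "B \<subseteq> insert w A" "w \<notin> B" "2 \<le> card B" "2 \<le> card (insert w A - B)"
      "splits (insert w A) e B" using red_avoid[of "insert w A" e w] by blast
    have eq: "insert w (Y - (Y - A)) = insert w A" using A(1) by blast
    have sY: "splits Y e (Y - A)" using A(1) splits_Compl by blast
    have s: "splits Y e B"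
      by (rule splits_transfer[OF sY _ _ assms(2) _ _ ee, of w]) (use w B A(1) eq in auto)
    have BA: "B \<subseteq> A" using B by blast
    have "card (Y - A) \<le> card (Y - B)" using BA fY by (intro card_mono) auto
    then have "2 \<le> card (Y - B)" using A by linarith
    then have "card A \<le> card B" using A s B(3) BA by blast
    then have "A = B" using BA fA card_seteq by blast
    then have "insert w A - B = {w}" using w by blast
    then show False using B(4) by simp
  qed
  then show thesis using that A(1) card_2_iff by (metis insert_subset)
qed

text \<open>Induction on the coordinates outside \<open>Q\<close>. A cherry inside \<open>Q\<close>
  is itself the wanted split. Otherwise one of its elements, \<open>p'\<close>, lies outside
  \<open>Q\<close>; it is deleted and later put back next to its partner \<open>q'\<close>.\<close>

lemma four_point_split:
  assumes "crd Y e" "Y \<subseteq> V" "Q \<subseteq> Y" "card Q = 4" "\<forall>k. e k \<in> S"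
  shows "\<exists>A \<subseteq> Y. splits Y e A \<and> card (A \<inter> Q) = 2"
  using assms
proof (induction "card (Y - Q)" arbitrary: Y)
  case 0
  have fY: "finite Y" using 0(3) finite_V finite_subset by blast
  have YQ: "Y = Q" using 0(1,4) fY by auto
  have "red Y e" using 0(2) YQ 0(5) pts_refl[OF 0(6), of Y] unfolding crd_def by (metis order_refl)
  then obtain A where A: "A \<subseteq> Y" "2 \<le> card A" "2 \<le> card (Y - A)" "splits Y e A"
    unfolding red_def by blast
  have "card A + card (Y - A) = 4"
    using A(1) fY YQ 0(5) card_Diff_subset[of A Y] card_mono[OF fY A(1)] finite_subset[OF A(1) fY] by simp
  then have "card A = 2" using A by linarith
  moreover have "A \<inter> Q = A" using A(1) YQ by blast
  ultimately show ?case using A(1,4) by (intro exI[of _ A]) simp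
next
  case (Suc n)
  have fY: "finite Y" using Suc.prems(2) finite_V finite_subset by blast
  then have "4 \<le> card Y" using Suc.prems(3,4) card_mono by metis
  then obtain p q where pq: "p \<in> Y" "q \<in> Y" "p \<noteq> q" "splits Y e {p, q}"
    using cherry[OF Suc.prems(1,2) _ Suc.prems(5)] by blast
  show ?case
  proof (cases "p \<in> Q \<and> q \<in> Q")
    case True
    then have "{p, q} \<inter> Q = {p, q}" by blast
    then show ?thesis using pq by (intro exI[of _ "{p, q}"]) auto
  next
    case False
    then obtain p' q' where pq': "p' \<in> Y" "q' \<in> Y" "p' \<noteq> q'" "splits Y e {p', q'}" "p' \<notin> Q"
      using pq by (metis insert_commute)
    let ?Y = "Y - {p'}"
    have ee: "e \<in> pts X e" for X using Suc.prems(5) by (rule pts_refl)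
    have "\<exists>A \<subseteq> ?Y. splits ?Y e A \<and> card (A \<inter> Q) = 2"
    proof (rule Suc.hyps(1))
      have "Y - Q = insert p' (?Y - Q)" using pq' by blast
      then have "card (Y - Q) = Suc (card (?Y - Q))" using fY by (metis DiffE card_insert_disjoint finite_Diff insertI1)
      then show "n = card (?Y - Q)" using Suc.hyps(2) by simp
      show "crd ?Y e" using crd_mono[OF Suc.prems(1) _ ee] by blast
    qed (use Suc.prems pq' in auto)
    then obtain A where A: "A \<subseteq> ?Y" "splits ?Y e A" "card (A \<inter> Q) = 2" by blast
    define B where "B = (if q' \<in> A then ?Y - A else A)"
    have B: "B \<subseteq> ?Y" "splits ?Y e B" "q' \<notin> B" using A splits_Compl by (auto simp: B_def)
    have cB: "card (B \<inter> Q) = 2"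
    proof (cases "q' \<in> A")
      case True
      have "B \<inter> Q = Q - (A \<inter> Q)" using Suc.prems(3) pq'(5) True by (auto simp: B_def)
      moreover have "finite Q" using Suc.prems(3) fY finite_subset by blast
      ultimately show ?thesis using A(3) Suc.prems(4) by (simp add: card_Diff_subset)
    qed (use A B_def in auto)
    have eq: "insert q' (Y - {p', q'}) = ?Y" using pq' by blast
    have "splits Y e B"
      by (rule splits_transfer[OF pq'(4) _ _ Suc.prems(2) _ _ ee, of q']) (use pq' B eq in auto)
    then show ?thesis using B cB by blast
  qed
qed

text \<open>The pairing usually written \<open>ab|cd\<close> for four leaves of a tree. Unlike in a
  tree, several pairings of the same coordinates may hold together.\<close>

definition quartet :: "'i \<Rightarrow> 'i \<Rightarrow> 'i \<Rightarrow> 'i \<Rightarrow> ('i \<Rightarrow> 'a) \<Rightarrow> bool" where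
  "quartet a b c d e \<longleftrightarrow> splits {a, b, c, d} e {a, b}"

lemma quartet_sym1: "quartet b a c d e = quartet a b c d e"
  by (simp add: quartet_def insert_commute)

lemma quartet_sym2: "quartet a b d c e = quartet a b c d e"
  by (simp add: quartet_def insert_commute)

lemma quartet_swap:
  assumes "distinct [a, b, c, d]"
  shows "quartet c d a b e = quartet a b c d e"
proof -
  have "{c, d, a, b} = {a, b, c, d}" by auto
  then show ?thesis using splits_compl[of "{a, b, c, d}" "{c, d}" "{a, b}" e] assms
    by (auto simp: quartet_def)
qed

lemma quartet_base: "e' \<in> pts {a, b, c, d} e \<Longrightarrow> quartet a b c d e' = quartet a b c d e"
  by (simp add: quartet_def splits_base)

lemma quartetI:
  assumes "splits Y e A" "e' \<in> pts Y e" "{a, b, c, d} \<subseteq> Y" "a \<in> A" "b \<in> A" "c \<notin> A" "d \<notin> A"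
  shows "quartet a b c d e'"
  unfolding quartet_def by (rule splits_restrict[OF assms(1-3)]) (use assms in auto)

lemma quartetI':
  assumes "splits Y e A" "e' \<in> pts Y e" "{a, b, c, d} \<subseteq> Y" "a \<notin> A" "b \<notin> A" "c \<in> A" "d \<in> A"
  shows "quartet a b c d e'"
  unfolding quartet_def by (rule splits_restrict_compl[OF assms(1-3)]) (use assms in auto)

lemma quartet_five:
  assumes "distinct [a, b, c, d, d']" "{a, b, c, d, d'} \<subseteq> V"
    and "\<And>e'. e' \<in> pts {a, b, c, d, d'} e \<Longrightarrow> quartet a b c d e' \<and> quartet a b c d' e'"
  shows "splits {a, b, c, d, d'} e {a, b}"
proof (rule splits_local[of _ _ a c])
  fix f g e' assume h: "f \<in> {a, b} - {a}" "g \<in> {a, b, c, d, d'} - {a, b} - {c}" "e' \<in> pts {a, b, c, d, d'} e"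
  then have f: "f = b" and g: "g = d \<or> g = d'" by auto
  have "quartet b a d c e'" "quartet b a d' c e'" using assms(3)[OF h(3)] by (simp_all add: quartet_sym1 quartet_sym2)
  then show "splits {f, a, g, c} e' {f, a}" using f g by (auto simp: quartet_def)
qed (use assms in auto)

text \<open>The gain is uniformity: a single split of \<open>Y\<close> cuts the four coordinates in
  half, so one pairing serves all points of \<open>pts Y e\<close>.\<close>

lemma four_point_cases:
  assumes "crd Y e" "Y \<subseteq> V" "{a, b, c, d} \<subseteq> Y" "distinct [a, b, c, d]" "\<forall>k. e k \<in> S"
  shows "(\<forall>e' \<in> pts Y e. quartet a b c d e') \<or> (\<forall>e' \<in> pts Y e. quartet a c b d e') \<or>
     (\<forall>e' \<in> pts Y e. quartet a d b c e')"
proof -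
  have "card {a, b, c, d} = 4" using assms(4) by auto
  then obtain A where A: "splits Y e A" "card (A \<inter> {a, b, c, d}) = 2"
    using four_point_split[OF assms(1-3) _ assms(5)] by blast
  define B where "B = (if a \<in> A then A else Y - A)"
  have B: "splits Y e B" using A splits_Compl by (auto simp: B_def)
  have BQ: "card (B \<inter> {a, b, c, d}) = 2"
  proof (cases "a \<in> A")
    case False
    then have "B \<inter> {a, b, c, d} = {a, b, c, d} - (A \<inter> {a, b, c, d})" using assms(3) by (auto simp: B_def)
    moreover have "card ({a, b, c, d} - (A \<inter> {a, b, c, d})) = card {a, b, c, d} - card (A \<inter> {a, b, c, d})"
      by (rule card_Diff_subset) auto
    ultimately show ?thesis using A(2) \<open>card {a, b, c, d} = 4\<close> by simp
  qed (use A B_def in auto)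
  have aB: "a \<in> B" using assms(3) by (auto simp: B_def)
  have "B \<inter> {a, b, c, d} = insert a ((if b \<in> B then {b} else {}) \<union> (if c \<in> B then {c} else {}) \<union> (if d \<in> B then {d} else {}))"
    using aB by auto
  then consider "b \<in> B" "c \<notin> B" "d \<notin> B" | "b \<notin> B" "c \<in> B" "d \<notin> B" | "b \<notin> B" "c \<notin> B" "d \<in> B"
    using BQ assms(4) by (auto split: if_splits)
  then show ?thesis
  proof cases
    case 1
    have "quartet a b c d e'" if "e' \<in> pts Y e" for e' by (rule quartetI[OF B that assms(3)]) (use 1 aB in auto)
    then show ?thesis by blast
  next
    case 2
    have "{a, c, b, d} \<subseteq> Y" using assms(3) by blast
    then have "quartet a c b d e'" if "e' \<in> pts Y e" for e' by (rule quartetI[OF B that]) (use 2 aB in auto)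
    then show ?thesis by blast
  next
    case 3
    have "{a, d, b, c} \<subseteq> Y" using assms(3) by blast
    then have "quartet a d b c e'" if "e' \<in> pts Y e" for e' by (rule quartetI[OF B that]) (use 3 aB in auto)
    then show ?thesis by blast
  qed
qed

text \<open>This excludes quartets in which a second pairing holds, as in an iterated group
  operation; only the remaining ones behave like quartets of a tree.\<close>

definition unique :: "'i \<Rightarrow> 'i \<Rightarrow> 'i \<Rightarrow> 'i \<Rightarrow> ('i \<Rightarrow> 'a) \<Rightarrow> bool" where
  "unique a b c d e \<longleftrightarrow> quartet a b c d e \<and> \<not> quartet a c b d e \<and> \<not> quartet a d b c e"

lemma unique_swap:
  assumes "distinct [a, b, c, d]"
  shows "unique c d a b e = unique a b c d e"
proof -
  have "quartet c d a b e = quartet a b c d e" using assms by (rule quartet_swap)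
  moreover have "quartet c a d b e = quartet a c b d e"
    using quartet_sym1[of a c d b e] quartet_sym2[of a c d b e] by simp
  moreover have "quartet c b d a e = quartet a d b c e"
    using quartet_swap[of a d c b e] quartet_sym2[of a d c b e] quartet_sym2[of c b a d e] assms by auto
  ultimately show ?thesis unfolding unique_def by simp
qed

lemma unique_sym1:
  assumes "distinct [a, b, c, d]"
  shows "unique b a c d e = unique a b c d e"
proof -
  have "quartet b c a d e = quartet a d b c e" using assms by (intro quartet_swap) auto
  moreover have "quartet b d a c e = quartet a c b d e" using assms by (intro quartet_swap) auto
  ultimately show ?thesis unfolding unique_def by (auto simp: quartet_sym1)
qed

lemma unique_sym2: "unique a b d c e = unique a b c d e"
  unfolding unique_def by (auto simp: quartet_sym1 quartet_sym2)

text \<open>A twin may replace \<open>x\<close>: splits that avoid both \<open>i\<close> and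
  \<open>x\<close> pass between the two retracts on four coordinates through the one on
  five.\<close>

lemma twin_unique:
  assumes "unique x y z w e" "distinct [i, x, y, z, w]" "{i, x, y, z, w} \<subseteq> V" "\<forall>k. e k \<in> S"
    and tw: "splits {i, x, y, z, w} e {i, x}"
  shows "unique i y z w e"
proof -
  have ee: "e \<in> pts X e" for X using assms(4) by (rule pts_refl)
  have eqx: "insert x ({i, x, y, z, w} - {i, x}) = {x, y, z, w}" and eqi: "insert i ({i, x, y, z, w} - {i, x}) = {i, y, z, w}"
    using assms(2) by auto
  have iff: "splits {x, y, z, w} e C \<longleftrightarrow> splits {i, y, z, w} e C" if C: "C \<subseteq> {y, z, w}" for C
  proof
    assume s: "splits {x, y, z, w} e C"
    have "splits {i, x, y, z, w} e C"
      by (rule splits_transfer[OF tw _ _ assms(3) _ _ ee, of x]) (use C s eqx assms(2) in auto)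
    then show "splits {i, y, z, w} e C" by (rule splits_restrict[OF _ ee]) auto
  next
    assume s: "splits {i, y, z, w} e C"
    have "splits {i, x, y, z, w} e C"
      by (rule splits_transfer[OF tw _ _ assms(3) _ _ ee, of i]) (use C s eqi assms(2) in auto)
    then show "splits {x, y, z, w} e C" by (rule splits_restrict[OF _ ee]) auto
  qed
  have q: "quartet u r s t e \<longleftrightarrow> splits {u, y, z, w} e {s, t}"
    if "{r, s, t} = {y, z, w}" "distinct [u, r, s, t]" for u r s t
    unfolding quartet_def using that(2) insert_commute
    by (subst that(1)[symmetric]) (rule splits_compl, auto)
  have "quartet x r s t e \<longleftrightarrow> quartet i r s t e" if "{r, s, t} = {y, z, w}" "distinct [r, s, t]" for r s t
  proof -
    have "distinct [x, r, s, t]" "distinct [i, r, s, t]" using that assms(2) by auto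
    moreover have "{s, t} \<subseteq> {y, z, w}" using that(1) by blast
    ultimately show ?thesis using q[OF that(1), of x] q[OF that(1), of i] iff[of "{s, t}"] by simp
  qed
  from this[of y z w] this[of z y w] this[of w y z] show ?thesis
    using assms(1,2) unfolding unique_def by auto
qed

end

section \<open>Four-point splits when all proper retracts are reducible\<close>

text \<open>Six coordinates guarantee that any five form a proper subset, so that every retract on
  five coordinates is completely reducible.\<close>

locale red_retracts = latin S V F for S :: "'a set" and V :: "'i set" and F +
  fixes b :: "'i \<Rightarrow> 'a"
  assumes b_val: "\<forall>k. b k \<in> S"
    and V6: "6 \<le> card V"
    and proper_red: "\<And>Y e. Y \<subset> V \<Longrightarrow> 4 \<le> card Y \<Longrightarrow> e \<in> pts V b \<Longrightarrow> red Y e"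
begin

definition alw :: "'i \<Rightarrow> 'i \<Rightarrow> 'i \<Rightarrow> 'i \<Rightarrow> bool" where
  "alw x y z w \<longleftrightarrow> (\<forall>e \<in> pts V b. quartet x y z w e)"

lemma self: "e \<in> pts V b \<Longrightarrow> e \<in> pts X e"
  by (simp add: pts_def)

lemma val: "e \<in> pts V b \<Longrightarrow> \<forall>k. e k \<in> S"
  by (simp add: pts_def)

lemma upd: "e \<in> pts V b \<Longrightarrow> k \<in> V \<Longrightarrow> c \<in> S \<Longrightarrow> e(k := c) \<in> pts V b"
  by (rule pts_upd)

lemma down: "e' \<in> pts Y e \<Longrightarrow> Y \<subseteq> V \<Longrightarrow> e \<in> pts V b \<Longrightarrow> e' \<in> pts V b"
  by (rule pts_trans)

lemma proper_crd: "Y \<subset> V \<Longrightarrow> e \<in> pts V b \<Longrightarrow> crd Y e"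
  unfolding crd_def by (meson down proper_red psubset_imp_subset subset_psubset_trans)

lemma card_rest: "card X \<le> 5 \<Longrightarrow> X \<subseteq> V \<Longrightarrow> X \<subset> V"
  using V6 by force

lemma five_proper: "{u, v, x, y, z} \<subseteq> V \<Longrightarrow> {u, v, x, y, z} \<subset> V"
proof (rule card_rest)
  show "card {u, v, x, y, z} \<le> 5" using card_length[of "[u, v, x, y, z]"] by simp
qed

lemma alw_sym1: "alw y x z w = alw x y z w" and alw_sym2: "alw x y w z = alw x y z w"
  by (simp_all add: alw_def quartet_sym1 quartet_sym2)

lemma alw_swap: "distinct [x, y, z, w] \<Longrightarrow> alw z w x y = alw x y z w"
  by (simp add: alw_def quartet_swap)

lemma alwD: "alw x y z w \<Longrightarrow> e \<in> pts V b \<Longrightarrow> quartet x y z w e"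
  by (simp add: alw_def)

lemma alw_split:
  assumes "distinct [x, y, u, v, w]" "{x, y, u, v, w} \<subseteq> V" "alw x y u v" "alw x y u w" "e \<in> pts V b"
  shows "splits {x, y, u, v, w} e {x, y}"
proof (rule quartet_five[OF assms(1,2)])
  fix e' assume "e' \<in> pts {x, y, u, v, w} e"
  then have "e' \<in> pts V b" using down assms(2,5) by blast
  then show "quartet x y u v e' \<and> quartet x y u w e'" using assms(3,4) alwD by blast
qed

text \<open>The usual inference rule for quartets: the two given pairings combine to a split of all
  five coordinates, from which \<open>u\<close> is then dropped.\<close>

lemma alw_trans:
  assumes "distinct [x, y, u, v, w]" "{x, y, u, v, w} \<subseteq> V" "alw x y u v" "alw x y u w"
  shows "alw x y v w"
  unfolding alw_def
proof
  fix e assume e: "e \<in> pts V b"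
  show "quartet x y v w e"
    by (rule quartetI[OF alw_split[OF assms e] self[OF e]]) (use assms(1) in auto)
qed

lemma exists_outside:
  assumes "X \<subseteq> V" "card X \<le> 5" obtains k where "k \<in> V" "k \<notin> X"
  using card_rest[OF assms(2,1)] by blast

lemma quartet_cases:
  assumes "distinct [x, y, z, w]" "{x, y, z, w} \<subseteq> V" "e \<in> pts V b"
  shows "quartet x y z w e \<or> quartet x z y w e \<or> quartet x w y z e"
proof -
  have "{x, y, z, w} \<subset> V" using five_proper[of x x y z w] assms(2) by simp
  then have c: "crd {x, y, z, w} e" using proper_crd assms(3) by blast
  show ?thesis
    using four_point_cases[OF c assms(2) order_refl assms(1) val[OF assms(3)]]
      self[OF assms(3), of "{x, y, z, w}"] by meson
qed

text \<open>With \<open>k\<close> frozen, \<open>V - {k}\<close> is completely reducible and one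
  pairing holds at all its points, \<open>e0\<close> included. Uniqueness at \<open>e0\<close> says
  which one.\<close>

lemma unique_persists1:
  assumes u: "unique x y z w e0" and d: "distinct [x, y, z, w]" "{x, y, z, w} \<subseteq> V"
    and e: "e0 \<in> pts V b" "e1 \<in> pts V b" and k: "k \<in> V - {x, y, z, w}" "e1 k = e0 k"
  shows "quartet x y z w e1"
proof -
  have Y: "V - {k} \<subset> V" "{x, y, z, w} \<subseteq> V - {k}" using k d by auto
  have e1: "e1 \<in> pts (V - {k}) e0" using e k by (auto simp: pts_def)
  have c: "crd (V - {k}) e0" using proper_crd Y e by blast
  have e0: "e0 \<in> pts (V - {k}) e0" using e(1) by (rule self)
  show ?thesis
    using four_point_cases[OF c psubset_imp_subset[OF Y(1)] Y(2) d(1) val[OF e(1)]]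
  proof (elim disjE)
    assume "\<forall>e' \<in> pts (V - {k}) e0. quartet x y z w e'" then show ?thesis using e1 by (rule bspec)
  next
    assume "\<forall>e' \<in> pts (V - {k}) e0. quartet x z y w e'"
    from bspec[OF this e0] show ?thesis using u by (simp add: unique_def)
  next
    assume "\<forall>e' \<in> pts (V - {k}) e0. quartet x w y z e'"
    from bspec[OF this e0] show ?thesis using u by (simp add: unique_def)
  qed
qed

text \<open>Without a twin, \<open>k\<close> is the middle leaf of a tree with the cherries
  \<open>{x, y}\<close> and \<open>{z, w}\<close>. If after a change of \<open>x\<close> the retract
  without \<open>x\<close> paired \<open>k\<close> with \<open>z\<close> or \<open>w\<close>, this
  would lift through the split \<open>{x, y}\<close> and give \<open>k\<close> a twin.\<close>

lemma strict_middle: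
  assumes u: "unique x y z w e" and d: "distinct [k, x, y, z, w]" "{k, x, y, z, w} \<subseteq> V" and e: "e \<in> pts V b"
    and no: "\<And>q. q \<in> {x, y, z, w} \<Longrightarrow> \<not> splits {k, x, y, z, w} e {k, q}" and c: "c \<in> S"
  shows "unique y k z w (e(x := c))"
proof -
  let ?Y = "{k, x, y, z, w}"
  have ee: "e \<in> pts X e" for X using e by (rule self)
  have crd: "crd ?Y e" using proper_crd[OF five_proper[OF d(2)] e] .
  have card: "4 \<le> card ?Y" using d(1) by auto
  obtain p q where pq: "p \<in> ?Y" "q \<in> ?Y" "p \<noteq> q" "splits ?Y e {p, q}"
    by (rule cherry[OF crd d(2) card val[OF e]])
  have "p \<noteq> k"
  proof
    assume "p = k"
    then have "q \<in> {x, y, z, w}" "splits ?Y e {k, q}" using pq by auto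
    then show False using no by blast
  qed
  moreover have "q \<noteq> k"
  proof
    assume "q = k"
    then have "p \<in> {x, y, z, w}" "splits ?Y e {k, p}" using pq by (auto simp: insert_commute)
    then show False using no by blast
  qed
  ultimately have pq2: "p \<in> {x, y, z, w}" "q \<in> {x, y, z, w}" using pq(1,2) by auto
  have nq: "\<not> quartet x z y w e" "\<not> quartet x w y z e" using u by (auto simp: unique_def)
  \<comment> \<open>From one cherry the other follows: contract the first one to \<open>p'\<close>.
    Among the remaining four, \<open>k\<close> cannot pair with \<open>r\<close> or
    \<open>s\<close>, so \<open>r\<close> and \<open>s\<close> pair with each other.\<close>
  have other: "splits ?Y e (?Y - {p', q', k})"
    if h: "splits ?Y e {p', q'}" "{p', q'} = {x, y} \<and> {r, s} = {z, w} \<or> {p', q'} = {z, w} \<and> {r, s} = {x, y}"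
      "distinct [p', q', r, s]" for p' q' r s
  proof -
    have Ys: "?Y = {p', q', k, r, s}" using h(2) by auto
    have q4: "{p', k, r, s} \<subset> V"
    proof -
      have "{p', k, r, s} \<subseteq> ?Y" using Ys by auto
      then show ?thesis using five_proper[OF d(2)] by blast
    qed
    have dd: "distinct [p', q', k, r, s]" using h(2,3) d(1) by auto
    have tr: "splits ?Y e C" if "splits {p', k, r, s} e C" "C \<subseteq> {k, r, s}" for C
    proof (rule splits_transfer[OF h(1) _ _ d(2) _ _ ee, of p'])
      have "insert p' (?Y - {p', q'}) = {p', k, r, s}" using Ys dd by auto
      then show "splits (insert p' (?Y - {p', q'})) e C" using that by simp
    qed (use that Ys dd in auto)
    have rs: "r \<in> {x, y, z, w}" "s \<in> {x, y, z, w}" using h(2) by auto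
    have no1: "\<not> splits {p', k, r, s} e {k, r}" "\<not> splits {p', k, r, s} e {k, s}"
      using tr[of "{k, r}"] tr[of "{k, s}"] no[OF rs(1)] no[OF rs(2)] by blast+
    have "quartet r s k p' e \<or> quartet r k s p' e \<or> quartet r p' s k e"
      by (rule quartet_cases) (use dd q4 e in auto)
    moreover have "\<not> quartet r k s p' e" using no1(1) by (simp add: quartet_def insert_commute)
    moreover have "\<not> quartet r p' s k e"
    proof -
      have "distinct [s, k, r, p']" using dd by auto
      then have "quartet r p' s k e = quartet s k r p' e" using quartet_swap by blast
      then show ?thesis using no1(2) by (simp add: quartet_def insert_commute)
    qed
    ultimately have "quartet r s k p' e" by blast
    then have "splits {p', k, r, s} e {r, s}" by (simp add: quartet_def insert_commute)
    then have "splits ?Y e {r, s}" using tr[of "{r, s}"] by blast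
    moreover have "{r, s} = ?Y - {p', q', k}" using Ys dd by auto
    ultimately show ?thesis by simp
  qed
  have "splits ?Y e {x, y} \<and> splits ?Y e {z, w}"
  proof -
    have P: "\<not> splits ?Y e {x, z}" "\<not> splits ?Y e {y, w}" "\<not> splits ?Y e {x, w}" "\<not> splits ?Y e {y, z}"
    proof -
      have "quartet x z y w e" if "splits ?Y e {x, z}" by (rule quartetI[OF that ee]) (use d(1) in auto)
      then show "\<not> splits ?Y e {x, z}" using nq(1) by blast
      have "quartet x w y z e" if "splits ?Y e {x, w}" by (rule quartetI[OF that ee]) (use d(1) in auto)
      then show "\<not> splits ?Y e {x, w}" using nq(2) by blast
      have "quartet x z y w e" if "splits ?Y e {y, w}" by (rule quartetI'[OF that ee]) (use d(1) in auto)
      then show "\<not> splits ?Y e {y, w}" using nq(1) by blast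
      have "quartet x w y z e" if "splits ?Y e {y, z}" by (rule quartetI'[OF that ee]) (use d(1) in auto)
      then show "\<not> splits ?Y e {y, z}" using nq(2) by blast
    qed
    have "splits ?Y e {x, y} \<or> splits ?Y e {z, w}"
    proof -
      have "{p, q} = {x, y} \<or> {p, q} = {z, w} \<or> {p, q} = {x, z} \<or> {p, q} = {y, w} \<or> {p, q} = {x, w} \<or> {p, q} = {y, z}"
        using pq2 pq(3) unfolding doubleton_eq_iff by (elim insertE emptyE) simp_all
      then show ?thesis using pq(4) P by (elim disjE) simp_all
    qed
    then show ?thesis
    proof
      assume s: "splits ?Y e {x, y}"
      have "splits ?Y e (?Y - {x, y, k})" by (rule other[OF s, of z w]) (use d(1) in auto)
      moreover have "?Y - {x, y, k} = {z, w}" using d(1) by auto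
      ultimately show ?thesis using s by simp
    next
      assume s: "splits ?Y e {z, w}"
      have "splits ?Y e (?Y - {z, w, k})" by (rule other[OF s, of x y]) (use d(1) in auto)
      moreover have "?Y - {z, w, k} = {x, y}" using d(1) by auto
      ultimately show ?thesis using s by simp
    qed
  qed
  then have sxy: "splits ?Y e {x, y}" and szw: "splits ?Y e {z, w}" by auto
  have ex: "e(x := c) \<in> pts ?Y e" by (rule pts_upd[OF ee]) (use c in auto)
  have eq: "insert y (?Y - {x, y}) = {y, k, z, w}" using d(1) by auto
  have no2: "\<not> splits {y, k, z, w} (e(x := c)) {k, q}" if "q = z \<or> q = w" for q
  proof
    assume s: "splits {y, k, z, w} (e(x := c)) {k, q}"
    have "splits ?Y e {k, q}"
      by (rule splits_transfer[OF sxy _ _ d(2) _ _ ex, of y]) (use that s eq d(1) in auto)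
    moreover have "q \<in> {x, y, z, w}" using that by blast
    ultimately show False using no by blast
  qed
  have "quartet y k z w (e(x := c))" by (rule quartetI'[OF szw ex]) (use d(1) in auto)
  moreover have "\<not> quartet y z k w (e(x := c))"
  proof -
    have "distinct [k, w, y, z]" using d(1) by auto
    then have "quartet y z k w (e(x := c)) = quartet k w y z (e(x := c))" using quartet_swap by blast
    then show ?thesis using no2[of w] by (simp add: quartet_def insert_commute)
  qed
  moreover have "\<not> quartet y w k z (e(x := c))"
  proof -
    have "distinct [k, z, y, w]" using d(1) by auto
    then have "quartet y w k z (e(x := c)) = quartet k z y w (e(x := c))" using quartet_swap by blast
    then show ?thesis using no2[of z] by (simp add: quartet_def insert_commute)
  qed
  ultimately show ?thesis unfolding unique_def by blast
qed

text \<open>By \<open>unique_persists1\<close> only the change of a last outside coordinate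
  \<open>k\<close> can do harm. If it does, \<open>k\<close> has no twin and sits in the middle.
  Then \<open>yk|zw\<close> and \<open>xk|zw\<close> are unique, and they persist because
  \<open>x\<close> or \<open>y\<close> is now an outside coordinate that can be frozen.\<close>

lemma unique_persists:
  assumes u: "unique x y z w e0" and d: "distinct [x, y, z, w]" "{x, y, z, w} \<subseteq> V" and e0: "e0 \<in> pts V b"
  shows "alw x y z w"
  unfolding alw_def
proof (intro ballI, rule ccontr)
  fix e assume e: "e \<in> pts V b" and n: "\<not> quartet x y z w e"
  let ?Q = "{x, y, z, w}"
  have "card ?Q \<le> 5" using card_length[of "[x, y, z, w]"] by simp
  then obtain k where k: "k \<in> V" "k \<notin> ?Q" using exists_outside[OF d(2)] by blast
  have kQ: "{k, x, y, z, w} \<subseteq> V" using k d by auto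
  \<comment> \<open>\<open>e1\<close> links the two points: it differs from \<open>e0\<close> only
    at \<open>k\<close>, and it lies with \<open>e\<close> in one retract on
    \<open>V - {k}\<close>.\<close>
  define e1 where "e1 = e0(k := e k)"
  have e1: "e1 \<in> pts V b" unfolding e1_def using upd[OF e0 k(1)] val[OF e] by blast
  have Y: "V - {k} \<subset> V" "?Q \<subseteq> V - {k}" using k d by auto
  have ee: "e \<in> pts (V - {k}) e1" "e1 \<in> pts (V - {k}) e1" using e e1 k by (auto simp: pts_def e1_def)
  have crd: "crd (V - {k}) e1" using proper_crd Y e1 by blast
  have bad: "quartet x z y w e1 \<or> quartet x w y z e1"
    using four_point_cases[OF crd psubset_imp_subset[OF Y(1)] Y(2) d(1) val[OF e1]]
  proof (elim disjE)
    assume "\<forall>e' \<in> pts (V - {k}) e1. quartet x y z w e'"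
    from bspec[OF this ee(1)] show ?thesis using n by simp
  next
    assume "\<forall>e' \<in> pts (V - {k}) e1. quartet x z y w e'"
    from bspec[OF this ee(2)] show ?thesis by simp
  next
    assume "\<forall>e' \<in> pts (V - {k}) e1. quartet x w y z e'"
    from bspec[OF this ee(2)] show ?thesis by simp
  qed
  have kd: "distinct [k, x, y, z, w]" using k d by auto
  have no: "\<not> splits {k, x, y, z, w} e0 {k, q}" if q: "q \<in> ?Q" for q
  proof
    assume s: "splits {k, x, y, z, w} e0 {k, q}"
    have p: "e1 \<in> pts {k, x, y, z, w} e0" "e0 \<in> pts {k, x, y, z, w} e0"
      using e0 val[OF e] by (auto simp: pts_def e1_def)
    have tr: "splits ?Q e1 C \<Longrightarrow> splits ?Q e0 C" for C
      by (rule twin_transfer[OF s q _ d(2) p]) (use k in auto)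
    have "quartet x z y w e1 \<Longrightarrow> quartet x z y w e0"
      using tr[of "{x, z}"] by (simp add: quartet_def insert_commute)
    moreover have "quartet x w y z e1 \<Longrightarrow> quartet x w y z e0"
      using tr[of "{x, w}"] by (simp add: quartet_def insert_commute)
    ultimately show False using bad u unfolding unique_def by blast
  qed
  have qy: "quartet y k z w (e(x := c))" if c: "c \<in> S" for c
  proof -
    have "unique y k z w (e0(x := c))" by (rule strict_middle[OF u kd kQ e0 no c])
    then show ?thesis
      by (rule unique_persists1[of y k z w "e0(x := c)" "e(x := c)" x])
        (use kd kQ e0 e c upd[of _ x c] in auto)
  qed
  have qx: "quartet x k z w (e(y := c))" if c: "c \<in> S" for c
  proof -
    have "{k, x, y, z, w} = {k, y, x, z, w}" by auto
    then have "unique x k z w (e0(y := c))"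
      by (intro strict_middle[of y x z w e0 k c]) (use u unique_sym1[OF d(1)] kd kQ e0 no c in auto)
    then show ?thesis
      by (rule unique_persists1[of x k z w "e0(y := c)" "e(y := c)" y])
        (use kd kQ e0 e c upd[of _ y c] in auto)
  qed
  \<comment> \<open>The two pairings hold for all values of the omitted coordinate, so they combine
    to a split of five coordinates; dropping \<open>k\<close> restores the pairing that was assumed
    to fail.\<close>
  have "splits {z, w, k, x, y} e {z, w}"
  proof (rule quartet_five)
    fix e' assume e': "e' \<in> pts {z, w, k, x, y} e"
    have "quartet y k z w e' = quartet y k z w (e(x := e' x))"
      by (rule quartet_base) (use e' kd in \<open>auto simp: pts_def\<close>)
    moreover have "quartet x k z w e' = quartet x k z w (e(y := e' y))"
      by (rule quartet_base) (use e' kd in \<open>auto simp: pts_def\<close>)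
    moreover have "quartet z w k x e' = quartet x k z w e'" "quartet z w k y e' = quartet y k z w e'"
      using kd quartet_swap[of x k z w e'] quartet_swap[of y k z w e'] quartet_sym2[of z w k x e'] quartet_sym2[of z w k y e']
      by auto
    ultimately show "quartet z w k x e' \<and> quartet z w k y e'" using qx qy pts_in[OF e'] by simp
  qed (use kd kQ in auto)
  then have "quartet x y z w e" by (rule quartetI'[OF _ self[OF e]]) (use kd in auto)
  then show False using n by blast
qed

text \<open>If \<open>i\<close> has a twin, it replaces that twin. If not, it is in the middle, and
  \<open>strict_middle\<close> lets it replace \<open>x\<close>.\<close>

lemma unique_extend:
  assumes u: "unique x y z w e" and d: "distinct [i, x, y, z, w]" "{i, x, y, z, w} \<subseteq> V" and e: "e \<in> pts V b"
  shows "(unique i y z w e \<or> unique x i z w e) \<or> (unique x y i w e \<or> unique x y z i e)"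
proof (cases "\<exists>q \<in> {x, y, z, w}. splits {i, x, y, z, w} e {i, q}")
  case True
  then consider "splits {i, x, y, z, w} e {i, x}" | "splits {i, x, y, z, w} e {i, y}"
    | "splits {i, x, y, z, w} e {i, z}" | "splits {i, x, y, z, w} e {i, w}" by blast
  then show ?thesis
  proof cases
    case 1
    then show ?thesis using twin_unique[OF u d val[OF e]] by blast
  next
    case 2
    have t: "splits {i, y, x, z, w} e {i, y}" using 2 by (simp add: insert_commute)
    have u2: "unique y x z w e" using u unique_sym1[of x y z w e] d(1) by simp
    have "unique i x z w e"
      by (rule twin_unique[OF u2 _ _ val[OF e] t]) (use d in auto)
    moreover have "unique i x z w e = unique x i z w e" by (rule unique_sym1) (use d in auto)
    ultimately show ?thesis by blast
  next
    case 3
    have t: "splits {i, z, w, x, y} e {i, z}" using 3 by (simp add: insert_commute)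
    have u2: "unique z w x y e" using u unique_swap[of x y z w e] d(1) by simp
    have "unique i w x y e"
      by (rule twin_unique[OF u2 _ _ val[OF e] t]) (use d in auto)
    moreover have "unique i w x y e = unique x y i w e" by (rule unique_swap) (use d in auto)
    ultimately show ?thesis by blast
  next
    case 4
    have t: "splits {i, w, z, x, y} e {i, w}" using 4 by (simp add: insert_commute)
    have "unique w z x y e = unique x y w z e" by (rule unique_swap) (use d in auto)
    then have u2: "unique w z x y e" using u unique_sym2[of x y w z e] by simp
    have "unique i z x y e"
      by (rule twin_unique[OF u2 _ _ val[OF e] t]) (use d in auto)
    moreover have "unique i z x y e = unique x y i z e" by (rule unique_swap) (use d in auto)
    ultimately show ?thesis using unique_sym2[of x y z i e] by blast
  qed
next
  case False
  have "unique y i z w (e(x := e x))"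
    by (rule strict_middle[OF u d e]) (use val[OF e] False in auto)
  moreover have "unique y i z w e = unique i y z w e" by (rule unique_sym1) (use d in auto)
  ultimately show ?thesis by simp
qed

text \<open>A fifth leaf lies on one side of the inner edge of a quartet.
  \<open>unique_extend\<close> puts \<open>v\<close> in the place of one leaf, persistence makes
  this hold at all points, and \<open>alw_trans\<close> gives the pairing with the other leaf of
  that side.\<close>

lemma unique_dichotomy:
  assumes u: "unique x y z w e" and d: "distinct [v, x, y, z, w]" "{v, x, y, z, w} \<subseteq> V" and e: "e \<in> pts V b"
  shows "(alw x v z w \<and> alw y v z w) \<or> (alw z v x y \<and> alw w v x y)"
proof -
  have A: "alw x y z w" by (rule unique_persists[OF u]) (use d e in auto)
  have half: "alw x v z w \<and> alw y v z w"
    if h: "unique v y z w e \<or> unique x v z w e" and A: "alw x y z w"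
      and d: "distinct [v, x, y, z, w]" "{v, x, y, z, w} \<subseteq> V" for x y z w
  proof -
    have zw: "alw z w x y" using A alw_swap[of x y z w] d(1) by simp
    have sw: "alw z w x v = alw x v z w" "alw z w y v = alw y v z w" "alw z w v y = alw v y z w"
      using alw_swap[of x v z w] alw_swap[of y v z w] alw_swap[of v y z w] d(1) by auto
    from h have "alw z w x v \<and> alw z w y v"
    proof
      assume "unique v y z w e"
      then have "alw v y z w" by (rule unique_persists) (use d e in auto)
      then have 1: "alw z w y v" using sw alw_sym2[of z w v y] by simp
      have zw': "alw z w y x" using zw alw_sym2[of z w x y] by simp
      have "alw z w x v" by (rule alw_trans[OF _ _ zw' 1]) (use d in auto)
      then show ?thesis using 1 by simp
    next
      assume "unique x v z w e"
      then have "alw x v z w" by (rule unique_persists) (use d e in auto)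
      then have 1: "alw z w x v" using sw by simp
      have "alw z w y v" by (rule alw_trans[OF _ _ zw 1]) (use d in auto)
      then show ?thesis using 1 by simp
    qed
    then show ?thesis using sw by simp
  qed
  from unique_extend[OF u d e] show ?thesis
  proof
    assume "unique v y z w e \<or> unique x v z w e"
    then show ?thesis using half[OF _ A d] by blast
  next
    assume h: "unique x y v w e \<or> unique x y z v e"
    have 1: "unique v w x y e \<or> unique z v x y e"
      using h unique_swap[of x y v w e] unique_swap[of x y z v e] d by auto
    have 2: "alw z w x y" using A alw_swap[of x y z w] d by auto
    have "alw z v x y \<and> alw w v x y" by (rule half[OF 1 2]) (use d in auto)
    then show ?thesis by blast
  qed
qed

end

section \<open>Branches and edges of the decomposition tree\<close>

context latin
begin

text \<open>Seen from the leaf \<open>b\<close>, the tree has two branches. A cherry that contains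
  \<open>b\<close> shows them at once: its other element and everything else. Any other cherry loses
  one element, which is put back into the branch of its partner after the induction.\<close>

lemma marked_branches:
  assumes "crd Y e" "Y \<subseteq> V" "b \<in> Y" "3 \<le> card Y" "\<forall>k. e k \<in> S"
  shows "\<exists>A1 A2. A1 \<noteq> {} \<and> A2 \<noteq> {} \<and> A1 \<inter> A2 = {} \<and> A1 \<union> A2 = Y - {b} \<and> splits Y e A1 \<and> splits Y e A2"
  using assms
proof (induction "card Y" arbitrary: Y)
  case 0 then show ?case by simp
next
  case (Suc n)
  note crd = Suc.prems(1) and YV = Suc.prems(2) and bY = Suc.prems(3)
  have ee: "e \<in> pts X e" for X using Suc.prems(5) by (rule pts_refl)
  have fY: "finite Y" using YV finite_V finite_subset by blast
  have sing: "splits Y e {r}" if "r \<in> Y" for r by (rule splits_singleton) (use that YV in auto)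
  show ?case
  proof (cases "card Y = 3")
    case True
    then have "card (Y - {b}) = 2" using bY fY by simp
    then obtain c d where cd: "Y - {b} = {c, d}" "c \<noteq> d" by (meson card_2_iff)
    have "c \<in> Y" "d \<in> Y" using cd by auto
    then have "splits Y e {c}" "splits Y e {d}" by (simp_all add: sing)
    then show ?thesis using cd by (intro exI[of _ "{c}"] exI[of _ "{d}"]) simp
  next
    case False
    then have Y4: "4 \<le> card Y" using Suc.prems(4) by linarith
    obtain p q where pq: "p \<in> Y" "q \<in> Y" "p \<noteq> q" "splits Y e {p, q}"
      by (rule cherry[OF crd YV Y4 Suc.prems(5)])
    show ?thesis
    proof (cases "b = p \<or> b = q")
      case True
      then obtain r where r: "r \<in> Y" "r \<noteq> b" "splits Y e {b, r}"
      proof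
        assume "b = p" then show thesis using that[of q] pq by simp
      next
        assume "b = q" then show thesis using that[of p] pq insert_commute[of p q "{}"] by simp
      qed
      have 1: "splits Y e {r}" using r(1) by (rule sing)
      have "Y - {b, r} = Y - {b} - {r}" by blast
      then have 2: "splits Y e (Y - {b} - {r})" using r(3) splits_Compl by metis
      have "card (Y - {b} - {r}) \<noteq> 0" using Y4 fY r bY by simp
      then have "Y - {b} - {r} \<noteq> {}" by (metis card.empty)
      then show ?thesis using 1 2 r by (intro exI[of _ "{r}"] exI[of _ "Y - {b} - {r}"]) blast
    next
      case False
      let ?Y = "Y - {p}"
      have n: "n = card ?Y" using Suc.hyps(2) pq(1) fY by simp
      have ex: "\<exists>A1 A2. A1 \<noteq> {} \<and> A2 \<noteq> {} \<and> A1 \<inter> A2 = {} \<and> A1 \<union> A2 = ?Y - {b} \<and> splits ?Y e A1 \<and> splits ?Y e A2"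
      proof (rule Suc.hyps(1)[OF n])
        show "crd ?Y e" by (rule crd_mono[OF crd _ ee]) auto
        show "3 \<le> card ?Y" using Y4 pq(1) fY by simp
      qed (use Suc.prems False bY in auto)
      obtain A1 A2 where A: "A1 \<noteq> {}" "A2 \<noteq> {}" "A1 \<inter> A2 = {}" "A1 \<union> A2 = ?Y - {b}"
        "splits ?Y e A1" "splits ?Y e A2" "q \<in> A2"
      proof -
        obtain B1 B2 where B: "B1 \<noteq> {}" "B2 \<noteq> {}" "B1 \<inter> B2 = {}" "B1 \<union> B2 = ?Y - {b}"
          "splits ?Y e B1" "splits ?Y e B2" using ex by (elim exE conjE)
        have "q \<in> ?Y - {b}" using pq(1-3) False by blast
        then have "q \<in> B1 \<union> B2" using B(4) by simp
        then show thesis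
        proof
          assume "q \<in> B2" then show thesis using that[OF B] by blast
        next
          have "B2 \<inter> B1 = {}" "B2 \<union> B1 = ?Y - {b}" using B(3,4) by auto
          moreover assume "q \<in> B1"
          ultimately show thesis using that[OF B(2,1) _ _ B(6,5)] by blast
        qed
      qed
      have eq: "insert q (Y - {p, q}) = ?Y" using pq by blast
      have tr: "splits Y e B" if "splits ?Y e B" "B \<subseteq> ?Y" "q \<notin> B" for B
        by (rule splits_transfer[OF pq(4) _ _ YV _ _ ee, of q]) (use that pq eq in auto)
      have 1: "splits Y e A1" by (rule tr[OF A(5)]) (use A in auto)
      have "?Y - A2 = insert b A1" using A bY False by blast
      then have "splits ?Y e (insert b A1)" using A(6) splits_Compl by metis
      then have "splits Y e (insert b A1)" by (rule tr) (use A False bY in auto)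
      moreover have "Y - insert b A1 = insert p A2" using A pq False by blast
      ultimately have 2: "splits Y e (insert p A2)" using splits_Compl by metis
      have 3: "A1 \<inter> insert p A2 = {}" "A1 \<union> insert p A2 = Y - {b}" using A(3,4) pq(1-3) False by auto
      show ?thesis by (rule exI[of _ A1], rule exI[of _ "insert p A2"]) (use A(1,2) 1 2 3 in simp)
    qed
  qed
qed

text \<open>Contract the outside of \<open>A\<close> to the single coordinate \<open>b\<close> and
  take the branches seen from there.\<close>

lemma branches:
  assumes "crd Y e" "Y \<subseteq> V" "\<forall>k. e k \<in> S" "A \<subseteq> Y" "splits Y e A" "2 \<le> card A" "b \<in> Y - A"
  obtains A1 A2 where "A1 \<noteq> {}" "A2 \<noteq> {}" "A1 \<inter> A2 = {}" "A1 \<union> A2 = A" "splits Y e A1" "splits Y e A2"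
proof -
  have ee: "e \<in> pts X e" for X using assms(3) by (rule pts_refl)
  have fA: "finite A" by (rule finite_subset[OF subset_trans[OF assms(4,2)] finite_V])
  have sub: "insert b A \<subseteq> Y" using assms(4,7) by blast
  have c: "crd (insert b A) e" by (rule crd_mono[OF assms(1) sub ee])
  have "3 \<le> card (insert b A)" using assms(6,7) fA by simp
  from marked_branches[OF c subset_trans[OF sub assms(2)] insertI1 this assms(3)]
  obtain A1 A2 where A: "A1 \<noteq> {}" "A2 \<noteq> {}" "A1 \<inter> A2 = {}" "A1 \<union> A2 = insert b A - {b}"
    "splits (insert b A) e A1" "splits (insert b A) e A2" by (elim exE conjE)
  have eq: "insert b (Y - (Y - A)) = insert b A" using assms(4) by blast
  have sc: "splits Y e (Y - A)" using assms(5) splits_Compl by blast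
  have un: "A1 \<union> A2 = A" using A(4) assms(7) by blast
  have tr: "splits Y e B" if "splits (insert b A) e B" "B \<subseteq> A" for B
    by (rule splits_transfer[OF sc _ _ assms(2) _ _ ee, of b]) (use that assms(4,7) eq in auto)
  have "A1 \<subseteq> A" "A2 \<subseteq> A" using un by auto
  then have "splits Y e A1" "splits Y e A2" using tr[OF A(5)] tr[OF A(6)] by simp_all
  then show thesis using that A(1-3) un by blast
qed

text \<open>The companion of \<open>splits_transfer\<close> for sets that contain the representative
  \<open>d\<close>; it follows by passing to complements.\<close>

lemma splits_blow_up:
  assumes D: "splits Y e D" and dD: "d \<in> D" "D \<subseteq> Y" "Y \<subseteq> V" and e: "\<forall>k. e k \<in> S"
    and s: "splits (insert d (Y - D)) e B" and B: "d \<in> B" "B \<subseteq> insert d (Y - D)"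
  shows "splits Y e (B \<union> D)"
proof -
  have ee: "e \<in> pts X e" for X using e by (rule pts_refl)
  have "splits (insert d (Y - D)) e (insert d (Y - D) - B)" using s splits_Compl by blast
  then have "splits Y e (insert d (Y - D) - B)"
    by - (rule splits_transfer[OF D dD _ _ ee], use B in auto)
  then have "splits Y e (Y - (insert d (Y - D) - B))" using splits_Compl by blast
  moreover have "Y - (insert d (Y - D) - B) = B \<union> D" using B dD by auto
  ultimately show ?thesis by simp
qed

text \<open>Four nonempty parts such that the partition into the first two and the last two is an edge of
  the decomposition tree of \<open>Y\<close> whose two end nodes are not parts of one group node.\<close>

definition strong_edge :: "'i set \<Rightarrow> ('i \<Rightarrow> 'a) \<Rightarrow> 'i set \<Rightarrow> 'i set \<Rightarrow> 'i set \<Rightarrow> 'i set \<Rightarrow> bool" where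
  "strong_edge Y e A1 A2 B1 B2 \<longleftrightarrow>
     A1 \<noteq> {} \<and> A2 \<noteq> {} \<and> B1 \<noteq> {} \<and> B2 \<noteq> {} \<and> Y = A1 \<union> A2 \<union> (B1 \<union> B2) \<and>
     A1 \<inter> A2 = {} \<and> B1 \<inter> B2 = {} \<and> (A1 \<union> A2) \<inter> (B1 \<union> B2) = {} \<and>
     splits Y e A1 \<and> splits Y e A2 \<and> splits Y e B1 \<and> splits Y e B2 \<and> splits Y e (A1 \<union> A2) \<and>
     \<not> splits Y e (A1 \<union> B1) \<and> \<not> splits Y e (A1 \<union> B2)"

lemma strong_edge_flip:
  assumes "strong_edge Y e A1 A2 B1 B2" shows "strong_edge Y e A1 A2 B2 B1"
  using assms unfolding strong_edge_def Un_commute[of B2 B1] Int_commute[of B2 B1]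
  by (elim conjE) (intro conjI; assumption)

lemma strong_edge_swap:
  assumes h: "strong_edge Y e A1 A2 B1 B2" shows "strong_edge Y e B1 B2 A1 A2"
proof -
  have "splits Y e (B1 \<union> B2) = splits Y e (A1 \<union> A2)"
    by (rule splits_compl) (use h[unfolded strong_edge_def] in auto)
  moreover have "splits Y e (B1 \<union> A2) = splits Y e (A1 \<union> B2)"
    by (rule splits_compl) (use h[unfolded strong_edge_def] in auto)
  moreover have "B1 \<union> A1 = A1 \<union> B1" "(B1 \<union> B2) \<inter> (A1 \<union> A2) = (A1 \<union> A2) \<inter> (B1 \<union> B2)" by blast+
  moreover have "Y = B1 \<union> B2 \<union> (A1 \<union> A2)" using h unfolding strong_edge_def by blast
  ultimately show ?thesis using h unfolding strong_edge_def by argo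
qed

text \<open>A second pairing of representatives could be inflated, one part at a time, to the split
  \<open>A1 \<union> B1\<close>, which a strong edge excludes.\<close>

lemma strong_edge_quartet:
  assumes h: "strong_edge Y e A1 A2 B1 B2" and YV: "Y \<subseteq> V" and e: "\<forall>k. e k \<in> S"
    and z: "z \<in> A1" "w \<in> A2" "x \<in> B1" "y \<in> B2"
  shows "\<not> quartet z x w y e"
proof
  assume "quartet z x w y e"
  then have s: "splits {z, w, x, y} e {z, x}" by (simp add: quartet_def insert_commute)
  note hh = h[unfolded strong_edge_def]
  have ee: "e \<in> pts X e" for X using e by (rule pts_refl)
  have r: "splits Y' e D" if "splits Y e D" "Y' \<subseteq> Y" for Y' D by (rule splits_mono[OF that(1) ee that(2)])
  let ?Y1 = "A1 \<union> {w, x, y}" and ?Y2 = "A1 \<union> A2 \<union> {x, y}" and ?Y3 = "A1 \<union> A2 \<union> (B1 \<union> {y})"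
  have 1: "splits ?Y1 e ({z, x} \<union> A1)"
  proof (rule splits_blow_up[OF _ z(1) _ _ e])
    show "splits ?Y1 e A1" by (rule r) (use hh z in auto)
    have "insert z (?Y1 - A1) = {z, w, x, y}" using hh z by auto
    then show "splits (insert z (?Y1 - A1)) e {z, x}" using s by simp
  qed (use hh z YV in auto)
  have 2: "splits ?Y2 e ({z, x} \<union> A1)"
  proof (rule splits_transfer[OF _ z(2) _ _ _ _ ee])
    show "splits ?Y2 e A2" by (rule r) (use hh z in auto)
    have "insert w (?Y2 - A2) = ?Y1" using hh z by auto
    then show "splits (insert w (?Y2 - A2)) e ({z, x} \<union> A1)" using 1 by simp
  qed (use hh z YV in auto)
  have 3: "splits ?Y3 e ({z, x} \<union> A1 \<union> B1)"
  proof (rule splits_blow_up[OF _ z(3) _ _ e])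
    show "splits ?Y3 e B1" by (rule r) (use hh z in auto)
    have "insert x (?Y3 - B1) = ?Y2" using hh z by auto
    then show "splits (insert x (?Y3 - B1)) e ({z, x} \<union> A1)" using 2 by simp
  qed (use hh z YV in auto)
  have 4: "splits Y e ({z, x} \<union> A1 \<union> B1)"
  proof (rule splits_transfer[OF _ z(4) _ _ _ _ ee])
    show "splits Y e B2" using hh by blast
    have "insert y (Y - B2) = ?Y3" using hh z by auto
    then show "splits (insert y (Y - B2)) e ({z, x} \<union> A1 \<union> B1)" using 3 by simp
  qed (use hh z YV in auto)
  have eq: "{z, x} \<union> A1 \<union> B1 = A1 \<union> B1" using z by auto
  from 4 hh show False unfolding eq by blast
qed

lemma strong_edge_unique:
  assumes h: "strong_edge Y e A1 A2 B1 B2" and YV: "Y \<subseteq> V" and e: "\<forall>k. e k \<in> S"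
    and z: "z \<in> A1" "w \<in> A2" "x \<in> B1" "y \<in> B2"
  shows "unique z w x y e"
proof -
  note hh = h[unfolded strong_edge_def]
  have ee: "e \<in> pts X e" for X using e by (rule pts_refl)
  have s: "splits Y e (A1 \<union> A2)" using hh by blast
  have "quartet z w x y e" by (rule quartetI[OF s ee]) (use hh z in auto)
  moreover have "\<not> quartet z x w y e" by (rule strong_edge_quartet[OF h YV e z])
  moreover have "\<not> quartet z y w x e"
    by (rule strong_edge_quartet[OF strong_edge_flip[OF h] YV e z(1,2,4,3)])
  ultimately show ?thesis unfolding unique_def by blast
qed

text \<open>In a smallest separating set, \<open>z\<close> and \<open>w\<close> lie in different
  branches. Among all such pairs \<open>A1\<close>, \<open>A2\<close> take one with the largest
  union. If \<open>A1 \<union> B1\<close> were a split too, then either \<open>x\<close> and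
  \<open>y\<close> lie in one part and the other part could be added to \<open>A1\<close> or
  \<open>A2\<close>, or they are separated and a second pairing of the given quartet
  appears.\<close>

lemma strong_edge_exists:
  assumes crd: "crd Y e" and YV: "Y \<subseteq> V" and e: "\<forall>k. e k \<in> S"
    and d: "distinct [x, y, z, w]" "{x, y, z, w} \<subseteq> Y" and u: "unique x y z w e"
  obtains A1 A2 B1 B2 where "strong_edge Y e A1 A2 B1 B2"
proof -
  have ee: "e \<in> pts X e" for X using e by (rule pts_refl)
  have fY: "finite Y" using YV finite_V finite_subset by blast
  have nq: "\<not> quartet x z y w e" "\<not> quartet x w y z e" using u by (auto simp: unique_def)
  let ?sep = "\<lambda>A. A \<subseteq> Y \<and> splits Y e A \<and> z \<in> A \<and> w \<in> A \<and> x \<notin> A \<and> y \<notin> A"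
  have "\<exists>A. ?sep A"
  proof -
    have "card {x, y, z, w} = 4" using d(1) by auto
    then obtain A where A: "A \<subseteq> Y" "splits Y e A" "card (A \<inter> {x, y, z, w}) = 2"
      using four_point_split[OF crd YV d(2) _ e] by blast
    have q: "quartet p r s t e" if "p \<in> A" "r \<in> A" "s \<notin> A" "t \<notin> A" "{p, r, s, t} \<subseteq> Y" for p r s t
      by (rule quartetI[OF A(2) ee]) (use that in auto)
    have q': "quartet p r s t e" if "p \<notin> A" "r \<notin> A" "s \<in> A" "t \<in> A" "{p, r, s, t} \<subseteq> Y" for p r s t
      by (rule quartetI'[OF A(2) ee]) (use that in auto)
    have 1: "\<not> (x \<in> A \<and> z \<in> A \<and> y \<notin> A \<and> w \<notin> A)" "\<not> (x \<in> A \<and> w \<in> A \<and> y \<notin> A \<and> z \<notin> A)"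
      "\<not> (y \<in> A \<and> w \<in> A \<and> x \<notin> A \<and> z \<notin> A)" "\<not> (y \<in> A \<and> z \<in> A \<and> x \<notin> A \<and> w \<notin> A)"
      using q[of x z y w] q[of x w y z] q'[of x z y w] q'[of x w y z] nq d(2) by auto
    have "A \<inter> {x, y, z, w} = (if x \<in> A then {x} else {}) \<union> (if y \<in> A then {y} else {}) \<union> (if z \<in> A then {z} else {}) \<union> (if w \<in> A then {w} else {})"
      by auto
    then have "(x \<in> A \<and> y \<in> A \<and> z \<notin> A \<and> w \<notin> A) \<or> (x \<notin> A \<and> y \<notin> A \<and> z \<in> A \<and> w \<in> A)"
      using A(3) 1 d(1) by (auto split: if_splits)
    then show ?thesis
    proof
      assume "x \<in> A \<and> y \<in> A \<and> z \<notin> A \<and> w \<notin> A"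
      moreover have "splits Y e (Y - A)" using A(2) splits_Compl by blast
      ultimately show ?thesis using d(2) by (intro exI[of _ "Y - A"]) simp
    qed (use A in blast)
  qed
  then obtain A0 where "?sep A0" by (elim exE)
  then obtain A where A: "?sep A \<and> (\<forall>B. ?sep B \<longrightarrow> card A \<le> card B)"
    by (elim ex_has_least_nat[of ?sep _ card, THEN exE])
  have fA: "finite A" using A fY finite_subset by blast
  let ?P = "\<lambda>p. ?sep (fst p \<union> snd p) \<and> fst p \<inter> snd p = {} \<and> splits Y e (fst p) \<and> splits Y e (snd p) \<and> z \<in> fst p \<and> w \<in> snd p"
  have "\<exists>p. ?P p"
  proof -
    have "{z, w} \<subseteq> A" using A by blast
    then have "card {z, w} \<le> card A" using fA by (rule card_mono[rotated])
    then have A2: "2 \<le> card A" using d(1) by simp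
    have AY: "A \<subseteq> Y" "splits Y e A" "x \<in> Y - A" using A d(2) by auto
    obtain C1 C2 where C: "C1 \<noteq> {}" "C2 \<noteq> {}" "C1 \<inter> C2 = {}" "C1 \<union> C2 = A" "splits Y e C1" "splits Y e C2"
      by (rule branches[OF crd YV e AY(1,2) A2 AY(3)])
    have no: "\<not> (z \<in> C \<and> w \<in> C)" if "C \<subset> A" "splits Y e C" for C
    proof
      assume "z \<in> C \<and> w \<in> C"
      then have "?sep C" using that A by auto
      then have "card A \<le> card C" using A by blast
      then show False using psubset_card_mono[OF fA that(1)] by simp
    qed
    have "C1 \<subset> A" "C2 \<subset> A" using C by auto
    then have "\<not> (z \<in> C1 \<and> w \<in> C1)" "\<not> (z \<in> C2 \<and> w \<in> C2)" using no C by blast+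
    then have "z \<in> C1 \<and> w \<in> C2 \<or> z \<in> C2 \<and> w \<in> C1" using A C(4) by blast
    then show ?thesis
    proof
      assume "z \<in> C1 \<and> w \<in> C2"
      then show ?thesis using A C by (intro exI[of _ "(C1, C2)"]) simp
    next
      assume "z \<in> C2 \<and> w \<in> C1"
      moreover have "C2 \<union> C1 = A" "C2 \<inter> C1 = {}" using C by auto
      ultimately show ?thesis using A C by (intro exI[of _ "(C2, C1)"]) simp
    qed
  qed
  then obtain p0 where "?P p0" by (elim exE)
  then obtain p where p: "?P p \<and> (\<forall>q. ?P q \<longrightarrow> card (Y - (fst p \<union> snd p)) \<le> card (Y - (fst q \<union> snd q)))"
    by (elim ex_has_least_nat[of ?P _ "\<lambda>q. card (Y - (fst q \<union> snd q))", THEN exE])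
  define A1 A2 where "A1 = fst p" and "A2 = snd p"
  have A12: "A1 \<union> A2 \<subseteq> Y" "splits Y e (A1 \<union> A2)" "x \<notin> A1 \<union> A2" "y \<notin> A1 \<union> A2" "A1 \<inter> A2 = {}"
    "splits Y e A1" "splits Y e A2" "z \<in> A1" "w \<in> A2"
    using p unfolding A1_def A2_def by auto
  have best: "card (Y - (A1 \<union> A2)) \<le> card (Y - (C1 \<union> C2))" if "?P (C1, C2)" for C1 C2
    using p that unfolding A1_def A2_def by force
  define B where "B = Y - (A1 \<union> A2)"
  have B: "B \<subseteq> Y" "splits Y e B" "x \<in> B" "y \<in> B" "z \<in> Y - B"
    using A12 d(2) splits_Compl by (auto simp: B_def)
  have fB: "finite B" using B fY finite_subset by blast
  have "{x, y} \<subseteq> B" using B by blast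
  then have "card {x, y} \<le> card B" using fB by (rule card_mono[rotated])
  then have cB: "2 \<le> card B" using d(1) by simp
  obtain B1 B2 where B12: "B1 \<noteq> {}" "B2 \<noteq> {}" "B1 \<inter> B2 = {}" "B1 \<union> B2 = B" "splits Y e B1" "splits Y e B2"
    by (rule branches[OF crd YV e B(1,2) cB B(5)])
  have no: "\<not> splits Y e (A1 \<union> C1)"
    if C: "C1 \<noteq> {}" "C2 \<noteq> {}" "C1 \<inter> C2 = {}" "C1 \<union> C2 = B" "splits Y e C1" "splits Y e C2" for C1 C2
  proof
    assume s: "splits Y e (A1 \<union> C1)"
    have s2: "splits Y e (A2 \<union> C2)"
      by (rule splits_compl[THEN iffD1, OF _ s]) (use C A12 B_def in auto)
    have grow: False if "?P (D1, D2)" "D1 \<union> D2 = Y - E" "E \<subset> B" for D1 D2 E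
    proof -
      have "Y - (D1 \<union> D2) = E" using that B by auto
      then have "card B \<le> card E" using best[OF that(1)] by (simp add: B_def)
      then show False using psubset_card_mono[OF fB that(3)] by simp
    qed
    have s3: "splits Y e (Y - C1)" "splits Y e (Y - C2)" using C splits_Compl by auto
    consider "x \<in> C1" "y \<in> C1" | "x \<in> C2" "y \<in> C2" | "x \<in> C1" "y \<in> C2" | "x \<in> C2" "y \<in> C1"
      using B C by blast
    then show False
    proof cases
      case 1
      have un: "A1 \<union> (A2 \<union> C2) = Y - C1" using C A12 B_def by auto
      show False
      proof (rule grow[OF _ un])
        show "?P (A1, A2 \<union> C2)" using un s3 s2 A12 1 C B_def by auto
      qed (use C in auto)
    next
      case 2
      have un: "(A1 \<union> C1) \<union> A2 = Y - C2" using C A12 B_def by auto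
      show False
      proof (rule grow[OF _ un])
        show "?P (A1 \<union> C1, A2)" using un s3 s A12 2 C B_def by auto
      qed (use C in auto)
    next
      case 3
      have "quartet x z y w e" by (rule quartetI[OF s ee]) (use 3 C A12 B_def d(2) in auto)
      then show False using nq by blast
    next
      case 4
      have "quartet x w y z e" by (rule quartetI'[OF s ee]) (use 4 C A12 B_def d(2) in auto)
      then show False using nq by blast
    qed
  qed
  have "\<not> splits Y e (A1 \<union> B1)" by (rule no[OF B12])
  moreover have "\<not> splits Y e (A1 \<union> B2)" by (rule no[OF B12(2,1) _ _ B12(6,5)]) (use B12 in auto)
  ultimately have "strong_edge Y e A1 A2 B1 B2"
    unfolding strong_edge_def using A12 B12 B_def by auto
  then show thesis using that by blast
qed

end

section \<open>From a retract on all coordinates but one to the whole\<close>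

context red_retracts
begin

text \<open>A cherry without \<open>i\<close> is contracted to \<open>p\<close>, which leaves a
  quartet of \<open>p\<close>, \<open>i\<close>, \<open>r\<close>, \<open>s\<close>. Its pairing
  cannot be only that of \<open>i\<close> with \<open>p\<close>, since it would then be unique; so
  \<open>i\<close> also pairs with \<open>r\<close> or \<open>s\<close>, and this lifts.\<close>

lemma twin_exists:
  assumes nu: "\<And>x y z w. distinct [x, y, z, w] \<Longrightarrow> {x, y, z, w} \<subseteq> V \<Longrightarrow> \<not> unique x y z w e"
    and d: "distinct [i, x, y, z, w]" "{i, x, y, z, w} \<subseteq> V" and e: "e \<in> pts V b"
  shows "\<exists>q \<in> {x, y, z, w}. splits {i, x, y, z, w} e {i, q}"
proof -
  let ?Y = "{i, x, y, z, w}"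
  have crd: "crd ?Y e" using proper_crd[OF five_proper[OF d(2)] e] .
  have card: "4 \<le> card ?Y" using d(1) by simp
  obtain p q where pq: "p \<in> ?Y" "q \<in> ?Y" "p \<noteq> q" "splits ?Y e {p, q}"
    by (rule cherry[OF crd d(2) card val[OF e]])
  consider "p = i" | "q = i" | "p \<noteq> i" "q \<noteq> i" by blast
  then show ?thesis
  proof cases
    case 1
    then have "q \<in> {x, y, z, w}" using pq(2,3) by auto
    then show ?thesis using 1 pq(4) by blast
  next
    case 2
    then have "p \<in> {x, y, z, w}" using pq(1,3) by auto
    then show ?thesis using 2 pq(4) insert_commute[of p q "{}"] by auto
  next
    case 3
    have "card ({x, y, z, w} - {p, q}) = 2" using pq(1-3) 3 d(1) by (auto simp: card_Diff_subset)
    then obtain r s where rs: "{x, y, z, w} - {p, q} = {r, s}" "r \<noteq> s" by (meson card_2_iff)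
    have rs2: "r \<in> {x, y, z, w}" "s \<in> {x, y, z, w}" "r \<notin> {p, q}" "s \<notin> {p, q}" using rs(1) by auto
    have dd: "distinct [p, i, r, s]" using rs2 rs(2) 3 d(1) by auto
    have sub: "{p, i, r, s} \<subseteq> V" using rs2 pq(1) d(2) by auto
    have eq: "insert p (?Y - {p, q}) = {p, i, r, s}"
    proof -
      have "?Y - {p, q} = insert i ({x, y, z, w} - {p, q})" using 3 by auto
      then show ?thesis using rs(1) by simp
    qed
    have "quartet p r i s e \<or> quartet p s i r e"
      using quartet_cases[OF dd sub e] nu[OF dd sub] unfolding unique_def by (auto simp: quartet_sym2)
    then obtain t where t: "t \<in> {r, s}" "splits {p, i, r, s} e {i, t}"
    proof
      assume "quartet p r i s e"
      then have "quartet i s p r e" using quartet_swap[of p r i s e] dd by auto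
      then have "splits {p, i, r, s} e {i, s}" by (simp add: quartet_def insert_commute)
      then show thesis using that[of s] by simp
    next
      assume "quartet p s i r e"
      then have "quartet i r p s e" using quartet_swap[of p s i r e] dd by auto
      then have "splits {p, i, r, s} e {i, r}" by (simp add: quartet_def insert_commute)
      then show thesis using that[of r] by simp
    qed
    have "splits ?Y e {i, t}"
    proof (rule splits_transfer[OF pq(4) _ _ d(2) _ _ self[OF e], of p])
      show "splits (insert p (?Y - {p, q})) e {i, t}" using t(2) eq by simp
      show "{i, t} \<inter> {p, q} = {}" using t(1) rs2 3 by auto
      show "{i, t} \<subseteq> ?Y" using t(1) rs2 by auto
    qed (use pq in auto)
    moreover have "t \<in> {x, y, z, w}" using t(1) rs2 by auto
    ultimately show ?thesis by blast
  qed
qed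

text \<open>Twins make all pairings constant. Let \<open>{x, y}\<close> be a cherry of the
  coordinates other than \<open>v\<close>. If \<open>xy|vd\<close> holds for some \<open>d\<close>,
  the cherry splits \<open>V\<close>. If not, the lack of unique quartets forces
  \<open>xv|yd\<close> for all \<open>d\<close>, and \<open>{x, v}\<close> splits
  \<open>V\<close>.\<close>

lemma red_if_no_unique:
  assumes nu: "\<And>x y z w e. distinct [x, y, z, w] \<Longrightarrow> {x, y, z, w} \<subseteq> V \<Longrightarrow> e \<in> pts V b \<Longrightarrow> \<not> unique x y z w e"
  shows "red V b"
proof -
  have bV: "b \<in> pts V b" using b_val by (rule pts_refl)
  have const: "alw x y z w" if q: "quartet x y z w e" and e: "e \<in> pts V b"
    and d: "distinct [x, y, z, w]" "{x, y, z, w} \<subseteq> V" for x y z w e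
    unfolding alw_def
  proof
    fix e' assume e': "e' \<in> pts V b"
    show "quartet x y z w e'"
    proof (rule constant_on_pts[of "{x, y, z, w}" e b e' "quartet x y z w", OF d(2) e e' q])
      fix f i c assume h: "i \<in> V - {x, y, z, w}" "f \<in> pts V b" "quartet x y z w f" "c \<in> S"
      have di: "distinct [i, x, y, z, w]" "{i, x, y, z, w} \<subseteq> V" using h(1) d by auto
      have "\<exists>q \<in> {x, y, z, w}. splits {i, x, y, z, w} f {i, q}"
        by (rule twin_exists[OF _ di h(2)]) (rule nu[OF _ _ h(2)])
      then obtain q where q: "q \<in> {x, y, z, w}" "splits {i, x, y, z, w} f {i, q}" by (elim bexE)
      have f: "f \<in> pts {i, x, y, z, w} f" using h(2) by (rule self)
      have f2: "f(i := c) \<in> pts {i, x, y, z, w} f" by (rule pts_upd[OF f]) (use h in auto)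
      show "quartet x y z w (f(i := c))" unfolding quartet_def
        by (rule twin_transfer[OF q(2,1) h(1) d(2) f f2]) (use h(3) quartet_def in simp)
    next
      fix f g assume "f \<in> pts V b" "g \<in> pts {x, y, z, w} f" "quartet x y z w f"
      then show "quartet x y z w g" using quartet_base by blast
    qed
  qed
  obtain v where v: "v \<in> V" using V6 by fastforce
  have Y: "V - {v} \<subset> V" "V - {v} \<subseteq> V" using v by auto
  have cV: "5 \<le> card (V - {v})" using V6 v finite_V by simp
  have "4 \<le> card (V - {v})" using cV by simp
  then obtain x y where xy: "x \<in> V - {v}" "y \<in> V - {v}" "x \<noteq> y" "splits (V - {v}) b {x, y}"
    by (rule cherry[OF proper_crd[OF Y(1) bV] Y(2) _ b_val])
  have xyd: "alw x y d d'" if "d \<in> V - {v, x, y}" "d' \<in> V - {v, x, y}" "d \<noteq> d'" for d d'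
  proof (rule const[OF _ bV])
    show "quartet x y d d' b" by (rule quartetI[OF xy(4) self[OF bV]]) (use that xy in auto)
  qed (use that xy in auto)
  show ?thesis
  proof (cases "\<exists>d \<in> V - {v, x, y}. alw x y v d")
    case True
    then obtain d where d: "d \<in> V - {v, x, y}" "alw x y v d" by blast
    have "splits V b {x, y}"
    proof (rule splits_local[of _ _ x d])
      fix c f e' assume h: "c \<in> {x, y} - {x}" "f \<in> V - {x, y} - {d}" "e' \<in> pts V b"
      have c: "c = y" using h(1) by blast
      have "alw x y f d" using xyd[of f d] d h(2) by (cases "f = v") auto
      then have "quartet y x f d e'" using alwD[OF _ h(3)] quartet_sym1 by blast
      then show "splits {c, x, f, d} e' {c, x}" unfolding quartet_def c .
    qed (use xy d in auto)
    moreover have "2 \<le> card (V - {x, y})" using V6 xy finite_V by (simp add: card_Diff_subset)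
    ultimately show ?thesis using xy by (intro redI[of "{x, y}"]) auto
  next
    case False
    have vd: "alw x v y d" if d: "d \<in> V - {v, x, y}" for d
    proof -
      have dd: "distinct [x, y, v, d]" "{x, y, v, d} \<subseteq> V" using d xy v by auto
      have dd2: "distinct [x, d, y, v]" "{x, d, y, v} \<subseteq> V" using d xy v by auto
      have n: "\<not> quartet x y v d b" using const[OF _ bV dd] False d by blast
      have "quartet x v y d b \<or> quartet x d y v b" using quartet_cases[OF dd bV] n by blast
      then have q: "quartet x v y d b"
      proof
        \<comment> \<open>The pairing \<open>xd|yv\<close> is not the only one, and
          \<open>xy|vd\<close> is excluded, so \<open>xv|yd\<close> holds as well.\<close>
        assume h: "quartet x d y v b"
        have "\<not> unique x d y v b" by (rule nu[OF dd2 bV])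
        then have "quartet x y d v b \<or> quartet x v d y b" using h unfolding unique_def by blast
        then show ?thesis using n quartet_sym2[of x y d v b] quartet_sym2[of x v d y b] by blast
      qed
      show ?thesis by (rule const[OF q bV]) (use dd in auto)
    qed
    have "splits V b {x, v}"
    proof (rule splits_local[of _ _ x y])
      fix c f e' assume h: "c \<in> {x, v} - {x}" "f \<in> V - {x, v} - {y}" "e' \<in> pts V b"
      have c: "c = v" using h(1) by blast
      have "alw x v y f" by (rule vd) (use h in auto)
      then have "quartet v x f y e'" using alwD[OF _ h(3)] quartet_sym1 quartet_sym2 by blast
      then show "splits {c, x, f, y} e' {c, x}" unfolding quartet_def c .
    qed (use xy v in auto)
    moreover have "2 \<le> card (V - {x, v})" using V6 xy v finite_V by (simp add: card_Diff_subset)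
    ultimately show ?thesis using xy v by (intro redI[of "{x, v}"]) auto
  qed
qed

lemma transversal:
  assumes h: "strong_edge (V - {v}) e A1 A2 B1 B2" and v: "v \<in> V" and e: "e \<in> pts V b"
    and z: "z \<in> A1" "w \<in> A2" "x \<in> B1" "y \<in> B2"
  shows "distinct [v, z, w, x, y]" "{v, z, w, x, y} \<subseteq> V" "alw x y z w"
    "(alw x y z v \<and> alw x y w v) \<or> (alw z w x v \<and> alw z w y v)"
proof -
  note hh = h[unfolded strong_edge_def]
  have Y: "V - {v} = A1 \<union> A2 \<union> (B1 \<union> B2)" using hh by blast
  have inY: "z \<in> V - {v}" "w \<in> V - {v}" "x \<in> V - {v}" "y \<in> V - {v}" unfolding Y using z by auto
  show d: "distinct [v, z, w, x, y]"
  proof -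
    have "z \<noteq> w" "x \<noteq> y" "z \<noteq> x" "z \<noteq> y" "w \<noteq> x" "w \<noteq> y" using hh z by blast+
    then show ?thesis using inY by auto
  qed
  show sub: "{v, z, w, x, y} \<subseteq> V" using inY v by auto
  have u: "unique z w x y e" by (rule strong_edge_unique[OF h _ val[OF e] z]) auto
  have d4: "distinct [z, w, x, y]" "{z, w, x, y} \<subseteq> V" using d sub by auto
  have "alw z w x y" by (rule unique_persists[OF u d4 e])
  then show "alw x y z w" using alw_swap[OF d4(1)] by simp
  have s: "alw x y z v = alw z v x y" "alw x y w v = alw w v x y" "alw z w x v = alw x v z w" "alw z w y v = alw y v z w"
    using d by (auto intro!: alw_swap)
  show "(alw x y z v \<and> alw x y w v) \<or> (alw z w x v \<and> alw z w y v)"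
    using unique_dichotomy[OF u d sub e] unfolding s .
qed

text \<open>Here \<open>v\<close> is always on the side of \<open>A1\<close> and \<open>A2\<close>,
  so \<open>B1 \<union> B2\<close> is the candidate split. The given pairings join elements of
  different \<open>B\<close> parts; for two elements of \<open>B1\<close> the test makes a detour
  through \<open>y0\<close> in \<open>B2\<close>.\<close>

lemma red_if_strong_edge_half:
  assumes h: "strong_edge (V - {v}) e A1 A2 B1 B2" and v: "v \<in> V" and e: "e \<in> pts V b"
    and a: "\<And>x y z. x \<in> B1 \<Longrightarrow> y \<in> B2 \<Longrightarrow> z \<in> A1 \<union> A2 \<Longrightarrow> alw x y z v"
  shows "red V b"
proof -
  note hh = h[unfolded strong_edge_def]
  note tv = transversal[OF h v e]
  have Y: "V - {v} = A1 \<union> A2 \<union> (B1 \<union> B2)" using hh by blast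
  have disj: "A1 \<inter> A2 = {}" "B1 \<inter> B2 = {}" "(A1 \<union> A2) \<inter> (B1 \<union> B2) = {}" using hh by blast+
  have vn: "v \<notin> A1 \<union> A2 \<union> (B1 \<union> B2)" unfolding Y[symmetric] by simp
  have AV: "A1 \<union> A2 \<union> (B1 \<union> B2) \<subseteq> V" unfolding Y[symmetric] by blast
  obtain z0 w0 x0 y0 where o: "z0 \<in> A1" "w0 \<in> A2" "x0 \<in> B1" "y0 \<in> B2" using hh by blast
  have 1: "alw x y d z0" if x: "x \<in> B1" "y \<in> B2" and d: "d \<in> insert v (A1 \<union> A2) - {z0}" for x y d
  proof -
    consider "d = v" | "d \<in> A2" | "d \<in> A1" "d \<noteq> z0" using d by blast
    then show ?thesis
    proof cases
      case 1
      have "alw x y z0 v" using a x o by blast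
      then show ?thesis using 1 alw_sym2 by blast
    next
      case 2
      have "alw x y z0 d" by (rule tv(3)[OF o(1) 2 x])
      then show ?thesis using alw_sym2 by blast
    next
      case 3
      have "alw x y d w0" by (rule tv(3)[OF 3(1) o(2) x])
      moreover have "alw x y z0 w0" by (rule tv(3)[OF o(1,2) x])
      ultimately have q: "alw x y w0 d" "alw x y w0 z0" using alw_sym2 by blast+
      show ?thesis
        by (rule alw_trans[OF _ _ q]) (use tv(1,2)[OF 3(1) o(2) x] tv(1,2)[OF o(1,2) x] 3(2) in auto)
    qed
  qed
  let ?B = "B1 \<union> B2"
  have comp: "V - ?B = insert v (A1 \<union> A2)" using Y v vn disj(3) by blast
  have "splits V b ?B"
  proof (rule splits_local[of _ _ x0 z0])
    fix c d e' assume c: "c \<in> ?B - {x0}" and d: "d \<in> V - ?B - {z0}" and e': "e' \<in> pts V b"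
    have d2: "d \<in> insert v (A1 \<union> A2) - {z0}" using d comp by blast
    have ds: "d \<notin> ?B" "d \<noteq> z0" "d \<in> V" "z0 \<notin> ?B" using d o disj(3) by auto
    have "alw c x0 d z0"
    proof (cases "c \<in> B2")
      case True
      then have "alw x0 c d z0" using 1[OF o(3) _ d2] by blast
      then show ?thesis using alw_sym1 by blast
    next
      case False
      then have c1: "c \<in> B1" "c \<noteq> x0" using c by auto
      have dist: "distinct [d, z0, y0, c, x0]" using c1 o ds disj(2) by auto
      have subV: "{d, z0, y0, c, x0} \<subseteq> V" using c1 o ds AV by auto
      have q: "alw c y0 d z0" "alw x0 y0 d z0" using 1[OF c1(1) o(4) d2] 1[OF o(3,4) d2] by auto
      have q1: "alw d z0 y0 c" using q(1) alw_swap[of c y0 d z0] alw_sym2[of d z0 y0 c] dist by auto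
      have q2: "alw d z0 y0 x0" using q(2) alw_swap[of x0 y0 d z0] alw_sym2[of d z0 y0 x0] dist by auto
      have "alw d z0 c x0" by (rule alw_trans[OF dist subV q1 q2])
      then show ?thesis using alw_swap[of d z0 c x0] dist by auto
    qed
    then have "quartet c x0 d z0 e'" using alwD[OF _ e'] by blast
    then show "splits {c, x0, d, z0} e' {c, x0}" unfolding quartet_def .
  next
    show "z0 \<in> V - ?B" using comp o by blast
  qed (use o AV in auto)
  moreover have "2 \<le> card ?B"
  proof -
    have "finite ?B" using AV finite_V finite_subset by auto
    moreover have "{x0, y0} \<subseteq> ?B" "x0 \<noteq> y0" using o disj by auto
    ultimately show ?thesis using card_mono[of ?B "{x0, y0}"] by simp
  qed
  moreover have "2 \<le> card (V - ?B)"
  proof -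
    have "{z0, w0} \<subseteq> V - ?B" "z0 \<noteq> w0" using o comp disj by auto
    then show ?thesis using card_mono[of "V - ?B" "{z0, w0}"] finite_V by simp
  qed
  moreover have "?B \<subseteq> V" using AV by blast
  ultimately show ?thesis using redI by blast
qed

text \<open>The side on which \<open>v\<close> attaches must not depend on the representatives. Once
  a single test fails to put \<open>v\<close> on the \<open>B\<close> side, every choice of
  \<open>x\<close> and \<open>y\<close> must put it on the \<open>A\<close> side relative to
  \<open>z0\<close> and \<open>w0\<close>, for otherwise the failing test could be inferred;
  \<open>alw_trans\<close> then reaches all other elements of \<open>A1\<close> and
  \<open>A2\<close>.\<close>

lemma red_if_unique:
  assumes u: "unique x y z w e" and d: "distinct [x, y, z, w]" "{x, y, z, w} \<subseteq> V" and e: "e \<in> pts V b"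
  shows "red V b"
proof -
  have "card {x, y, z, w} \<le> 5" using card_length[of "[x, y, z, w]"] by simp
  then obtain v where v: "v \<in> V" "v \<notin> {x, y, z, w}" using exists_outside[OF d(2)] by blast
  have Y: "V - {v} \<subset> V" "V - {v} \<subseteq> V" using v by auto
  have d2: "{x, y, z, w} \<subseteq> V - {v}" using d v by auto
  obtain A1 A2 B1 B2 where h: "strong_edge (V - {v}) e A1 A2 B1 B2"
    by (rule strong_edge_exists[OF proper_crd[OF Y(1) e] Y(2) val[OF e] d(1) d2 u])
  note tv = transversal[OF h v(1) e]
  show ?thesis
  proof (cases "\<forall>z \<in> A1. \<forall>w \<in> A2. \<forall>x \<in> B1 \<union> B2. alw z w x v")
    case True
    show ?thesis by (rule red_if_strong_edge_half[OF strong_edge_swap[OF h] v(1) e]) (use True in auto)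
  next
    case False
    then obtain z0 w0 x0 where n: "z0 \<in> A1" "w0 \<in> A2" "x0 \<in> B1 \<union> B2" "\<not> alw z0 w0 x0 v" by blast
    have R: "alw x y z0 v \<and> alw x y w0 v" if x: "x \<in> B1" "y \<in> B2" for x y
    proof (rule ccontr)
      assume "\<not> ?thesis"
      then have L: "alw z0 w0 x v" "alw z0 w0 y v" using tv(4)[OF n(1,2) x] by auto
      have sw: "alw z0 w0 x' y'" if "x' \<in> B1" "y' \<in> B2" for x' y'
        using tv(3)[OF n(1,2) that] alw_swap[of x' y' z0 w0] tv(1)[OF n(1,2) that] by auto
      from n(3) have "alw z0 w0 x0 v"
      proof
        assume x0: "x0 \<in> B1"
        show ?thesis
        proof (cases "x0 = x")
          case False
          have q: "alw z0 w0 y x0" using sw[OF x0 x(2)] alw_sym2 by blast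
          show ?thesis by (rule alw_trans[OF _ _ q L(2)]) (use tv(1,2)[OF n(1,2) x0 x(2)] in auto)
        qed (use L in simp)
      next
        assume x0: "x0 \<in> B2"
        show ?thesis
        proof (cases "x0 = y")
          case False
          have q: "alw z0 w0 x x0" using sw[OF x(1) x0] .
          show ?thesis by (rule alw_trans[OF _ _ q L(1)]) (use tv(1,2)[OF n(1,2) x(1) x0] in auto)
        qed (use L in simp)
      qed
      then show False using n(4) by blast
    qed
    show ?thesis
    proof (rule red_if_strong_edge_half[OF h v(1) e])
      fix x y z assume x: "x \<in> B1" "y \<in> B2" and z: "z \<in> A1 \<union> A2"
      from z show "alw x y z v"
      proof
        assume z1: "z \<in> A1"
        have q: "alw x y w0 z" using tv(3)[OF z1 n(2) x] alw_sym2 by blast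
        show ?thesis by (rule alw_trans[OF _ _ q]) (use tv(1,2)[OF z1 n(2) x] R[OF x] in auto)
      next
        assume z1: "z \<in> A2"
        have q: "alw x y z0 z" using tv(3)[OF n(1) z1 x] .
        show ?thesis by (rule alw_trans[OF _ _ q]) (use tv(1,2)[OF n(1) z1 x] R[OF x] in auto)
      qed
    qed
  qed
qed

theorem red_whole: "red V b"
  using red_if_no_unique red_if_unique by blast

end

section \<open>Irreducible retracts with one or two coordinates fewer\<close>

context latin
begin

text \<open>With five coordinates any three form an irreducible retract, as a split needs two on
  each side. With six or more, a largest irreducible proper retract would miss at least three
  coordinates if the claim failed, so its extensions by one or two are still proper.\<close>

theorem exists_irreducible_retract:
  assumes V5: "5 \<le> card V" and e: "\<forall>k. e k \<in> S" and irr: "\<not> red V e"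
  shows "\<exists>Y e'. Y \<subset> V \<and> e' \<in> pts V e \<and> \<not> red Y e' \<and> (card Y = card V - 1 \<or> card Y = card V - 2)"
proof (rule ccontr)
  assume "\<not> ?thesis"
  then have H: "red Y e'" if "Y \<subset> V" "e' \<in> pts V e" "card Y = card V - 1 \<or> card Y = card V - 2" for Y e'
    using that by blast
  have eV: "e \<in> pts V e" using e by (rule pts_refl)
  have V6: "6 \<le> card V"
  proof (rule ccontr)
    assume "\<not> 6 \<le> card V"
    then have V: "card V = 5" using V5 by linarith
    obtain Y where Y: "Y \<subseteq> V" "card Y = 3" using obtain_subset_with_card_n[of 3 V] V by auto
    have "Y \<subset> V" using Y V by auto
    then have "red Y e" using H[OF _ eV] Y V by simp
    then obtain A where A: "A \<subseteq> Y" "2 \<le> card A" "2 \<le> card (Y - A)" unfolding red_def by blast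
    have fY: "finite Y" using Y(2) card.infinite by fastforce
    have "card A + card (Y - A) = 3"
      using A(1) fY Y(2) card_Diff_subset[of A Y] card_mono[OF fY A(1)] finite_subset[OF A(1) fY] by simp
    then show False using A by linarith
  qed
  have "\<not> red_retracts S V F e" using red_retracts.red_whole irr by blast
  then have "\<exists>X e'. X \<subset> V \<and> 4 \<le> card X \<and> e' \<in> pts V e \<and> \<not> red X e'"
    using e V6 latin_axioms unfolding red_retracts_def red_retracts_axioms_def by blast
  then obtain X0 e0 where X0: "X0 \<subset> V" "4 \<le> card X0" "e0 \<in> pts V e" "\<not> red X0 e0" by blast
  let ?P = "\<lambda>X. X \<subset> V \<and> 4 \<le> card X \<and> (\<exists>e' \<in> pts V e. \<not> red X e')"
  have "?P X0" using X0 by blast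
  then obtain X where X: "?P X \<and> (\<forall>X'. ?P X' \<longrightarrow> card (V - X) \<le> card (V - X'))"
    by (elim ex_has_least_nat[of ?P _ "\<lambda>X. card (V - X)", THEN exE])
  then obtain e1 where e1: "e1 \<in> pts V e" "\<not> red X e1" by blast
  have XV: "X \<subset> V" "4 \<le> card X" using X by blast+
  have fX: "finite X" using XV(1) finite_V finite_subset by blast
  have larger: "red X' e'" if "X' \<subset> V" "X \<subset> X'" "e' \<in> pts V e" for X' e'
  proof (rule ccontr)
    assume n: "\<not> red X' e'"
    have "card X \<le> card X'" using that finite_V finite_subset by (metis card_mono psubset_imp_subset)
    then have "?P X'" using that n XV by auto
    then have "card (V - X) \<le> card (V - X')" using X by blast
    moreover have "V - X' \<subset> V - X" using that by blast
    ultimately show False using psubset_card_mono[of "V - X" "V - X'"] finite_V by simp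
  qed
  have cX: "card X + 3 \<le> card V"
  proof -
    have "card X < card V" using XV finite_V by (simp add: psubset_card_mono)
    moreover have "card X \<noteq> card V - 1" "card X \<noteq> card V - 2" using H[OF XV(1) e1(1)] e1(2) by blast+
    ultimately show ?thesis by linarith
  qed
  have e1S: "\<forall>k. e1 k \<in> S" using e1(1) by (simp add: pts_def)
  have p: "pts V e1 = pts V e" by (rule pts_base[OF e1(1)])
  have "red V e1"
  proof (rule red_if_extensions_red[OF e1(2) e1S XV])
    fix i e' assume h: "i \<in> V - X" "e' \<in> pts V e1"
    have "card (insert i X) < card V" using cX h(1) fX by simp
    then have "insert i X \<noteq> V" by blast
    then show "red (insert i X) e'" using h XV p by (intro larger) auto
  next
    fix i j e' assume h: "i \<in> V - X" "j \<in> V - X" "i \<noteq> j" "e' \<in> pts V e1"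
    have "card (insert i (insert j X)) < card V" using cX h fX by simp
    then have "insert i (insert j X) \<noteq> V" by blast
    then show "red (insert i (insert j X)) e'" using h XV p by (intro larger) auto
  qed
  then show False using irr red_base[OF e1(1)] by blast
qed

end

section \<open>Autotopies moving two coordinates\<close>

lemma funpow_permutes: "\<alpha> permutes S \<Longrightarrow> (\<alpha> ^^ k) permutes S"
  by (induction k) (auto simp: permutes_id[unfolded id_def] id_def intro: permutes_compose)

text \<open>All orbits of the powers of \<alpha> have the same length \<open>N\<close>, the order of
  \<alpha>. So \<open>N\<close> divides the prime \<open>card S\<close>, and \<open>N\<close> is not
  1.\<close>

lemma semiregular_prime_transitive:
  assumes "\<alpha> permutes S" "finite S" "prime (card S)" "\<alpha> \<noteq> id"
    and semi: "\<And>k u. u \<in> S \<Longrightarrow> (\<alpha> ^^ k) u = u \<Longrightarrow> \<alpha> ^^ k = id"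
    and uv: "u \<in> S" "v \<in> S"
  shows "\<exists>k. (\<alpha> ^^ k) u = v"
proof -
  have pk: "(\<alpha> ^^ k) permutes S" for k using assms(1) by (rule funpow_permutes)
  have inS: "(\<alpha> ^^ k) w \<in> S" if "w \<in> S" for k w using permutes_in_image[OF pk] that by blast
  have ijk: "\<alpha> ^^ (j - i) = id" if "i \<le> j" "(\<alpha> ^^ i) w = (\<alpha> ^^ j) w" "w \<in> S" for i j w
  proof -
    have "(\<alpha> ^^ j) w = (\<alpha> ^^ i) ((\<alpha> ^^ (j - i)) w)" using that(1) by (metis comp_apply funpow_add le_add_diff_inverse)
    then have "(\<alpha> ^^ (j - i)) w = w" using that(2) pk[of i] by (metis permutes_inj injD)
    then show ?thesis using semi that(3) by blast
  qed
  have "\<exists>k>0. \<alpha> ^^ k = id"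
  proof -
    have "\<not> inj_on (\<lambda>k. (\<alpha> ^^ k) u) {..card S}"
    proof
      assume "inj_on (\<lambda>k. (\<alpha> ^^ k) u) {..card S}"
      then have "card {..card S} \<le> card S"
        using card_inj_on_le[of _ "{..card S}" S] inS[OF uv(1)] assms(2) by blast
      then show False by simp
    qed
    then obtain i j where "i \<noteq> j" "(\<alpha> ^^ i) u = (\<alpha> ^^ j) u" unfolding inj_on_def by blast
    then show ?thesis using ijk[of i j u] ijk[of j i u] uv(1)
      by (metis nat_neq_iff zero_less_diff less_imp_le_nat)
  qed
  define N where "N = (LEAST k. k > 0 \<and> \<alpha> ^^ k = id)"
  have N: "N > 0" "\<alpha> ^^ N = id"
    using LeastI_ex[OF \<open>\<exists>k>0. \<alpha> ^^ k = id\<close>] by (auto simp: N_def)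
  have Nmin: "N \<le> k" if "k > 0" "\<alpha> ^^ k = id" for k unfolding N_def by (rule Least_le) (use that in auto)
  define orb where "orb w = (\<lambda>k. (\<alpha> ^^ k) w) ` {..<N}" for w
  have card_orb: "card (orb w) = N" if "w \<in> S" for w
  proof -
    have "inj_on (\<lambda>k. (\<alpha> ^^ k) w) {..<N}"
    proof (rule linorder_inj_onI)
      fix i j assume h: "i < j" "i \<in> {..<N}" "j \<in> {..<N}"
      show "(\<alpha> ^^ i) w \<noteq> (\<alpha> ^^ j) w"
      proof
        assume "(\<alpha> ^^ i) w = (\<alpha> ^^ j) w"
        then have "N \<le> j - i" using Nmin[of "j - i"] ijk[of i j w] h that by simp
        then show False using h by auto
      qed
    qed auto
    then show ?thesis by (simp add: orb_def card_image)
  qed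
  have powmod: "\<alpha> ^^ k = \<alpha> ^^ (k mod N)" for k
  proof -
    have "\<alpha> ^^ (N * (k div N)) = id" using N(2) by (simp add: funpow_mult[symmetric] id_def[symmetric])
    then have "\<alpha> ^^ (k mod N + N * (k div N)) = \<alpha> ^^ (k mod N)" by (simp only: funpow_add) simp
    then show ?thesis by simp
  qed
  have orb_mem: "x \<in> orb w \<longleftrightarrow> (\<exists>k. x = (\<alpha> ^^ k) w)" for x w
    unfolding orb_def using powmod N(1) by (metis (no_types, lifting) image_iff lessThan_iff mod_less_divisor)
  have sub: "orb w \<subseteq> S" if "w \<in> S" for w using inS[OF that] by (auto simp: orb_def)
  have same: "orb x = orb w" if "x \<in> orb w" for x w
  proof -
    obtain k where k: "k < N" "x = (\<alpha> ^^ k) w" using \<open>x \<in> orb w\<close> by (auto simp: orb_def)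
    have "(\<alpha> ^^ (N - k)) x = w"
      using k N(2) by (metis comp_apply funpow_add id_apply le_add_diff_inverse2 less_imp_le_nat)
    then have "w \<in> orb x" using orb_mem by metis
    have tr: "z \<in> orb y" if "z \<in> orb y'" "y' \<in> orb y" for z y y'
      using that unfolding orb_mem by (metis comp_apply funpow_add)
    show ?thesis using tr \<open>x \<in> orb w\<close> \<open>w \<in> orb x\<close> by blast
  qed
  have self: "w \<in> orb w" for w using orb_mem by (metis funpow_0)
  have "N * card (orb ` S) = card (\<Union> (orb ` S))"
  proof (rule card_partition)
    show "finite (\<Union> (orb ` S))" using assms(2) by (auto simp: orb_def)
    show "c1 \<inter> c2 = {}" if "c1 \<in> orb ` S" "c2 \<in> orb ` S" "c1 \<noteq> c2" for c1 c2
      using that same by (metis disjoint_iff image_iff)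
  qed (use assms(2) card_orb in auto)
  moreover have "\<Union> (orb ` S) = S" using sub self by blast
  ultimately have "N dvd card S" by (metis dvd_triv_left)
  moreover have "N \<noteq> 1" using N(2) assms(4) by auto
  ultimately have "N = card S" using assms(3) prime_nat_iff by blast
  then have "orb u = S" using card_orb[OF uv(1)] sub[OF uv(1)] assms(2) by (simp add: card_subset_eq)
  then show ?thesis using uv(2) orb_mem by metis
qed

text \<open>A subgroup of a product of two permutation groups. The components will be the actions of
  one autotopy at two of its coordinates.\<close>

definition perm_pair_group :: "(('a \<Rightarrow> 'a) \<times> ('a \<Rightarrow> 'a)) set \<Rightarrow> bool" where
  "perm_pair_group K \<longleftrightarrow> (id, id) \<in> K \<and>
     (\<forall>g \<in> K. bij (fst g) \<and> bij (snd g) \<and> (inv (fst g), inv (snd g)) \<in> K) \<and>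
     (\<forall>g \<in> K. \<forall>h \<in> K. (fst g \<circ> fst h, snd g \<circ> snd h) \<in> K)"

lemma orbit_stabilizer_pairs:
  assumes K: "perm_pair_group K" "finite K" and pr: "pr = fst \<or> pr = snd"
  shows "card K = card {h \<in> K. pr h a = a} * card ((\<lambda>h. pr h a) ` K)"
proof -
  note k = K(1)[unfolded perm_pair_group_def]
  define fib where "fib v = {h \<in> K. pr h a = v}" for v
  let ?O = "(\<lambda>h. pr h a) ` K"
  have cf: "card (fib v) = card (fib a)" if v: "v \<in> ?O" for v
  proof -
    obtain g where g: "g \<in> K" "v = pr g a" using v by blast
    let ?g' = "(inv (fst g), inv (snd g))"
    have g': "?g' \<in> K" "bij (fst g)" "bij (snd g)" using k g by auto
    have inv: "inv (fst g) (fst g x) = x" "inv (snd g) (snd g x) = x"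
      "fst g (inv (fst g) x) = x" "snd g (inv (snd g) x) = x" for x
      using g' by (simp_all add: bij_is_inj bij_is_surj surj_f_inv_f)
    have "bij_betw (\<lambda>h. (fst g \<circ> fst h, snd g \<circ> snd h)) (fib a) (fib v)"
    proof (rule bij_betw_byWitness[where f' = "\<lambda>h. (inv (fst g) \<circ> fst h, inv (snd g) \<circ> snd h)"])
      show "(\<lambda>h. (fst g \<circ> fst h, snd g \<circ> snd h)) ` fib a \<subseteq> fib v"
        using k g pr by (auto simp: fib_def)
      show "(\<lambda>h. (inv (fst g) \<circ> fst h, inv (snd g) \<circ> snd h)) ` fib v \<subseteq> fib a"
      proof
        fix h assume "h \<in> (\<lambda>h. (inv (fst g) \<circ> fst h, inv (snd g) \<circ> snd h)) ` fib v"
        then obtain l where l: "l \<in> K" "pr l a = v" "h = (inv (fst g) \<circ> fst l, inv (snd g) \<circ> snd l)"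
          by (auto simp: fib_def)
        have "(fst ?g' \<circ> fst l, snd ?g' \<circ> snd l) \<in> K" using k g'(1) l(1) by blast
        then have "h \<in> K" using l(3) by simp
        moreover have "pr h a = a" using pr l g inv by auto
        ultimately show "h \<in> fib a" by (simp add: fib_def)
      qed
    qed (use inv in \<open>auto simp: comp_def\<close>)
    then show ?thesis using bij_betw_same_card by metis
  qed
  have "card (fib a) * card (fib ` ?O) = card (\<Union> (fib ` ?O))"
  proof (rule card_partition)
    show "finite (\<Union> (fib ` ?O))" using K(2) by (auto simp: fib_def)
    show "card c = card (fib a)" if "c \<in> fib ` ?O" for c using that cf by auto
    show "c1 \<inter> c2 = {}" if "c1 \<in> fib ` ?O" "c2 \<in> fib ` ?O" "c1 \<noteq> c2" for c1 c2
      using that by (auto simp: fib_def)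
  qed (use K(2) in auto)
  moreover have "\<Union> (fib ` ?O) = K" by (auto simp: fib_def)
  moreover have "card (fib ` ?O) = card ?O"
  proof (rule card_image, rule inj_onI)
    fix v w assume "v \<in> ?O" "w \<in> ?O" "fib v = fib w"
    then show "v = w" unfolding fib_def by blast
  qed
  ultimately show ?thesis by (simp add: fib_def)
qed

text \<open>The order of a group acting transitively on \<open>S\<close> is divisible by the prime \<open>card S\<close>; if it also
  acts intransitively on \<open>S\<close>, all orbits of the second action are too small for this divisor to get lost
  when passing to stabilizers, so even the kernel of the second action is nontrivial.\<close>

lemma kernel_nontrivial:
  assumes S: "finite S" "prime (card S)" and K: "perm_pair_group K"
    and perm: "\<And>h. h \<in> K \<Longrightarrow> fst h permutes S \<and> snd h permutes S"
    and trans: "\<And>u v. u \<in> S \<Longrightarrow> v \<in> S \<Longrightarrow> \<exists>h \<in> K. snd h u = v"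
    and M: "M \<subset> S" "M \<noteq> {}" "\<And>h. h \<in> K \<Longrightarrow> fst h ` M = M"
  shows "\<exists>\<beta>. \<beta> \<noteq> id \<and> (id, \<beta>) \<in> K"
proof -
  note k = K[unfolded perm_pair_group_def]
  have finK: "finite K"
  proof (rule finite_subset)
    show "K \<subseteq> {p. p permutes S} \<times> {p. p permutes S}" using perm by (auto simp: mem_Times_iff)
  qed (use finite_permutations[OF S(1)] in auto)
  \<comment> \<open>Stabilizing all points of \<open>S\<close>, one after the other, leaves the
    kernel of the first component.\<close>
  define stab where "stab T = {h \<in> K. \<forall>u \<in> T. fst h u = u}" for T
  have group: "perm_pair_group (stab T)" for T
  proof -
    have "inv (fst g) u = u" if "g \<in> K" "fst g u = u" for g u
      using that k by (metis bij_is_inj inv_f_f)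
    then show ?thesis using k unfolding perm_pair_group_def stab_def by auto
  qed
  have "card S dvd card (stab T)" if "finite T" "T \<subseteq> S" for T
    using that
  proof (induction T rule: finite_induct)
    case empty
    obtain u where u: "u \<in> S" using M(1) by blast
    have "(\<lambda>h. snd h u) ` K = S"
    proof
      show "(\<lambda>h. snd h u) ` K \<subseteq> S"
      proof
        fix v assume "v \<in> (\<lambda>h. snd h u) ` K"
        then obtain h where h: "h \<in> K" "v = snd h u" by blast
        have "snd h permutes S" using perm[OF h(1)] by simp
        then show "v \<in> S" using h(2) u permutes_in_image by metis
      qed
      show "S \<subseteq> (\<lambda>h. snd h u) ` K" using trans[OF u] by blast
    qed
    then have "card K = card {h \<in> K. snd h u = u} * card S"
      using orbit_stabilizer_pairs[OF K finK, of snd u] by simp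
    moreover have "stab {} = K" by (simp add: stab_def)
    ultimately show ?case by simp
  next
    case (insert a T)
    let ?O = "(\<lambda>h. fst h a) ` stab T"
    have fin: "finite (stab T)" using finK by (simp add: stab_def)
    have "{h \<in> stab T. fst h a = a} = stab (insert a T)" by (auto simp: stab_def)
    then have c: "card (stab T) = card (stab (insert a T)) * card ?O"
      using orbit_stabilizer_pairs[OF group fin, of fst a] by simp
    have "(id, id) \<in> stab T" using k by (simp add: stab_def)
    then have "a \<in> ?O" by force
    then have pos: "card ?O > 0" using fin by (simp add: card_gt_0_iff) blast
    have aS: "a \<in> S" using insert.prems by blast
    have "?O \<subseteq> M \<or> ?O \<subseteq> S - M"
    proof (cases "a \<in> M")
      case True
      have "fst h a \<in> M" if "h \<in> stab T" for h
        using that True M(3)[of h] by (auto simp: stab_def)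
      then show ?thesis by blast
    next
      case False
      have "fst h a \<in> S - M" if "h \<in> K" for h
      proof -
        have "fst h a \<notin> M"
        proof
          assume "fst h a \<in> M"
          then have "fst h a \<in> fst h ` M" using M(3)[OF that] by simp
          then show False using False perm[OF that] by (metis imageE permutes_inj injD)
        qed
        moreover have "fst h a \<in> S" using perm[OF that] aS permutes_in_image by metis
        ultimately show ?thesis by blast
      qed
      then show ?thesis by (auto simp: stab_def)
    qed
    then have "?O \<subset> S" using M(1,2) by blast
    then have "card ?O < card S" using S(1) by (simp add: psubset_card_mono)
    then have "\<not> card S dvd card ?O" using pos by (simp add: nat_dvd_not_less)
    moreover have "card S dvd card (stab (insert a T)) * card ?O" using insert c by simp
    ultimately show ?case using S(2) prime_dvd_mult_iff by blast
  qed
  then have dv: "card S dvd card (stab S)" using S(1) by blast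
  have fin: "finite (stab S)" using finK by (simp add: stab_def)
  have "(id, id) \<in> stab S" using k by (simp add: stab_def)
  then have "card (stab S) > 0" using fin by (auto simp: card_gt_0_iff)
  then have "card S \<le> card (stab S)" using dv by (simp add: dvd_imp_le)
  moreover have "2 \<le> card S" using S(2) by (rule prime_ge_2_nat)
  moreover note \<open>card S \<le> card (stab S)\<close>
  ultimately have "\<not> stab S \<subseteq> {(id, id)}" using card_mono[of "{(id, id)}" "stab S"] by fastforce
  then obtain h where h: "h \<in> stab S" "h \<noteq> (id, id)" by blast
  have "fst h u = u" for u
  proof (cases "u \<in> S")
    case False
    then show ?thesis using h(1) perm by (simp add: stab_def permutes_def)
  qed (use h(1) in \<open>simp add: stab_def\<close>)
  then have "fst h = id" by auto
  then have "h = (id, snd h)" by (metis prod.collapse)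
  moreover have "h \<in> K" using h(1) by (simp add: stab_def)
  ultimately show ?thesis using h(2) by metis
qed

section \<open>Rigid Latin predicates\<close>

definition act :: "'i \<Rightarrow> ('a \<Rightarrow> 'a) \<Rightarrow> ('i \<Rightarrow> 'a) \<Rightarrow> 'i \<Rightarrow> 'a" where
  "act q \<alpha> x = x(q := \<alpha> (x q))"

lemma act_comp: "act q \<alpha> (act q \<beta> x) = act q (\<alpha> \<circ> \<beta>) x"
  by (simp add: act_def)

lemma act_commute: "q \<noteq> r \<Longrightarrow> act q \<alpha> (act r \<beta> x) = act r \<beta> (act q \<alpha> x)"
  by (simp add: act_def fun_upd_twist)

lemma act_id: "act q id x = x"
  by (simp add: act_def)

lemma act_val: "\<alpha> permutes S \<Longrightarrow> \<forall>k. x k \<in> S \<Longrightarrow> \<forall>k. act q \<alpha> x k \<in> S"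
  by (simp add: act_def permutes_in_image)

lemma act_inv:
  assumes "\<alpha> permutes S" shows "act q \<alpha> (act q (inv \<alpha>) x) = x" "act q (inv \<alpha>) (act q \<alpha> x) = x"
  using permutes_inv_o[OF assms] by (simp_all add: act_comp act_id)

text \<open>\<open>H\<close> will be a retract on \<open>X\<close> with the other values
  substituted, so by \<open>H_cong\<close> it does not see them any more.\<close>

locale latin_pred =
  fixes S :: "'a set" and X :: "'i set" and H :: "('i \<Rightarrow> 'a) \<Rightarrow> bool"
  assumes H_solve: "\<forall>k. x k \<in> S \<Longrightarrow> r \<in> X \<Longrightarrow> \<exists>!c. c \<in> S \<and> H (x(r := c))"
    and H_cong: "(\<And>k. k \<in> X \<Longrightarrow> x k = y k) \<Longrightarrow> H x = H y"
begin

lemma H_unique: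
  assumes "\<forall>k. x k \<in> S" "r \<in> X" "H x" "c \<in> S" "H (x(r := c))"
  shows "c = x r"
  using H_solve[OF assms(1,2)] assms by (metis fun_upd_triv)

lemma H_exists:
  assumes "\<forall>k. x k \<in> S" "r \<in> X" obtains c where "c \<in> S" "H (x(r := c))"
  using H_solve[OF assms] by blast

text \<open>An equation such as \<open>x q + x r + x w = 0\<close> in a group admits the forbidden
  autotopies: shift one coordinate forward and another one back. Rigidity is the opposite
  extreme.\<close>

definition rigid :: bool where
  "rigid \<longleftrightarrow> (\<forall>q \<in> X. \<forall>r \<in> X. \<forall>\<alpha> \<beta>. q \<noteq> r \<longrightarrow> \<alpha> permutes S \<longrightarrow> \<beta> permutes S \<longrightarrow>
     (\<forall>x. (\<forall>k. x k \<in> S) \<longrightarrow> H (act q \<alpha> (act r \<beta> x)) = H x) \<longrightarrow> \<alpha> = id \<and> \<beta> = id)"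

lemma rigid_eq:
  assumes rigid "q \<in> X" "r \<in> X" "q \<noteq> r"
    and p: "\<alpha> permutes S" "\<beta> permutes S" "\<alpha>' permutes S" "\<beta>' permutes S"
    and eq: "\<And>x. \<forall>k. x k \<in> S \<Longrightarrow> H (act q \<alpha> (act r \<beta> x)) = H (act q \<alpha>' (act r \<beta>' x))"
  shows "\<alpha> = \<alpha>'" "\<beta> = \<beta>'"
proof -
  have R: "\<mu> = id \<and> \<nu> = id" if "\<mu> permutes S" "\<nu> permutes S"
    "\<forall>x. (\<forall>k. x k \<in> S) \<longrightarrow> H (act q \<mu> (act r \<nu> x)) = H x" for \<mu> \<nu>
    using assms(1-4) that unfolding rigid_def by blast
  have "\<alpha> \<circ> inv \<alpha>' = id \<and> \<beta> \<circ> inv \<beta>' = id"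
  proof (rule R, goal_cases)
    case 1 show ?case using p by (auto intro: permutes_compose permutes_inv)
  next
    case 2 show ?case using p by (auto intro: permutes_compose permutes_inv)
  next
    case 3 show ?case
    proof (intro allI impI)
    fix x :: "'i \<Rightarrow> 'a" assume x: "\<forall>k. x k \<in> S"
    let ?y = "act q (inv \<alpha>') (act r (inv \<beta>') x)"
    have y: "\<forall>k. ?y k \<in> S" using x p by (intro act_val permutes_inv) auto
    have "act q \<alpha>' (act r \<beta>' ?y) = x"
      using assms(4) by (simp add: act_commute[of r q] act_inv(1)[OF p(3)] act_inv(1)[OF p(4)])
    moreover have "act q \<alpha> (act r \<beta> ?y) = act q (\<alpha> \<circ> inv \<alpha>') (act r (\<beta> \<circ> inv \<beta>') x)"
      using assms(4) by (simp add: act_commute[of r q] act_comp[symmetric])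
    ultimately show "H (act q (\<alpha> \<circ> inv \<alpha>') (act r (\<beta> \<circ> inv \<beta>') x)) = H x" using eq[OF y] by (simp only:)
    qed
  qed
  then show "\<alpha> = \<alpha>'" "\<beta> = \<beta>'" using permutes_inv_o[OF p(3)] permutes_inv_o[OF p(4)]
    by (metis comp_assoc comp_id id_comp)+
qed

lemma rigid_eq1:
  assumes rigid "q \<in> X" "r \<in> X" "q \<noteq> r" "\<alpha> permutes S" "\<beta> permutes S"
    and eq: "\<And>x. \<forall>k. x k \<in> S \<Longrightarrow> H (act q \<alpha> x) = H (act r \<beta> x)"
  shows "\<alpha> = id" "\<beta> = id"
proof -
  have "H (act q \<alpha> (act r id x)) = H (act q id (act r \<beta> x))" if "\<forall>k. x k \<in> S" for x
    using eq[OF that] by (simp add: act_id)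
  from rigid_eq[OF assms(1-4) assms(5) permutes_id permutes_id assms(6) this]
  show "\<alpha> = id" "\<beta> = id" by auto
qed

text \<open>If a power of \<alpha> fixes \<open>a\<close>, put \<open>a\<close> at \<open>q\<close>
  and any \<open>v\<close> at \<open>r\<close>, and solve for a third coordinate \<open>w\<close>.
  The power of the autotopy now moves only \<open>r\<close>, so it must fix \<open>v\<close>. Hence
  the powers are semiregular, and the prime order makes them transitive.\<close>

lemma two_autotopy_transitive:
  assumes S: "finite S" "prime (card S)" and q: "q \<in> X" "r \<in> X" "w \<in> X" "q \<noteq> r" "w \<noteq> q" "w \<noteq> r"
    and p: "\<alpha> permutes S" "\<beta> permutes S" "\<alpha> \<noteq> id \<or> \<beta> \<noteq> id"
    and inv: "\<And>x. \<forall>k. x k \<in> S \<Longrightarrow> H (act q \<alpha> (act r \<beta> x)) = H x"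
    and uv: "u \<in> S" "v \<in> S"
  shows "\<exists>k. (\<alpha> ^^ k) u = v" and "\<alpha> \<noteq> id"
    and "\<And>k x. \<forall>k. x k \<in> S \<Longrightarrow> H (act q (\<alpha> ^^ k) (act r (\<beta> ^^ k) x)) = H x"
proof -
  have pa: "(\<alpha> ^^ k) permutes S" "(\<beta> ^^ k) permutes S" for k using p funpow_permutes by auto
  show pow: "H (act q (\<alpha> ^^ k) (act r (\<beta> ^^ k) x)) = H x" if x: "\<forall>k. x k \<in> S" for k x
  proof (induction k)
    case 0 then show ?case by (simp add: act_id[unfolded id_def] id_def)
  next
    case (Suc k)
    let ?y = "act q (\<alpha> ^^ k) (act r (\<beta> ^^ k) x)"
    have "\<forall>k. ?y k \<in> S" using x pa by (intro act_val) auto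
    then have "H (act q \<alpha> (act r \<beta> ?y)) = H ?y" by (rule inv)
    moreover have "act q \<alpha> (act r \<beta> ?y) = act q (\<alpha> ^^ Suc k) (act r (\<beta> ^^ Suc k) x)"
      using q(4) by (simp add: act_commute[of r q] act_comp)
    ultimately show ?case using Suc.IH by (simp only:)
  qed
  have fixes_all: "\<beta>' = id"
    if h: "q' \<in> X" "r' \<in> X" "q' \<noteq> r'" "w \<noteq> q'" "w \<noteq> r'" "\<beta>' permutes S" "a \<in> S" "\<alpha>' a = a"
      "\<And>x. \<forall>k. x k \<in> S \<Longrightarrow> H (act q' \<alpha>' (act r' \<beta>' x)) = H x" for q' r' \<alpha>' \<beta>' a
  proof
    fix v show "\<beta>' v = id v"
    proof (cases "v \<in> S")
      case True
      let ?x = "\<lambda>k. if k = q' then a else v"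
      have xv: "\<forall>k. ?x k \<in> S" using True h(7) by simp
      obtain c where c: "c \<in> S" "H (?x(w := c))" by (rule H_exists[OF xv q(3)])
      let ?y = "?x(w := c)"
      have y: "\<forall>k. ?y k \<in> S" using True h(7) c(1) by simp
      have "act q' \<alpha>' (act r' \<beta>' ?y) = ?y(r' := \<beta>' v)" using h(3,4,5,8) by (auto simp: act_def fun_eq_iff)
      moreover have "H (act q' \<alpha>' (act r' \<beta>' ?y))" using h(9)[OF y] c(2) by blast
      ultimately have "H (?y(r' := \<beta>' v))" by (simp only:)
      moreover have "\<beta>' v \<in> S" using True h(6) permutes_in_image by metis
      ultimately have "\<beta>' v = ?y r'" using H_unique[OF y h(2) c(2)] by blast
      then show ?thesis using h(3,5) by simp
    qed (use h(6) in \<open>simp add: permutes_def\<close>)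
  qed
  have semi: "\<alpha> ^^ k = id" if "a \<in> S" "(\<alpha> ^^ k) a = a" for k a
  proof -
    have "\<beta> ^^ k = id" by (rule fixes_all[OF q(1,2,4,5,6) pa(2) that pow])
    then have "H (act r (\<beta> ^^ k) (act q (\<alpha> ^^ k) x)) = H x" if "\<forall>k. x k \<in> S" for x
      using pow[OF that, of k] q(4) by (simp add: act_commute[of r q])
    from fixes_all[OF q(2,1) _ q(6,5) pa(1) that(1) _ this] show ?thesis
      using \<open>\<beta> ^^ k = id\<close> q(4) by auto
  qed
  show ne: "\<alpha> \<noteq> id"
  proof
    assume a: "\<alpha> = id"
    have "\<beta> = id" by (rule fixes_all[OF q(1,2,4,5,6) p(2) uv(1) _ inv]) (use a in simp)
    then show False using a p(3) by blast
  qed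
  show "\<exists>k. (\<alpha> ^^ k) u = v"
    by (rule semiregular_prime_transitive[OF p(1) S ne semi uv])
qed

end

context latin_pred
begin

lemma rigid_transfer:
  assumes rigid "q \<in> X" "\<sigma> permutes S" and H': "latin_pred S X H'"
    and eq: "\<And>x. \<forall>k. x k \<in> S \<Longrightarrow> H' x = H (act q \<sigma> x)"
  shows "latin_pred.rigid S X H'"
  unfolding latin_pred.rigid_def[OF H']
proof (intro ballI allI impI)
  fix q' r \<alpha> \<beta> assume h: "q' \<in> X" "r \<in> X" "q' \<noteq> r" "\<alpha> permutes S" "\<beta> permutes S"
    and inv': "\<forall>x. (\<forall>k. x k \<in> S) \<longrightarrow> H' (act q' \<alpha> (act r \<beta> x)) = H' x"
  have e: "H (act q \<sigma> (act q' \<alpha> (act r \<beta> x))) = H (act q \<sigma> x)" if x: "\<forall>k. x k \<in> S" for x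
  proof -
    have "\<forall>k. act q' \<alpha> (act r \<beta> x) k \<in> S" by (intro act_val h x)
    from eq[OF this] eq[OF x] inv' x show ?thesis by metis
  qed
  have pid: "\<sigma> \<circ> \<alpha> permutes S" "\<sigma> \<circ> \<beta> permutes S" "id permutes S"
    using assms(3) h permutes_compose permutes_id by auto
  consider "q' = q" | "r = q" | "q' \<noteq> q" "r \<noteq> q" by blast
  then show "\<alpha> = id \<and> \<beta> = id"
  proof cases
    case 1
    have "H (act q (\<sigma> \<circ> \<alpha>) (act r \<beta> x)) = H (act q \<sigma> (act r id x))" if "\<forall>k. x k \<in> S" for x
      using e[OF that] 1 by (simp add: act_comp act_id)
    from rigid_eq[OF assms(1) assms(2) h(2) _ pid(1) h(5) assms(3) pid(3) this] 1 h(3)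
    have a: "\<sigma> \<circ> \<alpha> = \<sigma>" and "\<beta> = id" by auto
    have "inv \<sigma> \<circ> (\<sigma> \<circ> \<alpha>) = inv \<sigma> \<circ> \<sigma>" using a by simp
    then show ?thesis using \<open>\<beta> = id\<close> permutes_inv_o[OF assms(3)] by (simp add: comp_assoc[symmetric])
  next
    case 2
    have "H (act q (\<sigma> \<circ> \<beta>) (act q' \<alpha> x)) = H (act q \<sigma> (act q' id x))" if "\<forall>k. x k \<in> S" for x
      using e[OF that] 2 h(3) by (simp add: act_comp act_id act_commute[of q' q])
    from rigid_eq[OF assms(1) assms(2) h(1) _ pid(2) h(4) assms(3) pid(3) this] 2 h(3)
    have a: "\<sigma> \<circ> \<beta> = \<sigma>" and "\<alpha> = id" by auto
    have "inv \<sigma> \<circ> (\<sigma> \<circ> \<beta>) = inv \<sigma> \<circ> \<sigma>" using a by simp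
    then show ?thesis using \<open>\<alpha> = id\<close> permutes_inv_o[OF assms(3)] by (simp add: comp_assoc[symmetric])
  next
    case 3
    have "H (act q' \<alpha> (act r \<beta> x)) = H (act q' id (act r id x))" if x: "\<forall>k. x k \<in> S" for x
    proof -
      let ?y = "act q (inv \<sigma>) x"
      have y: "\<forall>k. ?y k \<in> S" by (intro act_val permutes_inv assms(3) x)
      have "act q \<sigma> (act q' \<alpha> (act r \<beta> ?y)) = act q' \<alpha> (act r \<beta> (act q \<sigma> ?y))"
        using 3 by (simp add: act_commute[of q q'] act_commute[of q r])
      then show ?thesis using e[OF y] by (simp only: act_inv(1)[OF assms(3)] act_id)
    qed
    from rigid_eq[OF assms(1) h(1-5) pid(3) pid(3) this] show ?thesis by blast
  qed
qed

text \<open>Latin squares of order two or three are cyclic. The map \<delta> from column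
  \<open>v0\<close> to column \<open>v1\<close> has no fixed symbol, and with at most three symbols
  it permutes the columns. With this permutation of the columns it forms an autotopy that moves two
  coordinates.\<close>

lemma rigid_card:
  assumes rigid and fin: "finite S" and S2: "2 \<le> card S" and X: "X = {p, q, r}" "distinct [p, q, r]"
  shows "4 \<le> card S"
proof (rule ccontr)
  assume "\<not> 4 \<le> card S"
  then have c3: "card S \<le> 3" by linarith
  define pt where "pt u v w = (\<lambda>k. if k = p then u else if k = q then v else w)" for u v w :: 'a
  have pt: "\<forall>k. pt u v w k \<in> S" if "u \<in> S" "v \<in> S" "w \<in> S" for u v w using that by (simp add: pt_def)
  have upd: "(pt u v w)(p := u') = pt u' v w" "(pt u v w)(q := v') = pt u v' w" for u v w u' v'
    using X(2) by (auto simp: pt_def)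
  have updr: "H ((pt u v w)(r := w')) = H (pt u v w')" for u v w w'
    by (rule H_cong) (use X in \<open>auto simp: pt_def\<close>)
  have ex: "\<exists>!w. w \<in> S \<and> H (pt u v w)" if "u \<in> S" "v \<in> S" for u v
    using H_solve[OF pt[OF that that(1)], of r] X by (simp add: updr)
  define f where "f u v = (THE w. w \<in> S \<and> H (pt u v w))" for u v
  have f: "f u v \<in> S" "H (pt u v (f u v))" if "u \<in> S" "v \<in> S" for u v
    using theI'[OF ex[OF that]] by (auto simp: f_def)
  have f_eq: "H (pt u v w) \<longleftrightarrow> w = f u v" if "u \<in> S" "v \<in> S" "w \<in> S" for u v w
    using ex[OF that(1,2)] f[OF that(1,2)] that(3) by blast
  have f_v: "v = v'" if "u \<in> S" "v \<in> S" "v' \<in> S" "f u v = f u v'" for u v v'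
  proof -
    have "v' = pt u v (f u v) q"
      by (rule H_unique[OF pt[OF that(1,2) f(1)[OF that(1,2)]] _ f(2)[OF that(1,2)] that(3)])
        (use f(2)[OF that(1,3)] that(4) X upd in auto)
    then show ?thesis using X by (simp add: pt_def split: if_splits)
  qed
  have f_u: "u = u'" if "u \<in> S" "u' \<in> S" "v \<in> S" "f u v = f u' v" for u u' v
  proof -
    have "u' = pt u v (f u v) p"
      by (rule H_unique[OF pt[OF that(1,3) f(1)[OF that(1,3)]] _ f(2)[OF that(1,3)] that(2)])
        (use f(2)[OF that(2,3)] that(4) X upd in auto)
    then show ?thesis by (simp add: pt_def)
  qed
  have f_w: "\<exists>u \<in> S. f u v = w" if vw: "v \<in> S" "w \<in> S" for v w
  proof -
    have "p \<in> X" using X by simp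
    then obtain u where "u \<in> S" "H ((pt v v w)(p := u))" by (rule H_exists[OF pt[OF vw(1,1,2)]])
    then show ?thesis using f_eq[of u v w] vw by (auto simp: upd)
  qed
  obtain v0 v1 where v01: "v0 \<in> S" "v1 \<in> S" "v0 \<noteq> v1"
  proof -
    have "\<not> card S \<le> 1" using S2 by simp
    then show thesis using that fin by (metis card_le_Suc0_iff_eq One_nat_def)
  qed
  define \<delta> where "\<delta> w = (if w \<in> S then f (SOME u. u \<in> S \<and> f u v0 = w) v1 else w)" for w
  have d: "\<delta> (f u v0) = f u v1" if u: "u \<in> S" for u
  proof -
    have "(SOME u'. u' \<in> S \<and> f u' v0 = f u v0) = u"
      by (rule some_equality) (use u f_u v01 in auto)
    then show ?thesis using f(1)[OF u v01(1)] by (simp add: \<delta>_def)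
  qed
  have dS: "\<delta> w \<in> S" "\<delta> w \<noteq> w" if w: "w \<in> S" for w
  proof -
    obtain u where u: "u \<in> S" "f u v0 = w" using f_w[OF v01(1) w] by blast
    show "\<delta> w \<in> S" using d[OF u(1)] f(1)[OF u(1) v01(2)] u(2) by simp
    show "\<delta> w \<noteq> w" using d[OF u(1)] f_v[OF u(1) v01(1,2)] u(2) v01(3) by auto
  qed
  have dinj: "inj_on \<delta> S"
  proof (rule inj_onI)
    fix w w' assume w: "w \<in> S" "w' \<in> S" "\<delta> w = \<delta> w'"
    obtain u where u: "u \<in> S" "f u v0 = w" using f_w[OF v01(1) w(1)] by blast
    obtain u' where u': "u' \<in> S" "f u' v0 = w'" using f_w[OF v01(1) w(2)] by blast
    have "f u v1 = f u' v1" using w(3) d[OF u(1)] d[OF u'(1)] u(2) u'(2) by simp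
    then show "w = w'" using f_u[OF u(1) u'(1) v01(2)] u u' by simp
  qed
  have dperm: "\<delta> permutes S"
  proof (rule bij_imp_permutes)
    show "bij_betw \<delta> S S" using dinj dS(1) fin by (simp add: bij_betw_def endo_inj_surj image_subset_iff)
  qed (simp add: \<delta>_def)
  have sub3: "S = {a, b, c}" if "a \<in> S" "b \<in> S" "c \<in> S" "distinct [a, b, c]" for a b c
    using card_seteq[OF fin, of "{a, b, c}"] that c3 by simp
  have "\<exists>v' \<in> S. \<forall>u \<in> S. f u v' = \<delta> (f u v)" if v: "v \<in> S" for v
  proof (cases "\<exists>v2 \<in> S. v2 \<noteq> v0 \<and> v2 \<noteq> v1")
    case True
    then obtain v2 where v2: "v2 \<in> S" "v2 \<noteq> v0" "v2 \<noteq> v1" by blast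
    have Sv: "S = {v0, v1, v2}" using sub3 v01 v2 by auto
    \<comment> \<open>Row \<open>u\<close> contains three different symbols. As \<delta> is
      injective without fixed points, it must run through them as a cycle.\<close>
    have three: "f u v2 = \<delta> (\<delta> (f u v0)) \<and> \<delta> (f u v2) = f u v0" if u: "u \<in> S" for u
    proof -
      let ?w = "f u v0"
      have m: "?w \<in> S" "\<delta> ?w \<in> S" "f u v2 \<in> S" "\<delta> (\<delta> ?w) \<in> S" "\<delta> (f u v2) \<in> S" using f u v01 v2 dS by auto
      have ne: "?w \<noteq> \<delta> ?w" "f u v2 \<noteq> ?w" "f u v2 \<noteq> \<delta> ?w"
      proof -
        show "?w \<noteq> \<delta> ?w" using dS(2)[OF m(1)] by simp
        show "f u v2 \<noteq> ?w" using f_v[OF u v2(1) v01(1)] v2(2) by blast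
        show "f u v2 \<noteq> \<delta> ?w" unfolding d[OF u] using f_v[OF u v2(1) v01(2)] v2(3) by blast
      qed
      have Sw: "S = {?w, \<delta> ?w, f u v2}" by (rule sub3[OF m(1-3)]) (use ne in simp)
      have n1: "\<delta> (f u v2) \<noteq> f u v2" by (rule dS(2)[OF m(3)])
      have n2: "\<delta> (f u v2) \<noteq> \<delta> ?w" unfolding inj_on_eq_iff[OF dinj m(3,1)] by (rule ne(2))
      have a: "\<delta> (f u v2) = ?w" using Sw m(5) n1 n2 by blast
      have n3: "\<delta> (\<delta> ?w) \<noteq> \<delta> ?w" by (rule dS(2)[OF m(2)])
      have n4: "\<delta> (\<delta> ?w) \<noteq> \<delta> (f u v2)" unfolding inj_on_eq_iff[OF dinj m(2,3)] using ne(3) by simp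
      have "\<delta> (\<delta> ?w) = f u v2"
        using equalityD1[OF Sw, THEN subsetD, OF m(4)] n3 n4[unfolded a] by simp
      then show ?thesis using a by simp
    qed
    have "v = v0 \<or> v = v1 \<or> v = v2" using v Sv by blast
    then show ?thesis
    proof (elim disjE)
      assume "v = v0" then show ?thesis using d v01 by (intro bexI[of _ v1]) simp_all
    next
      assume "v = v1" then show ?thesis using d three v2 by (intro bexI[of _ v2]) simp_all
    next
      assume "v = v2" moreover have "\<forall>u \<in> S. f u v0 = \<delta> (f u v2)" using three by metis
      ultimately show ?thesis using v01(1) by blast
    qed
  next
    case False
    then have Sv: "S = {v0, v1}" using v01 by blast
    then have c2: "card S = 2" using v01 by simp
    have "\<delta> (\<delta> w) = w" if w: "w \<in> S" for w
    proof -
      have "S = {w, \<delta> w}" using card_seteq[OF fin, of "{w, \<delta> w}"] w dS[OF w] c2 by auto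
      from equalityD1[OF this, THEN subsetD, OF dS(1)[OF dS(1)[OF w]]] show ?thesis
        using dS(2)[OF dS(1)[OF w]] by simp
    qed
    then have two: "\<delta> (f u v1) = f u v0" if "u \<in> S" for u using d[OF that] f(1)[OF that v01(1)] by metis
    have "v = v0 \<or> v = v1" using v Sv by blast
    then show ?thesis
    proof
      assume "v = v0" then show ?thesis using d v01 by (intro bexI[of _ v1]) simp_all
    next
      assume "v = v1" then show ?thesis using two v01 by (intro bexI[of _ v0]) simp_all
    qed
  qed
  then have "\<forall>v \<in> S. \<exists>v'. v' \<in> S \<and> (\<forall>u \<in> S. f u v' = \<delta> (f u v))" by blast
  from bchoice[OF this] obtain g where g: "\<And>v. v \<in> S \<Longrightarrow> g v \<in> S \<and> (\<forall>u \<in> S. f u (g v) = \<delta> (f u v))" by blast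
  define \<alpha> where "\<alpha> v = (if v \<in> S then g v else v)" for v
  have aS: "\<alpha> v \<in> S" "f u (\<alpha> v) = \<delta> (f u v)" if "v \<in> S" "u \<in> S" for u v using g[OF that(1)] that by (auto simp: \<alpha>_def)
  have "inj_on \<alpha> S"
  proof (rule inj_onI)
    fix v v' assume v: "v \<in> S" "v' \<in> S" "\<alpha> v = \<alpha> v'"
    then have "\<delta> (f v v) = \<delta> (f v v')" using aS(2)[of v v] aS(2)[of v' v] by simp
    then have "f v v = f v v'" unfolding inj_on_eq_iff[OF dinj f(1)[OF v(1,1)] f(1)[OF v(1,2)]] .
    then show "v = v'" by (rule f_v[OF v(1,1,2)])
  qed
  moreover have "\<alpha> ` S \<subseteq> S" using g by (auto simp: \<alpha>_def)
  ultimately have "bij_betw \<alpha> S S" using fin by (simp add: bij_betw_def endo_inj_surj)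
  then have aperm: "\<alpha> permutes S" by (rule bij_imp_permutes) (simp add: \<alpha>_def)
  have "H (act q \<alpha> (act r \<delta> x)) = H x" if x: "\<forall>k. x k \<in> S" for x
  proof -
    have xS: "x p \<in> S" "x q \<in> S" "x r \<in> S" using x by auto
    have "H x = H (pt (x p) (x q) (x r))" by (rule H_cong) (use X in \<open>auto simp: pt_def\<close>)
    moreover have "H (act q \<alpha> (act r \<delta> x)) = H (pt (x p) (\<alpha> (x q)) (\<delta> (x r)))"
      by (rule H_cong) (use X in \<open>auto simp: pt_def act_def\<close>)
    moreover have "H (pt (x p) (\<alpha> (x q)) (\<delta> (x r))) \<longleftrightarrow> \<delta> (x r) = \<delta> (f (x p) (x q))"
      using f_eq[OF xS(1) aS(1)[OF xS(2,1)] dS(1)[OF xS(3)]] aS(2)[OF xS(2,1)] by simp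
    moreover have "\<delta> (x r) = \<delta> (f (x p) (x q)) \<longleftrightarrow> x r = f (x p) (x q)"
      by (rule inj_on_eq_iff[OF dinj xS(3) f(1)[OF xS(1,2)]])
    ultimately show ?thesis using f_eq[OF xS] by simp
  qed
  then have "\<forall>x. (\<forall>k. x k \<in> S) \<longrightarrow> H (act q \<alpha> (act r \<delta> x)) = H x" by blast
  moreover have "q \<in> X" "r \<in> X" "q \<noteq> r" using X by auto
  ultimately have "\<delta> = id" using assms(1) aperm dperm unfolding rigid_def by blast
  then show False using dS(2)[OF v01(1)] by simp
qed

end

section \<open>Tables of rigid retracts\<close>

text \<open>\<open>G a b\<close> will be the retract on \<open>X\<close> with \<open>i\<close> fixed
  at \<open>a\<close> and \<open>j\<close> at \<open>b\<close>. In row \<open>b\<close> the value of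
  \<open>i\<close> acts only at the twin \<open>s b\<close>, by the permutations \<sigma>; in column
  \<open>a\<close> the value of \<open>j\<close> acts only at \<open>t a\<close>, by \<tau>. The
  twins may change from row to row and from column to column.\<close>

locale table =
  fixes S :: "'a set" and X :: "'i set" and G :: "'a \<Rightarrow> 'a \<Rightarrow> ('i \<Rightarrow> 'a) \<Rightarrow> bool"
    and s :: "'a \<Rightarrow> 'i" and t :: "'a \<Rightarrow> 'i"
    and \<sigma> :: "'a \<Rightarrow> 'a \<Rightarrow> 'a \<Rightarrow> 'a \<Rightarrow> 'a" and \<tau> :: "'a \<Rightarrow> 'a \<Rightarrow> 'a \<Rightarrow> 'a \<Rightarrow> 'a"
  assumes finite_S: "finite S" and S2: "2 \<le> card S"
    and G_latin: "\<And>a b. a \<in> S \<Longrightarrow> b \<in> S \<Longrightarrow> latin_pred S X (G a b)"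
    and G_inj1: "\<And>a a' b x. \<forall>k. x k \<in> S \<Longrightarrow> a \<in> S \<Longrightarrow> a' \<in> S \<Longrightarrow> b \<in> S \<Longrightarrow> G a b x \<Longrightarrow> G a' b x \<Longrightarrow> a = a'"
    and G_inj2: "\<And>a b b' x. \<forall>k. x k \<in> S \<Longrightarrow> a \<in> S \<Longrightarrow> b \<in> S \<Longrightarrow> b' \<in> S \<Longrightarrow> G a b x \<Longrightarrow> G a b' x \<Longrightarrow> b = b'"
    and s_in: "\<And>b. b \<in> S \<Longrightarrow> s b \<in> X" and t_in: "\<And>a. a \<in> S \<Longrightarrow> t a \<in> X"
    and \<sigma>_perm: "\<And>a a' b. a \<in> S \<Longrightarrow> a' \<in> S \<Longrightarrow> b \<in> S \<Longrightarrow> \<sigma> b a a' permutes S"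
    and \<tau>_perm: "\<And>a b b'. a \<in> S \<Longrightarrow> b \<in> S \<Longrightarrow> b' \<in> S \<Longrightarrow> \<tau> a b b' permutes S"
    and row: "\<And>a a' b x. \<forall>k. x k \<in> S \<Longrightarrow> a \<in> S \<Longrightarrow> a' \<in> S \<Longrightarrow> b \<in> S \<Longrightarrow> G a' b x = G a b (act (s b) (\<sigma> b a a') x)"
    and col: "\<And>a b b' x. \<forall>k. x k \<in> S \<Longrightarrow> a \<in> S \<Longrightarrow> b \<in> S \<Longrightarrow> b' \<in> S \<Longrightarrow> G a b' x = G a b (act (t a) (\<tau> a b b') x)"
    and other: "\<And>q. \<exists>r \<in> X. r \<noteq> q"
begin

lemma transposed: "table S X (\<lambda>a b. G b a) t s \<tau> \<sigma>"
proof (rule table.intro, goal_cases)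
  case (4 a a' b x)
  then show ?case using G_inj2[of x b a a'] by simp
next
  case (5 a b b' x)
  then show ?case using G_inj1[of x b b' a] by simp
next
  case (10 a a' b x)
  then show ?case by (intro col)
next
  case (11 a b b' x)
  then show ?case by (intro row)
qed (use finite_S S2 G_latin s_in t_in \<sigma>_perm \<tau>_perm other in simp_all)

text \<open>Distinct values of \<open>i\<close> give disjoint predicates, hence distinct images of
  \<open>u\<close>. So for fixed \<open>a\<close> and \<open>b\<close> the permutations
  \<open>\<sigma> b a a'\<close> form a Latin square.\<close>

lemma row_bij:
  assumes "a \<in> S" "b \<in> S" "u \<in> S"
  shows "bij_betw (\<lambda>a'. \<sigma> b a a' u) S S"
proof -
  interpret latin_pred S X "G a b" using G_latin assms by blast
  have "inj_on (\<lambda>a'. \<sigma> b a a' u) S"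
  proof (rule inj_onI)
    fix a1 a2 assume a: "a1 \<in> S" "a2 \<in> S" "\<sigma> b a a1 u = \<sigma> b a a2 u"
    obtain r where r: "r \<in> X" "r \<noteq> s b" using other by blast
    let ?y = "\<lambda>k. if k = s b then \<sigma> b a a1 u else u"
    have y: "\<forall>k. ?y k \<in> S" using \<sigma>_perm[OF assms(1) a(1) assms(2)] assms(3) by (simp add: permutes_in_image)
    obtain c where c: "c \<in> S" "G a b (?y(r := c))" by (rule H_exists[OF y r(1)])
    let ?x = "?y(r := c, s b := u)"
    have x: "\<forall>k. ?x k \<in> S" using y c(1) assms(3) by simp
    have e: "act (s b) (\<sigma> b a a1) ?x = ?y(r := c)" "act (s b) (\<sigma> b a a2) ?x = ?y(r := c)"
      using r(2) a(3) by (auto simp: act_def)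
    have "G a1 b ?x" using row[OF x assms(1) a(1) assms(2)] c(2) unfolding e by (rule iffD2)
    moreover have "G a2 b ?x" using row[OF x assms(1) a(2) assms(2)] c(2) unfolding e by (rule iffD2)
    ultimately show "a1 = a2" using G_inj1[OF x a(1,2) assms(2)] by blast
  qed
  moreover have "(\<lambda>a'. \<sigma> b a a' u) ` S \<subseteq> S"
    using \<sigma>_perm[OF assms(1) _ assms(2)] assms(3) by (auto simp: permutes_in_image)
  ultimately show ?thesis using finite_S by (simp add: bij_betw_def endo_inj_surj)
qed

lemma \<sigma>_self:
  assumes "a \<in> S" "b \<in> S" shows "\<sigma> b a a = id"
proof
  interpret latin_pred S X "G a b" using G_latin assms by blast
  fix u show "\<sigma> b a a u = id u"
  proof (cases "u \<in> S")
    case True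
    obtain r where r: "r \<in> X" "r \<noteq> s b" using other by blast
    obtain c where c: "c \<in> S" "G a b ((\<lambda>_. u)(r := c))" by (rule H_exists[OF _ r(1), of "\<lambda>_. u"]) (use True in simp)
    let ?x = "(\<lambda>_. u)(r := c)"
    have x: "\<forall>k. ?x k \<in> S" using True c by simp
    have "G a b (act (s b) (\<sigma> b a a) ?x)" by (rule iffD1[OF row[OF x assms(1,1,2)] c(2)])
    moreover have "act (s b) (\<sigma> b a a) ?x = ?x(s b := \<sigma> b a a u)" using r by (simp add: act_def)
    moreover have "\<sigma> b a a u \<in> S" using \<sigma>_perm[OF assms(1,1,2)] True by (simp add: permutes_in_image)
    ultimately have "\<sigma> b a a u = ?x (s b)" using H_unique[OF x s_in[OF assms(2)] c(2)] by simp
    then show ?thesis using r by simp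
  qed (use \<sigma>_perm[OF assms(1,1,2)] in \<open>simp add: permutes_def\<close>)
qed

lemma \<sigma>_id:
  assumes "a \<in> S" "a' \<in> S" "b \<in> S" "\<sigma> b a a' = id" shows "a = a'"
  using row_bij[OF assms(1,3,1)] \<sigma>_self[OF assms(1,3)] assms unfolding bij_betw_def inj_on_def by auto

lemma \<tau>_id:
  assumes "a \<in> S" "b \<in> S" "b' \<in> S" "\<tau> a b b' = id" shows "b = b'"
  using table.\<sigma>_id[OF transposed] assms by blast

lemma col_bij:
  assumes "a \<in> S" "b \<in> S" "u \<in> S"
  shows "bij_betw (\<lambda>b'. \<tau> a b b' u) S S"
  using table.row_bij[OF transposed] assms by blast

text \<open>There are two ways around the rectangle with corners \<open>(a, b)\<close> and
  \<open>(a', b')\<close>. Comparing them is how rigidity is exploited below.\<close>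

lemma rect:
  assumes "\<forall>k. x k \<in> S" "a \<in> S" "a' \<in> S" "b \<in> S" "b' \<in> S"
  shows "G a b (act (t a) (\<tau> a b b') (act (s b') (\<sigma> b' a a') x)) =
         G a b (act (s b) (\<sigma> b a a') (act (t a') (\<tau> a' b b') x))"
proof -
  have 1: "\<forall>k. act (s b') (\<sigma> b' a a') x k \<in> S" by (rule act_val[OF \<sigma>_perm assms(1)]) (use assms in auto)
  have 2: "\<forall>k. act (t a') (\<tau> a' b b') x k \<in> S" by (rule act_val[OF \<tau>_perm assms(1)]) (use assms in auto)
  have "G a' b' x = G a b (act (t a) (\<tau> a b b') (act (s b') (\<sigma> b' a a') x))"
    using row[OF assms(1,2,3,5)] col[OF 1 assms(2,4,5)] by simp
  moreover have "G a' b' x = G a b (act (s b) (\<sigma> b a a') (act (t a') (\<tau> a' b b') x))"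
    using col[OF assms(1,3,4,5)] row[OF 2 assms(2,3,4)] by simp
  ultimately show ?thesis by simp
qed

end

locale rigid_table = table +
  assumes G_rigid: "\<And>a b. a \<in> S \<Longrightarrow> b \<in> S \<Longrightarrow> latin_pred.rigid S X (G a b)"
begin

lemma rigid_transposed: "rigid_table S X (\<lambda>a b. G b a) t s \<tau> \<sigma>"
  using transposed G_rigid by (simp add: rigid_table_def rigid_table_axioms_def)

text \<open>Both ways around the rectangle move the same two coordinates, so rigidity equates the
  permutations at each of them.\<close>

lemma \<sigma>_const:
  assumes ab: "a \<in> S" "a' \<in> S" "b \<in> S" "b' \<in> S" and st: "s b = s b'" "t a = t a'" "s b \<noteq> t a"
  shows "\<sigma> b' a a' = \<sigma> b a a'"
proof -
  interpret latin_pred S X "G a b" using G_latin ab by blast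
  have "G a b (act (t a) (\<tau> a b b') (act (s b) (\<sigma> b' a a') x)) = G a b (act (t a) (\<tau> a' b b') (act (s b) (\<sigma> b a a') x))"
    if "\<forall>k. x k \<in> S" for x
    using rect[OF that ab] st by (simp add: act_commute[of "t a'" "s b'"])
  from rigid_eq(2)[OF G_rigid[OF ab(1,3)] t_in[OF ab(1)] s_in[OF ab(3)] _ \<tau>_perm \<sigma>_perm \<tau>_perm \<sigma>_perm this]
  show ?thesis using ab st by metis
qed

text \<open>One way around the rectangle moves only \<open>s b\<close>, the other one moves
  \<open>t a'\<close> as well. Rigidity makes this extra move trivial, against
  \<open>b \<noteq> b'\<close>.\<close>

lemma no_half_turn:
  assumes ab: "a \<in> S" "a' \<in> S" "b \<in> S" "b' \<in> S" "b \<noteq> b'" and st: "s b = s b'" "t a = s b" "t a' \<noteq> s b"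
  shows False
proof -
  interpret latin_pred S X "G a b" using G_latin ab by blast
  have e: "G a b (act (t a') id (act (s b) (\<tau> a b b' \<circ> \<sigma> b' a a') x)) = G a b (act (t a') (\<tau> a' b b') (act (s b) (\<sigma> b a a') x))"
    if "\<forall>k. x k \<in> S" for x
    using rect[OF that ab(1-4)] st by (simp add: act_id act_comp act_commute[of "t a'" "s b'"])
  have c: "\<tau> a b b' \<circ> \<sigma> b' a a' permutes S" using \<sigma>_perm \<tau>_perm ab by (intro permutes_compose) auto
  have "id = \<tau> a' b b'"
    by (rule rigid_eq(1)[OF G_rigid[OF ab(1,3)] t_in[OF ab(2)] s_in[OF ab(3)] st(3) permutes_id c _ _ e])
      (use \<tau>_perm \<sigma>_perm ab in auto)
  then show False using \<tau>_id[of a' b b'] ab by simp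
qed

text \<open>This is \<open>rect\<close> with the move in row \<open>b\<close> cancelled. What
  remains of the two rows is one permutation at \<open>s b\<close>, which measures how much row
  \<open>b'\<close> deviates from row \<open>b\<close>.\<close>

lemma two_columns:
  assumes ab: "a \<in> S" "a' \<in> S" "b \<in> S" "b' \<in> S" and st: "s b = s b'" "t a \<noteq> s b" "t a' \<noteq> s b"
    and x: "\<forall>k. x k \<in> S"
  shows "G a b (act (t a) (\<tau> a b b') (act (s b) (\<sigma> b' a a' \<circ> inv (\<sigma> b a a')) x)) = G a b (act (t a') (\<tau> a' b b') x)"
proof -
  have p: "\<sigma> b a a' permutes S" using \<sigma>_perm ab by blast
  let ?y = "act (s b) (inv (\<sigma> b a a')) x"
  have y: "\<forall>k. ?y k \<in> S" by (intro act_val permutes_inv p x)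
  have "act (t a) (\<tau> a b b') (act (s b') (\<sigma> b' a a') ?y) = act (t a) (\<tau> a b b') (act (s b) (\<sigma> b' a a' \<circ> inv (\<sigma> b a a')) x)"
    using st by (simp add: act_comp)
  moreover have "act (s b) (\<sigma> b a a') (act (t a') (\<tau> a' b b') ?y) = act (t a') (\<tau> a' b b') x"
  proof -
    have "act (s b) (\<sigma> b a a') (act (t a') (\<tau> a' b b') ?y) = act (t a') (\<tau> a' b b') (act (s b) (\<sigma> b a a') ?y)"
      using st(3) by (simp add: act_commute[of "s b" "t a'"])
    then show ?thesis by (simp only: act_inv(1)[OF p])
  qed
  ultimately show ?thesis using rect[OF y ab] by (simp only:)
qed

end

text \<open>By the rectangle conditions \<open>P\<close> and \<open>Q\<close> depend on the
  coordinates other than \<open>q\<close> through the same classes. For each value \<open>u\<close>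
  at \<open>q\<close>, one context that solves \<open>Q\<close> is chosen, and
  \<open>\<sigma> u\<close> is the value that solves \<open>P\<close> in it.\<close>

lemma twin_perm:
  assumes P: "latin_pred S X P" and Q: "latin_pred S X Q" and fin: "finite S" and o: "c0 \<in> S"
    and q: "q \<in> X" "r \<in> X" "r \<noteq> q"
    and PQ: "\<And>x y. \<forall>k. x k \<in> S \<Longrightarrow> \<forall>k. y k \<in> S \<Longrightarrow> P x \<Longrightarrow> Q y \<Longrightarrow> P (y(q := x q)) \<Longrightarrow> Q (x(q := y q))"
    and QP: "\<And>x y. \<forall>k. x k \<in> S \<Longrightarrow> \<forall>k. y k \<in> S \<Longrightarrow> Q x \<Longrightarrow> P y \<Longrightarrow> Q (y(q := x q)) \<Longrightarrow> P (x(q := y q))"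
  shows "\<exists>\<sigma>. \<sigma> permutes S \<and> (\<forall>x. (\<forall>k. x k \<in> S) \<longrightarrow> Q x = P (act q \<sigma> x))"
proof -
  interpret P: latin_pred S X P by (rule P)
  interpret Q: latin_pred S X Q by (rule Q)
  define p where "p u = (\<lambda>_. c0)(q := u)" for u :: 'a
  have pS: "\<forall>k. p u k \<in> S" if "u \<in> S" for u using that o by (simp add: p_def)
  have "\<exists>c d. c \<in> S \<and> d \<in> S \<and> Q ((p u)(r := c)) \<and> P ((p u)(r := c, q := d))" if u: "u \<in> S" for u
  proof -
    obtain c where c: "c \<in> S" "Q ((p u)(r := c))" by (rule Q.H_exists[OF pS[OF u] q(2)])
    have "\<forall>k. ((p u)(r := c)) k \<in> S" using pS[OF u] c by simp
    then obtain d where "d \<in> S" "P ((p u)(r := c, q := d))" by (rule P.H_exists[OF _ q(1)])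
    then show ?thesis using c by blast
  qed
  then obtain c \<sigma>0 where c: "\<And>u. u \<in> S \<Longrightarrow> c u \<in> S \<and> \<sigma>0 u \<in> S \<and> Q ((p u)(r := c u)) \<and> P ((p u)(r := c u, q := \<sigma>0 u))"
    by metis
  define \<sigma> where "\<sigma> u = (if u \<in> S then \<sigma>0 u else u)" for u
  have eq: "Q x = P (act q \<sigma> x)" if x: "\<forall>k. x k \<in> S" for x
  proof -
    let ?u = "x q"
    have u: "?u \<in> S" using x by blast
    note cu = c[OF u]
    have a: "act q \<sigma> x = x(q := \<sigma>0 ?u)" using u by (simp add: act_def \<sigma>_def)
    define z1 where "z1 = (p ?u)(r := c ?u)"
    define z2 where "z2 = z1(q := \<sigma>0 ?u)"
    have z: "Q z1" "P z2" using cu by (auto simp: z1_def z2_def)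
    have zS: "\<forall>k. z1 k \<in> S" using pS[OF u] cu by (simp add: z1_def)
    then have zS2: "\<forall>k. z2 k \<in> S" using cu by (simp add: z2_def)
    have zq: "z1 q = x q" "z2 q = \<sigma>0 ?u" using q(3) by (simp_all add: z1_def z2_def p_def)
    then have e: "z2(q := x q) = z1" by (auto simp: z2_def fun_eq_iff)
    have x2: "\<forall>k. (x(q := \<sigma>0 ?u)) k \<in> S" using x cu by simp
    show ?thesis unfolding a
    proof
      assume h: "Q x"
      have "P (x(q := z2 q))" by (rule QP[OF x zS2 h z(2)]) (simp only: e z)
      then show "P (x(q := \<sigma>0 ?u))" by (simp only: zq)
    next
      assume h: "P (x(q := \<sigma>0 ?u))"
      have "z1(q := (x(q := \<sigma>0 ?u)) q) = z2" by (simp add: z2_def)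
      then have "P (z1(q := (x(q := \<sigma>0 ?u)) q))" using z(2) by (simp only:)
      from PQ[OF x2 zS h z(1) this] have "Q ((x(q := \<sigma>0 ?u))(q := z1 q))" .
      moreover have "(x(q := \<sigma>0 ?u))(q := z1 q) = x" using zq by simp
      ultimately show "Q x" by (simp only:)
    qed
  qed
  have "inj_on \<sigma> S"
  proof (rule inj_onI)
    fix u u' assume u: "u \<in> S" "u' \<in> S" "\<sigma> u = \<sigma> u'"
    obtain d where d: "d \<in> S" "Q ((p u)(r := d))" by (rule Q.H_exists[OF pS[OF u(1)] q(2)])
    define x where "x = (p u)(r := d)"
    define y where "y = x(q := u')"
    have x: "\<forall>k. x k \<in> S" using pS[OF u(1)] d by (simp add: x_def)
    have y: "\<forall>k. y k \<in> S" using x u by (simp add: y_def)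
    have xq: "x q = u" using q(3) by (simp add: x_def p_def)
    have "act q \<sigma> y = act q \<sigma> x" using u(3) xq by (simp add: act_def y_def)
    moreover have Qx: "Q x" using d(2) by (simp add: x_def)
    ultimately have "Q y" using eq[OF x] eq[OF y] by simp
    then have "u' = x q" using Q.H_unique[OF x q(1) Qx u(2)] by (simp add: y_def)
    then show "u = u'" using xq by simp
  qed
  moreover have "\<sigma> ` S \<subseteq> S" using c by (auto simp: \<sigma>_def)
  ultimately have "bij_betw \<sigma> S S" using fin by (simp add: bij_betw_def endo_inj_surj)
  then have "\<sigma> permutes S" by (rule bij_imp_permutes) (simp add: \<sigma>_def)
  then show ?thesis using eq by blast
qed

lemma two_elements:
  assumes "2 \<le> card S" obtains b b' where "b \<in> S" "b' \<in> S" "b \<noteq> b'"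
proof -
  have "finite S" using assms card.infinite by fastforce
  moreover have "\<not> card S \<le> 1" using assms by simp
  ultimately show thesis using that by (metis card_le_Suc0_iff_eq One_nat_def)
qed

context rigid_table
begin

text \<open>As the column twins are not constant, one of them differs from \<open>s b\<close>;
  together with a column twin equal to \<open>s b\<close> it would be a case of
  \<open>no_half_turn\<close>.\<close>

lemma columns_avoid:
  assumes ab: "b \<in> S" "b' \<in> S" "b \<noteq> b'" "s b = s b'" and nc: "a0 \<in> S" "a1 \<in> S" "t a0 \<noteq> t a1" and a: "a \<in> S"
  shows "t a \<noteq> s b"
proof
  assume h: "t a = s b"
  have "t a0 \<noteq> s b \<or> t a1 \<noteq> s b" using nc(3) by auto
  then show False using no_half_turn[OF a nc(1) ab(1-3,4) h] no_half_turn[OF a nc(2) ab(1-3,4) h] by blast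
qed

text \<open>Otherwise \<open>X = {A, B, C}\<close>, all rows have twin \<open>A\<close>, and both
  \<open>B\<close> and \<open>C\<close> occur as column twins. Comparing row \<open>b0\<close> with
  all rows \<open>b\<close> gives autotopies whose actions at \<open>B\<close> are transitive,
  whereas those at \<open>A\<close> preserve a proper subset \<open>M\<close>. By
  \<open>kernel_nontrivial\<close> some nontrivial autotopy does not move \<open>A\<close>, against
  rigidity.\<close>

lemma columns_const_if_rows_const:
  assumes pr: "prime (card S)" and X3: "card X = 3" and sA: "\<And>b. b \<in> S \<Longrightarrow> s b = A"
    and a0: "a0 \<in> S" and a1: "a1 \<in> S"
  shows "t a0 = t a1"
proof (rule ccontr)
  assume ne: "t a0 \<noteq> t a1"
  obtain b b' where bb: "b \<in> S" "b' \<in> S" "b \<noteq> b'" using two_elements[OF S2] by blast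
  have tA: "t a \<noteq> A" if "a \<in> S" for a
    using columns_avoid[OF bb _ a0 a1 ne that] sA bb by simp
  define B C where "B = t a0" and "C = t a1"
  have BC: "B \<noteq> C" "B \<noteq> A" "C \<noteq> A" using ne tA a0 a1 by (auto simp: B_def C_def)
  have AX: "A \<in> X" "B \<in> X" "C \<in> X" using s_in[OF bb(1)] sA[OF bb(1)] t_in a0 a1 by (auto simp: B_def C_def)
  have "finite X" using X3 card.infinite by fastforce
  then have X: "X = {A, B, C}" using card_seteq[of X "{A, B, C}"] X3 AX BC by simp
  have tBC: "t a = B \<or> t a = C" if "a \<in> S" for a using t_in[OF that] tA[OF that] X by blast
  define b0 where "b0 = b"
  have b0: "b0 \<in> S" using bb b0_def by simp
  interpret \<Phi>: latin_pred S X "G a0 b0" using G_latin a0 b0 by blast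
  have rig: "\<Phi>.rigid" using G_rigid a0 b0 by blast
  \<comment> \<open>The deviation of row \<open>b\<close> from row \<open>b0\<close> at
    \<open>A\<close>, measured between the columns \<open>a0\<close> and \<open>a\<close>.\<close>
  define lam where "lam a b = \<sigma> b a0 a \<circ> inv (\<sigma> b0 a0 a)" for a b
  have lam_perm: "lam a b permutes S" if "a \<in> S" "b \<in> S" for a b
    unfolding lam_def by (intro permutes_compose permutes_inv \<sigma>_perm a0 b0 that)
  have key: "G a0 b0 (act B (\<tau> a0 b0 b) (act A (lam a b) x)) = G a0 b0 (act (t a) (\<tau> a b0 b) x)"
    if "a \<in> S" "b \<in> S" "\<forall>k. x k \<in> S" for a b x
    using two_columns[OF a0 that(1) b0 that(2) _ _ _ that(3)] sA[OF b0] sA[OF that(2)] tA[OF a0] tA[OF that(1)]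
    by (simp add: lam_def B_def)
  have lam_eq: "lam a b = lam a1 b" if a: "a \<in> S" "t a = C" and b: "b \<in> S" for a b
  proof -
    have half: "G a0 b0 (act B (\<tau> a0 b0 b) y) = G a0 b0 (act C (\<tau> a' b0 b) (act A (inv (lam a' b)) y))"
      if a': "a' \<in> S" "t a' = C" and y: "\<forall>k. y k \<in> S" for a' y
    proof -
      have "\<forall>k. act A (inv (lam a' b)) y k \<in> S" by (intro act_val permutes_inv lam_perm a' b y)
      from key[OF a'(1) b this] show ?thesis using a'(2) by (simp add: act_inv(1)[OF lam_perm[OF a'(1) b]])
    qed
    have "G a0 b0 (act C (\<tau> a b0 b) (act A (inv (lam a b)) y)) = G a0 b0 (act C (\<tau> a1 b0 b) (act A (inv (lam a1 b)) y))"
      if y: "\<forall>k. y k \<in> S" for y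
      using half[OF a y] half[OF a1 C_def[symmetric] y] by simp
    from \<Phi>.rigid_eq(2)[OF rig AX(3,1) BC(3) \<tau>_perm[OF a(1) b0 b] permutes_inv[OF lam_perm[OF a(1) b]]
        \<tau>_perm[OF a1 b0 b] permutes_inv[OF lam_perm[OF a1 b]] this]
    have "inv (inv (lam a b)) = inv (inv (lam a1 b))" by simp
    then show ?thesis using lam_perm[OF a(1) b] lam_perm[OF a1 b] by (simp add: inv_inv_eq permutes_bij)
  qed
  define IB IC where "IB = {a \<in> S. t a = B}" and "IC = {a \<in> S. t a = C}"
  have I: "IB \<union> IC = S" "IB \<inter> IC = {}" "IB \<subseteq> S" "IC \<subseteq> S" "a0 \<in> IB" "a1 \<in> IC"
    using tBC BC a0 a1 by (auto simp: IB_def IC_def B_def C_def)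
  \<comment> \<open>The images of one symbol under the moves in row \<open>b0\<close> to the columns
    with twin \<open>C\<close>. The moves to columns with twin \<open>B\<close> are the same in all
    rows, so the complement of \<open>M\<close>, and with it \<open>M\<close>, is common to all
    rows.\<close>
  define M where "M = (\<lambda>a. \<sigma> b0 a0 a a0) ` IC"
  have img: "(\<lambda>a. \<sigma> b a0 a a0) ` IC = S - (\<lambda>a. \<sigma> b a0 a a0) ` IB" if b: "b \<in> S" for b
  proof -
    have bij: "bij_betw (\<lambda>a. \<sigma> b a0 a a0) S S" by (rule row_bij[OF a0 b a0])
    have "IC = S - IB" using I by blast
    then show ?thesis using inj_on_image_set_diff[OF bij_betw_imp_inj_on[OF bij], of S IB] bij I(3)
      by (simp add: bij_betw_def)
  qed
  have IBconst: "\<sigma> b a0 a = \<sigma> b0 a0 a" if "a \<in> IB" "b \<in> S" for a b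
    using \<sigma>_const[OF a0 _ b0 that(2), of a] that sA b0 BC(2) by (auto simp: IB_def B_def)
  have M_inv: "lam a1 b ` M = M" if b: "b \<in> S" for b
  proof -
    have "lam a1 b (\<sigma> b0 a0 a a0) = \<sigma> b a0 a a0" if a: "a \<in> IC" for a
    proof -
      have aS: "a \<in> S" "t a = C" using a by (auto simp: IC_def)
      have "lam a1 b (\<sigma> b0 a0 a a0) = lam a b (\<sigma> b0 a0 a a0)" using lam_eq[OF aS b] by simp
      also have "\<dots> = \<sigma> b a0 a a0" unfolding lam_def
        using permutes_inverses(2)[OF \<sigma>_perm[OF a0 aS(1) b0]] by simp
      finally show ?thesis .
    qed
    then have "lam a1 b ` M = (\<lambda>a. \<sigma> b a0 a a0) ` IC" by (simp add: M_def image_image)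
    also have "\<dots> = S - (\<lambda>a. \<sigma> b a0 a a0) ` IB" by (rule img[OF b])
    also have "\<dots> = S - (\<lambda>a. \<sigma> b0 a0 a a0) ` IB" using IBconst[OF _ b] by (simp cong: image_cong)
    also have "\<dots> = M" unfolding M_def using img[OF b0] by simp
    finally show ?thesis .
  qed
  have M: "M \<subset> S" "M \<noteq> {}"
  proof -
    have "M = S - (\<lambda>a. \<sigma> b0 a0 a a0) ` IB" unfolding M_def by (rule img[OF b0])
    moreover have "\<sigma> b0 a0 a0 a0 \<in> (\<lambda>a. \<sigma> b0 a0 a a0) ` IB" using I(5) by blast
    moreover have "\<sigma> b0 a0 a0 a0 \<in> S" using \<sigma>_self[OF a0 b0] a0 by simp
    ultimately show "M \<subset> S" by blast
    show "M \<noteq> {}" using I(6) by (auto simp: M_def)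
  qed
  \<comment> \<open>The action at \<open>C\<close> is only required to exist, so an element
    \<open>(id, \<beta>)\<close> is an autotopy that moves \<open>B\<close> and \<open>C\<close>
    alone.\<close>
  define K where "K = {(\<mu>, \<beta>). \<mu> permutes S \<and> \<beta> permutes S \<and> \<mu> ` M = M \<and>
    (\<exists>\<gamma>. \<gamma> permutes S \<and> (\<forall>x. (\<forall>k. x k \<in> S) \<longrightarrow> G a0 b0 (act A \<mu> (act B \<beta> (act C \<gamma> x))) = G a0 b0 x))}"
  have comm: "act B \<beta> (act A \<mu> x) = act A \<mu> (act B \<beta> x)" "act C \<gamma> (act A \<mu> x) = act A \<mu> (act C \<gamma> x)"
    "act C \<gamma> (act B \<beta> x) = act B \<beta> (act C \<gamma> x)" for \<mu> \<beta> \<gamma> :: "'a \<Rightarrow> 'a" and x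
    using BC by (auto intro: act_commute)
  have group: "perm_pair_group K"
    unfolding perm_pair_group_def
  proof (intro conjI ballI)
    show "(id, id) \<in> K" unfolding K_def
      by (auto intro!: exI[of _ id] simp: act_id permutes_id)
  next
    fix g assume g: "g \<in> K"
    then obtain \<gamma> where \<gamma>: "fst g permutes S" "snd g permutes S" "fst g ` M = M" "\<gamma> permutes S"
      "\<And>x. \<forall>k. x k \<in> S \<Longrightarrow> G a0 b0 (act A (fst g) (act B (snd g) (act C \<gamma> x))) = G a0 b0 x"
      unfolding K_def by auto
    show "bij (fst g)" "bij (snd g)" using \<gamma> permutes_bij by auto
    have "inv (fst g) ` M = M"
      using \<gamma>(3) image_inv_f_f[OF permutes_inj[OF \<gamma>(1)], of M] by simp
    moreover have "G a0 b0 (act A (inv (fst g)) (act B (inv (snd g)) (act C (inv \<gamma>) x))) = G a0 b0 x"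
      if x: "\<forall>k. x k \<in> S" for x
    proof -
      let ?y = "act A (inv (fst g)) (act B (inv (snd g)) (act C (inv \<gamma>) x))"
      have y: "\<forall>k. ?y k \<in> S" by (intro act_val permutes_inv \<gamma> x)
      have "act A (fst g) (act B (snd g) (act C \<gamma> ?y)) = x"
        by (simp add: comm act_inv(1)[OF \<gamma>(1)] act_inv(1)[OF \<gamma>(2)] act_inv(1)[OF \<gamma>(4)])
      then show ?thesis using \<gamma>(5)[OF y] by simp
    qed
    ultimately show "(inv (fst g), inv (snd g)) \<in> K"
      unfolding K_def using \<gamma>(1,2,4) permutes_inv by blast
  next
    fix g h assume g: "g \<in> K" and h: "h \<in> K"
    obtain \<gamma> where \<gamma>: "fst g permutes S" "snd g permutes S" "fst g ` M = M" "\<gamma> permutes S"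
      "\<And>x. \<forall>k. x k \<in> S \<Longrightarrow> G a0 b0 (act A (fst g) (act B (snd g) (act C \<gamma> x))) = G a0 b0 x"
      using g unfolding K_def by auto
    obtain \<delta> where \<delta>: "fst h permutes S" "snd h permutes S" "fst h ` M = M" "\<delta> permutes S"
      "\<And>x. \<forall>k. x k \<in> S \<Longrightarrow> G a0 b0 (act A (fst h) (act B (snd h) (act C \<delta> x))) = G a0 b0 x"
      using h unfolding K_def by auto
    have "G a0 b0 (act A (fst g \<circ> fst h) (act B (snd g \<circ> snd h) (act C (\<gamma> \<circ> \<delta>) x))) = G a0 b0 x"
      if x: "\<forall>k. x k \<in> S" for x
    proof -
      let ?y = "act A (fst h) (act B (snd h) (act C \<delta> x))"
      have y: "\<forall>k. ?y k \<in> S" by (intro act_val \<delta> x)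
      have "act A (fst g \<circ> fst h) (act B (snd g \<circ> snd h) (act C (\<gamma> \<circ> \<delta>) x)) = act A (fst g) (act B (snd g) (act C \<gamma> ?y))"
        by (simp add: comm act_comp[symmetric])
      then show ?thesis using \<gamma>(5)[OF y] \<delta>(5)[OF x] by simp
    qed
    moreover have "(fst g \<circ> fst h) ` M = M" using \<gamma>(3) \<delta>(3) by (metis image_comp)
    moreover have "fst g \<circ> fst h permutes S" "snd g \<circ> snd h permutes S" "\<gamma> \<circ> \<delta> permutes S"
      by (intro permutes_compose \<gamma> \<delta>)+
    ultimately show "(fst g \<circ> fst h, snd g \<circ> snd h) \<in> K" unfolding K_def by blast
  qed
  have "\<exists>\<beta>. \<beta> \<noteq> id \<and> (id, \<beta>) \<in> K"
  proof (rule kernel_nontrivial[OF finite_S pr group])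
    fix u v assume uv: "u \<in> S" "v \<in> S"
    have "(\<lambda>b. \<tau> a0 b0 b u) ` S = S" using col_bij[OF a0 b0 uv(1)] by (simp add: bij_betw_def)
    from equalityD2[OF this, THEN subsetD, OF uv(2)]
    obtain b where b: "b \<in> S" "\<tau> a0 b0 b u = v" by (elim imageE) simp
    have tp: "\<tau> a0 b0 b permutes S" "\<tau> a1 b0 b permutes S" using \<tau>_perm a0 a1 b0 b by auto
    have "G a0 b0 (act A (lam a1 b) (act B (\<tau> a0 b0 b) (act C (inv (\<tau> a1 b0 b)) x))) = G a0 b0 x"
      if x: "\<forall>k. x k \<in> S" for x
    proof -
      have "\<forall>k. act C (inv (\<tau> a1 b0 b)) x k \<in> S" by (intro act_val permutes_inv tp x)
      from key[OF a1 b(1) this] show ?thesis by (simp add: comm C_def[symmetric] act_inv(1)[OF tp(2)])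
    qed
    then have "(lam a1 b, \<tau> a0 b0 b) \<in> K"
      unfolding K_def using lam_perm[OF a1 b(1)] tp permutes_inv[OF tp(2)] M_inv[OF b(1)] by blast
    then show "\<exists>h \<in> K. snd h u = v" using b(2) by force
  qed (use M in \<open>auto simp: K_def\<close>)
  then obtain \<beta> where \<beta>: "\<beta> \<noteq> id" "(id, \<beta>) \<in> K" by blast
  then obtain \<gamma> where \<gamma>: "\<beta> permutes S" "\<gamma> permutes S"
    "\<forall>x. (\<forall>k. x k \<in> S) \<longrightarrow> G a0 b0 (act B \<beta> (act C \<gamma> x)) = G a0 b0 x"
    unfolding K_def by (auto simp: act_id)
  then have "\<beta> = id" using rig AX BC unfolding \<Phi>.rigid_def by blast
  then show False using \<beta>(1) by blast
qed

text \<open>Four symbols and three coordinates force repetitions: two rows share \<open>A\<close>,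
  so no column has \<open>A\<close>; then two columns share \<open>B\<close>, so no row has
  \<open>B\<close>. Some row has \<open>C\<close>, so \<open>C\<close> is not repeated among the
  columns and occurs only at \<open>d0\<close>. A Latin square is determined by all its columns but
  one, so \<open>d0\<close> also shows no deviation between the rows \<open>b\<close> and
  \<open>b'\<close>, and \<open>two_columns\<close> equates a move at \<open>B\<close> with one at
  \<open>C\<close>.\<close>

lemma rows_or_columns_const:
  assumes X3: "card X = 3" and S4: "4 \<le> card S"
    and b01: "b0 \<in> S" "b1 \<in> S" "s b0 \<noteq> s b1" and a01: "a0 \<in> S" "a1 \<in> S" "t a0 \<noteq> t a1"
  shows False
proof -
  interpret T: rigid_table S X "\<lambda>a b. G b a" t s \<tau> \<sigma> by (rule rigid_transposed)
  have finX: "finite X" using X3 card.infinite by fastforce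
  have "\<not> inj_on s S"
  proof
    assume "inj_on s S"
    then have "card S \<le> card X" using card_inj_on_le[of s S X] s_in finX by blast
    then show False using S4 X3 by simp
  qed
  then obtain b b' where b: "b \<in> S" "b' \<in> S" "b \<noteq> b'" "s b = s b'" unfolding inj_on_def by blast
  define A where "A = s b"
  have tA: "t a \<noteq> A" if "a \<in> S" for a using columns_avoid[OF b a01 that] by (simp add: A_def)
  have AX: "A \<in> X" using s_in b A_def by simp
  have "\<not> inj_on t S"
  proof
    assume "inj_on t S"
    moreover have "t ` S \<subseteq> X - {A}" using t_in tA by blast
    ultimately have "card S \<le> card (X - {A})" using card_inj_on_le[of t S "X - {A}"] finX by blast
    then show False using S4 X3 AX finX by simp
  qed
  then obtain a a' where a: "a \<in> S" "a' \<in> S" "a \<noteq> a'" "t a = t a'" unfolding inj_on_def by blast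
  define B where "B = t a"
  have sB: "s c \<noteq> B" if "c \<in> S" for c using T.columns_avoid[OF a b01 that] by (simp add: B_def)
  have AB: "A \<noteq> B" "B \<in> X" using tA[OF a(1)] t_in[OF a(1)] by (auto simp: B_def)
  obtain c0 where c0: "c0 \<in> S" "s c0 \<noteq> A" using b01 by metis
  obtain d0 where d0: "d0 \<in> S" "t d0 \<noteq> B" using a01 by metis
  define C where "C = s c0"
  have C: "C \<in> X" "C \<noteq> A" "C \<noteq> B" using s_in[OF c0(1)] c0(2) sB[OF c0(1)] by (auto simp: C_def)
  have X: "X = {A, B, C}" using card_seteq[OF finX, of "{A, B, C}"] X3 AX AB C by simp
  have tBC: "t x = B \<or> t x = C" if "x \<in> S" for x using t_in[OF that] tA[OF that] X by blast
  have d0C: "t d0 = C" using tBC[OF d0(1)] d0(2) by blast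
  have onlyd: "t x = B" if x: "x \<in> S" "x \<noteq> d0" for x
  proof (rule ccontr)
    assume "t x \<noteq> B"
    then have "t x = t d0" using tBC[OF x(1)] d0C by simp
    from T.columns_avoid[OF x(1) d0(1) x(2) this b01 c0(1)] show False using \<open>t x = t d0\<close> d0C C_def by simp
  qed
  have "d0 \<noteq> a \<or> d0 \<noteq> a'" using a(3) by blast
  then obtain e0 where e0: "e0 \<in> S" "t e0 = B" using onlyd a by blast
  have sb: "s b = A" "s b' = A" using b(4) by (auto simp: A_def)
  have const: "\<sigma> b' e0 x = \<sigma> b e0 x" if x: "x \<in> S" "x \<noteq> d0" for x
    by (rule \<sigma>_const[OF e0(1) x(1) b(1,2,4)]) (use onlyd[OF x] e0 sb AB in auto)
  have "\<sigma> b' e0 d0 u = \<sigma> b e0 d0 u" if u: "u \<in> S" for u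
  proof -
    have one: "{\<sigma> c e0 d0 u} = S - (\<lambda>x. \<sigma> c e0 x u) ` (S - {d0})" if c: "c \<in> S" for c
    proof -
      have bij: "bij_betw (\<lambda>x. \<sigma> c e0 x u) S S" by (rule row_bij[OF e0(1) c u])
      have "(\<lambda>x. \<sigma> c e0 x u) ` (S - (S - {d0})) = S - (\<lambda>x. \<sigma> c e0 x u) ` (S - {d0})"
        using inj_on_image_set_diff[OF bij_betw_imp_inj_on[OF bij], of S "S - {d0}"] bij by (simp add: bij_betw_def)
      moreover have "S - (S - {d0}) = {d0}" using d0 by blast
      ultimately show ?thesis by simp
    qed
    have im: "(\<lambda>x. \<sigma> b' e0 x u) ` (S - {d0}) = (\<lambda>x. \<sigma> b e0 x u) ` (S - {d0})"
      by (rule image_cong) (use const in auto)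
    have "{\<sigma> b' e0 d0 u} = {\<sigma> b e0 d0 u}" unfolding one[OF b(1)] one[OF b(2)] im ..
    then show ?thesis by simp
  qed
  then have eq: "\<sigma> b' e0 d0 = \<sigma> b e0 d0"
    using \<sigma>_perm[OF e0(1) d0(1) b(1)] \<sigma>_perm[OF e0(1) d0(1) b(2)]
    by (intro ext) (metis permutes_not_in)
  interpret \<Phi>: latin_pred S X "G e0 b" using G_latin e0 b by blast
  have p: "\<sigma> b e0 d0 permutes S" using \<sigma>_perm e0 d0 b by blast
  have "G e0 b (act B (\<tau> e0 b b') x) = G e0 b (act C (\<tau> d0 b b') x)" if x: "\<forall>k. x k \<in> S" for x
  proof -
    have "\<sigma> b' e0 d0 \<circ> inv (\<sigma> b e0 d0) = id" using eq permutes_inv_o(1)[OF p] by simp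
    then show ?thesis
      using two_columns[OF e0(1) d0(1) b(1,2,4) _ _ x] e0(2) d0C sb AB C by (simp add: act_id)
  qed
  from \<Phi>.rigid_eq1(1)[OF G_rigid[OF e0(1) b(1)] AB(2) C(1) _ \<tau>_perm[OF e0(1) b(1,2)] \<tau>_perm[OF d0(1) b(1,2)] this] C(3)
  have "\<tau> e0 b b' = id" by blast
  then show False using \<tau>_id[OF e0(1) b(1,2)] b(3) by blast
qed

theorem rigid_table_const:
  assumes pr: "prime (card S)" and X3: "card X = 3" and b: "b0 \<in> S" "b1 \<in> S" and a: "a0 \<in> S" "a1 \<in> S"
  shows "s b0 = s b1 \<and> t a0 = t a1"
proof -
  interpret T: rigid_table S X "\<lambda>a b. G b a" t s \<tau> \<sigma> by (rule rigid_transposed)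
  interpret \<Phi>: latin_pred S X "G a0 b0" using G_latin a b by blast
  obtain p q r where X: "X = {p, q, r}" "distinct [p, q, r]" using X3 by (auto simp: card_3_iff)
  have S4: "4 \<le> card S" by (rule \<Phi>.rigid_card[OF G_rigid[OF a(1) b(1)] finite_S S2 X])
  have "(\<forall>b \<in> S. s b = s b0) \<or> (\<forall>a \<in> S. t a = t a0)"
    using rows_or_columns_const[OF X3 S4 b(1) _ _ a(1)] by metis
  then show ?thesis
  proof
    assume h: "\<forall>b \<in> S. s b = s b0"
    have "t a0 = t a1" by (rule columns_const_if_rows_const[OF pr X3 _ a, of "s b0"]) (use h in blast)
    then show ?thesis using h b(2) by simp
  next
    assume h: "\<forall>a \<in> S. t a = t a0"
    have "s b0 = s b1" by (rule T.columns_const_if_rows_const[OF pr X3 _ b, of "t a0"]) (use h in blast)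
    then show ?thesis using h a(2) by simp
  qed
qed

end

lemma (in table) rigid_all:
  assumes r: "a \<in> S" "b \<in> S" "latin_pred.rigid S X (G a b)" and a': "a' \<in> S" "b' \<in> S"
  shows "latin_pred.rigid S X (G a' b')"
proof -
  have 1: "latin_pred.rigid S X (G a' b)"
    by (rule latin_pred.rigid_transfer[OF G_latin[OF r(1,2)] r(3) s_in[OF r(2)] \<sigma>_perm[OF r(1) a'(1) r(2)] G_latin[OF a'(1) r(2)] row])
      (use r a' in auto)
  show ?thesis
    by (rule latin_pred.rigid_transfer[OF G_latin[OF a'(1) r(2)] 1 t_in[OF a'(1)] \<tau>_perm[OF a'(1) r(2) a'(2)] G_latin[OF a'] col])
      (use r a' in auto)
qed

section \<open>Prime order\<close>

locale prime_critical = latin S V F for S :: "'a set" and V :: "'i set" and F +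
  assumes finite_S: "finite S" and prime_S: "prime (card S)"
    and F_cong: "\<And>x y. (\<And>k. k \<in> V \<Longrightarrow> x k = y k) \<Longrightarrow> F x = F y"
    and all_red: "\<And>k e. k \<in> V \<Longrightarrow> \<forall>k. e k \<in> S \<Longrightarrow> red (V - {k}) e"
begin

definition G :: "'i \<Rightarrow> 'i \<Rightarrow> 'a \<Rightarrow> 'a \<Rightarrow> ('i \<Rightarrow> 'a) \<Rightarrow> bool" where
  "G i j a b x = F (x(i := a, j := b))"

definition dec :: "'i set \<Rightarrow> 'i \<Rightarrow> 'i \<Rightarrow> bool" where
  "dec X i j \<longleftrightarrow> V = insert i (insert j X) \<and> i \<noteq> j \<and> i \<notin> X \<and> j \<notin> X"

lemma dec_sym: "dec X i j \<Longrightarrow> dec X j i"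
  unfolding dec_def insert_commute[of j i] by blast

lemma G_sym: "i \<noteq> j \<Longrightarrow> G j i b a x = G i j a b x"
  by (simp add: G_def fun_upd_twist)

lemma S2: "2 \<le> card S"
  using prime_S by (rule prime_ge_2_nat)

text \<open>Only values in \<open>V\<close> matter, so a constant function can serve as a base point
  that prescribes the one fixed coordinate.\<close>

lemma splits_V_cong:
  assumes "splits Y e A" "\<forall>k. e k \<in> S" "\<And>k. k \<in> V - Y \<Longrightarrow> e k = e' k"
  shows "splits Y e' A"
  unfolding splits_def
proof (intro ballI impI)
  fix x y assume x: "x \<in> pts Y e'" and y: "y \<in> pts Y e'" and h: "F x" "F y" "F (mix A x y)"
  let ?x = "mix Y x e" and ?y = "mix Y y e"
  have p: "?x \<in> pts Y e" "?y \<in> pts Y e" using x y assms(2) by (auto simp: pts_def mix_def)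
  have "F ?x = F x" "F ?y = F y" "F (mix A ?x ?y) = F (mix A x y)" "F (mix A ?y ?x) = F (mix A y x)"
    by (rule F_cong; use x y assms(3) in \<open>auto simp: pts_def mix_def\<close>)+
  then show "F (mix A y x)" using splitsD[OF assms(1) p] h by simp
qed

lemma red_V_cong:
  assumes "red Y e" "\<forall>k. e k \<in> S" "\<And>k. k \<in> V - Y \<Longrightarrow> e k = e' k"
  shows "red Y e'"
  using assms(1) splits_V_cong[OF _ assms(2,3)] unfolding red_def by blast

lemma G_latin:
  assumes d: "dec X i j" and ab: "a \<in> S" "b \<in> S"
  shows "latin_pred S X (G i j a b)"
proof
  fix x :: "'i \<Rightarrow> 'a" and r assume x: "\<forall>k. x k \<in> S" and r: "r \<in> X"
  have "r \<in> V" "r \<noteq> i" "r \<noteq> j" using d r by (auto simp: dec_def)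
  then have eq: "G i j a b (x(r := c)) = F ((x(i := a, j := b))(r := c))" for c
    unfolding G_def by (simp add: fun_upd_twist)
  have "\<forall>k. (x(i := a, j := b)) k \<in> S" using x ab by simp
  then show "\<exists>!c. c \<in> S \<and> G i j a b (x(r := c))" unfolding eq by (rule unique_value) fact
next
  fix x y :: "'i \<Rightarrow> 'a" assume h: "\<And>k. k \<in> X \<Longrightarrow> x k = y k"
  show "G i j a b x = G i j a b y"
    unfolding G_def by (rule F_cong) (use h d in \<open>auto simp: dec_def\<close>)
qed

lemma G_inj:
  assumes d: "dec X i j" and x: "\<forall>k. x k \<in> S" and ab: "a \<in> S" "a' \<in> S" "b \<in> S" "G i j a b x" "G i j a' b x"
  shows "a = a'"
proof -
  have 1: "x(i := c, j := b) = x(j := b, i := c)" for c by (rule fun_upd_twist) (use d in \<open>simp add: dec_def\<close>)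
  have xj: "\<forall>k. (x(j := b)) k \<in> S" using x ab(3) by simp
  have i: "i \<in> V" using d by (simp add: dec_def)
  have "F (x(j := b, i := a))" "F (x(j := b, i := a'))" using ab(4,5) unfolding G_def 1 .
  then show ?thesis using unique_value[OF xj i] ab(1,2) by blast
qed

lemma F_eq_G: "x i = a \<Longrightarrow> x j = b \<Longrightarrow> F x = G i j a b x"
  by (auto simp: G_def)

text \<open>The form in which a split enters \<open>twin_perm\<close>, where \<open>P\<close> and
  \<open>Q\<close> are the retracts for two values of \<open>i\<close>.\<close>

lemma split_rect:
  assumes d: "dec X i j" and q: "q \<in> X" and s: "splits (insert i X) e {i, q}" and e: "\<forall>k. e k \<in> S" "e j = b"
    and x: "\<forall>k. x k \<in> S" and y: "\<forall>k. y k \<in> S" and a: "a \<in> S" "a' \<in> S"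
    and h: "G i j a b x" "G i j a' b y" "G i j a b (y(q := x q))"
  shows "G i j a' b (x(q := y q))"
proof -
  let ?x = "mix (insert i X) (x(i := a)) e" and ?y = "mix (insert i X) (y(i := a')) e"
  have p: "?x \<in> pts (insert i X) e" "?y \<in> pts (insert i X) e"
    using x y a e by (auto simp: pts_def mix_def)
  note dd = d[unfolded dec_def]
  have 1: "F ?x = G i j a b x" "F ?y = G i j a' b y"
    unfolding G_def by (rule F_cong; use dd e in \<open>auto simp: mix_def\<close>)+
  have 2: "F (mix {i, q} ?x ?y) = G i j a b (y(q := x q))"
    unfolding G_def by (rule F_cong) (use dd e q in \<open>auto simp: mix_def\<close>)
  have 3: "F (mix {i, q} ?y ?x) = G i j a' b (x(q := y q))"
    unfolding G_def by (rule F_cong) (use dd e q in \<open>auto simp: mix_def\<close>)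
  show ?thesis using splitsD[OF s p] h unfolding 1 2 3 by blast
qed

lemma dec_other:
  assumes "dec X i j" "3 \<le> card X" shows "\<exists>r \<in> X. r \<noteq> q"
proof (rule ccontr)
  assume "\<not> ?thesis"
  then have "X \<subseteq> {q}" by blast
  then have "card X \<le> card {q}" by (intro card_mono) auto
  then show False using assms(2) by simp
qed

lemma row_perm:
  assumes d: "dec X i j" and X3: "3 \<le> card X" and q: "q \<in> X" and ab: "a \<in> S" "a' \<in> S" "b \<in> S"
    and s: "\<And>e. \<forall>k. e k \<in> S \<Longrightarrow> e j = b \<Longrightarrow> splits (insert i X) e {i, q}"
  shows "\<exists>\<sigma>. \<sigma> permutes S \<and> (\<forall>x. (\<forall>k. x k \<in> S) \<longrightarrow> G i j a' b x = G i j a b (act q \<sigma> x))"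
proof -
  obtain r where r: "r \<in> X" "r \<noteq> q" using dec_other[OF d X3] by blast
  have e: "\<forall>k. (\<lambda>_. b) k \<in> S" "(\<lambda>_. b) j = b" using ab by auto
  note sp = split_rect[OF d q s[OF e] e]
  show ?thesis
    by (rule twin_perm[OF G_latin[OF d ab(1,3)] G_latin[OF d ab(2,3)] finite_S ab(1) q r])
      (rule sp, use ab in auto)+
qed

lemma table_exists:
  assumes d: "dec X i j" and X3: "3 \<le> card X"
    and s: "\<And>b. b \<in> S \<Longrightarrow> s b \<in> X" "\<And>b e. b \<in> S \<Longrightarrow> \<forall>k. e k \<in> S \<Longrightarrow> e j = b \<Longrightarrow> splits (insert i X) e {i, s b}"
    and t: "\<And>a. a \<in> S \<Longrightarrow> t a \<in> X" "\<And>a e. a \<in> S \<Longrightarrow> \<forall>k. e k \<in> S \<Longrightarrow> e i = a \<Longrightarrow> splits (insert j X) e {j, t a}"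
  obtains \<sigma> \<tau> where "table S X (G i j) s t \<sigma> \<tau>"
proof -
  define \<sigma> where "\<sigma> b a a' = (SOME \<rho>. \<rho> permutes S \<and> (\<forall>x. (\<forall>k. x k \<in> S) \<longrightarrow> G i j a' b x = G i j a b (act (s b) \<rho> x)))" for b a a'
  define \<tau> where "\<tau> a b b' = (SOME \<rho>. \<rho> permutes S \<and> (\<forall>x. (\<forall>k. x k \<in> S) \<longrightarrow> G j i b' a x = G j i b a (act (t a) \<rho> x)))" for a b b'
  have \<sigma>: "\<sigma> b a a' permutes S \<and> (\<forall>x. (\<forall>k. x k \<in> S) \<longrightarrow> G i j a' b x = G i j a b (act (s b) (\<sigma> b a a') x))"
    if "a \<in> S" "a' \<in> S" "b \<in> S" for a a' b
  proof -
    have "\<exists>\<rho>. \<rho> permutes S \<and> (\<forall>x. (\<forall>k. x k \<in> S) \<longrightarrow> G i j a' b x = G i j a b (act (s b) \<rho> x))"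
      by (rule row_perm[OF d X3 s(1)[OF that(3)] that s(2)[OF that(3)]])
    then show ?thesis unfolding \<sigma>_def by (rule someI_ex)
  qed
  have \<tau>: "\<tau> a b b' permutes S \<and> (\<forall>x. (\<forall>k. x k \<in> S) \<longrightarrow> G j i b' a x = G j i b a (act (t a) (\<tau> a b b') x))"
    if "b \<in> S" "b' \<in> S" "a \<in> S" for a b b'
  proof -
    have "\<exists>\<rho>. \<rho> permutes S \<and> (\<forall>x. (\<forall>k. x k \<in> S) \<longrightarrow> G j i b' a x = G j i b a (act (t a) \<rho> x))"
      by (rule row_perm[OF dec_sym[OF d] X3 t(1)[OF that(3)] that t(2)[OF that(3)]])
    then show ?thesis unfolding \<tau>_def by (rule someI_ex)
  qed
  have ij: "i \<noteq> j" using d by (simp add: dec_def)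
  have "table S X (G i j) s t \<sigma> \<tau>"
  proof (rule table.intro, goal_cases)
    case 1 show ?case by (rule finite_S)
  next
    case 2 show ?case by (rule S2)
  next
    case (3 a b) then show ?case by (rule G_latin[OF d])
  next
    case (4 a a' b x) then show ?case using G_inj[OF d] by blast
  next
    case (5 a b b' x) then show ?case using G_inj[OF dec_sym[OF d] 5(1), of b b' a] by (simp add: G_sym[OF ij])
  next
    case (6 b) then show ?case by (rule s(1))
  next
    case (7 a) then show ?case by (rule t(1))
  next
    case (8 a a' b) then show ?case using \<sigma> by blast
  next
    case (9 a b b') then show ?case using \<tau> by blast
  next
    case (10 a a' b x) then show ?case using \<sigma> by blast
  next
    case (11 a b b' x) then show ?case using \<tau>[of b b' a] by (simp add: G_sym[OF ij])
  next
    case (12 q) show ?case by (rule dec_other[OF d X3])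
  qed
  then show thesis by (rule that)
qed

lemma attach_exists:
  assumes d: "dec X i j" and irr: "\<not> red X e" and e: "\<forall>k. e k \<in> S"
  obtains q where "q \<in> X" "splits (insert i X) e {i, q}"
proof -
  have VX: "V - {j} = insert i X" "X \<subseteq> V" "i \<in> V - X" "j \<in> V" using d by (auto simp: dec_def)
  have r: "red (insert i X) e" using all_red[OF VX(4) e] VX(1) by simp
  have ee: "e \<in> pts (insert i X) e" using e by (rule pts_refl)
  show thesis by (rule attach[OF irr VX(2,3) r ee]) (rule that)
qed

text \<open>\<open>irr_transfer\<close> is applied for \<open>i\<close> and then for
  \<open>j\<close>. The twins it needs exist because all retracts with one fixed coordinate are
  reducible.\<close>

lemma irr_everywhere:
  assumes d: "dec X i j" and irr: "\<not> red X e" and e: "\<forall>k. e k \<in> S" and e': "\<forall>k. e' k \<in> S"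
  shows "\<not> red X e'"
proof -
  have step: "\<not> red X (f(i := b))" if d: "dec X i j" and f: "\<forall>k. f k \<in> S" "\<not> red X f" and b: "b \<in> S" for f b i j
  proof -
    obtain q where q: "q \<in> X" "splits (insert i X) f {i, q}" by (rule attach_exists[OF d f(2,1)])
    have ff: "f \<in> pts (insert i X) f" using f(1) by (rule pts_refl)
    show ?thesis
      by (rule irr_transfer[OF f(2) _ q(1) _ q(2) ff]) (use d ff b in \<open>auto simp: dec_def intro: pts_upd\<close>)
  qed
  have 1: "\<not> red X (e(i := e' i))" using step[OF d e irr] e' by blast
  have "\<forall>k. (e(i := e' i)) k \<in> S" using e e' by simp
  from step[OF dec_sym[OF d] this 1, of "e' j"] have 2: "\<not> red X (e(i := e' i, j := e' j))" using e' by blast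
  show ?thesis
  proof
    assume "red X e'"
    then have "red X (e(i := e' i, j := e' j))"
      by (rule red_V_cong) (use e' d in \<open>auto simp: dec_def\<close>)
    then show False using 2 by blast
  qed
qed

lemma attach_function:
  assumes d: "dec X i j" and irr: "\<And>e. \<forall>k. e k \<in> S \<Longrightarrow> \<not> red X e"
  shows "\<exists>s. \<forall>b \<in> S. s b \<in> X \<and> (\<forall>e. (\<forall>k. e k \<in> S) \<longrightarrow> e j = b \<longrightarrow> splits (insert i X) e {i, s b})"
proof -
  have "\<exists>q. q \<in> X \<and> splits (insert i X) (\<lambda>_. b) {i, q}" if "b \<in> S" for b
  proof -
    have e: "\<forall>k. (\<lambda>_. b) k \<in> S" using that by simp
    show ?thesis by (rule attach_exists[OF d irr[OF e] e]) blast
  qed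
  then obtain s where s: "\<And>b. b \<in> S \<Longrightarrow> s b \<in> X \<and> splits (insert i X) (\<lambda>_. b) {i, s b}" by metis
  show ?thesis
  proof (intro exI[of _ s] ballI conjI allI impI)
    fix b e assume h: "b \<in> S" "\<forall>k. e k \<in> S" "e j = b"
    show "splits (insert i X) e {i, s b}"
      by (rule splits_V_cong[OF conjunct2[OF s[OF h(1)]]]) (use h d in \<open>auto simp: dec_def\<close>)
  qed (use s in blast)
qed

definition row_split :: "'i set \<Rightarrow> 'i \<Rightarrow> 'i \<Rightarrow> 'a \<Rightarrow> 'i \<Rightarrow> bool" where
  "row_split X i j b q \<longleftrightarrow> (\<forall>e. (\<forall>k. e k \<in> S) \<longrightarrow> e j = b \<longrightarrow> splits (insert i X) e {i, q})"

lemma row_splitD: "row_split X i j b q \<Longrightarrow> \<forall>k. e k \<in> S \<Longrightarrow> e j = b \<Longrightarrow> splits (insert i X) e {i, q}"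
  by (simp add: row_split_def)

lemma red_if_common_twin:
  assumes d: "dec X i j" and X3: "3 \<le> card X" and A: "A \<in> X" and r: "\<And>b. b \<in> S \<Longrightarrow> row_split X i j b A"
    and c: "\<And>a. a \<in> S \<Longrightarrow> row_split X j i a A"
  shows "red V e"
proof -
  have dd: "V = insert i (insert j X)" "i \<noteq> j" "i \<notin> X" "j \<notin> X" using d by (auto simp: dec_def)
  have fX: "finite X" using finite_V dd by simp
  have iA: "i \<noteq> A" "j \<noteq> A" using dd A by auto
  have "card (X - {A}) \<noteq> 0" using X3 A fX by simp
  then have "X - {A} \<noteq> {}" by (metis card.empty)
  then obtain d0 where d0: "d0 \<in> X - {A}" by blast
  have "splits V e {i, j, A}"
  proof (rule splits_local[of _ _ A d0])
    fix c f e' assume cc: "c \<in> {i, j, A} - {A}" and f: "f \<in> V - {i, j, A} - {d0}" and e': "e' \<in> pts V e"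
    have v: "\<forall>k. e' k \<in> S" using pts_in[OF e'] by blast
    have ee: "e' \<in> pts Y e'" for Y using v by (rule pts_refl)
    have fX: "f \<in> X" "f \<noteq> A" "f \<noteq> i" "f \<noteq> j" using f dd by auto
    from cc have "c = i \<or> c = j" by blast
    then show "splits {c, A, f, d0} e' {c, A}"
    proof
      assume ci: "c = i"
      have "splits (insert i X) e' {i, A}" using row_splitD[OF r v refl] v by blast
      then show ?thesis by (rule splits_restrict[OF _ ee]) (use ci fX A d0 in auto)
    next
      assume cj: "c = j"
      have "splits (insert j X) e' {j, A}" using row_splitD[OF c v refl] v by blast
      then show ?thesis by (rule splits_restrict[OF _ ee]) (use cj fX A d0 in auto)
    qed
  qed (use A dd d0 in auto)
  moreover have "V - {i, j, A} = X - {A}" using dd by auto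
  moreover have "2 \<le> card (X - {A})" using X3 A fX by simp
  moreover have "2 \<le> card {i, j, A}" using dd(2) iA by (simp add: card_insert_if)
  ultimately show ?thesis using A dd(1) by (intro redI[of "{i, j, A}"]) auto
qed

text \<open>If the twins agree, \<open>i\<close>, \<open>j\<close> and their common twin form the
  split. If they differ, \<open>\<sigma>_const\<close> makes the action of \<open>i\<close> at
  \<open>A\<close> independent of \<open>j\<close>, so \<open>i\<close> and \<open>A\<close> enter
  only in combination.\<close>

lemma red_if_const:
  assumes T: "rigid_table S X (G i j) s t \<sigma> \<tau>" and d: "dec X i j" and X3: "3 \<le> card X"
    and s: "\<And>b e. b \<in> S \<Longrightarrow> \<forall>k. e k \<in> S \<Longrightarrow> e j = b \<Longrightarrow> splits (insert i X) e {i, s b}"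
    and t: "\<And>a e. a \<in> S \<Longrightarrow> \<forall>k. e k \<in> S \<Longrightarrow> e i = a \<Longrightarrow> splits (insert j X) e {j, t a}"
    and sc: "\<And>b. b \<in> S \<Longrightarrow> s b = A" and tc: "\<And>a. a \<in> S \<Longrightarrow> t a = B" and e: "\<forall>k. e k \<in> S"
  shows "red V e"
proof -
  interpret rigid_table S X "G i j" s t \<sigma> \<tau> by (rule T)
  have o: "e i \<in> S" using e by blast
  have AB: "A \<in> X" "B \<in> X" using s_in[OF o] t_in[OF o] sc[OF o] tc[OF o] by auto
  have dd: "V = insert i (insert j X)" "i \<noteq> j" "i \<notin> X" "j \<notin> X" using d by (auto simp: dec_def)
  have fX: "finite X" using finite_V dd by simp
  have iA: "i \<noteq> A" "j \<noteq> A" using dd AB by auto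
  show ?thesis
  proof (cases "A = B")
    case True
    show ?thesis
    proof (rule red_if_common_twin[OF d X3 AB(1)])
      show "row_split X i j b A" if b: "b \<in> S" for b
        unfolding row_split_def using s[OF b] sc[OF b] by simp
      show "row_split X j i a A" if a: "a \<in> S" for a
        unfolding row_split_def using t[OF a] tc[OF a] True by simp
    qed
  next
    case False
    have "splits V e {i, A}" unfolding splits_def
    proof (intro ballI impI)
      fix x y assume x: "x \<in> pts V e" and y: "y \<in> pts V e" and h: "F x" "F y" "F (mix {i, A} x y)"
      have v: "\<forall>k. x k \<in> S" "\<forall>k. y k \<in> S" using pts_in x y by blast+
      define a a' b b' where "a = x i" and "a' = y i" and "b = x j" and "b' = y j"
      have S: "a \<in> S" "a' \<in> S" "b \<in> S" "b' \<in> S" using v by (auto simp: a_def a'_def b_def b'_def)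
      interpret L: latin_pred S X "G i j a b'" by (rule G_latin[OF S(1,4)])
      let ?\<sigma> = "\<sigma> b' a a'"
      have c: "\<sigma> b a a' = ?\<sigma>" by (rule \<sigma>_const[OF S(1,2,4,3)]) (use sc tc S False in auto)
      have ip: "?\<sigma> permutes S" by (rule \<sigma>_perm[OF S(1,2,4)])
      have "F y = G i j a' b' y" by (rule F_eq_G) (auto simp: a'_def b'_def)
      also have "\<dots> = G i j a b' (act A ?\<sigma> y)" using row[OF v(2) S(1,2,4)] sc[OF S(4)] by simp
      finally have 1: "G i j a b' (act A ?\<sigma> y)" using h by simp
      have "F (mix {i, A} x y) = G i j a b' (y(A := x A))"
        unfolding G_def by (rule F_cong) (use dd AB in \<open>auto simp: mix_def a_def b'_def\<close>)
      then have 2: "G i j a b' (y(A := x A))" using h by simp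
      \<comment> \<open>Two solutions that differ at most at \<open>A\<close> coincide, so the
        permutation carries \<open>y A\<close> to \<open>x A\<close>.\<close>
      have 3: "x A = ?\<sigma> (y A)"
      proof -
        have "\<forall>k. act A ?\<sigma> y k \<in> S" by (rule act_val[OF ip v(2)])
        moreover have "(act A ?\<sigma> y)(A := x A) = y(A := x A)" by (simp add: act_def)
        ultimately have "x A = act A ?\<sigma> y A" using L.H_unique[OF _ AB(1) 1, of "x A"] 2 v by simp
        then show ?thesis by (simp add: act_def)
      qed
      define z where "z = x(A := y A)"
      have z: "\<forall>k. z k \<in> S" using v by (simp add: z_def)
      have "F (mix {i, A} y x) = G i j a' b z"
        unfolding G_def by (rule F_cong) (use dd AB in \<open>auto simp: mix_def a'_def b_def z_def\<close>)
      also have "\<dots> = G i j a b (act A ?\<sigma> z)" using row[OF z S(1,2,3)] sc[OF S(3)] c by simp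
      also have "act A ?\<sigma> z = x" using 3 by (simp add: act_def z_def fun_upd_idem)
      also have "G i j a b x = F x" by (rule F_eq_G[symmetric]) (auto simp: a_def b_def)
      finally show "F (mix {i, A} y x)" using h by simp
    qed
    moreover have "2 \<le> card {i, A}" using iA by simp
    moreover have "2 \<le> card (V - {i, A})"
    proof -
      have "V - {i, A} = insert j (X - {A})" using dd AB by auto
      then show ?thesis using X3 AB fX dd by simp
    qed
    ultimately show ?thesis using AB dd(1) by (intro redI[of "{i, A}"]) auto
  qed
qed

lemma rigid_if_irr:
  assumes d: "dec X i j" and X3: "4 \<le> card X" and irr: "\<And>e. \<forall>k. e k \<in> S \<Longrightarrow> \<not> red X e" and ab: "a \<in> S" "b \<in> S"
  shows "latin_pred.rigid S X (G i j a b)"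
proof -
  interpret L: latin_pred S X "G i j a b" by (rule G_latin[OF d ab])
  have dd: "V = insert i (insert j X)" "i \<noteq> j" "i \<notin> X" "j \<notin> X" using d by (auto simp: dec_def)
  have fX: "finite X" using finite_V dd by simp
  show ?thesis unfolding L.rigid_def
  proof (intro ballI allI impI, rule ccontr)
    fix q r \<alpha> \<beta> assume q: "q \<in> X" "r \<in> X" "q \<noteq> r" and p: "\<alpha> permutes S" "\<beta> permutes S"
      and inv: "\<forall>x. (\<forall>k. x k \<in> S) \<longrightarrow> G i j a b (act q \<alpha> (act r \<beta> x)) = G i j a b x" and n: "\<not> (\<alpha> = id \<and> \<beta> = id)"
    have c2: "2 \<le> card (X - {q, r})" using X3 q fX by (simp add: card_Diff_subset)
    then have "X - {q, r} \<noteq> {}" by (metis card.empty not_numeral_le_zero)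
    then obtain w where w: "w \<in> X" "w \<noteq> q" "w \<noteq> r" by blast
    have n': "\<alpha> \<noteq> id \<or> \<beta> \<noteq> id" using n by blast
    have inv': "\<And>x. \<forall>k. x k \<in> S \<Longrightarrow> G i j a b (act q \<alpha> (act r \<beta> x)) = G i j a b x" using inv by blast
    have tr1: "\<exists>k. (\<alpha> ^^ k) u = v" if "u \<in> S" "v \<in> S" for u v
      by (rule L.two_autotopy_transitive(1)[OF finite_S prime_S q(1,2) w(1) q(3) w(2,3) p n' _ that]) (rule inv')
    have tr3: "G i j a b (act q (\<alpha> ^^ k) (act r (\<beta> ^^ k) x)) = G i j a b x" if "\<forall>k. x k \<in> S" for k x
      by (rule L.two_autotopy_transitive(3)[OF finite_S prime_S q(1,2) w(1) q(3) w(2,3) p n' _ ab(1) ab(1) that]) (rule inv')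
    define e where "e = (\<lambda>_. a)(j := b)"
    have e: "\<forall>k. e k \<in> S" "e i = a" "e j = b" using ab dd by (auto simp: e_def)
    have "splits X e {q, r}" unfolding splits_def
    proof (intro ballI impI)
      fix x y assume x: "x \<in> pts X e" and y: "y \<in> pts X e" and h: "F x" "F y" "F (mix {q, r} x y)"
      have v: "\<forall>k. x k \<in> S" "\<forall>k. y k \<in> S" using pts_in x y by blast+
      have FG: "F z = G i j a b z" if "z \<in> pts X e" for z
        by (rule F_eq_G) (use pts_off[OF that] dd e in auto)
      \<comment> \<open>A power of the autotopy takes \<open>x q\<close> to \<open>y q\<close>.
        Applied to the mixed point it shows that \<open>x r\<close> goes to \<open>y r\<close>;
        applied to \<open>x\<close> it then produces the opposite mixture.\<close>
      obtain k where k: "(\<alpha> ^^ k) (x q) = y q" using tr1[of "x q" "y q"] v by blast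
      have bk: "(\<beta> ^^ k) (x r) \<in> S" using funpow_permutes[OF p(2)] v(1) by (metis permutes_in_image)
      let ?m = "mix {q, r} x y"
      have m: "?m \<in> pts X e" "mix {q, r} y x \<in> pts X e" using x y pts_mix by auto
      have mv: "\<forall>k. ?m k \<in> S" using pts_in[OF m(1)] by blast
      have "G i j a b (act q (\<alpha> ^^ k) (act r (\<beta> ^^ k) ?m)) = G i j a b ?m" by (rule tr3[OF mv])
      moreover have "act q (\<alpha> ^^ k) (act r (\<beta> ^^ k) ?m) = y(r := (\<beta> ^^ k) (x r))"
        using k q by (auto simp: act_def mix_def fun_eq_iff)
      ultimately have "G i j a b (y(r := (\<beta> ^^ k) (x r)))" using h(3) FG[OF m(1)] by simp
      moreover have "G i j a b y" using h(2) FG[OF y] by simp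
      ultimately have b: "(\<beta> ^^ k) (x r) = y r" using L.H_unique[OF v(2) q(2) _ bk] by blast
      have "act q (\<alpha> ^^ k) (act r (\<beta> ^^ k) x) = mix {q, r} y x"
        using k b q by (auto simp: act_def mix_def fun_eq_iff)
      then have "G i j a b (mix {q, r} y x) = G i j a b x" using tr3[OF v(1), of k] by simp
      then show "F (mix {q, r} y x)" using FG[OF m(2)] FG[OF x] h(1) by simp
    qed
    then have "red X e" using q c2 by (intro redI[of "{q, r}"]) auto
    then show False using irr[OF e(1)] by blast
  qed
qed

text \<open>Exchange \<open>i\<close> with its twin \<open>A\<close>. The new set \<open>X'\<close>
  is irreducible too, its complement is \<open>{j, A}\<close>, and so it remains irreducible when
  \<open>j\<close> changes. A new twin \<open>B\<close> of \<open>i\<close> would split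
  \<open>X'\<close> by \<open>{i, B}\<close>.\<close>

lemma attach_const:
  assumes d: "dec X i j" and X4: "4 \<le> card X" and irr: "\<And>e. \<forall>k. e k \<in> S \<Longrightarrow> \<not> red X e"
    and e: "\<forall>k. e k \<in> S" and f: "f = e(j := b)" "b \<in> S"
    and A: "A \<in> X" "splits (insert i X) e {i, A}" and B: "B \<in> X" "splits (insert i X) f {i, B}"
  shows "A = B"
proof (rule ccontr)
  assume ne: "A \<noteq> B"
  have dd: "V = insert i (insert j X)" "i \<noteq> j" "i \<notin> X" "j \<notin> X" using d by (auto simp: dec_def)
  have fX: "finite X" using finite_V dd by simp
  define X' where "X' = insert i (X - {A})"
  have X': "card X' = card X" "X' \<subseteq> V" "j \<notin> X'" "A \<notin> X'" using dd A(1) fX X4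
    by (auto simp: X'_def card_Diff_singleton)
  have eq: "insert i (insert i X - {i, A}) = X'" using dd(3) A(1) unfolding X'_def by blast
  have "V = insert j (insert A X')" unfolding dd(1) X'_def using A(1) by blast
  moreover have "j \<noteq> A" using A(1) dd(4) by blast
  ultimately have d': "dec X' j A" using X'(3,4) unfolding dec_def by blast
  have ee: "e \<in> pts Y e" for Y using e by (rule pts_refl)
  have "\<not> red X' e"
  proof
    assume "red X' e"
    then obtain C where C: "C \<subseteq> X'" "i \<notin> C" "2 \<le> card C" "2 \<le> card (X' - C)" "splits X' e C"
      using red_avoid[of X' e i] unfolding X'_def by blast
    have CX: "C \<subseteq> X - {A}" using C(1,2) by (auto simp: X'_def)
    have "splits (insert i X) e C"
      by (rule splits_transfer[OF A(2) _ _ _ _ _ ee, of i]) (use CX dd(1,3) A(1) C(5) eq in auto)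
    then have "splits X e C" by (rule splits_restrict[OF _ ee]) auto
    moreover have "card (X - C) = card X - card C" "card (X' - C) = card X' - card C"
      using finite_subset[OF CX] fX C(1) CX by (auto intro!: card_Diff_subset)
    moreover have "C \<subseteq> X" "2 \<le> card (X - C)" using CX C(4) X'(1) calculation(2,3) by auto
    ultimately have "red X e" using C(3) redI by blast
    then show False using irr[OF e] by blast
  qed
  moreover have fv: "\<forall>k. f k \<in> S" using e f by simp
  ultimately have "\<not> red X' f" using irr_everywhere[OF d' _ e fv] X'(1) X4 by simp
  moreover have "splits X' f {i, B}"
    by (rule splits_restrict[OF B(2) pts_refl[OF fv]]) (auto simp: X'_def)
  moreover have "{i, B} \<subseteq> X'" "card {i, B} = 2" using ne B(1) dd by (auto simp: X'_def card_insert_if)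
  moreover have "2 \<le> card (X' - {i, B})"
    using X'(1) X4 calculation(3,4) by (simp add: card_Diff_subset)
  ultimately show False using redI[of "{i, B}" X' f] by simp
qed

theorem red_if_irreducible_pair_retract:
  assumes d: "dec X i j" and X4: "4 \<le> card X" and irr: "\<not> red X e0" and e0: "\<forall>k. e0 k \<in> S" and e: "\<forall>k. e k \<in> S"
  shows "red V e"
proof -
  have X3: "3 \<le> card X" using X4 by simp
  have irr': "\<not> red X f" if "\<forall>k. f k \<in> S" for f by (rule irr_everywhere[OF d irr e0 that])
  obtain s where s: "\<And>b. b \<in> S \<Longrightarrow> s b \<in> X"
    "\<And>b e. b \<in> S \<Longrightarrow> \<forall>k. e k \<in> S \<Longrightarrow> e j = b \<Longrightarrow> splits (insert i X) e {i, s b}"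
    using attach_function[OF d irr'] by metis
  obtain t where t: "\<And>a. a \<in> S \<Longrightarrow> t a \<in> X"
    "\<And>a e. a \<in> S \<Longrightarrow> \<forall>k. e k \<in> S \<Longrightarrow> e i = a \<Longrightarrow> splits (insert j X) e {j, t a}"
    using attach_function[OF dec_sym[OF d] irr'] by metis
  obtain \<sigma> \<tau> where T: "table S X (G i j) s t \<sigma> \<tau>" by (rule table_exists[OF d X3 s t])
  have RT: "rigid_table S X (G i j) s t \<sigma> \<tau>"
    unfolding rigid_table_def rigid_table_axioms_def using T rigid_if_irr[OF d X4 irr'] by blast
  define c where "c = e i"
  have c: "c \<in> S" "\<forall>k. (\<lambda>_. c) k \<in> S" using e by (auto simp: c_def)
  have sc: "s b = s c" if b: "b \<in> S" for b
  proof (rule attach_const[OF d X4 irr' _ _ c(1) s(1)[OF b] _ s(1)[OF c(1)]])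
    show "\<forall>k. (\<lambda>_. b) k \<in> S" using b by simp
    show "splits (insert i X) (\<lambda>_. b) {i, s b}" by (rule s(2)[OF b]) (use b in auto)
    show "splits (insert i X) ((\<lambda>_. b)(j := c)) {i, s c}" by (rule s(2)[OF c(1)]) (use b c in auto)
  qed simp_all
  have tc: "t b = t c" if b: "b \<in> S" for b
  proof (rule attach_const[OF dec_sym[OF d] X4 irr' _ _ c(1) t(1)[OF b] _ t(1)[OF c(1)]])
    show "\<forall>k. (\<lambda>_. b) k \<in> S" using b by simp
    show "splits (insert j X) (\<lambda>_. b) {j, t b}" by (rule t(2)[OF b]) (use b in auto)
    show "splits (insert j X) ((\<lambda>_. b)(i := c)) {j, t c}" by (rule t(2)[OF c(1)]) (use b c in auto)
  qed simp_all
  show ?thesis by (rule red_if_const[OF RT d X3 s(2) t(2) sc tc e])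
qed

lemma three_not_red: "card X = 3 \<Longrightarrow> \<not> red X e"
proof
  assume X: "card X = 3" "red X e"
  then obtain A where A: "A \<subseteq> X" "2 \<le> card A" "2 \<le> card (X - A)" unfolding red_def by blast
  have fX: "finite X" using X card.infinite by fastforce
  have "card A + card (X - A) = 3"
    using A(1) fX X(1) card_Diff_subset[of A X] card_mono[OF fX A(1)] finite_subset[OF A(1) fX] by simp
  then show False using A by linarith
qed

text \<open>On three coordinates rigidity is not automatic, but known for one pair of values it
  spreads over the table, as all entries are isotopic.\<close>

theorem red_if_rigid_triple:
  assumes d: "dec X i j" and X3: "card X = 3" and r: "a \<in> S" "b \<in> S" "latin_pred.rigid S X (G i j a b)" and e: "\<forall>k. e k \<in> S"
  shows "red V e"
proof -
  have X3': "3 \<le> card X" using X3 by simp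
  note irr' = three_not_red[OF X3]
  obtain s where s: "\<And>b. b \<in> S \<Longrightarrow> s b \<in> X"
    "\<And>b e. b \<in> S \<Longrightarrow> \<forall>k. e k \<in> S \<Longrightarrow> e j = b \<Longrightarrow> splits (insert i X) e {i, s b}"
    using attach_function[OF d irr'] by metis
  obtain t where t: "\<And>a. a \<in> S \<Longrightarrow> t a \<in> X"
    "\<And>a e. a \<in> S \<Longrightarrow> \<forall>k. e k \<in> S \<Longrightarrow> e i = a \<Longrightarrow> splits (insert j X) e {j, t a}"
    using attach_function[OF dec_sym[OF d] irr'] by metis
  obtain \<sigma> \<tau> where T: "table S X (G i j) s t \<sigma> \<tau>" by (rule table_exists[OF d X3' s t])
  have RT: "rigid_table S X (G i j) s t \<sigma> \<tau>"
    unfolding rigid_table_def rigid_table_axioms_def using T table.rigid_all[OF T r] by blast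
  have c: "s x = s a \<and> t x = t a" if "x \<in> S" for x
    by (rule rigid_table.rigid_table_const[OF RT prime_S X3 that r(1) that r(1)])
  show ?thesis by (rule red_if_const[OF RT d X3' s(2) t(2) _ _ e, of "s a" "t a"]) (use c in auto)
qed

end

section \<open>Translation groups of order a prime\<close>

text \<open>\<open>c\<close> acts on \<open>S\<close> as a single cycle, and its powers form a
  regular cyclic group.\<close>

definition transitive_on :: "'a set \<Rightarrow> ('a \<Rightarrow> 'a) \<Rightarrow> bool" where
  "transitive_on S c \<longleftrightarrow> c permutes S \<and> (\<forall>u \<in> S. \<forall>v \<in> S. \<exists>k. (c ^^ k) u = v)"

text \<open>A regular abelian group is its own centralizer.\<close>

lemma transitive_on_commuting:
  assumes c: "transitive_on S c" and \<rho>: "\<rho> permutes S" and comm: "\<rho> \<circ> c = c \<circ> \<rho>" and S: "S \<noteq> {}"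
  shows "\<exists>k. \<rho> = c ^^ k"
proof -
  obtain u where u: "u \<in> S" using S by blast
  have cp: "c permutes S" using c by (simp add: transitive_on_def)
  have "\<rho> u \<in> S" using u \<rho> by (simp add: permutes_in_image)
  then obtain k where k: "(c ^^ k) u = \<rho> u" using c u unfolding transitive_on_def by blast
  have comm': "\<rho> ((c ^^ n) v) = (c ^^ n) (\<rho> v)" for n v
    by (induction n) (use fun_cong[OF comm] in \<open>simp_all add: comp_def\<close>)
  have "\<rho> v = (c ^^ k) v" for v
  proof (cases "v \<in> S")
    case True
    then obtain n where n: "(c ^^ n) u = v" using c u unfolding transitive_on_def by blast
    have "\<rho> v = (c ^^ n) ((c ^^ k) u)" using comm'[of n u] n k by simp
    also have "\<dots> = (c ^^ k) ((c ^^ n) u)" by (metis add.commute comp_apply funpow_add)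
    finally show ?thesis using n by simp
  next
    case False
    then show ?thesis using \<rho> funpow_permutes[OF cp, of k] by (simp add: permutes_not_in)
  qed
  then show ?thesis by blast
qed

lemma transitive_on_fixpoint:
  assumes c: "transitive_on S c" and u: "u \<in> S" "(c ^^ k) u = u"
  shows "c ^^ k = id"
proof
  fix v show "(c ^^ k) v = id v"
  proof (cases "v \<in> S")
    case True
    then obtain n where n: "(c ^^ n) u = v" using c u unfolding transitive_on_def by blast
    have "(c ^^ k) ((c ^^ n) u) = (c ^^ n) ((c ^^ k) u)" by (metis add.commute comp_apply funpow_add)
    then show ?thesis using n u by simp
  next
    case False
    then show ?thesis using c funpow_permutes[of c S k] by (simp add: permutes_not_in transitive_on_def)
  qed
qed

lemma transitive_on_order:
  assumes c: "transitive_on S c" and S: "finite S" "S \<noteq> {}"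
  shows "c ^^ card S = id"
proof -
  obtain u where u: "u \<in> S" using S by blast
  have cp: "(c ^^ k) permutes S" for k using c funpow_permutes by (auto simp: transitive_on_def)
  have inS: "(c ^^ k) u \<in> S" for k using cp u by (metis permutes_in_image)
  have "\<not> inj_on (\<lambda>k. (c ^^ k) u) {..card S}"
  proof
    assume "inj_on (\<lambda>k. (c ^^ k) u) {..card S}"
    then have "card {..card S} \<le> card S" using card_inj_on_le[of _ "{..card S}" S] inS S by blast
    then show False by simp
  qed
  then obtain i j where "i \<le> card S" "j \<le> card S" "i \<noteq> j" "(c ^^ i) u = (c ^^ j) u" unfolding inj_on_def by blast
  then obtain i j where ij: "i < j" "j \<le> card S" "(c ^^ i) u = (c ^^ j) u"
    by (metis nat_neq_iff)
  define N where "N = j - i"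
  have N: "N > 0" "N \<le> card S" using ij by (auto simp: N_def)
  have "(c ^^ j) u = (c ^^ i) ((c ^^ N) u)" using ij(1) unfolding N_def
    by (metis comp_apply funpow_add le_add_diff_inverse less_imp_le_nat)
  then have Nu: "(c ^^ N) u = u" using ij(3) permutes_inj[OF cp[of i]] by (metis injD)
  have idN: "c ^^ N = id" by (rule transitive_on_fixpoint[OF c u Nu])
  have "S \<subseteq> (\<lambda>k. (c ^^ k) u) ` {..<N}"
  proof
    fix v assume "v \<in> S"
    then obtain k where k: "(c ^^ k) u = v" using c u unfolding transitive_on_def by blast
    have "c ^^ (N * (k div N)) = id" using idN by (simp add: funpow_mult[symmetric] id_def[symmetric])
    then have "c ^^ (k mod N + N * (k div N)) = c ^^ (k mod N)" by (simp only: funpow_add) simp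
    then have "(c ^^ (k mod N)) u = v" using k by simp
    then show "v \<in> (\<lambda>k. (c ^^ k) u) ` {..<N}" using N(1) by (intro image_eqI[of _ _ "k mod N"]) auto
  qed
  then have "card S \<le> card ((\<lambda>k. (c ^^ k) u) ` {..<N})" by (intro card_mono) auto
  also have "\<dots> \<le> N" using card_image_le[of "{..<N}"] by simp
  finally have "N = card S" using N by simp
  then show ?thesis using idN by simp
qed

lemma transitive_on_nontrivial:
  assumes c: "transitive_on S c" and S: "2 \<le> card S" shows "c \<noteq> id"
proof
  assume "c = id"
  then have "(c ^^ k) u = u" for k u using id_funpow[of k] by (metis id_apply)
  then have "u = v" if "u \<in> S" "v \<in> S" for u v using c that unfolding transitive_on_def by metis
  moreover have "finite S" using S card.infinite by fastforce
  ultimately have "card S \<le> 1" by (simp add: card_le_Suc0_iff_eq)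
  then show False using S by simp
qed

lemma transitive_on_power:
  assumes c: "transitive_on S c" and S: "finite S" "prime (card S)" and n: "c ^^ n \<noteq> id"
  shows "transitive_on S (c ^^ n)"
  unfolding transitive_on_def
proof (intro conjI ballI)
  show p: "(c ^^ n) permutes S" using c funpow_permutes by (auto simp: transitive_on_def)
  fix u v assume uv: "u \<in> S" "v \<in> S"
  show "\<exists>k. ((c ^^ n) ^^ k) u = v"
  proof (rule semiregular_prime_transitive[OF p S n _ uv])
    fix k w assume "w \<in> S" "((c ^^ n) ^^ k) w = w"
    then show "(c ^^ n) ^^ k = id" using transitive_on_fixpoint[OF c] by (simp add: funpow_mult)
  qed
qed

text \<open>A fixed-point-free element normalizing a regular cyclic group of prime order belongs to it: if the
  induced automorphism \<open>c \<mapsto> c\<^sup>l\<close> is nontrivial, the element acts as \<open>n \<mapsto> l n + m\<close> modulo \<open>card S\<close>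
  and has a fixed point.\<close>

lemma normalizing_transitive:
  assumes c: "transitive_on S c" and \<rho>: "transitive_on S \<rho>" and S: "finite S" "prime (card S)"
    and norm: "\<rho> \<circ> c = (c ^^ l) \<circ> \<rho>"
  shows "\<exists>k. \<rho> = c ^^ k"
proof -
  let ?p = "card S"
  have ne: "S \<noteq> {}" using S by auto
  obtain u where u: "u \<in> S" using ne by blast
  have \<rho>p: "\<rho> permutes S" and cperm: "c permutes S" using \<rho> c by (auto simp: transitive_on_def)
  have step: "\<rho> ((c ^^ n) x) = (c ^^ (l * n)) (\<rho> x)" for n x
  proof (induction n)
    case (Suc n)
    have "\<rho> ((c ^^ Suc n) x) = (c ^^ l) (\<rho> ((c ^^ n) x))" using fun_cong[OF norm, of "(c ^^ n) x"] by simp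
    also have "\<dots> = (c ^^ (l * Suc n)) (\<rho> x)" unfolding Suc by (simp add: funpow_add)
    finally show ?case .
  qed simp
  have cp: "c ^^ ?p = id" by (rule transitive_on_order[OF c S(1) ne])
  have cong_pow: "c ^^ a = c ^^ b" if "[a = b] (mod ?p)" for a b
  proof -
    have "c ^^ k = c ^^ (k mod ?p)" for k
    proof -
      have "c ^^ (?p * (k div ?p)) = id" using cp by (simp add: funpow_mult[symmetric] id_def[symmetric])
      then have "c ^^ (k mod ?p + ?p * (k div ?p)) = c ^^ (k mod ?p)" by (simp only: funpow_add) simp
      then show ?thesis by simp
    qed
    then show ?thesis using that unfolding cong_def by metis
  qed
  have "[l = 1] (mod ?p)"
  proof (rule ccontr)
    assume n1: "\<not> [l = 1] (mod ?p)"
    \<comment> \<open>\<open>d\<close> represents \<open>l - 1\<close> modulo \<open>card S\<close>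
      without leaving the natural numbers.\<close>
    define d where "d = l + ?p - 1"
    have d: "d + 1 = l + ?p" using prime_gt_0_nat[OF S(2)] by (simp add: d_def)
    have "\<not> ?p dvd d"
    proof
      assume "?p dvd d"
      then have "[d + 1 = 0 + 1] (mod ?p)" by (intro cong_add) (simp_all add: cong_0_iff)
      then have "[l + ?p = 1] (mod ?p)" using d by simp
      then show False using n1 by (simp add: cong_def)
    qed
    then have "coprime d ?p" using prime_imp_coprime[OF S(2)] coprime_commute by blast
    then obtain x where x: "[d * x = 1] (mod ?p)" using cong_solve_coprime_nat by auto
    have "\<rho> u \<in> S" using u \<rho>p by (simp add: permutes_in_image)
    then obtain m where m: "(c ^^ m) u = \<rho> u" using c u unfolding transitive_on_def by blast
    \<comment> \<open>The factor \<open>card S - 1\<close> represents -1, so \<open>n\<close> is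
      \<open>- m / (l - 1)\<close> modulo \<open>card S\<close>, the solution of
      \<open>l * n + m = n\<close>.\<close>
    define n where "n = x * (m * (?p - 1))"
    have "[d * n = 1 * (m * (?p - 1))] (mod ?p)" using cong_scalar_right[OF x, of "m * (?p - 1)"]
      by (simp add: n_def mult.assoc)
    then have "[d * n + (n + m) = 1 * (m * (?p - 1)) + (n + m)] (mod ?p)" by (rule cong_add) simp
    moreover have "d * n + (n + m) = ?p * n + (l * n + m)"
    proof -
      have "d * n + (n + m) = (d + 1) * n + m" by (simp add: algebra_simps)
      then show ?thesis unfolding d by (simp add: algebra_simps)
    qed
    moreover have "1 * (m * (?p - 1)) + (n + m) = ?p * m + n"
    proof -
      have "m * (?p - 1) + m = m * ((?p - 1) + 1)" by (simp only: distrib_left mult_1_right)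
      then have "m * (?p - 1) + m = m * ?p" using prime_gt_0_nat[OF S(2)] by simp
      then show ?thesis by (simp add: algebra_simps)
    qed
    ultimately have "[?p * n + (l * n + m) = ?p * m + n] (mod ?p)" by (simp only:)
    then have "[l * n + m = n] (mod ?p)" by (simp add: cong_def)
    then have "(c ^^ (l * n + m)) u = (c ^^ n) u" using cong_pow by metis
    then have "\<rho> ((c ^^ n) u) = (c ^^ n) u" using step[of n u] m by (simp add: funpow_add)
    moreover have "(c ^^ n) u \<in> S" using funpow_permutes[OF cperm] u by (metis permutes_in_image)
    ultimately have "\<rho> ^^ 1 = id" by (intro transitive_on_fixpoint[OF \<rho>]) simp_all
    then show False using transitive_on_nontrivial[OF \<rho> prime_ge_2_nat[OF S(2)]] by simp
  qed
  then have "c ^^ l = c ^^ 1" by (rule cong_pow)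
  then have "\<rho> \<circ> c = c \<circ> \<rho>" using norm by simp
  then show ?thesis by (rule transitive_on_commuting[OF c \<rho>p _ ne])
qed

text \<open>Permutations at \<open>q\<close> whose effect on \<open>H\<close> can also be produced
  at \<open>r\<close>. For \<open>x q + x r + x w = 0\<close> in a cyclic group they are the
  translations.\<close>

definition Tr :: "'a set \<Rightarrow> (('i \<Rightarrow> 'a) \<Rightarrow> bool) \<Rightarrow> 'i \<Rightarrow> 'i \<Rightarrow> ('a \<Rightarrow> 'a) set" where
  "Tr S H q r = {\<alpha>. \<alpha> permutes S \<and>
     (\<exists>\<beta>. \<beta> permutes S \<and> (\<forall>x. (\<forall>k. x k \<in> S) \<longrightarrow> H (act q \<alpha> x) = H (act r \<beta> x)))}"

text \<open>An isotopy at a third coordinate commutes with the actions at \<open>q\<close> and at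
  \<open>r\<close>.\<close>

lemma Tr_mono:
  assumes z: "z \<noteq> q" "z \<noteq> r" and \<sigma>: "\<sigma> permutes S"
    and H': "\<And>x. \<forall>k. x k \<in> S \<Longrightarrow> H' x = H (act z \<sigma> x)"
  shows "Tr S H q r \<subseteq> Tr S H' q r"
proof
  fix \<alpha> assume "\<alpha> \<in> Tr S H q r"
  then obtain \<beta> where b: "\<alpha> permutes S" "\<beta> permutes S" "\<And>x. \<forall>k. x k \<in> S \<Longrightarrow> H (act q \<alpha> x) = H (act r \<beta> x)"
    unfolding Tr_def by blast
  have "H' (act q \<alpha> x) = H' (act r \<beta> x)" if x: "\<forall>k. x k \<in> S" for x
  proof -
    have "H' (act q \<alpha> x) = H (act z \<sigma> (act q \<alpha> x))" by (rule H'[OF act_val[OF b(1) x]])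
    also have "act z \<sigma> (act q \<alpha> x) = act q \<alpha> (act z \<sigma> x)" by (rule act_commute[OF z(1)])
    also have "H \<dots> = H (act r \<beta> (act z \<sigma> x))" by (rule b(3)[OF act_val[OF \<sigma> x]])
    also have "act r \<beta> (act z \<sigma> x) = act z \<sigma> (act r \<beta> x)" by (rule act_commute[OF z(2)[symmetric]])
    also have "H \<dots> = H' (act r \<beta> x)" by (rule H'[OF act_val[OF b(2) x], symmetric])
    finally show ?thesis .
  qed
  then show "\<alpha> \<in> Tr S H' q r" unfolding Tr_def using b by blast
qed

lemma Tr_eq:
  assumes z: "z \<noteq> q" "z \<noteq> r" and \<sigma>: "\<sigma> permutes S"
    and H': "\<And>x. \<forall>k. x k \<in> S \<Longrightarrow> H' x = H (act z \<sigma> x)"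
  shows "Tr S H' q r = Tr S H q r"
proof
  show "Tr S H q r \<subseteq> Tr S H' q r" by (rule Tr_mono[OF z \<sigma>]) (rule H')
  have "H x = H' (act z (inv \<sigma>) x)" if "\<forall>k. x k \<in> S" for x
    using H'[OF act_val[OF permutes_inv[OF \<sigma>] that]] by (simp add: act_inv(1)[OF \<sigma>])
  then show "Tr S H' q r \<subseteq> Tr S H q r" by (intro Tr_mono[OF z permutes_inv[OF \<sigma>]])
qed

lemma Tr_conj:
  assumes z: "z \<noteq> r" and \<sigma>: "\<sigma> permutes S"
    and H': "\<And>x. \<forall>k. x k \<in> S \<Longrightarrow> H' x = H (act z \<sigma> x)" and \<alpha>: "\<alpha> \<in> Tr S H' z r"
  shows "\<sigma> \<circ> \<alpha> \<circ> inv \<sigma> \<in> Tr S H z r"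
proof -
  obtain \<beta> where b: "\<alpha> permutes S" "\<beta> permutes S" "\<And>x. \<forall>k. x k \<in> S \<Longrightarrow> H' (act z \<alpha> x) = H' (act r \<beta> x)"
    using \<alpha> unfolding Tr_def by blast
  have "H (act z (\<sigma> \<circ> \<alpha> \<circ> inv \<sigma>) x) = H (act r \<beta> x)" if x: "\<forall>k. x k \<in> S" for x
  proof -
    let ?y = "act z (inv \<sigma>) x"
    have y: "\<forall>k. ?y k \<in> S" by (rule act_val[OF permutes_inv[OF \<sigma>] x])
    have "H (act z (\<sigma> \<circ> \<alpha> \<circ> inv \<sigma>) x) = H (act z \<sigma> (act z \<alpha> ?y))" by (simp add: act_comp comp_assoc)
    also have "\<dots> = H' (act z \<alpha> ?y)" by (rule H'[OF act_val[OF b(1) y], symmetric])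
    also have "\<dots> = H' (act r \<beta> ?y)" by (rule b(3)[OF y])
    also have "\<dots> = H (act z \<sigma> (act r \<beta> ?y))" by (rule H'[OF act_val[OF b(2) y]])
    also have "act z \<sigma> (act r \<beta> ?y) = act r \<beta> (act z \<sigma> ?y)" by (rule act_commute[OF z])
    also have "act z \<sigma> ?y = x" by (rule act_inv(1)[OF \<sigma>])
    finally show ?thesis .
  qed
  moreover have "\<sigma> \<circ> \<alpha> \<circ> inv \<sigma> permutes S" by (intro permutes_compose permutes_inv \<sigma> b)
  ultimately show ?thesis unfolding Tr_def using b by blast
qed

context latin_pred
begin

lemma act_injective:
  assumes q: "q \<in> X" "w \<in> X" "w \<noteq> q" and p: "\<alpha> permutes S" "\<beta> permutes S"
    and eq: "\<And>x. \<forall>k. x k \<in> S \<Longrightarrow> H (act q \<alpha> x) = H (act q \<beta> x)"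
  shows "\<alpha> = \<beta>"
proof
  fix u show "\<alpha> u = \<beta> u"
  proof (cases "u \<in> S")
    case True
    define x0 where "x0 = (\<lambda>_::'i. u)(q := \<alpha> u)"
    have au: "\<alpha> u \<in> S" "\<beta> u \<in> S" using True p by (auto simp: permutes_in_image)
    have x0: "\<forall>k. x0 k \<in> S" using True au by (simp add: x0_def)
    obtain c where c: "c \<in> S" "H (x0(w := c))" by (rule H_exists[OF x0 q(2)])
    define x where "x = (\<lambda>_. u)(w := c)"
    have x: "\<forall>k. x k \<in> S" using True c by (simp add: x_def)
    have e: "act q \<alpha> x = x0(w := c)" using q(3) by (auto simp: act_def x_def x0_def fun_eq_iff)
    have v: "\<forall>k. (x0(w := c)) k \<in> S" using x0 c by simp
    have "H (act q \<beta> x)" using eq[OF x] c(2) unfolding e by simp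
    moreover have "act q \<beta> x = (x0(w := c))(q := \<beta> u)" using q(3) by (auto simp: act_def x_def x0_def fun_eq_iff)
    ultimately have "\<beta> u = (x0(w := c)) q" using H_unique[OF v q(1) c(2) au(2)] by simp
    then show ?thesis using q(3) by (simp add: x0_def)
  next
    case False then show ?thesis using p by (simp add: permutes_not_in)
  qed
qed

lemma transitive_transfer:
  assumes q: "q \<in> X" "w \<in> X" "q \<noteq> w" and c: "transitive_on S \<alpha>" and g: "\<gamma> permutes S"
    and eq: "\<And>k x. \<forall>k. x k \<in> S \<Longrightarrow> H (act q (\<alpha> ^^ k) x) = H (act w (\<gamma> ^^ k) x)"
  shows "transitive_on S \<gamma>"
  unfolding transitive_on_def
proof (intro conjI ballI g)
  fix u v assume uv: "u \<in> S" "v \<in> S"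
  define y where "y = (\<lambda>_::'i. u)(w := v)"
  have y: "\<forall>k. y k \<in> S" using uv by (simp add: y_def)
  have z: "\<forall>k. (\<lambda>_::'i. u) k \<in> S" using uv by simp
  obtain a where a: "a \<in> S" "H (y(q := a))" by (rule H_exists[OF y q(1)])
  obtain a' where a': "a' \<in> S" "H ((\<lambda>_. u)(q := a'))" by (rule H_exists[OF z q(1)])
  obtain k where k: "(\<alpha> ^^ k) a = a'" using c a a' unfolding transitive_on_def by blast
  define x where "x = (\<lambda>_::'i. u)(q := a)"
  have x: "\<forall>k. x k \<in> S" using uv a by (simp add: x_def)
  have "act q (\<alpha> ^^ k) x = (\<lambda>_. u)(q := a')" using k by (auto simp: act_def x_def fun_eq_iff)
  then have "H (act w (\<gamma> ^^ k) x)" using eq[OF x, of k] a'(2) by simp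
  moreover have "act w (\<gamma> ^^ k) x = (y(q := a))(w := (\<gamma> ^^ k) u)" using q(3) by (auto simp: act_def x_def y_def fun_eq_iff)
  moreover have "(\<gamma> ^^ k) u \<in> S" using funpow_permutes[OF g] uv by (metis permutes_in_image)
  moreover have v: "\<forall>k. (y(q := a)) k \<in> S" using y a by simp
  ultimately have "(\<gamma> ^^ k) u = (y(q := a)) w" using H_unique[OF v q(2) a(2)] by simp
  then show "\<exists>k. (\<gamma> ^^ k) u = v" using q(3) by (auto simp: y_def)
qed

lemma act_powers:
  assumes q: "q \<noteq> w" and p: "\<alpha> permutes S" "\<gamma> permutes S"
    and eq: "\<And>x. \<forall>k. x k \<in> S \<Longrightarrow> H (act q \<alpha> x) = H (act w \<gamma> x)" and x: "\<forall>k. x k \<in> S"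
  shows "H (act q (\<alpha> ^^ n) x) = H (act w (\<gamma> ^^ n) x)"
  using x
proof (induction n arbitrary: x)
  case (Suc n)
  have pn: "(\<alpha> ^^ n) permutes S" using p funpow_permutes by blast
  have "H (act q (\<alpha> ^^ Suc n) x) = H (act q \<alpha> (act q (\<alpha> ^^ n) x))" by (simp add: act_comp)
  also have "\<dots> = H (act w \<gamma> (act q (\<alpha> ^^ n) x))" by (rule eq[OF act_val[OF pn Suc.prems]])
  also have "act w \<gamma> (act q (\<alpha> ^^ n) x) = act q (\<alpha> ^^ n) (act w \<gamma> x)" by (rule act_commute[OF q[symmetric]])
  also have "H \<dots> = H (act w (\<gamma> ^^ n) (act w \<gamma> x))" by (rule Suc.IH[OF act_val[OF p(2) Suc.prems]])
  also have "act w (\<gamma> ^^ n) (act w \<gamma> x) = act w (\<gamma> ^^ Suc n) x" by (simp add: act_comp funpow_Suc_right del: funpow.simps)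
  finally show ?case .
qed (simp add: act_id[unfolded id_def] id_def)

text \<open>The given autotopy is transitive at \<open>q\<close>, so two solutions with the same
  value at \<open>w\<close> differ by one of its powers. Hence a shift by \<alpha> at
  \<open>q\<close> can be undone or produced at \<open>w\<close> alone, by \<open>twin_perm\<close>,
  and all three coordinates carry matching cycles.\<close>

lemma cyclic_translations:
  assumes nr: "\<not> rigid" and fin: "finite S" "prime (card S)" and X: "card X = 3"
  shows "\<exists>c. (\<forall>q \<in> X. transitive_on S (c q)) \<and>
    (\<forall>q \<in> X. \<forall>r \<in> X. \<forall>x. (\<forall>k. x k \<in> S) \<longrightarrow> H (act q (c q) x) = H (act r (c r) x))"
proof -
  obtain q r \<alpha> \<beta> where q: "q \<in> X" "r \<in> X" "q \<noteq> r" and p: "\<alpha> permutes S" "\<beta> permutes S"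
    and inv: "\<And>x. \<forall>k. x k \<in> S \<Longrightarrow> H (act q \<alpha> (act r \<beta> x)) = H x" and n: "\<alpha> \<noteq> id \<or> \<beta> \<noteq> id"
    using nr unfolding rigid_def by blast
  have finX: "finite X" using X card.infinite by fastforce
  have "card (X - {q, r}) = 1" using q X finX by (simp add: card_Diff_subset)
  then obtain w where w: "X - {q, r} = {w}" by (rule card_1_singletonE)
  have w': "w \<in> X" "w \<noteq> q" "w \<noteq> r" and Xe: "X = {q, r, w}" using w q by auto
  have tr: "\<exists>k. (\<alpha> ^^ k) u = v" if "u \<in> S" "v \<in> S" for u v
    by (rule two_autotopy_transitive(1)[OF fin q(1,2) w'(1) q(3) w'(2,3) p n _ that]) (rule inv)
  have c0: "\<exists>c. c \<in> S" using prime_ge_2_nat[OF fin(2)] by (metis card.empty equals0I not_numeral_le_zero)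
  then obtain c0 where c0: "c0 \<in> S" by blast
  have pow: "H (act q (\<alpha> ^^ k) (act r (\<beta> ^^ k) x)) = H x" if "\<forall>k. x k \<in> S" for k x
    by (rule two_autotopy_transitive(3)[OF fin q(1,2) w'(1) q(3) w'(2,3) p n _ c0 c0 that]) (rule inv)
  have ta: "transitive_on S \<alpha>" using tr p unfolding transitive_on_def by blast
  define Q where "Q x = H (act q \<alpha> x)" for x
  have Ql: "latin_pred S X Q"
  proof
    fix x :: "'i \<Rightarrow> 'a" and s assume x: "\<forall>k. x k \<in> S" and s: "s \<in> X"
    show "\<exists>!c. c \<in> S \<and> Q (x(s := c))"
    proof (cases "s = q")
      case True
      have e: "Q (x(s := c)) = H (x(s := \<alpha> c))" for c using True by (simp add: Q_def act_def)
      obtain d where d: "d \<in> S" "H (x(s := d))" by (rule H_exists[OF x s])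
      have uq: "d' = d" if "d' \<in> S" "H (x(s := d'))" for d' using H_solve[OF x s] d that by blast
      have "d \<in> \<alpha> ` S" using permutes_image[OF p(1)] d(1) by simp
      then obtain c where c: "c \<in> S" "\<alpha> c = d" by (elim imageE) simp
      show ?thesis
      proof (rule ex1I[of _ c])
        show "c \<in> S \<and> Q (x(s := c))" using c d e by simp
        fix c' assume "c' \<in> S \<and> Q (x(s := c'))"
        then have "\<alpha> c' = d" using uq[of "\<alpha> c'"] e p(1) by (simp add: permutes_in_image)
        then show "c' = c" using c(2) permutes_inj[OF p(1)] by (metis injD)
      qed
    next
      case False
      have e: "Q (x(s := c)) = H ((act q \<alpha> x)(s := c))" for c using False by (simp add: Q_def act_def fun_upd_twist)
      show ?thesis unfolding e by (rule H_solve[OF act_val[OF p(1) x] s])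
    qed
  next
    fix x y :: "'i \<Rightarrow> 'a" assume "\<And>k. k \<in> X \<Longrightarrow> x k = y k"
    then show "Q x = Q y" unfolding Q_def using q(1) by (intro H_cong) (simp add: act_def)
  qed
  have same: "\<exists>k. x q = (\<alpha> ^^ k) (y q) \<and> x r = (\<beta> ^^ k) (y r)"
    if x: "\<forall>k. x k \<in> S" and y: "\<forall>k. y k \<in> S" and h: "H x" "H y" "x w = y w" for x y
  proof -
    obtain k where k: "(\<alpha> ^^ k) (y q) = x q" using tr x y by blast
    have "H (act q (\<alpha> ^^ k) (act r (\<beta> ^^ k) y))" using pow[OF y] h(2) by simp
    moreover have "H (act q (\<alpha> ^^ k) (act r (\<beta> ^^ k) y)) = H (x(r := (\<beta> ^^ k) (y r)))"
      by (rule H_cong) (use Xe q w' k h(3) in \<open>auto simp: act_def\<close>)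
    moreover have "(\<beta> ^^ k) (y r) \<in> S" using funpow_permutes[OF p(2)] y by (metis permutes_in_image)
    ultimately have "(\<beta> ^^ k) (y r) = x r" using H_unique[OF x q(2) h(1)] by blast
    then show ?thesis using k by metis
  qed
  have PQ: "Q (x(w := y w))" if x: "\<forall>k. x k \<in> S" and y: "\<forall>k. y k \<in> S" and h: "H x" "Q y" "H (y(w := x w))" for x y
  proof -
    have yv: "\<forall>k. (y(w := x w)) k \<in> S" using x y by simp
    obtain k where k: "x q = (\<alpha> ^^ k) (y q)" "x r = (\<beta> ^^ k) (y r)"
      using same[OF x yv h(1,3)] w'(2,3) by auto
    have "H (act q (\<alpha> ^^ k) (act r (\<beta> ^^ k) (act q \<alpha> y)))" using pow[OF act_val[OF p(1) y]] h(2) by (simp add: Q_def)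
    moreover have "H (act q (\<alpha> ^^ k) (act r (\<beta> ^^ k) (act q \<alpha> y))) = H (act q \<alpha> (x(w := y w)))"
      by (rule H_cong) (use Xe q w' k in \<open>auto simp: act_def funpow_swap1\<close>)
    ultimately show ?thesis by (simp add: Q_def)
  qed
  have QP: "H (x(w := y w))" if x: "\<forall>k. x k \<in> S" and y: "\<forall>k. y k \<in> S" and h: "Q x" "H y" "Q (y(w := x w))" for x y
  proof -
    have yv: "\<forall>k. act q \<alpha> (y(w := x w)) k \<in> S" using x y by (intro act_val p) simp
    have xv: "\<forall>k. act q \<alpha> x k \<in> S" by (rule act_val[OF p(1) x])
    have "\<exists>k. act q \<alpha> x q = (\<alpha> ^^ k) (act q \<alpha> (y(w := x w)) q) \<and> act q \<alpha> x r = (\<beta> ^^ k) (act q \<alpha> (y(w := x w)) r)"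
      by (rule same[OF xv yv h(1)[unfolded Q_def] h(3)[unfolded Q_def]]) (use w' in \<open>simp add: act_def\<close>)
    then obtain k where k: "\<alpha> (x q) = (\<alpha> ^^ k) (\<alpha> (y q))" "x r = (\<beta> ^^ k) (y r)"
      using w' q by (auto simp: act_def)
    have "\<alpha> (x q) = \<alpha> ((\<alpha> ^^ k) (y q))" using k(1) by (simp add: funpow_swap1)
    then have k1: "x q = (\<alpha> ^^ k) (y q)" using permutes_inj[OF p(1)] by (metis injD)
    have "H (act q (\<alpha> ^^ k) (act r (\<beta> ^^ k) y))" using pow[OF y] h(2) by simp
    moreover have "H (act q (\<alpha> ^^ k) (act r (\<beta> ^^ k) y)) = H (x(w := y w))"
      by (rule H_cong) (use Xe q w' k(2) k1 in \<open>auto simp: act_def\<close>)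
    ultimately show ?thesis by simp
  qed
  have "\<exists>\<gamma>. \<gamma> permutes S \<and> (\<forall>x. (\<forall>k. x k \<in> S) \<longrightarrow> Q x = H (act w \<gamma> x))"
    by (rule twin_perm[OF latin_pred_axioms Ql fin(1) c0 w'(1) q(1) w'(2)[symmetric]]) (rule PQ QP; assumption)+
  then obtain \<gamma> where g: "\<gamma> permutes S" "\<And>x. \<forall>k. x k \<in> S \<Longrightarrow> H (act q \<alpha> x) = H (act w \<gamma> x)"
    unfolding Q_def by blast
  have b: "H (act q \<alpha> x) = H (act r (inv_into UNIV \<beta>) x)" if x: "\<forall>k. x k \<in> S" for x
  proof -
    have bi: "inv \<beta> permutes S" using p(2) by (rule permutes_inv)
    have "H (act q \<alpha> (act r \<beta> (act r (inv \<beta>) x))) = H (act r (inv \<beta>) x)" by (rule inv[OF act_val[OF bi x]])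
    then show ?thesis by (simp only: act_inv(1)[OF p(2)])
  qed
  have bi: "inv \<beta> permutes S" using p(2) by (rule permutes_inv)
  have tb: "transitive_on S (inv \<beta>)" by (rule transitive_transfer[OF q ta bi act_powers[OF q(3) p(1) bi b]])
  have tg: "transitive_on S \<gamma>"
    by (rule transitive_transfer[OF q(1) w'(1) w'(2)[symmetric] ta g(1) act_powers[OF w'(2)[symmetric] p(1) g]])
  define c where "c u = (if u = q then \<alpha> else if u = r then inv \<beta> else \<gamma>)" for u
  have cq: "c q = \<alpha>" "c r = inv \<beta>" "c w = \<gamma>" using q w' by (auto simp: c_def)
  have all: "H (act u (c u) x) = H (act q \<alpha> x)" if "u \<in> X" "\<forall>k. x k \<in> S" for u x
    using that b[OF that(2)] g(2)[OF that(2)] cq unfolding Xe by auto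
  show ?thesis
    by (rule exI[of _ c]) (use all ta tb tg cq Xe in auto)
qed

text \<open>Match the permutation at \<open>q\<close> with a power of the cycle at one value
  \<open>u\<close>. Keeping \<open>u\<close> at \<open>q\<close> and solving for \<open>w\<close>
  identifies the permutation at \<open>r\<close>, and this in turn determines the one at
  \<open>q\<close>.\<close>

lemma Tr_powers:
  assumes q: "q \<in> X" "r \<in> X" "q \<noteq> r" "w \<in> X" "w \<noteq> q" "w \<noteq> r" and c: "transitive_on S (c q)" "transitive_on S (c r)" and S: "S \<noteq> {}"
    and eq: "\<And>x. \<forall>k. x k \<in> S \<Longrightarrow> H (act q (c q) x) = H (act r (c r) x)"
  shows "Tr S H q r = range (\<lambda>k. c q ^^ k)"
proof
  have p: "c q permutes S" "c r permutes S" using c by (auto simp: transitive_on_def)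
  have pk: "(c q ^^ k) permutes S" "(c r ^^ k) permutes S" for k using p funpow_permutes by auto
  note pow = act_powers[OF q(3) p eq]
  show "range (\<lambda>k. c q ^^ k) \<subseteq> Tr S H q r"
    unfolding Tr_def using pk pow by blast
  show "Tr S H q r \<subseteq> range (\<lambda>k. c q ^^ k)"
  proof
    fix \<alpha> assume "\<alpha> \<in> Tr S H q r"
    then obtain \<beta> where b: "\<alpha> permutes S" "\<beta> permutes S" "\<And>x. \<forall>k. x k \<in> S \<Longrightarrow> H (act q \<alpha> x) = H (act r \<beta> x)"
      unfolding Tr_def by blast
    obtain u where u: "u \<in> S" using S by blast
    have "\<alpha> u \<in> S" using b(1) u by (simp add: permutes_in_image)
    then obtain k where k: "(c q ^^ k) u = \<alpha> u" using c(1) u unfolding transitive_on_def by blast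
    have bb: "\<beta> = c r ^^ k"
    proof
      fix v show "\<beta> v = (c r ^^ k) v"
      proof (cases "v \<in> S")
        case True
        define x0 where "x0 = (\<lambda>_::'i. u)(r := v)"
        have x0: "\<forall>k. x0 k \<in> S" using u True by (simp add: x0_def)
        have bv: "\<beta> v \<in> S" "(c r ^^ k) v \<in> S" using True b(2) pk(2) by (metis permutes_in_image)+
        have xv: "\<forall>k. (x0(r := \<beta> v)) k \<in> S" using x0 bv by simp
        obtain d where d: "d \<in> S" "H ((x0(r := \<beta> v))(w := d))" by (rule H_exists[OF xv q(4)])
        define x where "x = x0(w := d)"
        have x: "\<forall>k. x k \<in> S" using x0 d by (simp add: x_def)
        have e1: "act r \<beta> x = (x0(r := \<beta> v))(w := d)" using q by (auto simp: act_def x_def x0_def fun_eq_iff)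
        have e2: "act q \<alpha> x = act q (c q ^^ k) x" using k q by (auto simp: act_def x_def x0_def)
        have "H (act r \<beta> x)" using d(2) e1 by simp
        then have "H (act q (c q ^^ k) x)" using b(3)[OF x] e2 by simp
        then have 1: "H (act r (c r ^^ k) x)" using pow[OF _ x, of k] by simp
        have vv: "\<forall>k. act r \<beta> x k \<in> S" by (rule act_val[OF b(2) x])
        have e3: "act r (c r ^^ k) x = (act r \<beta> x)(r := (c r ^^ k) v)" using q by (auto simp: act_def x_def x0_def fun_eq_iff)
        have "(c r ^^ k) v = act r \<beta> x r"
          by (rule H_unique[OF vv q(2) \<open>H (act r \<beta> x)\<close> bv(2)]) (use 1 e3 in simp)
        then show ?thesis using q by (simp add: act_def x_def x0_def)
      next
        case False
        then show ?thesis using permutes_not_in[OF b(2)] permutes_not_in[OF pk(2)[of k]] by simp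
      qed
    qed
    have "\<alpha> = c q ^^ k"
    proof (rule act_injective[OF q(1,4,5) b(1) pk(1)])
      fix x :: "'i \<Rightarrow> 'a" assume x: "\<forall>k. x k \<in> S"
      show "H (act q \<alpha> x) = H (act q (c q ^^ k) x)" using b(3)[OF x] pow[OF _ x, of k] bb by simp
    qed
    then show "\<alpha> \<in> range (\<lambda>k. c q ^^ k)" by blast
  qed
qed

end

section \<open>Five coordinates without rigid retracts\<close>

context latin
begin

text \<open>When \<open>A\<close> splits \<open>Y\<close>, the context outside \<open>A\<close> acts
  through one value, and \<open>x0\<close> alone takes it through all possibilities. So the exchange
  of \<open>w1\<close> for \<open>w2\<close> may be tested in another context \<open>n\<close> with
  \<open>x0\<close> varying.\<close>

lemma pair_equiv:
  assumes s: "splits Y e A" and A: "x0 \<in> Y - A" "Y \<subseteq> V"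
    and w: "w1 \<in> pts Y e" "w2 \<in> pts Y e" "\<And>k. k \<notin> A \<Longrightarrow> w1 k = w2 k" and n: "n \<in> pts Y e"
    and h: "\<And>c. c \<in> S \<Longrightarrow> F ((mix A w1 n)(x0 := c)) = F ((mix A w2 n)(x0 := c))"
  shows "F w1 = F w2"
proof -
  have half: "F w2" if w: "w1 \<in> pts Y e" "w2 \<in> pts Y e" "\<And>k. k \<notin> A \<Longrightarrow> w1 k = w2 k" "F w1"
    and h: "\<And>c. c \<in> S \<Longrightarrow> F ((mix A w1 n)(x0 := c)) = F ((mix A w2 n)(x0 := c))" for w1 w2
  proof -
    have m: "mix A w1 n \<in> pts Y e" "mix A w2 n \<in> pts Y e" by (rule pts_mix[OF w(1) n], rule pts_mix[OF w(2) n])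
    have "\<forall>k. mix A w1 n k \<in> S" using pts_in[OF m(1)] by blast
    then obtain c where c: "c \<in> S" "F ((mix A w1 n)(x0 := c))" using solve[of "mix A w1 n" x0] A by blast
    define m2 where "m2 = (mix A w2 n)(x0 := c)"
    have m2: "m2 \<in> pts Y e" unfolding m2_def by (rule pts_upd[OF m(2) _ c(1)]) (use A in blast)
    have "F m2" using h[OF c(1)] c(2) by (simp add: m2_def)
    moreover have "mix A w1 m2 = (mix A w1 n)(x0 := c)" using A by (auto simp: mix_def m2_def fun_eq_iff)
    ultimately have "F (mix A m2 w1)" using splitsD[OF s w(1) m2 w(4)] c(2) by simp
    moreover have "mix A m2 w1 = w2" using A w(3) by (auto simp: mix_def m2_def fun_eq_iff)
    ultimately show ?thesis by simp
  qed
  show ?thesis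
  proof
    assume "F w1" then show "F w2" using half[OF w _ h] by blast
  next
    assume f: "F w2" show "F w1" by (rule half[OF w(2,1) w(3)[symmetric] f]) (use h in simp_all)
  qed
qed

end

context prime_critical
begin

lemma decI: "V = insert i (insert j X) \<Longrightarrow> i \<noteq> j \<Longrightarrow> i \<notin> X \<Longrightarrow> j \<notin> X \<Longrightarrow> dec X i j"
  unfolding dec_def by blast

lemma row_split_exists:
  assumes d: "dec X i j" and X3: "card X = 3" and b: "b \<in> S"
  obtains q where "q \<in> X" "row_split X i j b q"
proof -
  show thesis using attach_function[OF d three_not_red[OF X3]] b that unfolding row_split_def by blast
qed

lemma row_split_perm:
  assumes d: "dec X i j" and X3: "card X = 3" and q: "q \<in> X" and ab: "a \<in> S" "a' \<in> S" "b \<in> S" and s: "row_split X i j b q"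
  obtains \<sigma> where "\<sigma> permutes S" "\<And>x. \<forall>k. x k \<in> S \<Longrightarrow> G i j a' b x = G i j a b (act q \<sigma> x)"
proof -
  have X3': "3 \<le> card X" using X3 by simp
  show thesis using row_perm[OF d X3' q ab row_splitD[OF s]] that by blast
qed

text \<open>The converse of \<open>row_perm\<close>: three corners of a rectangle force the
  permutations for two values of \<open>i\<close> to agree at the values in question, which gives
  the fourth corner.\<close>

lemma row_split_if_perms:
  assumes d: "dec X i j" and q: "q \<in> X" and ab: "a \<in> S" "b \<in> S"
    and h: "\<And>a1. a1 \<in> S \<Longrightarrow> \<exists>\<beta>. \<beta> permutes S \<and> (\<forall>p. (\<forall>k. p k \<in> S) \<longrightarrow> G i j a1 b p = G i j a b (act q \<beta> p))"
  shows "row_split X i j b q"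
  unfolding row_split_def splits_def
proof (intro allI impI ballI)
  fix e x y assume e: "\<forall>k. e k \<in> S" "e j = b" and x: "x \<in> pts (insert i X) e" and y: "y \<in> pts (insert i X) e"
    and f: "F x" "F y" "F (mix {i, q} x y)"
  have dd: "V = insert i (insert j X)" "i \<noteq> j" "i \<notin> X" "j \<notin> X" using d by (auto simp: dec_def)
  have iq: "q \<noteq> i" "q \<noteq> j" using q dd by auto
  have v: "\<forall>k. x k \<in> S" "\<forall>k. y k \<in> S" using pts_in x y by blast+
  have j: "x j = b" "y j = b" using pts_off[OF x, of j] pts_off[OF y, of j] dd e by auto
  interpret L: latin_pred S X "G i j a b" by (rule G_latin[OF d ab])
  obtain \<beta>1 where b1: "\<beta>1 permutes S" "\<And>p. \<forall>k. p k \<in> S \<Longrightarrow> G i j (x i) b p = G i j a b (act q \<beta>1 p)" using h v(1) by blast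
  obtain \<beta>2 where b2: "\<beta>2 permutes S" "\<And>p. \<forall>k. p k \<in> S \<Longrightarrow> G i j (y i) b p = G i j a b (act q \<beta>2 p)" using h v(2) by blast
  define z where "z = y(q := x q)"
  define z' where "z' = x(q := y q)"
  have zv: "\<forall>k. z k \<in> S" "\<forall>k. z' k \<in> S" using v by (auto simp: z_def z'_def)
  have Fy: "G i j a b (act q \<beta>2 y)" using f(2) b2(2)[OF v(2)] F_eq_G[of y i "y i" j b] j by simp
  have Fx: "G i j a b (act q \<beta>1 x)" using f(1) b1(2)[OF v(1)] F_eq_G[of x i "x i" j b] j by simp
  have "mix {i, q} x y = z(i := x i, j := b)" using j iq by (auto simp: mix_def z_def fun_eq_iff)
  then have "G i j (x i) b z" using f(3) by (simp add: G_def)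
  then have Gz: "G i j a b (act q \<beta>1 z)" using b1(2)[OF zv(1)] by simp
  have yv: "\<forall>k. act q \<beta>2 y k \<in> S" by (rule act_val[OF b2(1) v(2)])
  have "\<beta>1 (x q) \<in> S" using b1(1) v(1) by (simp add: permutes_in_image)
  moreover have "act q \<beta>1 z = (act q \<beta>2 y)(q := \<beta>1 (x q))" by (simp add: act_def z_def)
  ultimately have "\<beta>1 (x q) = act q \<beta>2 y q" using L.H_unique[OF yv q Fy, of "\<beta>1 (x q)"] Gz by simp
  then have eq: "\<beta>1 (x q) = \<beta>2 (y q)" by (simp add: act_def)
  have "act q \<beta>2 z' = act q \<beta>1 x" using eq by (simp add: act_def z'_def)
  then have "G i j (y i) b z'" using b2(2)[OF zv(2)] Fx by simp
  moreover have "mix {i, q} y x = z'(i := y i, j := b)" using j iq by (auto simp: mix_def z'_def fun_eq_iff)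
  ultimately show "F (mix {i, q} y x)" by (simp add: G_def)
qed

end

locale cyclic_case = prime_critical +
  assumes V5: "card V = 5"
    and not_rigid: "\<And>X i j a b. dec X i j \<Longrightarrow> a \<in> S \<Longrightarrow> b \<in> S \<Longrightarrow> \<not> latin_pred.rigid S X (G i j a b)"
begin

lemma card_X:
  assumes "dec X i j" shows "card X = 3"
proof -
  have dd: "V = insert i (insert j X)" "i \<noteq> j" "i \<notin> X" "j \<notin> X" using assms by (auto simp: dec_def)
  then have "finite X" using finite_V by simp
  then show ?thesis using V5 dd by simp
qed

lemma S_ne: "S \<noteq> {}" using S2 by auto

lemma third:
  assumes "card X = 3" obtains w where "w \<in> X" "w \<noteq> q" "w \<noteq> z"
proof -
  have "\<not> X \<subseteq> {q, z}"
  proof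
    assume "X \<subseteq> {q, z}"
    then have "card X \<le> card {q, z}" by (rule card_mono[rotated]) simp
    also have "\<dots> \<le> 2" by (simp add: card_insert_if)
    finally show False using assms by simp
  qed
  then show thesis using that by blast
qed

lemma three:
  assumes "card X = 3" "x \<in> X" "y \<in> X" "z \<in> X" "x \<noteq> y" "x \<noteq> z" "y \<noteq> z"
  shows "X = {x, y, z}"
proof -
  have f: "finite X" using assms(1) card.infinite by fastforce
  have "card X \<le> card {x, y, z}" using assms(1,5-7) by simp
  moreover have "{x, y, z} \<subseteq> X" using assms(2-4) by simp
  ultimately show ?thesis using card_seteq[OF f, of "{x, y, z}"] by blast
qed

lemma translation_choice:
  assumes d: "dec X i j" and ab: "a \<in> S" "b \<in> S"
  obtains c where "\<forall>q \<in> X. transitive_on S (c q)"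
    "\<forall>q \<in> X. \<forall>r \<in> X. \<forall>x. (\<forall>k. x k \<in> S) \<longrightarrow> G i j a b (act q (c q) x) = G i j a b (act r (c r) x)"
proof -
  interpret L: latin_pred S X "G i j a b" by (rule G_latin[OF d ab])
  obtain c where c: "\<And>q. q \<in> X \<Longrightarrow> transitive_on S (c q)"
    "\<And>q r x. q \<in> X \<Longrightarrow> r \<in> X \<Longrightarrow> \<forall>k. x k \<in> S \<Longrightarrow> G i j a b (act q (c q) x) = G i j a b (act r (c r) x)"
    using L.cyclic_translations[OF not_rigid[OF d ab] finite_S prime_S card_X[OF d]] by blast
  show thesis by (rule that[of c]) (use c in blast)+
qed

lemma translation_group:
  assumes d: "dec X i j" and ab: "a \<in> S" "b \<in> S" and q: "q \<in> X"
  obtains c where "transitive_on S c" "\<And>r. r \<in> X \<Longrightarrow> r \<noteq> q \<Longrightarrow> Tr S (G i j a b) q r = range (\<lambda>k. c ^^ k)"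
proof -
  interpret L: latin_pred S X "G i j a b" by (rule G_latin[OF d ab])
  obtain c where c: "\<forall>q \<in> X. transitive_on S (c q)"
    "\<forall>q \<in> X. \<forall>r \<in> X. \<forall>x. (\<forall>k. x k \<in> S) \<longrightarrow> G i j a b (act q (c q) x) = G i j a b (act r (c r) x)"
    by (rule translation_choice[OF d ab])
  show thesis
  proof (rule that[of "c q"])
    show "transitive_on S (c q)" by (rule bspec[OF c(1) q])
    fix r assume r: "r \<in> X" "r \<noteq> q"
    obtain w where w: "w \<in> X" "w \<noteq> q" "w \<noteq> r" by (rule third[OF card_X[OF d]])
    show "Tr S (G i j a b) q r = range (\<lambda>k. c q ^^ k)"
      by (rule L.Tr_powers[OF q r(1) r(2)[symmetric] w bspec[OF c(1) q] bspec[OF c(1) r(1)] S_ne]) (use c(2) q r(1) in blast)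
  qed
qed

text \<open>The translations at \<open>q\<close> do not depend on the partner, so \<open>r\<close>
  may be replaced by a coordinate \<open>w\<close> other than \<open>z\<close>, and the isotopy at
  \<open>z\<close> then commutes with both actions.\<close>

lemma Tr_change:
  assumes d: "dec X i j" and ab: "a \<in> S" "b \<in> S" "a' \<in> S" "b' \<in> S" and \<rho>: "\<rho> permutes S"
    and eq: "\<And>x. \<forall>k. x k \<in> S \<Longrightarrow> G i j a' b' x = G i j a b (act z \<rho> x)"
    and q: "q \<in> X" "q \<noteq> z" and r: "r \<in> X" "r \<noteq> q"
  shows "Tr S (G i j a' b') q r = Tr S (G i j a b) q r"
proof -
  obtain w where w: "w \<in> X" "w \<noteq> q" "w \<noteq> z" by (rule third[OF card_X[OF d]])
  obtain c where c: "\<And>r. r \<in> X \<Longrightarrow> r \<noteq> q \<Longrightarrow> Tr S (G i j a b) q r = range (\<lambda>k. c ^^ k)"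
    by (rule translation_group[OF d ab(1,2) q(1)]) blast
  obtain c' where c': "\<And>r. r \<in> X \<Longrightarrow> r \<noteq> q \<Longrightarrow> Tr S (G i j a' b') q r = range (\<lambda>k. c' ^^ k)"
    by (rule translation_group[OF d ab(3,4) q(1)]) blast
  have "Tr S (G i j a' b') q w = Tr S (G i j a b) q w"
  proof (rule Tr_eq[of z q w \<rho>])
    show "z \<noteq> q" "z \<noteq> w" using q w by auto
  qed (rule \<rho>, rule eq)
  then show ?thesis unfolding c[OF r] c[OF w(1,2)] c'[OF r] c'[OF w(1,2)] .
qed

text \<open>In the retract on \<open>{i, z, x}\<close> the variable \<open>i\<close> is a coordinate
  with a cycle of its own, which can be traded for one at \<open>z\<close>. That retract has
  \<open>y\<close> fixed; since \<open>{i, z}\<close> splits \<open>insert i X\<close>, the trade is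
  valid for all values of \<open>y\<close> by \<open>pair_equiv\<close>.\<close>

lemma row_shift:
  assumes d: "dec X i j" and z: "z \<in> X" and b: "b \<in> S" and s: "row_split X i j b z"
  obtains \<iota> \<delta> where "transitive_on S \<iota>" "transitive_on S \<delta>"
    "\<And>a n p. a \<in> S \<Longrightarrow> \<forall>k. p k \<in> S \<Longrightarrow> G i j ((\<iota> ^^ n) a) b p = G i j a b (act z (\<delta> ^^ n) p)"
proof -
  have dd: "V = insert i (insert j X)" "i \<noteq> j" "i \<notin> X" "j \<notin> X" using d by (auto simp: dec_def)
  obtain y where y: "y \<in> X" "y \<noteq> z" by (rule third[OF card_X[OF d], of z z]) blast
  obtain x where x: "x \<in> X" "x \<noteq> z" "x \<noteq> y" by (rule third[OF card_X[OF d]])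
  have X: "X = {x, y, z}" by (rule three[OF card_X[OF d] x(1) y(1) z]) (use x y in simp_all)
  have ne: "i \<noteq> x" "i \<noteq> y" "i \<noteq> z" "j \<noteq> x" "j \<noteq> y" "j \<noteq> z" using dd x y z by auto
  have "V = insert y (insert j {i, z, x})" unfolding dd(1) X by blast
  then have d': "dec {i, z, x} y j" by (rule decI) (use dd(2) ne x(2,3) y(2) in auto)
  obtain c where c0: "\<forall>q \<in> {i, z, x}. transitive_on S (c q)"
    "\<forall>q \<in> {i, z, x}. \<forall>r \<in> {i, z, x}. \<forall>p. (\<forall>k. p k \<in> S) \<longrightarrow> G y j b b (act q (c q) p) = G y j b b (act r (c r) p)"
    by (rule translation_choice[OF d' b b])
  have c: "transitive_on S (c i)" "transitive_on S (c z)" by (rule bspec[OF c0(1)], simp)+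
  have c3: "G y j b b (act i (c i) p) = G y j b b (act z (c z) p)" if p: "\<forall>k. p k \<in> S" for p
  proof -
    have "\<forall>p. (\<forall>k. p k \<in> S) \<longrightarrow> G y j b b (act i (c i) p) = G y j b b (act z (c z) p)"
      by (rule bspec[OF bspec[OF c0(2)]]) simp_all
    then show ?thesis using p by blast
  qed
  have perm: "c i permutes S" "c z permutes S" using c by (auto simp: transitive_on_def)
  have one: "G i j (c i a) b p = G i j a b (act z (c z) p)" if a: "a \<in> S" and p: "\<forall>k. p k \<in> S" for a p
  proof -
    define P where "P = p(i := a, j := b)"
    have P: "\<forall>k. P k \<in> S" using p a b by (simp add: P_def)
    define n where "n = P(y := b)"
    have ca: "c i a \<in> S" "c z (p z) \<in> S" using perm a p by (simp_all add: permutes_in_image)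
    have Pi: "P i = a" "P z = p z" "P j = b" using ne dd(2) by (auto simp: P_def)
    let ?w1 = "act i (c i) P" and ?w2 = "act z (c z) P"
    have pp: "P \<in> pts (insert i X) P" using P by (rule pts_refl)
    have w: "?w1 \<in> pts (insert i X) P" "?w2 \<in> pts (insert i X) P" "n \<in> pts (insert i X) P"
      unfolding act_def n_def by (rule pts_upd[OF pp]; use ca Pi b y z in simp)+
    have xY: "x \<in> insert i X - {i, z}" using x ne by auto
    have YV: "insert i X \<subseteq> V" using dd(1) by auto
    have "F ?w1 = F ?w2"
    proof (rule pair_equiv[OF row_splitD[OF s P Pi(3)] xY YV w(1,2) _ w(3)])
      fix k assume "k \<notin> {i, z}" then show "?w1 k = ?w2 k" by (simp add: act_def)
    next
      fix d assume dS: "d \<in> S"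
      define p' where "p' = P(x := d)"
      have p': "\<forall>k. p' k \<in> S" using P dS by (simp add: p'_def)
      have "(mix {i, z} ?w1 n)(x := d) = (act i (c i) p')(y := b, j := b)"
        using dd(2) ne x(2,3) y(2) Pi by (auto simp: mix_def act_def n_def p'_def fun_eq_iff)
      moreover have "(mix {i, z} ?w2 n)(x := d) = (act z (c z) p')(y := b, j := b)"
        using dd(2) ne x(2,3) y(2) Pi by (auto simp: mix_def act_def n_def p'_def fun_eq_iff)
      ultimately show "F ((mix {i, z} ?w1 n)(x := d)) = F ((mix {i, z} ?w2 n)(x := d))"
        using c3[OF p'] unfolding G_def by simp
    qed
    moreover have "?w1 = p(i := c i a, j := b)" using dd(2) by (auto simp: act_def P_def fun_eq_iff)
    moreover have "?w2 = (act z (c z) p)(i := a, j := b)" using ne by (auto simp: act_def P_def fun_eq_iff)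
    ultimately show ?thesis unfolding G_def by simp
  qed
  have "G i j ((c i ^^ n) a) b p = G i j a b (act z (c z ^^ n) p)" if a: "a \<in> S" and p: "\<forall>k. p k \<in> S" for a n p
    using p
  proof (induction n arbitrary: p)
    case (Suc n)
    have aS: "(c i ^^ n) a \<in> S" using funpow_permutes[OF perm(1)] a by (metis permutes_in_image)
    have "G i j ((c i ^^ Suc n) a) b p = G i j ((c i ^^ n) a) b (act z (c z) p)" using one[OF aS Suc.prems] by simp
    also have "\<dots> = G i j a b (act z (c z ^^ n) (act z (c z) p))" by (rule Suc.IH[OF act_val[OF perm(2) Suc.prems]])
    also have "act z (c z ^^ n) (act z (c z) p) = act z (c z ^^ Suc n) p" by (simp add: act_comp funpow_Suc_right del: funpow.simps)
    finally show ?case .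
  qed (simp add: act_id[unfolded id_def] id_def)
  then show thesis using that c by blast
qed

text \<open>If two values of \<open>i\<close> have the same translations at \<open>z\<close>, the
  passage \<rho> between them normalizes this group. Being a full cycle, it is itself a translation,
  and then so is the generator \<delta> of all passages. Translations at \<open>z\<close> can be
  traded for permutations at any \<open>q\<close>.\<close>

lemma row_aligned:
  assumes d: "dec X i j" and z: "z \<in> X" and b: "b \<in> S" and s: "row_split X i j b z"
    and aa: "a \<in> S" "a' \<in> S" "a \<noteq> a'" and r: "r \<in> X" "r \<noteq> z"
    and eq: "Tr S (G i j a b) z r = Tr S (G i j a' b) z r" and q: "q \<in> X"
  shows "row_split X i j b q"
proof (cases "q = z")
  case False
  obtain \<iota> \<delta> where id: "transitive_on S \<iota>" "transitive_on S \<delta>"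
    "\<And>a n p. a \<in> S \<Longrightarrow> \<forall>k. p k \<in> S \<Longrightarrow> G i j ((\<iota> ^^ n) a) b p = G i j a b (act z (\<delta> ^^ n) p)"
    using row_shift[OF d z b s] by metis
  obtain c where c: "transitive_on S c" "\<And>r. r \<in> X \<Longrightarrow> r \<noteq> z \<Longrightarrow> Tr S (G i j a b) z r = range (\<lambda>k. c ^^ k)"
    by (rule translation_group[OF d aa(1) b z]) blast
  interpret L: latin_pred S X "G i j a b" by (rule G_latin[OF d aa(1) b])
  have \<delta>p: "\<delta> permutes S" "(\<delta> ^^ k) permutes S" for k using id(2) funpow_permutes by (auto simp: transitive_on_def)
  obtain m where m: "(\<iota> ^^ m) a = a'" using id(1) aa unfolding transitive_on_def by blast
  define \<rho> where "\<rho> = \<delta> ^^ m"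
  have \<rho>: "G i j a' b p = G i j a b (act z \<rho> p)" if "\<forall>k. p k \<in> S" for p
    using id(3)[OF aa(1) that, of m] m by (simp add: \<rho>_def)
  have "\<rho> \<noteq> id"
  proof
    assume i: "\<rho> = id"
    have v: "\<forall>k. (\<lambda>_::'b. a) k \<in> S" using aa by simp
    obtain u where u: "u \<in> S" "G i j a b ((\<lambda>_. a)(z := u))" by (rule L.H_exists[OF v z])
    define p where "p = (\<lambda>_::'b. a)(z := u)"
    have p: "\<forall>k. p k \<in> S" using aa u by (simp add: p_def)
    have "G i j a b p" using u by (simp add: p_def)
    moreover have "G i j a' b p" using \<rho>[OF p] i calculation by (simp add: act_id)
    ultimately show False using G_inj[OF d p aa(1,2) b] aa(3) by blast
  qed
  then have \<rho>t: "transitive_on S \<rho>" unfolding \<rho>_def by (rule transitive_on_power[OF id(2) finite_S prime_S])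
  have \<rho>p: "\<rho> permutes S" using \<delta>p by (simp add: \<rho>_def)
  have cc: "c \<in> Tr S (G i j a' b) z r" unfolding eq[symmetric] c(2)[OF r] by (rule range_eqI[of _ _ 1]) simp
  have "\<rho> \<circ> c \<circ> inv \<rho> \<in> Tr S (G i j a b) z r"
    by (rule Tr_conj[OF r(2)[symmetric] \<rho>p _ cc]) (rule \<rho>)
  then obtain l where l: "\<rho> \<circ> c \<circ> inv \<rho> = c ^^ l" unfolding c(2)[OF r] by blast
  have "\<rho> \<circ> c = (\<rho> \<circ> c \<circ> inv \<rho>) \<circ> \<rho>" using permutes_inv_o(2)[OF \<rho>p] by (simp add: comp_assoc)
  then have "\<rho> \<circ> c = (c ^^ l) \<circ> \<rho>" unfolding l .
  then obtain k where k: "\<rho> = c ^^ k" using normalizing_transitive[OF c(1) \<rho>t finite_S prime_S] by blast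
  \<comment> \<open>\<delta> commutes with its power \<rho>, which is again a full cycle, so
    \<delta> is in turn a power of \<rho>.\<close>
  have "\<delta> \<circ> \<rho> = \<rho> \<circ> \<delta>" unfolding \<rho>_def by (simp add: funpow_swap1 fun_eq_iff)
  then obtain k' where k': "\<delta> = \<rho> ^^ k'" using transitive_on_commuting[OF \<rho>t \<delta>p(1) _ S_ne] by blast
  have "\<delta> = c ^^ (k * k')" unfolding k' k by (simp add: funpow_mult)
  then have "\<delta> \<in> Tr S (G i j a b) z q" unfolding c(2)[OF q False] by blast
  then obtain \<beta> where \<beta>: "\<beta> permutes S" "\<And>x. \<forall>k. x k \<in> S \<Longrightarrow> G i j a b (act z \<delta> x) = G i j a b (act q \<beta> x)"
    unfolding Tr_def by blast
  have pw: "G i j a b (act z (\<delta> ^^ n) x) = G i j a b (act q (\<beta> ^^ n) x)" if "\<forall>k. x k \<in> S" for n x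
    by (rule L.act_powers[OF False[symmetric] \<delta>p(1) \<beta>(1) _ that]) (rule \<beta>(2))
  show ?thesis
  proof (rule row_split_if_perms[OF d q aa(1) b])
    fix a1 assume a1: "a1 \<in> S"
    obtain n where n: "(\<iota> ^^ n) a = a1" using id(1) aa a1 unfolding transitive_on_def by blast
    have "G i j a1 b p = G i j a b (act q (\<beta> ^^ n) p)" if "\<forall>k. p k \<in> S" for p
      using id(3)[OF aa(1) that, of n] pw[OF that, of n] n by simp
    then show "\<exists>\<beta>. \<beta> permutes S \<and> (\<forall>p. (\<forall>k. p k \<in> S) \<longrightarrow> G i j a1 b p = G i j a b (act q \<beta> p))"
      using funpow_permutes[OF \<beta>(1)] by blast
  qed
qed (use s in simp)

text \<open>On two symbols the translations are all permutations, so they could not tell the values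
  of \<open>i\<close> apart.\<close>

lemma three_values:
  assumes d: "dec X i j" and z: "z \<in> X" "r \<in> X" "r \<noteq> z" and b: "b \<in> S"
    and inj: "\<And>a a'. a \<in> S \<Longrightarrow> a' \<in> S \<Longrightarrow> Tr S (G i j a b) z r = Tr S (G i j a' b) z r \<Longrightarrow> a = a'"
  shows "3 \<le> card S"
proof (rule ccontr)
  assume "\<not> 3 \<le> card S"
  then have c2: "card S = 2" using S2 by simp
  then have "card {p. p permutes S} = 2" using card_permutations[OF c2 finite_S] by simp
  have all: "Tr S (G i j a b) z r = {p. p permutes S}" if a: "a \<in> S" for a
  proof -
    obtain c where c: "transitive_on S c" "Tr S (G i j a b) z r = range (\<lambda>k. c ^^ k)"
      using translation_group[OF d a b z(1)] z by metis
    have sub: "Tr S (G i j a b) z r \<subseteq> {p. p permutes S}" unfolding Tr_def by blast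
    have fin: "finite {p. p permutes S}" by (rule finite_permutations[OF finite_S])
    have "c ^^ 0 \<in> Tr S (G i j a b) z r" "c ^^ 1 \<in> Tr S (G i j a b) z r" unfolding c(2) by (rule rangeI)+
    then have "{id, c} \<subseteq> Tr S (G i j a b) z r" by simp
    then have "card {id, c} \<le> card (Tr S (G i j a b) z r)" using finite_subset[OF sub fin] by (rule card_mono[rotated])
    moreover have "c \<noteq> id" by (rule transitive_on_nontrivial[OF c(1) S2])
    ultimately have "2 \<le> card (Tr S (G i j a b) z r)" by simp
    then show ?thesis using card_seteq[OF fin sub] \<open>card {p. p permutes S} = 2\<close> by simp
  qed
  obtain a a' where "a \<in> S" "a' \<in> S" "a \<noteq> a'" by (rule two_elements[OF S2])
  then show False using inj[of a a'] all by simp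
qed

text \<open>Suppose that row \<open>b\<close> has a twin \<open>q\<close> but not \<open>z\<close>.
  In row \<open>b0\<close> the translations at \<open>z\<close> determine \<open>a\<close>, and
  those at \<open>q\<close> are constant; in row \<open>b\<close> it is the other way round. Passing
  from row \<open>b0\<close> to row \<open>b\<close> in column \<open>a\<close> moves one coordinate
  only, so it preserves the translations at \<open>z\<close> or those at \<open>q\<close>. Each
  alternative is possible for at most one \<open>a\<close>, so there are only two values.\<close>

lemma row_split_everywhere:
  assumes d: "dec X i j" and z: "z \<in> X" and b0: "b0 \<in> S" and s: "row_split X i j b0 z"
    and ua: "q0 \<in> X" "\<not> row_split X i j b0 q0" and b: "b \<in> S"
  shows "row_split X i j b z"
proof (rule ccontr)
  assume n: "\<not> row_split X i j b z"
  obtain q where q: "q \<in> X" "row_split X i j b q" by (rule row_split_exists[OF d card_X[OF d] b])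
  have qz: "q \<noteq> z" using n q by blast
  have inj0: "a = a'" if "a \<in> S" "a' \<in> S" "Tr S (G i j a b0) z q = Tr S (G i j a' b0) z q" for a a'
    using row_aligned[OF d z b0 s that(1,2) _ q(1) qz that(3) ua(1)] ua(2) by blast
  have inj1: "a = a'" if "a \<in> S" "a' \<in> S" "Tr S (G i j a b) q z = Tr S (G i j a' b) q z" for a a'
    using row_aligned[OF d q(1) b q(2) that(1,2) _ z qz[symmetric] that(3) z] n by blast
  have const0: "Tr S (G i j a b0) q z = Tr S (G i j b0 b0) q z" if a: "a \<in> S" for a
  proof -
    obtain \<rho> where \<rho>: "\<rho> permutes S" "\<And>x. \<forall>k. x k \<in> S \<Longrightarrow> G i j a b0 x = G i j b0 b0 (act z \<rho> x)"
      using row_split_perm[OF d card_X[OF d] z b0 a b0 s] by metis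
    show ?thesis by (rule Tr_change[OF d b0 b0 a b0 \<rho>(1) _ q(1) qz z qz[symmetric]]) (rule \<rho>(2))
  qed
  have const1: "Tr S (G i j a b) z q = Tr S (G i j b0 b) z q" if a: "a \<in> S" for a
  proof -
    obtain \<rho> where \<rho>: "\<rho> permutes S" "\<And>x. \<forall>k. x k \<in> S \<Longrightarrow> G i j a b x = G i j b0 b (act q \<rho> x)"
      using row_split_perm[OF d card_X[OF d] q(1) b0 a b q(2)] by metis
    show ?thesis by (rule Tr_change[OF d b0 b a b \<rho>(1) _ z qz[symmetric] q(1) qz]) (rule \<rho>(2))
  qed
  have ij: "i \<noteq> j" using d by (simp add: dec_def)
  have alt: "Tr S (G i j a b0) z q = Tr S (G i j b0 b) z q \<or> Tr S (G i j a b) q z = Tr S (G i j b0 b0) q z" if a: "a \<in> S" for a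
  proof -
    obtain t where t: "t \<in> X" "row_split X j i a t" by (rule row_split_exists[OF dec_sym[OF d] card_X[OF d] a])
    obtain \<rho> where \<rho>: "\<rho> permutes S" "\<And>x. \<forall>k. x k \<in> S \<Longrightarrow> G j i b a x = G j i b0 a (act t \<rho> x)"
      using row_split_perm[OF dec_sym[OF d] card_X[OF d] t(1) b0 b a t(2)] by metis
    have \<rho>': "G i j a b x = G i j a b0 (act t \<rho> x)" if "\<forall>k. x k \<in> S" for x
      using \<rho>(2)[OF that] by (simp add: G_sym[OF ij])
    show ?thesis
    proof (cases "t = z")
      case False
      have "Tr S (G i j a b) z q = Tr S (G i j a b0) z q"
        by (rule Tr_change[OF d a b0 a b \<rho>(1) _ z False[symmetric] q(1) qz]) (rule \<rho>')
      then show ?thesis using const1[OF a] by simp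
    next
      case True
      have "Tr S (G i j a b) q z = Tr S (G i j a b0) q z"
        by (rule Tr_change[OF d a b0 a b \<rho>(1) _ q(1) _ z qz[symmetric]]) (use \<rho>' True qz in auto)
      then show ?thesis using const0[OF a] by simp
    qed
  qed
  define A0 where "A0 = {a \<in> S. Tr S (G i j a b0) z q = Tr S (G i j b0 b) z q}"
  define A1 where "A1 = {a \<in> S. Tr S (G i j a b) q z = Tr S (G i j b0 b0) q z}"
  have f: "finite A0" "finite A1" using finite_S by (auto simp: A0_def A1_def)
  have "card A0 \<le> Suc 0"
    unfolding card_le_Suc0_iff_eq[OF f(1)] using inj0 by (auto simp: A0_def)
  moreover have "card A1 \<le> Suc 0"
    unfolding card_le_Suc0_iff_eq[OF f(2)] using inj1 by (auto simp: A1_def)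
  moreover have "S = A0 \<union> A1" using alt by (auto simp: A0_def A1_def)
  ultimately have "card S \<le> 2" using card_Un_le[of A0 A1] by simp
  moreover have "3 \<le> card S" by (rule three_values[OF d z q(1) qz b0 inj0])
  ultimately show False by simp
qed

text \<open>Since \<open>{j, x}\<close> splits, \<open>j\<close> and \<open>x\<close> act on
  \<open>y\<close> and \<open>z\<close> through one value. Fixing \<open>j\<close> and varying
  \<open>x\<close>, or the reverse, allows the same trades between \<open>z\<close> and
  \<open>y\<close>.\<close>

lemma Tr_exchange_mono:
  assumes d: "dec X i j" and X: "X = {x, y, z}" "distinct [x, y, z]" and s: "row_split X j i a x"
    and v: "a \<in> S" "b \<in> S" "c \<in> S"
  shows "Tr S (G i j a b) z y \<subseteq> Tr S (G i x a c) z y"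
proof
  fix \<alpha> assume "\<alpha> \<in> Tr S (G i j a b) z y"
  then obtain \<beta> where p: "\<alpha> permutes S" "\<beta> permutes S"
    "\<And>p. \<forall>k. p k \<in> S \<Longrightarrow> G i j a b (act z \<alpha> p) = G i j a b (act y \<beta> p)"
    unfolding Tr_def by blast
  have dd: "V = insert i (insert j X)" "i \<noteq> j" "i \<notin> X" "j \<notin> X" using d by (auto simp: dec_def)
  have ne: "i \<noteq> x" "i \<noteq> y" "i \<noteq> z" "j \<noteq> x" "j \<noteq> y" "j \<noteq> z" "x \<noteq> y" "x \<noteq> z" "y \<noteq> z" using dd X by auto
  have "G i x a c (act z \<alpha> p0) = G i x a c (act y \<beta> p0)" if p0: "\<forall>k. p0 k \<in> S" for p0
  proof -
    define P where "P = p0(i := a, x := c)"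
    have P: "\<forall>k. P k \<in> S" "P i = a" using p0 v ne by (auto simp: P_def)
    define n where "n = P(j := b)"
    let ?w1 = "act z \<alpha> P" and ?w2 = "act y \<beta> P"
    let ?Y = "insert j X" and ?A = "insert j X - {j, x}"
    have pp: "P \<in> pts ?Y P" using P(1) by (rule pts_refl)
    have w: "?w1 \<in> pts ?Y P" "?w2 \<in> pts ?Y P" "n \<in> pts ?Y P"
      unfolding act_def n_def by (rule pts_upd[OF pp]; use P p v X in \<open>simp add: permutes_in_image\<close>)+
    have sA: "splits ?Y P ?A" using row_splitD[OF s P] splits_Compl by blast
    have A: "?A = {y, z}" using X ne by auto
    have xY: "x \<in> ?Y - ?A" using X by auto
    have YV: "?Y \<subseteq> V" using dd(1) by auto
    have "F ?w1 = F ?w2"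
    proof (rule pair_equiv[OF sA xY YV w(1,2) _ w(3)])
      fix k assume "k \<notin> ?A" then show "?w1 k = ?w2 k" unfolding A by (simp add: act_def)
    next
      fix d assume dS: "d \<in> S"
      define p' where "p' = P(x := d)"
      have p': "\<forall>k. p' k \<in> S" using P dS by (simp add: p'_def)
      have "(mix ?A ?w1 n)(x := d) = (act z \<alpha> p')(i := a, j := b)"
        unfolding A using ne dd(2) P(2) by (auto simp: mix_def act_def n_def p'_def fun_eq_iff)
      moreover have "(mix ?A ?w2 n)(x := d) = (act y \<beta> p')(i := a, j := b)"
        unfolding A using ne dd(2) P(2) by (auto simp: mix_def act_def n_def p'_def fun_eq_iff)
      ultimately show "F ((mix ?A ?w1 n)(x := d)) = F ((mix ?A ?w2 n)(x := d))"
        using p(3)[OF p'] unfolding G_def by simp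
    qed
    moreover have "?w1 = (act z \<alpha> p0)(i := a, x := c)" using ne by (auto simp: act_def P_def fun_eq_iff)
    moreover have "?w2 = (act y \<beta> p0)(i := a, x := c)" using ne by (auto simp: act_def P_def fun_eq_iff)
    ultimately show ?thesis unfolding G_def by simp
  qed
  then show "\<alpha> \<in> Tr S (G i x a c) z y" unfolding Tr_def using p(1,2) by blast
qed

lemma Tr_exchange:
  assumes d: "dec X i j" and X: "X = {x, y, z}" "distinct [x, y, z]" and s: "row_split X j i a x"
    and v: "a \<in> S" "b \<in> S" "c \<in> S"
  shows "Tr S (G i j a b) z y = Tr S (G i x a c) z y"
proof
  show "Tr S (G i j a b) z y \<subseteq> Tr S (G i x a c) z y" by (rule Tr_exchange_mono[OF assms])
  have dd: "V = insert i (insert j X)" "i \<noteq> j" "i \<notin> X" "j \<notin> X" using d by (auto simp: dec_def)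
  have "V = insert i (insert x {j, y, z})" unfolding dd(1) X(1) by blast
  then have d': "dec {j, y, z} i x" by (rule decI) (use dd(2-4) X in auto)
  have Y: "insert x {j, y, z} = insert j X" "{x, j} = {j, x}" using X(1) by auto
  have s': "row_split {j, y, z} x i a j" using s unfolding row_split_def Y .
  show "Tr S (G i x a c) z y \<subseteq> Tr S (G i j a b) z y"
    by (rule Tr_exchange_mono[OF d' refl _ s' v(1,3,2)]) (use dd X in auto)
qed

text \<open>If all coordinates are twins in all rows, any pair splits \<open>V\<close>. Otherwise
  some row has a restricted choice of twins, and \<open>row_split_everywhere\<close> makes
  \<open>z\<close> a twin of \<open>i\<close> for all values of \<open>j\<close>. The delicate case
  is a different twin \<open>x\<close> of \<open>j\<close>: the pair \<open>{i, z}\<close> then has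
  to be tested with \<open>x\<close> fixed as well.\<close>

theorem red_cyclic: "red V e"
proof (cases "\<forall>X i j. dec X i j \<longrightarrow> (\<forall>b \<in> S. \<forall>q \<in> X. row_split X i j b q)")
  case True
  obtain i z where iz: "i \<in> V" "z \<in> V" "i \<noteq> z"
    using two_elements[of V] V5 by auto
  have c3: "card (V - {i, z}) = 3" using V5 iz finite_V by (simp add: card_Diff_subset)
  then have "V - {i, z} \<noteq> {}" by (metis card.empty zero_neq_numeral)
  then obtain d0 where d0: "d0 \<in> V - {i, z}" by blast
  have "splits V e {i, z}"
  proof (rule splits_local[of _ _ z d0])
    fix c f e' assume c: "c \<in> {i, z} - {z}" and f: "f \<in> V - {i, z} - {d0}" and e': "e' \<in> pts V e"
    have v: "\<forall>k. e' k \<in> S" using pts_in[OF e'] by blast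
    obtain k where k: "k \<in> V - {i, z}" "k \<noteq> d0" "k \<noteq> f" by (rule third[OF c3])
    have dd: "dec (V - {i, k}) i k" unfolding dec_def using iz k by auto
    have Y: "insert i (V - {i, k}) = V - {k}" using iz k by auto
    have "z \<in> V - {i, k}" using iz k by blast
    then have "row_split (V - {i, k}) i k (e' k) z" using True dd v by blast
    from row_splitD[OF this v refl] have "splits (V - {k}) e' {i, z}" unfolding Y .
    then show "splits {c, z, f, d0} e' {c, z}"
      by (rule splits_restrict[OF _ pts_refl[OF v]]) (use c f k d0 iz in auto)
  qed (use iz d0 in auto)
  moreover have "2 \<le> card {i, z}" using iz(3) by simp
  ultimately show ?thesis using c3 iz by (intro redI[of "{i, z}"]) auto
next
  case False
  then obtain X i j b0 q0 where d: "dec X i j" and b0: "b0 \<in> S" and q0: "q0 \<in> X" "\<not> row_split X i j b0 q0" by blast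
  note cX = card_X[OF d]
  have X3: "3 \<le> card X" using cX by simp
  have dd: "V = insert i (insert j X)" "i \<noteq> j" "i \<notin> X" "j \<notin> X" using d by (auto simp: dec_def)
  obtain z where z: "z \<in> X" "row_split X i j b0 z" by (rule row_split_exists[OF d cX b0])
  have rows: "row_split X i j b z" if "b \<in> S" for b by (rule row_split_everywhere[OF d z(1) b0 z(2) q0 that])
  show ?thesis
  proof (cases "\<forall>a \<in> S. row_split X j i a z")
    case True
    show ?thesis by (rule red_if_common_twin[OF d X3 z(1) rows bspec[OF True]])
  next
    case nz: False
    then obtain a1 where a1: "a1 \<in> S" "\<not> row_split X j i a1 z" by blast
    obtain x where x: "x \<in> X" "row_split X j i a1 x" by (rule row_split_exists[OF dec_sym[OF d] cX a1(1)])
    have cols: "row_split X j i a x" if "a \<in> S" for a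
      by (rule row_split_everywhere[OF dec_sym[OF d] x(1) a1(1) x(2) z(1) a1(2) that])
    have xz: "x \<noteq> z" using x a1 by blast
    obtain y where y: "y \<in> X" "y \<noteq> x" "y \<noteq> z" by (rule third[OF cX])
    have X: "X = {x, y, z}" by (rule three[OF cX x(1) y(1) z(1)]) (use xz y in simp_all)
    have ne: "i \<noteq> x" "i \<noteq> y" "i \<noteq> z" "j \<noteq> x" "j \<noteq> y" "j \<noteq> z" using dd x y z by auto
    have dist: "distinct [x, y, z]" using xz y by auto
    have inj: "a = a'" if "a \<in> S" "a' \<in> S" "Tr S (G i j a b0) z y = Tr S (G i j a' b0) z y" for a a'
      using row_aligned[OF d z(1) b0 z(2) that(1,2) _ y(1,3) that(3) q0(1)] q0(2) by blast
    have "V = insert i (insert x {j, y, z})" unfolding dd(1) X by blast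
    then have d': "dec {j, y, z} i x" by (rule decI) (use dd(2) ne xz y(2) in auto)
    \<comment> \<open>By \<open>Tr_exchange\<close> the translations at \<open>z\<close> may be read
      off with \<open>x\<close> fixed in place of \<open>j\<close>. A twin of \<open>i\<close> other
      than \<open>z\<close> would make them independent of the value of \<open>i\<close>, against
      \<open>inj\<close>.\<close>
    have fixed_x: "row_split {j, y, z} i x c z" if c: "c \<in> S" for c
    proof (rule ccontr)
      assume n: "\<not> row_split {j, y, z} i x c z"
      obtain q where q: "q \<in> {j, y, z}" "row_split {j, y, z} i x c q" by (rule row_split_exists[OF d' card_X[OF d'] c])
      have qz: "q \<noteq> z" using n q by blast
      obtain a a' where aa: "a \<in> S" "a' \<in> S" "a \<noteq> a'" by (rule two_elements[OF S2])
      obtain \<rho> where \<rho>: "\<rho> permutes S" "\<And>p. \<forall>k. p k \<in> S \<Longrightarrow> G i x a' c p = G i x a c (act q \<rho> p)"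
        using row_split_perm[OF d' card_X[OF d'] q(1) aa(1,2) c q(2)] by metis
      have "Tr S (G i x a' c) z y = Tr S (G i x a c) z y"
        by (rule Tr_change[OF d' aa(1) c aa(2) c \<rho>(1) _ _ qz[symmetric] _ y(3)]) (use \<rho>(2) in auto)
      moreover have "Tr S (G i j u b0) z y = Tr S (G i x u c) z y" if "u \<in> S" for u
        by (rule Tr_exchange[OF d X dist cols[OF that] that b0 c])
      ultimately have "a = a'" using inj[OF aa(1,2)] aa by simp
      then show False using aa(3) by blast
    qed
    have "splits V e {i, z}"
    proof (rule splits_local[of _ _ z y])
      fix c f e' assume c: "c \<in> {i, z} - {z}" and f: "f \<in> V - {i, z} - {y}" and e': "e' \<in> pts V e"
      have v: "\<forall>k. e' k \<in> S" using pts_in[OF e'] by blast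
      have ee: "e' \<in> pts Y e'" for Y using v by (rule pts_refl)
      have cf: "c = i" "f = x \<or> f = j" using c f dd(1) X by auto
      from cf(2) show "splits {c, z, f, y} e' {c, z}"
      proof
        assume fx: "f = x"
        have "splits (insert i X) e' {i, z}" using row_splitD[OF rows v refl] v by blast
        then show ?thesis by (rule splits_restrict[OF _ ee]) (use cf(1) fx x y z in auto)
      next
        assume fj: "f = j"
        have "splits (insert i {j, y, z}) e' {i, z}" using row_splitD[OF fixed_x v refl] v by blast
        then show ?thesis by (rule splits_restrict[OF _ ee]) (use cf(1) fj in auto)
      qed
    next
      show "y \<in> V - {i, z}" using y ne dd(1) by auto
    qed (use z dd(1) in auto)
    moreover have "V - {i, z} = {j, x, y}" using dd(1,2) X ne dist by auto
    moreover have "card {j, x, y} = 3" using ne dist by simp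
    moreover have "2 \<le> card {i, z}" using ne(3) by simp
    ultimately show ?thesis using z dd(1) by (intro redI[of "{i, z}"]) auto
  qed
qed

end

section \<open>Conclusion for prime order\<close>

context prime_critical
begin

theorem red_prime:
  assumes V5: "5 \<le> card V" and e: "\<forall>k. e k \<in> S"
  shows "red V e"
proof (rule ccontr)
  assume irr: "\<not> red V e"
  obtain Y e' where Y: "Y \<subset> V" "e' \<in> pts V e" "\<not> red Y e'" "card Y = card V - 1 \<or> card Y = card V - 2"
    using exists_irreducible_retract[OF V5 e irr] by blast
  have e': "\<forall>k. e' k \<in> S" using pts_in[OF Y(2)] by blast
  have fY: "finite Y" using Y(1) finite_V finite_subset by blast
  have cd: "card (V - Y) = card V - card Y" using Y(1) fY by (intro card_Diff_subset) auto
  show False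
  proof (cases "card Y = card V - 1")
    case True
    then have "card (V - Y) = 1" using cd V5 by simp
    then obtain k where "V - Y = {k}" by (rule card_1_singletonE)
    then have "k \<in> V" "V - {k} = Y" using Y(1) by auto
    then show False using all_red[of k e'] e' Y(3) by simp
  next
    case False
    then have cY: "card Y = card V - 2" using Y(4) by blast
    then have "card (V - Y) = 2" using cd V5 by simp
    then obtain i j where ij: "V - Y = {i, j}" "i \<noteq> j" by (meson card_2_iff)
    have "V = insert i (insert j Y)" using ij Y(1) by blast
    then have d: "dec Y i j" unfolding dec_def using ij by blast
    show False
    proof (cases "card V = 5")
      case False
      then have "4 \<le> card Y" using cY V5 by simp
      then show False using red_if_irreducible_pair_retract[OF d _ Y(3) e' e] irr by blast
    next
      case True
      have "cyclic_case S V F"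
      proof (unfold_locales)
        show "card V = 5" by (rule True)
        fix X i j a b assume h: "dec X i j" "a \<in> S" "b \<in> S"
        show "\<not> latin_pred.rigid S X (G i j a b)"
        proof
          assume r: "latin_pred.rigid S X (G i j a b)"
          have dd: "V = insert i (insert j X)" "i \<noteq> j" "i \<notin> X" "j \<notin> X" using h by (auto simp: dec_def)
          have "finite X" using finite_V dd by simp
          then have "card X = 3" using True dd by simp
          then show False using red_if_rigid_triple[OF h(1) _ h(2,3) r e] irr by blast
        qed
      qed
      then show False using cyclic_case.red_cyclic irr by blast
    qed
  qed
qed

end

section \<open>Quasigroups and coordinates\<close>

definition holds :: "('a list \<Rightarrow> 'a) \<Rightarrow> nat \<Rightarrow> (nat \<Rightarrow> 'a) \<Rightarrow> bool" where
  "holds f n x = predicate_form f (map x [0..<Suc n])"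

lemma holds_iff: "holds f n x \<longleftrightarrow> x 0 = f (map (\<lambda>i. x (Suc i)) [0..<n])"
  unfolding holds_def predicate_form_def map_upt_Suc by simp

lemma holds_cong: "(\<And>k. k \<in> {..n} \<Longrightarrow> x k = y k) \<Longrightarrow> holds f n x = holds f n y"
  unfolding holds_def by (intro arg_cong[where f = "predicate_form f"] map_cong) auto

lemma map_upd: "(map x [0..<m])[i := y] = map (x(i := y)) [0..<m]"
  by (rule nth_equalityI) (auto simp: nth_list_update)

lemma map_tuples: "\<forall>k. x k \<in> S \<Longrightarrow> map x [0..<m] \<in> tuples S m"
  by (auto simp: tuples_def)

lemma latin_holds:
  assumes q: "quasigroup S n f" shows "latin S {..n} (holds f n)"
proof
  fix x :: "nat \<Rightarrow> 'a" and i assume x: "\<forall>k. x k \<in> S" and i: "i \<in> {..n}"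
  have "map x [0..<Suc n] \<in> tuples S (n + 1)" using map_tuples[OF x, of "Suc n"] by simp
  then have "\<exists>!y. y \<in> S \<and> predicate_form f ((map x [0..<Suc n])[i := y])" using q i unfolding quasigroup_def by blast
  then show "\<exists>!a. a \<in> S \<and> holds f n (x(i := a))" unfolding holds_def map_upd .
qed simp

lemma Cons_tuples: "c # us \<in> tuples S (Suc k) \<longleftrightarrow> c \<in> S \<and> us \<in> tuples S k"
  by (auto simp: tuples_def)

lemma tuples_Suc: "ys \<in> tuples S (Suc k) \<longleftrightarrow> (\<exists>c us. ys = c # us \<and> c \<in> S \<and> us \<in> tuples S k)"
  by (cases ys) (auto simp: tuples_def)

lemma tuples_append: "us \<in> tuples S m \<Longrightarrow> ws \<in> tuples S k \<Longrightarrow> us @ ws \<in> tuples S (m + k)"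
  by (auto simp: tuples_def)

text \<open>Position 0 of the predicate form contributes only that \<open>f\<close> maps into
  \<open>S\<close>; the other positions give unique solvability in each argument.\<close>

lemma quasigroup_iff:
  "quasigroup S n f \<longleftrightarrow> (\<forall>us \<in> tuples S n. f us \<in> S) \<and>
     (\<forall>us \<in> tuples S n. \<forall>j < n. \<forall>c \<in> S. \<exists>!y. y \<in> S \<and> f (us[j := y]) = c)" (is "?Q \<longleftrightarrow> ?V \<and> ?E")
proof
  assume q: ?Q
  have E: ?E
  proof (intro ballI allI impI)
    fix us j c assume h: "us \<in> tuples S n" "j < n" "c \<in> S"
    have "c # us \<in> tuples S (n + 1)" using h by (simp add: Cons_tuples)
    moreover have "Suc j \<le> n" using h(2) by simp
    ultimately have "\<exists>!y. y \<in> S \<and> predicate_form f ((c # us)[Suc j := y])" using q unfolding quasigroup_def by blast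
    then show "\<exists>!y. y \<in> S \<and> f (us[j := y]) = c" by (simp add: predicate_form_def eq_commute[of c])
  qed
  moreover have ?V using q unfolding quasigroup_def by blast
  ultimately show "?V \<and> ?E" by blast
next
  assume h: "?V \<and> ?E"
  show ?Q unfolding quasigroup_def
  proof (intro conjI ballI allI impI)
    show "f \<in> tuples S n \<rightarrow> S" using h by blast
    fix xs i assume x: "xs \<in> tuples S (n + 1)" and i: "i \<le> n"
    obtain c us where xs: "xs = c # us" "c \<in> S" "us \<in> tuples S n" using x by (auto simp: tuples_Suc)
    show "\<exists>!y. y \<in> S \<and> predicate_form f (xs[i := y])"
    proof (cases i)
      case 0
      have "f us \<in> S" using h xs(3) by blast
      then show ?thesis unfolding xs 0 by (auto simp: predicate_form_def)
    next
      case (Suc j)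
      then have "j < n" using i by simp
      then have "\<exists>!y. y \<in> S \<and> f (us[j := y]) = c" using h xs(2,3) by blast
      then show ?thesis unfolding xs Suc by (simp add: predicate_form_def eq_commute[of c])
    qed
  qed
qed

lemma quasigroup_solve:
  assumes "quasigroup S n f" "us \<in> tuples S n" "j < n" "c \<in> S"
  obtains y where "y \<in> S" "f (us[j := y]) = c"
  using assms unfolding quasigroup_iff by blast

lemma quasigroup_in: "quasigroup S n f \<Longrightarrow> us \<in> tuples S n \<Longrightarrow> f us \<in> S"
  unfolding quasigroup_iff by blast

lemma list_update_tuples: "us \<in> tuples S n \<Longrightarrow> y \<in> S \<Longrightarrow> us[j := y] \<in> tuples S n"
  using set_update_subset_insert[of us j y] by (auto simp: tuples_def)

lemma quasigroup_cancel:
  assumes q: "quasigroup S n f" and us: "us \<in> tuples S n" "j < n" and y: "y \<in> S" "y' \<in> S"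
    and eq: "f (us[j := y]) = f (us[j := y'])"
  shows "y = y'"
proof -
  have "f (us[j := y']) \<in> S" by (rule quasigroup_in[OF q list_update_tuples[OF us(1) y(2)]])
  then have "\<exists>!z. z \<in> S \<and> f (us[j := z]) = f (us[j := y'])" using q us unfolding quasigroup_iff by blast
  then show ?thesis using y eq by blast
qed

lemma permute_list_map: "permute_list \<sigma> (map x [0..<k]) = map (\<lambda>i. map x [0..<k] ! \<sigma> i) [0..<k]"
  by (simp add: permute_list_def)

text \<open>The inner arguments form the split \<open>A\<close>, and position 0 lies outside. If two
  points and one mixture hold, cancelling the first argument of \<open>h\<close> shows that the
  inner values are equal, so the other mixture holds too.\<close>

lemma red_if_reducible:
  assumes r: "reducible_quasigroup S k g"
  shows "latin.red S (holds g k) {..k} e"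
proof -
  obtain m h g' \<sigma> where m: "2 \<le> m" "m \<le> k - 1" and h: "quasigroup S (k - m + 1) h" and g': "quasigroup S m g'"
    and \<sigma>: "\<sigma> permutes {..<k}"
    and eq: "\<And>xs. xs \<in> tuples S k \<Longrightarrow> g xs = h (g' (take m (permute_list \<sigma> xs)) # drop m (permute_list \<sigma> xs))"
    using r unfolding reducible_quasigroup_def by auto
  define A where "A = (\<lambda>i. Suc (\<sigma> i)) ` {..<m}"
  have s: "\<sigma> i < k" if "i < k" for i using permutes_in_image[OF \<sigma>, of i] that by simp
  have "quasigroup S k g" using r by (simp add: reducible_quasigroup_def)
  then interpret latin S "{..k}" "holds g k" by (rule latin_holds)
  have inj: "inj \<sigma>" by (rule permutes_inj[OF \<sigma>])
  have A1: "A \<subseteq> {..k}" using s m by (auto simp: A_def Suc_le_eq)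
  have cA: "card A = m" unfolding A_def by (subst card_image) (use inj in \<open>auto simp: inj_on_def\<close>)
  have cB: "card ({..k} - A) = Suc k - m" using A1 cA by (subst card_Diff_subset) (auto intro: finite_subset)
  let ?u = "\<lambda>x. map (\<lambda>i. x (Suc (\<sigma> i))) [0..<m]" and ?w = "\<lambda>x. map (\<lambda>i. x (Suc (\<sigma> i))) [m..<k]"
  have H: "holds g k x \<longleftrightarrow> x 0 = h (g' (?u x) # ?w x)" if x: "\<forall>i. x i \<in> S" for x
  proof -
    have "permute_list \<sigma> (map (\<lambda>i. x (Suc i)) [0..<k]) = map (\<lambda>i. x (Suc (\<sigma> i))) [0..<k]"
      unfolding permute_list_map by (rule map_cong) (simp_all add: s)
    moreover have "map (\<lambda>i. x (Suc i)) [0..<k] \<in> tuples S k" by (rule map_tuples) (use x in blast)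
    moreover have "take m [0..<k] = [0..<m]" using m by simp
    ultimately show ?thesis unfolding holds_iff using eq by (simp add: take_map drop_map)
  qed
  have main: "holds g k (mix A y x)" if x: "\<forall>i. x i \<in> S" and y: "\<forall>i. y i \<in> S"
    and f: "holds g k x" "holds g k y" "holds g k (mix A x y)" for x y
  proof -
    have inA: "Suc (\<sigma> i) \<in> A \<longleftrightarrow> i < m" for i unfolding A_def using inj_eq[OF inj] by (simp add: image_iff)
    have u: "?u (mix A p q) = ?u p" for p q :: "nat \<Rightarrow> 'a" by (simp add: mix_def inA)
    have w: "?w (mix A p q) = ?w q" for p q :: "nat \<Rightarrow> 'a" by (simp add: mix_def inA)
    have z: "mix A p q 0 = q 0" for p q :: "nat \<Rightarrow> 'a" by (auto simp: mix_def A_def)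
    have v: "\<forall>i. mix A x y i \<in> S" "\<forall>i. mix A y x i \<in> S" using x y by (auto simp: mix_def)
    have uS: "g' (?u x) \<in> S" "g' (?u y) \<in> S"
      using g' map_tuples[of "\<lambda>i. x (Suc (\<sigma> i))" S m] map_tuples[of "\<lambda>i. y (Suc (\<sigma> i))" S m] x y
      unfolding quasigroup_iff by simp_all
    have "?w y \<in> tuples S (k - m)" using y by (auto simp: tuples_def)
    then have t: "g' (?u y) # ?w y \<in> tuples S (k - m + 1)" using uS(2) by (simp add: Cons_tuples)
    have "y 0 = h (g' (?u x) # ?w y)" using f(3) unfolding H[OF v(1)] u w z .
    moreover have "y 0 = h (g' (?u y) # ?w y)" using f(2) unfolding H[OF y] .
    ultimately have "h ((g' (?u y) # ?w y)[0 := g' (?u x)]) = h ((g' (?u y) # ?w y)[0 := g' (?u y)])" by simp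
    then have "g' (?u x) = g' (?u y)" by (rule quasigroup_cancel[OF h t _ uS, rotated]) simp
    then show ?thesis using f(1) unfolding H[OF v(2)] u w z H[OF x] by simp
  qed
  have "splits {..k} e A" unfolding splits_def
  proof (intro ballI impI)
    fix x y assume h: "x \<in> pts {..k} e" "y \<in> pts {..k} e"
    have v: "\<forall>i. x i \<in> S" "\<forall>i. y i \<in> S" using pts_in h by blast+
    assume "holds g k x" "holds g k y" "holds g k (mix A x y)"
    then show "holds g k (mix A y x)" by (rule main[OF v])
  qed
  moreover have "2 \<le> card A" "2 \<le> card ({..k} - A)" using cA cB m by auto
  ultimately show ?thesis using A1 by (intro redI[of A])
qed

lemma nths_eq_map: "nths xs A = map ((!) xs) (filter (\<lambda>i. i \<in> A) [0..<length xs])"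
proof -
  have z: "zip xs [0..<length xs] = map (\<lambda>i. (xs ! i, i)) [0..<length xs]" by (rule nth_equalityI) auto
  show ?thesis unfolding nths_def z by (simp add: filter_map comp_def)
qed

text \<open>\<open>L\<close> lists the free positions in increasing order, just as
  \<open>nths\<close> does, and \<open>g\<close> solves for its first entry, which need not be
  position 0. A reduction of \<open>g\<close> is carried along \<open>L\<close> to a split of
  \<open>Y\<close>.\<close>

lemma retract_at:
  assumes q: "quasigroup S n f" and Y: "Y \<subset> {..n}" "card Y = Suc k" and e: "\<forall>i. e i \<in> S"
    and irr: "\<not> latin.red S (holds f n) Y e"
  shows "\<exists>g. retract S n f k g \<and> irreducible_quasigroup S k g"
proof -
  interpret latin S "{..n}" "holds f n" by (rule latin_holds[OF q])
  define L where "L = filter (\<lambda>i. i \<in> Y) [0..<Suc n]"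
  have L: "set L = Y" "distinct L" using Y(1) by (auto simp: L_def simp del: upt_Suc)
  then have len: "length L = Suc k" using Y(2) distinct_card by metis
  have LY: "L ! j \<in> Y" if "j < Suc k" for j using L(1) len that nth_mem by metis
  have Ln: "L ! j \<in> {..n}" if "j < Suc k" for j using LY[OF that] Y(1) by blast
  define pos where "pos = inv_into {..<Suc k} ((!) L)"
  have injL: "inj_on ((!) L) {..<Suc k}" using L(2) len by (simp add: inj_on_nth)
  have imL: "(!) L ` {..<Suc k} = Y" using L(1) len by (auto simp: set_conv_nth)
  have pos: "pos (L ! j) = j" if "j < Suc k" for j unfolding pos_def using inv_into_f_f[OF injL] that by simp
  have pos': "pos i < Suc k" "L ! pos i = i" if "i \<in> Y" for i
    using inv_into_into[of i "(!) L" "{..<Suc k}"] f_inv_into_f[of i "(!) L" "{..<Suc k}"] that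
    unfolding imL pos_def by auto
  define pt where "pt ys = (\<lambda>i. if i \<in> Y then ys ! pos i else e i)" for ys
  have pt_val: "\<forall>i. pt ys i \<in> S" if "ys \<in> tuples S (Suc k)" for ys
    using that e pos'(1) by (auto simp: pt_def tuples_def subset_iff)
  have pt_upd: "pt (ys[j := y]) = (pt ys)(L ! j := y)" if "ys \<in> tuples S (Suc k)" "j < Suc k" for ys j y
    using that pos pos' LY by (fastforce simp: pt_def fun_eq_iff tuples_def nth_list_update)
  have pt_map: "pt (map x L) = x" if "\<And>i. i \<notin> Y \<Longrightarrow> x i = e i" for x
    using that pos' len by (auto simp: pt_def fun_eq_iff)
  define g where "g us = (THE y. y \<in> S \<and> holds f n (pt (y # us)))" for us
  have ex: "\<exists>!y. y \<in> S \<and> holds f n (pt (ys[j := y]))" if "ys \<in> tuples S (Suc k)" "j < Suc k" for ys j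
    unfolding pt_upd[OF that] by (rule unique_value[OF pt_val[OF that(1)] Ln[OF that(2)]])
  have ex0: "\<exists>!y. y \<in> S \<and> holds f n (pt (y # us))" if us: "us \<in> tuples S k" for us
  proof -
    have "e 0 # us \<in> tuples S (Suc k)" using us e by (simp add: Cons_tuples)
    from ex[OF this, of 0] show ?thesis by simp
  qed
  have g_iff: "predicate_form g ys \<longleftrightarrow> holds f n (pt ys)" if ys: "ys \<in> tuples S (Suc k)" for ys
  proof -
    obtain c us where c: "ys = c # us" "c \<in> S" "us \<in> tuples S k" using ys by (auto simp: tuples_Suc)
    show ?thesis unfolding c(1) predicate_form_def list.sel g_def
      using theI'[OF ex0[OF c(3)]] the1_equality[OF ex0[OF c(3)], of c] c(2) by metis
  qed
  have gS: "g us \<in> S" if "us \<in> tuples S k" for us unfolding g_def using theI'[OF ex0[OF that]] by blast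
  have up: "ys[j := y] \<in> tuples S (Suc k)" if "ys \<in> tuples S (Suc k)" "y \<in> S" for ys j y
    using that set_update_subset_insert[of ys j y] by (auto simp: tuples_def)
  have quasi: "quasigroup S k g" unfolding quasigroup_def
  proof (intro conjI ballI allI impI)
    show "g \<in> tuples S k \<rightarrow> S" using gS by blast
    fix ys i assume h: "ys \<in> tuples S (k + 1)" "i \<le> k"
    have ys: "ys \<in> tuples S (Suc k)" using h by simp
    have "(y \<in> S \<and> predicate_form g (ys[i := y])) \<longleftrightarrow> (y \<in> S \<and> holds f n (pt (ys[i := y])))" for y
      using g_iff[OF up[OF ys]] by blast
    then show "\<exists>!y. y \<in> S \<and> predicate_form g (ys[i := y])" using ex[OF ys, of i] h(2) by simp
  qed
  have g_map: "predicate_form g (map x L) \<longleftrightarrow> holds f n x" if x: "x \<in> pts Y e" for x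
  proof -
    have "map x L \<in> tuples S (Suc k)" using pts_in[OF x] len by (auto simp: tuples_def)
    then show ?thesis using g_iff pt_map[of x] pts_off[OF x] by metis
  qed
  have kn: "k < n" using psubset_card_mono[OF _ Y(1)] Y(2) by simp
  have retr: "retract S n f k g" unfolding retract_def
  proof (intro conjI exI[of _ "{0..n} - Y"] exI[of _ e] kn quasi)
    show "card ({0..n} - Y) = n - k" using Y by (subst card_Diff_subset) (auto intro: finite_subset)
    show "\<forall>xs \<in> tuples S (n + 1). (\<forall>i \<in> {0..n} - Y. xs ! i = e i) \<longrightarrow>
       predicate_form g (nths xs (- ({0..n} - Y))) = predicate_form f xs"
    proof (intro ballI impI)
      fix xs assume xs: "xs \<in> tuples S (n + 1)" "\<forall>i \<in> {0..n} - Y. xs ! i = e i"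
      define x where "x i = (if i \<le> n then xs ! i else e i)" for i
      have lx: "length xs = Suc n" using xs by (simp add: tuples_def)
      have v: "x i \<in> S" for i using xs(1) e lx unfolding tuples_def x_def
        by (cases "i \<le> n") (auto simp: subset_iff)
      have x: "x \<in> pts Y e" unfolding pts_def using v xs(2) by (auto simp: x_def)
      have "filter (\<lambda>i. i \<in> - ({0..n} - Y)) [0..<Suc n] = L" unfolding L_def by (rule filter_cong) auto
      then have "nths xs (- ({0..n} - Y)) = map ((!) xs) L" unfolding nths_eq_map lx by simp
      also have "\<dots> = map x L" using L(1) Y(1) by (auto simp: x_def)
      finally have "predicate_form g (nths xs (- ({0..n} - Y))) = holds f n x" using g_map[OF x] by simp
      also have "map x [0..<Suc n] = xs" by (rule nth_equalityI) (auto simp: lx x_def simp del: upt_Suc)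
      then have "holds f n x = predicate_form f xs" by (simp add: holds_def)
      finally show "predicate_form g (nths xs (- ({0..n} - Y))) = predicate_form f xs" .
    qed
  qed (use e in auto)
  interpret G: latin S "{..k}" "holds g k" by (rule latin_holds[OF quasi])
  have "\<not> reducible_quasigroup S k g"
  proof
    assume "reducible_quasigroup S k g"
    then have "latin.red S (holds g k) {..k} e" by (rule red_if_reducible)
    then obtain A where A: "A \<subseteq> {..k}" "2 \<le> card A" "2 \<le> card ({..k} - A)" "G.splits {..k} e A"
      unfolding G.red_def by blast
    let ?r = "\<lambda>x i. if i \<le> k then x (L ! i) else e i"
    have r_pts: "?r x \<in> pts {..k} e" if "x \<in> pts Y e" for x unfolding pts_def using pts_in[OF that] e by simp
    have tr: "holds g k (?r x) \<longleftrightarrow> holds f n x" if "x \<in> pts Y e" for x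
    proof -
      have "map (?r x) [0..<Suc k] = map x L" by (rule nth_equalityI) (auto simp: len simp del: upt_Suc)
      then show ?thesis using g_map[OF that] by (simp add: holds_def)
    qed
    define B where "B = (!) L ` A"
    have A': "A \<subseteq> {..<Suc k}" using A(1) by auto
    have inA: "L ! i \<in> B \<longleftrightarrow> i \<in> A" if "i \<le> k" for i
      unfolding B_def using inj_on_image_mem_iff[OF injL _ A', of i] that by simp
    have B: "B \<subseteq> Y" using A' imL unfolding B_def by blast
    have cB: "card B = card A" unfolding B_def by (rule card_image[OF inj_on_subset[OF injL A']])
    have D: "{..k} - A \<subseteq> {..<Suc k}" by auto
    have "Y - B = (!) L ` ({..k} - A)"
      unfolding B_def imL[symmetric] lessThan_Suc_atMost
      by (rule inj_on_image_set_diff[OF injL D A', symmetric, folded lessThan_Suc_atMost, unfolded lessThan_Suc_atMost])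
    then have cC: "card (Y - B) = card ({..k} - A)" using card_image[OF inj_on_subset[OF injL D]] by simp
    have "splits Y e B" unfolding splits_def
    proof (intro ballI impI)
      fix x y assume h: "x \<in> pts Y e" "y \<in> pts Y e" "holds f n x" "holds f n y" "holds f n (mix B x y)"
      have mr: "holds g k (mix A (?r p) (?r r)) \<longleftrightarrow> holds f n (mix B p r)" if pr: "p \<in> pts Y e" "r \<in> pts Y e" for p r
      proof -
        have "holds g k (mix A (?r p) (?r r)) = holds g k (?r (mix B p r))"
          by (rule holds_cong) (simp add: mix_def inA)
        also have "\<dots> = holds f n (mix B p r)" by (rule tr[OF pts_mix[OF pr]])
        finally show ?thesis .
      qed
      have "holds g k (mix A (?r y) (?r x))"
        using G.splitsD[OF A(4) r_pts[OF h(1)] r_pts[OF h(2)]] h(3-5) tr[OF h(1)] tr[OF h(2)] mr[OF h(1,2)] by blast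
      then show "holds f n (mix B y x)" using mr[OF h(2,1)] by blast
    qed
    then have "red Y e" using B A(2,3) cB cC by (intro redI[of B]) simp_all
    then show False using irr by simp
  qed
  then show ?thesis using retr quasi unfolding irreducible_quasigroup_def by blast
qed

section \<open>Composing operations from a split\<close>

lemma replicate_tuples: "s \<in> S \<Longrightarrow> replicate k s \<in> tuples S k"
  by (auto simp: tuples_def)

lemma sorting_permutation:
  assumes B: "B \<subseteq> {..<n}"
  obtains \<sigma> where "\<sigma> permutes {..<n}" "\<And>i. i < n \<Longrightarrow> \<sigma> i \<in> B \<longleftrightarrow> i < card B"
proof -
  have fB: "finite B" using B finite_subset by blast
  define ps where "ps = sorted_list_of_set B @ sorted_list_of_set ({..<n} - B)"
  have d: "distinct ps" and st: "set ps = {..<n}" using fB B by (auto simp: ps_def)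
  have len: "length ps = n" using distinct_card[OF d] st by simp
  define \<sigma> where "\<sigma> i = (if i < n then ps ! i else i)" for i
  have "bij_betw (\<lambda>i. ps ! i) {..<n} {..<n}" using bij_betw_nth[OF d] len st by simp
  then have "bij_betw \<sigma> {..<n} {..<n}" by (rule bij_betw_cong[THEN iffD1, rotated]) (simp add: \<sigma>_def)
  then have \<sigma>: "\<sigma> permutes {..<n}" by (rule bij_imp_permutes) (simp add: \<sigma>_def)
  have "\<sigma> i \<in> B \<longleftrightarrow> i < card B" if i: "i < n" for i
  proof (cases "i < card B")
    case True
    then have "\<sigma> i = sorted_list_of_set B ! i" using i by (simp add: \<sigma>_def ps_def nth_append)
    also have "\<dots> \<in> set (sorted_list_of_set B)" using True by (intro nth_mem) simp
    finally show ?thesis using True fB by simp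
  next
    case False
    then have "\<sigma> i = sorted_list_of_set ({..<n} - B) ! (i - card B)" using i by (simp add: \<sigma>_def ps_def nth_append)
    moreover have "i - card B < length (sorted_list_of_set ({..<n} - B))" using False i len by (simp add: ps_def)
    ultimately have "\<sigma> i \<in> set (sorted_list_of_set ({..<n} - B))" using nth_mem by metis
    then show ?thesis using False by simp
  qed
  then show thesis using that \<sigma> by blast
qed

lemma permute_list_update:
  assumes \<tau>: "\<tau> permutes {..<length us}" and j: "j < length us"
  shows "permute_list \<tau> (us[j := y]) = (permute_list \<tau> us)[inv \<tau> j := y]"
proof (rule nth_equalityI)
  fix i assume "i < length (permute_list \<tau> (us[j := y]))"
  then have i: "i < length us" by simp
  have "\<tau> i < length us" using permutes_in_image[OF \<tau>, of i] i by simp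
  moreover have "\<tau> i = j \<longleftrightarrow> i = inv \<tau> j" using permutes_inverses[OF \<tau>] by metis
  ultimately show "permute_list \<tau> (us[j := y]) ! i = (permute_list \<tau> us)[inv \<tau> j := y] ! i"
    using i j by (cases "i = inv \<tau> j") (simp_all add: permute_list_def nth_list_update)
qed simp

lemma permute_tuples:
  assumes "\<tau> permutes {..<n}" "us \<in> tuples S n" shows "permute_list \<tau> us \<in> tuples S n"
  using assms by (auto simp: tuples_def)

lemma quasigroup_permuted:
  assumes q: "quasigroup S n f" and \<tau>: "\<tau> permutes {..<n}"
  shows "quasigroup S n (\<lambda>us. f (permute_list \<tau> us))"
  unfolding quasigroup_iff
proof (intro conjI ballI allI impI)
  fix us assume us: "us \<in> tuples S n"
  have pu: "permute_list \<tau> us \<in> tuples S n" by (rule permute_tuples[OF \<tau> us])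
  show "f (permute_list \<tau> us) \<in> S" by (rule quasigroup_in[OF q pu])
  fix j c assume j: "j < n" and c: "c \<in> S"
  have len: "length us = n" using us by (simp add: tuples_def)
  have "inv \<tau> j < n" using permutes_in_image[OF permutes_inv[OF \<tau>], of j] j by simp
  then have "\<exists>!y. y \<in> S \<and> f ((permute_list \<tau> us)[inv \<tau> j := y]) = c" using q pu c unfolding quasigroup_iff by blast
  then show "\<exists>!y. y \<in> S \<and> f (permute_list \<tau> (us[j := y])) = c"
    using permute_list_update[of \<tau> us j] \<tau> j len by simp
qed

text \<open>The inner operation is \<open>f\<close> with its last arguments set to the constant \<open>s\<close>; the splitting
  condition says that it determines the value of \<open>f\<close> for all other choices of the last arguments.\<close>

lemma decompose:
  assumes q: "quasigroup S n f" and m: "1 \<le> m" "m \<le> n" and s: "s \<in> S"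
    and split: "\<And>u u' w w'. u \<in> tuples S m \<Longrightarrow> u' \<in> tuples S m \<Longrightarrow> w \<in> tuples S (n - m) \<Longrightarrow> w' \<in> tuples S (n - m) \<Longrightarrow>
      f (u @ w) = f (u' @ w) \<Longrightarrow> f (u @ w') = f (u' @ w')"
  obtains h g where "quasigroup S (n - m + 1) h" "quasigroup S m g"
    "\<forall>u \<in> tuples S m. \<forall>w \<in> tuples S (n - m). f (u @ w) = h (g u # w)"
proof -
  define b where "b = replicate (n - m) s"
  have b: "b \<in> tuples S (n - m)" unfolding b_def by (rule replicate_tuples[OF s])
  define g where "g u = f (u @ b)" for u
  define r where "r t = (SOME u. u \<in> tuples S m \<and> g u = t)" for t
  define h where "h tw = f (r (hd tw) @ tl tw)" for tw
  have ap: "u @ w \<in> tuples S n" if "u \<in> tuples S m" "w \<in> tuples S (n - m)" for u w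
    using tuples_append[OF that] m by simp
  have len: "length u = m" if "u \<in> tuples S m" for u using that by (simp add: tuples_def)
  have gS: "g u \<in> S" if "u \<in> tuples S m" for u unfolding g_def by (rule quasigroup_in[OF q ap[OF that b]])
  have first: "\<exists>u \<in> tuples S m. f (u @ w) = c" if w: "w \<in> tuples S (n - m)" and c: "c \<in> S" for w c
  proof -
    define u0 where "u0 = replicate m s"
    have u0: "u0 \<in> tuples S m" unfolding u0_def by (rule replicate_tuples[OF s])
    have "0 < n" using m by simp
    then obtain y where y: "y \<in> S" "f ((u0 @ w)[0 := y]) = c" by (rule quasigroup_solve[OF q ap[OF u0 w] _ c])
    have "(u0 @ w)[0 := y] = u0[0 := y] @ w" using len[OF u0] m by (simp add: list_update_append)
    then show ?thesis using list_update_tuples[OF u0 y(1)] y(2) by metis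
  qed
  have r: "r t \<in> tuples S m" "g (r t) = t" if t: "t \<in> S" for t
  proof -
    have "\<exists>u. u \<in> tuples S m \<and> g u = t" using first[OF b t] unfolding g_def by blast
    from someI_ex[OF this] show "r t \<in> tuples S m" "g (r t) = t" unfolding r_def by blast+
  qed
  have eq: "f (u @ w) = h (g u # w)" if u: "u \<in> tuples S m" and w: "w \<in> tuples S (n - m)" for u w
    unfolding h_def list.sel using split[OF u r(1)[OF gS[OF u]] b w] r(2)[OF gS[OF u]] by (simp add: g_def)
  have G: "quasigroup S m g" unfolding quasigroup_iff
  proof (intro conjI ballI allI impI gS)
    fix us j c assume h: "us \<in> tuples S m" "j < m" "c \<in> S"
    have j: "j < n" using h(2) m by simp
    have "(us @ b)[j := y] = us[j := y] @ b" for y using len[OF h(1)] h(2) by (simp add: list_update_append)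
    moreover have "\<exists>!y. y \<in> S \<and> f ((us @ b)[j := y]) = c" using q ap[OF h(1) b] j h(3) unfolding quasigroup_iff by blast
    ultimately show "\<exists>!y. y \<in> S \<and> g (us[j := y]) = c" unfolding g_def by simp
  qed
  have H: "quasigroup S (n - m + 1) h" unfolding quasigroup_iff
  proof (intro conjI ballI allI impI)
    fix us assume "us \<in> tuples S (n - m + 1)"
    then obtain t w where us: "us = t # w" "t \<in> S" "w \<in> tuples S (n - m)" by (auto simp: tuples_Suc)
    have rw: "r t @ w \<in> tuples S n" by (rule ap[OF r(1)[OF us(2)] us(3)])
    show "h us \<in> S" unfolding h_def us(1) list.sel by (rule quasigroup_in[OF q rw])
    fix j c assume j: "j < n - m + 1" and c: "c \<in> S"
    show "\<exists>!y. y \<in> S \<and> h (us[j := y]) = c"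
    proof (cases j)
      case 0
      show ?thesis
      proof (rule ex_ex1I)
        obtain u where u: "u \<in> tuples S m" "f (u @ w) = c" using first[OF us(3) c] by blast
        show "\<exists>y. y \<in> S \<and> h (us[j := y]) = c" unfolding us(1) 0 list_update_code
          using eq[OF u(1) us(3)] u gS[OF u(1)] by metis
        fix y y' assume "y \<in> S \<and> h (us[j := y]) = c" "y' \<in> S \<and> h (us[j := y']) = c"
        then have y: "y \<in> S" "y' \<in> S" "f (r y @ w) = f (r y' @ w)" by (simp_all add: us(1) 0 h_def)
        have "f (r y @ b) = f (r y' @ b)" by (rule split[OF r(1)[OF y(1)] r(1)[OF y(2)] us(3) b y(3)])
        then have "g (r y) = g (r y')" by (simp add: g_def)
        then show "y = y'" unfolding r(2)[OF y(1)] r(2)[OF y(2)] .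
      qed
    next
      case (Suc i)
      then have i: "m + i < n" using j m by simp
      have "(r t @ w)[m + i := y] = r t @ w[i := y]" for y using len[OF r(1)[OF us(2)]] by (simp add: list_update_append)
      moreover have "\<exists>!y. y \<in> S \<and> f ((r t @ w)[m + i := y]) = c" using q rw i c unfolding quasigroup_iff by blast
      ultimately show ?thesis unfolding h_def us(1) Suc by simp
    qed
  qed
  show thesis by (rule that[OF H G]) (use eq in blast)
qed

text \<open>The dependent variable must stay outside the inner operation, so the side of the split
  without 0 supplies the inner arguments. A permutation brings them to the front, where
  \<open>decompose\<close> applies.\<close>

lemma reducible_if_red:
  assumes q: "quasigroup S n f" and e: "\<forall>i. e i \<in> S" and red: "latin.red S (holds f n) {..n} e"
  shows "reducible_quasigroup S n f"
proof -
  interpret latin S "{..n}" "holds f n" by (rule latin_holds[OF q])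
  obtain A0 where A0: "A0 \<subseteq> {..n}" "2 \<le> card A0" "2 \<le> card ({..n} - A0)" "splits {..n} e A0"
    using red unfolding red_def by blast
  define A where "A = (if 0 \<in> A0 then {..n} - A0 else A0)"
  have A: "A \<subseteq> {..n}" "2 \<le> card A" "2 \<le> card ({..n} - A)" "0 \<notin> A"
    using A0(1-3) double_diff[of A0 "{..n}" "{..n}"] unfolding A_def by auto
  have "splits {..n} e ({..n} - A0) = splits {..n} e A0" by (rule splits_compl) simp
  then have sA: "splits {..n} e A" using A0(4) by (simp add: A_def)
  define B where "B = {i. i < n \<and> Suc i \<in> A}"
  have AB: "A = Suc ` B"
  proof
    show "A \<subseteq> Suc ` B"
    proof
      fix x assume x: "x \<in> A"
      then obtain i where i: "x = Suc i" using A(4) by (cases x) auto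
      then have "i \<in> B" using x A(1) unfolding B_def by (auto simp: Suc_le_eq)
      then show "x \<in> Suc ` B" using i by blast
    qed
  qed (auto simp: B_def)
  define m where "m = card B"
  have cA: "card A = m" unfolding AB m_def by (rule card_image) simp
  have fA: "finite A" using A(1) finite_subset by blast
  have "card ({..n} - A) = Suc n - m" using card_Diff_subset[OF fA A(1)] cA by simp
  then have m: "2 \<le> m" "m \<le> n - 1" using A(2,3) cA by simp_all
  have m': "1 \<le> m" "m \<le> n" using m by simp_all
  obtain \<sigma> where \<sigma>: "\<sigma> permutes {..<n}" "\<And>i. i < n \<Longrightarrow> \<sigma> i \<in> B \<longleftrightarrow> i < card B"
    by (rule sorting_permutation[of B n]) (auto simp: B_def)
  define \<tau> where "\<tau> = inv \<sigma>"
  have \<tau>: "\<tau> permutes {..<n}" unfolding \<tau>_def by (rule permutes_inv[OF \<sigma>(1)])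
  have \<tau>B: "Suc i \<in> A \<longleftrightarrow> \<tau> i < m" if i: "i < n" for i
  proof -
    have "\<tau> i < n" using permutes_in_image[OF \<tau>, of i] i by simp
    then have "\<sigma> (\<tau> i) \<in> B \<longleftrightarrow> \<tau> i < m" unfolding m_def by (rule \<sigma>(2))
    moreover have "\<sigma> (\<tau> i) = i" unfolding \<tau>_def by (rule permutes_inverses(1)[OF \<sigma>(1)])
    ultimately show ?thesis using i unfolding B_def by simp
  qed
  define \<phi> where "\<phi> us = f (permute_list \<tau> us)" for us
  have q\<phi>: "quasigroup S n \<phi>" unfolding \<phi>_def by (rule quasigroup_permuted[OF q \<tau>])
  define P where "P c us = (\<lambda>k. case k of 0 \<Rightarrow> c | Suc i \<Rightarrow> if i < n then us ! \<tau> i else e k)" for c us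
  have P0: "P c us 0 = c" for c us by (simp add: P_def)
  have PS: "P c us (Suc i) = (if i < n then us ! \<tau> i else e (Suc i))" for c us i by (simp add: P_def)
  have P_holds: "holds f n (P c us) \<longleftrightarrow> c = \<phi> us" if us: "length us = n" for c us
  proof -
    have "map (\<lambda>i. P c us (Suc i)) [0..<n] = permute_list \<tau> us" unfolding permute_list_def us by (rule map_cong) (simp_all add: PS)
    then show ?thesis unfolding holds_iff P0 \<phi>_def by simp
  qed
  have P_pts: "P c us \<in> pts {..n} e" if c: "c \<in> S" and us: "us \<in> tuples S n" for c us
  proof -
    have "P c us k \<in> S" for k
    proof (cases k)
      case 0 then show ?thesis using c P0 by simp
    next
      case (Suc i)
      show ?thesis
      proof (cases "i < n")
        case True
        then have "\<tau> i < n" using permutes_in_image[OF \<tau>, of i] by simp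
        then have "us ! \<tau> i \<in> set us" using us by (intro nth_mem) (simp add: tuples_def)
        then show ?thesis using us True unfolding Suc PS by (auto simp: tuples_def)
      qed (use e Suc PS in simp)
    qed
    moreover have "P c us k = e k" if k: "k \<notin> {..n}" for k using k PS[of c us "k - 1"] by (cases k) auto
    ultimately show ?thesis unfolding pts_def by blast
  qed
  have split: "\<phi> (u @ w') = \<phi> (u' @ w')" if u: "u \<in> tuples S m" "u' \<in> tuples S m"
    and w: "w \<in> tuples S (n - m)" "w' \<in> tuples S (n - m)" and eq: "\<phi> (u @ w) = \<phi> (u' @ w)" for u u' w w'
  proof -
    have ap: "v @ z \<in> tuples S n" if "v \<in> tuples S m" "z \<in> tuples S (n - m)" for v z
      using tuples_append[OF that] m by simp
    have len: "length (v @ z) = n" "length v = m" if "v \<in> tuples S m" "z \<in> tuples S (n - m)" for v z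
      using that m by (simp_all add: tuples_def)
    define c where "c = \<phi> (u @ w)"
    define c' where "c' = \<phi> (u @ w')"
    have cS: "c \<in> S" "c' \<in> S" unfolding c_def c'_def by (rule quasigroup_in[OF q\<phi> ap]; use u w in simp)+
    have mixP: "mix A (P c1 (v @ z)) (P c2 (v' @ z')) = P c2 (v @ z')"
      if v: "v \<in> tuples S m" "v' \<in> tuples S m" "z \<in> tuples S (n - m)" "z' \<in> tuples S (n - m)" for c1 c2 v v' z z'
    proof
      fix k show "mix A (P c1 (v @ z)) (P c2 (v' @ z')) k = P c2 (v @ z') k"
      proof (cases k)
        case 0 then show ?thesis using A(4) by (simp add: mix_def P0)
      next
        case (Suc i)
        show ?thesis using \<tau>B[of i] len[OF v(1,3)] len[OF v(2,4)] A(1) unfolding Suc mix_def PS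
          by (auto simp: nth_append)
      qed
    qed
    have "holds f n (P c' (u' @ w'))"
    proof -
      \<comment> \<open>Three corners hold: \<open>(u, w')\<close> with value \<open>c'\<close>, and
        \<open>(u', w)\<close> and \<open>(u, w)\<close> with value \<open>c\<close>. The split
        yields \<open>(u', w')\<close> with value \<open>c'\<close>.\<close>
      have "holds f n (mix A (P c (u' @ w)) (P c' (u @ w')))"
      proof (rule splitsD[OF sA])
        show "P c' (u @ w') \<in> pts {..n} e" by (rule P_pts[OF cS(2) ap[OF u(1) w(2)]])
        show "P c (u' @ w) \<in> pts {..n} e" by (rule P_pts[OF cS(1) ap[OF u(2) w(1)]])
        show "holds f n (P c' (u @ w'))" unfolding P_holds[OF len(1)[OF u(1) w(2)]] c'_def ..
        show "holds f n (P c (u' @ w))" unfolding P_holds[OF len(1)[OF u(2) w(1)]] c_def by (rule eq)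
        show "holds f n (mix A (P c' (u @ w')) (P c (u' @ w)))"
          unfolding mixP[OF u w(2,1)] P_holds[OF len(1)[OF u(1) w(1)]] c_def ..
      qed
      then show ?thesis unfolding mixP[OF u(2,1) w] .
    qed
    then show ?thesis unfolding P_holds[OF len(1)[OF u(2) w(2)]] c'_def .
  qed
  obtain h g where hg: "quasigroup S (n - m + 1) h" "quasigroup S m g"
    "\<forall>u \<in> tuples S m. \<forall>w \<in> tuples S (n - m). \<phi> (u @ w) = h (g u # w)"
    by (rule decompose[OF q\<phi> m' e[rule_format, of 0] split])
  have "f xs = h (g (take m (permute_list \<sigma> xs)) # drop m (permute_list \<sigma> xs))" if xs: "xs \<in> tuples S n" for xs
  proof -
    let ?ys = "permute_list \<sigma> xs"
    have lx: "length xs = n" using xs by (simp add: tuples_def)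
    have ys: "?ys \<in> tuples S n" by (rule permute_tuples[OF \<sigma>(1) xs])
    have "permute_list \<tau> ?ys = permute_list (\<sigma> \<circ> \<tau>) xs" using permute_list_compose[of \<tau> xs \<sigma>] \<tau> lx by simp
    also have "\<dots> = xs" unfolding \<tau>_def permutes_inv_o(1)[OF \<sigma>(1)] by simp
    finally have "f xs = \<phi> (take m ?ys @ drop m ?ys)" by (simp add: \<phi>_def)
    also have "\<dots> = h (g (take m ?ys) # drop m ?ys)"
    proof (rule bspec[OF bspec[OF hg(3)]])
      show "take m ?ys \<in> tuples S m" using ys m' set_take_subset[of m ?ys] by (auto simp: tuples_def)
      show "drop m ?ys \<in> tuples S (n - m)" using ys m' set_drop_subset[of m ?ys] by (auto simp: tuples_def)
    qed
    finally show ?thesis .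
  qed
  then show ?thesis unfolding reducible_quasigroup_def using q hg(1,2) \<sigma>(1) m by (meson atLeastAtMost_iff)
qed

theorem theorem1:
  fixes S :: "'a set" and n :: nat and f :: "'a list \<Rightarrow> 'a"
  assumes "n \<ge> 4"
    and "S \<noteq> {}"
    and "irreducible_quasigroup S n f"
  shows "((\<exists>g. retract S n f (n - 1) g \<and> irreducible_quasigroup S (n - 1) g) \<or>
          (\<exists>g. retract S n f (n - 2) g \<and> irreducible_quasigroup S (n - 2) g)) \<and>
         (finite S \<and> prime (card S) \<longrightarrow>
          (\<exists>g. retract S n f (n - 1) g \<and> irreducible_quasigroup S (n - 1) g))"
proof -
  have q: "quasigroup S n f" and irr: "\<not> reducible_quasigroup S n f"
    using assms(3) by (simp_all add: irreducible_quasigroup_def)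
  interpret latin S "{..n}" "holds f n" by (rule latin_holds[OF q])
  obtain s where s: "s \<in> S" using assms(2) by blast
  define e where "e = (\<lambda>_::nat. s)"
  have e: "\<forall>k. e k \<in> S" using s by (simp add: e_def)
  have nred: "\<not> red {..n} e" using reducible_if_red[OF q e] irr by blast
  have V5: "5 \<le> card {..n}" using assms(1) by simp
  obtain Y e' where Y: "Y \<subset> {..n}" "e' \<in> pts {..n} e" "\<not> red Y e'" "card Y = card {..n} - 1 \<or> card Y = card {..n} - 2"
    using exists_irreducible_retract[OF V5 e nred] by blast
  have e': "\<forall>k. e' k \<in> S" using pts_in[OF Y(2)] by blast
  \<comment> \<open>A retract of arity \<open>k\<close> has \<open>k + 1\<close> free coordinates,
    as its dependent variable is counted.\<close>
  have "card Y = Suc (n - 1) \<or> card Y = Suc (n - 2)" using Y(4) assms(1) by auto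
  then have "(\<exists>g. retract S n f (n - 1) g \<and> irreducible_quasigroup S (n - 1) g) \<or>
          (\<exists>g. retract S n f (n - 2) g \<and> irreducible_quasigroup S (n - 2) g)"
    using retract_at[OF q Y(1) _ e' Y(3)] by blast
  moreover have "\<exists>g. retract S n f (n - 1) g \<and> irreducible_quasigroup S (n - 1) g" if p: "finite S" "prime (card S)"
  proof (rule ccontr)
    assume no: "\<not> (\<exists>g. retract S n f (n - 1) g \<and> irreducible_quasigroup S (n - 1) g)"
    have "prime_critical S {..n} (holds f n)"
    proof (unfold_locales)
      show "finite S" "prime (card S)" by (rule p)+
      show "holds f n x = holds f n y" if "\<And>k. k \<in> {..n} \<Longrightarrow> x k = y k" for x y using that by (rule holds_cong)
      show "red ({..n} - {k}) d" if k: "k \<in> {..n}" and d: "\<forall>k. d k \<in> S" for k d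
      proof (rule ccontr)
        assume nr: "\<not> red ({..n} - {k}) d"
        have "{..n} - {k} \<subset> {..n}" "card ({..n} - {k}) = Suc (n - 1)" using k assms(1) by auto
        then show False using retract_at[OF q _ _ d nr] no by blast
      qed
    qed
    then have "red {..n} e" by (rule prime_critical.red_prime[OF _ V5 e])
    then show False using nred by simp
  qed
  ultimately show ?thesis by blast
qed

end
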